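(* Let $C$ be a right semiperfect coalgebra over a field $K$. Let $\mathscr X$ be a poset and let $\mathscr R:\mathscr X\longrightarrow\mathscr Ent_C$ be an entwined $C$-representation of $\mathscr X$. Suppose that $\mathscr R$ is flat. Then the category $Cart^C-\mathscr R$ of cartesian entwined modules over $\mathscr R$ is a Grothendieck category.
   Context: Conventions. $\otimes=\otimes_K$; coalgebras are coassociative counital $K$-coalgebras; $\Delta_C(c)=c_1\otimes c_2$ and comodule coactions are written $m\mapsto m_0\otimes m_1$ (summation suppressed). For a small $K$-linear category $\mathcal R$, a right $\mathcal R$-module is a $K$-linear functor $\mathcal R^{op}\to Vect_K$; for $m\in\mathcal M(r)$, $f\in\mathcal R(s,r)$ write $mf:=\mathcal M(f)(m)\in\mathcal M(s)$. $C$ is right semiperfect if the category of right $C$-comodules has enough projectives. A poset is viewed as a category with a single morphism $x\to y$ when $x\le y$. Entwining structure. $(\mathcal R,C,\psi)$ consists of a small $K$-linear category $\mathcal R$, a $K$-coalgebra $C$ and $K$-linear maps $\psi_{rs}:C\otimes\mathcal R(r,s)\to\mathcal R(r,s)\otimes C$, written $\psi(c\otimes f)=f_\psi\otimes c^\psi$, such that for $f\in\mathcal R(r,s)$, $g\in\mathcal R(s,t)$, $c\in C$: $(gf)_\psi\otimes c^\psi=g_\psi f_\psi\otimes {c^\psi}^\psi$ ($\psi$ is first applied to $c\otimes g$, then to $c^\psi\otimes f$); $\varepsilon_C(c^\psi)f_\psi=\varepsilon_C(c)f$; $f_\psi\otimes\Delta_C(c^\psi)={f_\psi}_\psi\otimes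 {c_1}^\psi\otimes {c_2}^\psi$ ($\psi$ is first applied to $c_2\otimes f$, then to $c_1\otimes f_\psi$); $\psi(c\otimes id_r)=id_r\otimes c$. Entwined modules. $\mathbf M_{\mathcal R}^C(\psi)$ has as objects right $\mathcal R$-modules $\mathcal M$ with a right $C$-comodule structure on each $\mathcal M(s)$ such that $(mf)_0\otimes(mf)_1=m_0f_\psi\otimes {m_1}^\psi$ for $f\in\mathcal R(s,r)$, $m\in\mathcal M(r)$; morphisms are morphisms of right $\mathcal R$-modules that are $C$-colinear at each object. Representations. $\mathscr Ent_C$ is the category of entwining structures $(\mathcal R,C,\psi)$ with $C$ fixed; a morphism $\alpha:(\mathcal R,C,\psi)\to(\mathcal S,C,\psi')$ is a $K$-linear functor $\alpha:\mathcal R\to\mathcal S$ with $\alpha(f_\psi)\otimes c^\psi=\alpha(f)_{\psi'}\otimes c^{\psi'}$. It induces $\alpha_\ast:\mathbf M_{\mathcal S}^C(\psi')\to\mathbf M_{\mathcal R}^C(\psi)$, $(\alpha_\ast\mathcal N)(r)=\mathcal N(\alpha(r))$ (same coaction, $\mathcal R$ acting through $\alpha$), with left adjoint $\alpha^\ast$: $(\alpha^\ast\mathcal M)(s)$ is the quotient of $\bigoplus_{r}\mathcal M(r)\otimes\mathcal S(s,\alpha(r))$ by the span of all $m'\otimes\alpha(g)f-m'g\otimes f$, with coaction $m\otimes f\mapsto m_0\otimes f_{\psi'}\otimes {m_1}^{\psi'}$. An entwined $C$-representation of $\mathscr X$ is a functor $\mathscr R:\mathscr X\to\mathscr Ent_C$,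 $x\mapsto(\mathscr R_x,C,\psi_x)$; for $\alpha:x\to y$ in $\mathscr X$ write $\alpha_\ast,\alpha^\ast$ for $\mathscr R_{\alpha\ast},\mathscr R_\alpha^\ast$. $\mathscr R$ is flat if $\alpha^\ast:\mathbf M^C_{\mathscr R_x}(\psi_x)\to\mathbf M^C_{\mathscr R_y}(\psi_y)$ is exact for every $\alpha:x\to y$ in $\mathscr X$. Modules over $\mathscr R$. An object $\mathscr M$ of $Mod^C-\mathscr R$ consists of $\mathscr M_x\in\mathbf M^C_{\mathscr R_x}(\psi_x)$ for each $x\in\mathscr X$ and morphisms $\mathscr M_\alpha:\mathscr M_x\to\alpha_\ast\mathscr M_y$ in $\mathbf M^C_{\mathscr R_x}(\psi_x)$ for each $\alpha:x\to y$ (equivalently, by adjunction, $\mathscr M^\alpha:\alpha^\ast\mathscr M_x\to\mathscr M_y$), with $\mathscr M_{id_x}=id$ and $\mathscr M_{\beta\alpha}=\alpha_\ast(\mathscr M_\beta)\circ\mathscr M_\alpha$. A morphism $\eta:\mathscr M\to\mathscr N$ consists of morphisms $\eta_x:\mathscr M_x\to\mathscr N_x$ with $\mathscr N_\alpha\circ\eta_x=\alpha_\ast(\eta_y)\circ\mathscr M_\alpha$. $\mathscr M$ is cartesian if every $\mathscr M^\alpha$ is an isomorphism; $Cart^C-\mathscr R$ is the full subcategory of $Mod^C-\mathscr R$ of cartesian modules. *)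

theory Defs
  imports "HOL-Algebra.Module" "HOL-Algebra.AbelCoset"
begin

unbundle cardinal_syntax


section \<open>Categories\<close>

text \<open>
  Arrows are indexed by their domain and codomain, so the sets \<open>Arr \<C> a b\<close> need not be disjoint,
  and composition \<open>Cmp \<C> a b c g f\<close> (first \<open>f : a \<rightarrow> b\<close>, then \<open>g : b \<rightarrow> c\<close>) carries its objects.
\<close>

record ('p, 'q) cat =
  Ob  :: "'p set"
  Arr :: "'p \<Rightarrow> 'p \<Rightarrow> 'q set"
  Idn :: "'p \<Rightarrow> 'q"
  Cmp :: "'p \<Rightarrow> 'p \<Rightarrow> 'p \<Rightarrow> 'q \<Rightarrow> 'q \<Rightarrow> 'q"

definition is_cat :: "('p, 'q) cat \<Rightarrow> bool" where
  "is_cat \<C> \<longleftrightarrow>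
     (\<forall>a\<in>Ob \<C>. Idn \<C> a \<in> Arr \<C> a a) \<and>
     (\<forall>a\<in>Ob \<C>. \<forall>b\<in>Ob \<C>. \<forall>c\<in>Ob \<C>. \<forall>f\<in>Arr \<C> a b. \<forall>g\<in>Arr \<C> b c.
        Cmp \<C> a b c g f \<in> Arr \<C> a c) \<and>
     (\<forall>a\<in>Ob \<C>. \<forall>b\<in>Ob \<C>. \<forall>f\<in>Arr \<C> a b.
        Cmp \<C> a a b f (Idn \<C> a) = f \<and> Cmp \<C> a b b (Idn \<C> b) f = f) \<and>
     (\<forall>a\<in>Ob \<C>. \<forall>b\<in>Ob \<C>. \<forall>c\<in>Ob \<C>. \<forall>d\<in>Ob \<C>. \<forall>f\<in>Arr \<C> a b. \<forall>g\<in>Arr \<C> b c. \<forall>h\<in>Arr \<C> c d.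
        Cmp \<C> a c d h (Cmp \<C> a b c g f) = Cmp \<C> a b d (Cmp \<C> b c d h g) f)"

record ('p, 'q, 'p2, 'q2) cfunctor =
  fob :: "'p \<Rightarrow> 'p2"
  far :: "'p \<Rightarrow> 'p \<Rightarrow> 'q \<Rightarrow> 'q2"

definition is_functor ::
  "('p, 'q) cat \<Rightarrow> ('p2, 'q2) cat \<Rightarrow> ('p, 'q, 'p2, 'q2) cfunctor \<Rightarrow> bool" where
  "is_functor \<C> \<D> F \<longleftrightarrow>
     (\<forall>a\<in>Ob \<C>. fob F a \<in> Ob \<D>) \<and>
     (\<forall>a\<in>Ob \<C>. \<forall>b\<in>Ob \<C>. \<forall>f\<in>Arr \<C> a b. far F a b f \<in> Arr \<D> (fob F a) (fob F b)) \<and>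
     (\<forall>a\<in>Ob \<C>. far F a a (Idn \<C> a) = Idn \<D> (fob F a)) \<and>
     (\<forall>a\<in>Ob \<C>. \<forall>b\<in>Ob \<C>. \<forall>c\<in>Ob \<C>. \<forall>f\<in>Arr \<C> a b. \<forall>g\<in>Arr \<C> b c.
        far F a c (Cmp \<C> a b c g f) = Cmp \<D> (fob F a) (fob F b) (fob F c) (far F b c g) (far F a b f))"

definition nat_trans ::
  "('p, 'q) cat \<Rightarrow> ('p2, 'q2) cat \<Rightarrow> ('p, 'q, 'p2, 'q2) cfunctor \<Rightarrow> ('p, 'q, 'p2, 'q2) cfunctor
     \<Rightarrow> ('p \<Rightarrow> 'q2) \<Rightarrow> bool" where
  "nat_trans \<C> \<D> F G \<eta> \<longleftrightarrow>
     (\<forall>a\<in>Ob \<C>. \<eta> a \<in> Arr \<D> (fob F a) (fob G a)) \<and>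
     (\<forall>a\<in>Ob \<C>. \<forall>b\<in>Ob \<C>. \<forall>f\<in>Arr \<C> a b.
        Cmp \<D> (fob F a) (fob G a) (fob G b) (far G a b f) (\<eta> a) =
        Cmp \<D> (fob F a) (fob F b) (fob G b) (\<eta> b) (far F a b f))"

definition poset_cat :: "'x set \<Rightarrow> 'x rel \<Rightarrow> ('x, unit) cat" where
  "poset_cat X leq =
     \<lparr>Ob = X, Arr = (\<lambda>x y. if (x, y) \<in> leq then {()} else {}), Idn = (\<lambda>x. ()), Cmp = (\<lambda>x y z g f. ())\<rparr>"

definition is_mono :: "('p, 'q) cat \<Rightarrow> 'p \<Rightarrow> 'p \<Rightarrow> 'q \<Rightarrow> bool" where
  "is_mono \<C> a b f \<longleftrightarrow> f \<in> Arr \<C> a b \<and>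
     (\<forall>x\<in>Ob \<C>. \<forall>g\<in>Arr \<C> x a. \<forall>h\<in>Arr \<C> x a. Cmp \<C> x a b f g = Cmp \<C> x a b f h \<longrightarrow> g = h)"

definition is_epi :: "('p, 'q) cat \<Rightarrow> 'p \<Rightarrow> 'p \<Rightarrow> 'q \<Rightarrow> bool" where
  "is_epi \<C> a b f \<longleftrightarrow> f \<in> Arr \<C> a b \<and>
     (\<forall>x\<in>Ob \<C>. \<forall>g\<in>Arr \<C> b x. \<forall>h\<in>Arr \<C> b x. Cmp \<C> a b x g f = Cmp \<C> a b x h f \<longrightarrow> g = h)"

definition zero_object :: "('p, 'q) cat \<Rightarrow> 'p \<Rightarrow> bool" where
  "zero_object \<C> z \<longleftrightarrow> z \<in> Ob \<C> \<and> (\<forall>a\<in>Ob \<C>. (\<exists>!f. f \<in> Arr \<C> z a) \<and> (\<exists>!f. f \<in> Arr \<C> a z))"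

definition zero_arrow :: "('p, 'q) cat \<Rightarrow> 'p \<Rightarrow> 'p \<Rightarrow> 'q \<Rightarrow> bool" where
  "zero_arrow \<C> a b f \<longleftrightarrow>
     (\<exists>z g h. zero_object \<C> z \<and> g \<in> Arr \<C> a z \<and> h \<in> Arr \<C> z b \<and> f = Cmp \<C> a z b h g)"

definition is_kernel :: "('p, 'q) cat \<Rightarrow> 'p \<Rightarrow> 'p \<Rightarrow> 'q \<Rightarrow> 'p \<Rightarrow> 'q \<Rightarrow> bool" where
  "is_kernel \<C> a b f k i \<longleftrightarrow>
     k \<in> Ob \<C> \<and> i \<in> Arr \<C> k a \<and> zero_arrow \<C> k b (Cmp \<C> k a b f i) \<and>
     (\<forall>x\<in>Ob \<C>. \<forall>h\<in>Arr \<C> x a. zero_arrow \<C> x b (Cmp \<C> x a b f h) \<longrightarrow>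
        (\<exists>!u. u \<in> Arr \<C> x k \<and> Cmp \<C> x k a i u = h))"

definition is_cokernel :: "('p, 'q) cat \<Rightarrow> 'p \<Rightarrow> 'p \<Rightarrow> 'q \<Rightarrow> 'p \<Rightarrow> 'q \<Rightarrow> bool" where
  "is_cokernel \<C> a b f q p \<longleftrightarrow>
     q \<in> Ob \<C> \<and> p \<in> Arr \<C> b q \<and> zero_arrow \<C> a q (Cmp \<C> a b q p f) \<and>
     (\<forall>x\<in>Ob \<C>. \<forall>h\<in>Arr \<C> b x. zero_arrow \<C> a x (Cmp \<C> a b x h f) \<longrightarrow>
        (\<exists>!u. u \<in> Arr \<C> q x \<and> Cmp \<C> b q x u p = h))"

definition is_coproduct :: "('p, 'q) cat \<Rightarrow> 'i set \<Rightarrow> ('i \<Rightarrow> 'p) \<Rightarrow> 'p \<Rightarrow> ('i \<Rightarrow> 'q) \<Rightarrow> bool" where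
  "is_coproduct \<C> I F c \<iota> \<longleftrightarrow>
     c \<in> Ob \<C> \<and> (\<forall>i\<in>I. \<iota> i \<in> Arr \<C> (F i) c) \<and>
     (\<forall>x\<in>Ob \<C>. \<forall>h. (\<forall>i\<in>I. h i \<in> Arr \<C> (F i) x) \<longrightarrow>
        (\<exists>!u. u \<in> Arr \<C> c x \<and> (\<forall>i\<in>I. Cmp \<C> (F i) c x u (\<iota> i) = h i)))"

definition is_product :: "('p, 'q) cat \<Rightarrow> 'i set \<Rightarrow> ('i \<Rightarrow> 'p) \<Rightarrow> 'p \<Rightarrow> ('i \<Rightarrow> 'q) \<Rightarrow> bool" where
  "is_product \<C> I F c \<pi> \<longleftrightarrow>
     c \<in> Ob \<C> \<and> (\<forall>i\<in>I. \<pi> i \<in> Arr \<C> c (F i)) \<and>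
     (\<forall>x\<in>Ob \<C>. \<forall>h. (\<forall>i\<in>I. h i \<in> Arr \<C> x (F i)) \<longrightarrow>
        (\<exists>!u. u \<in> Arr \<C> x c \<and> (\<forall>i\<in>I. Cmp \<C> x c (F i) (\<pi> i) u = h i)))"

definition short_exact :: "('p, 'q) cat \<Rightarrow> 'p \<Rightarrow> 'p \<Rightarrow> 'p \<Rightarrow> 'q \<Rightarrow> 'q \<Rightarrow> bool" where
  "short_exact \<C> a b c f g \<longleftrightarrow>
     a \<in> Ob \<C> \<and> b \<in> Ob \<C> \<and> c \<in> Ob \<C> \<and> f \<in> Arr \<C> a b \<and> g \<in> Arr \<C> b c \<and>
     is_kernel \<C> b c g a f \<and> is_cokernel \<C> a b f c g"

definition exact_functor ::
  "('p, 'q) cat \<Rightarrow> ('p2, 'q2) cat \<Rightarrow> ('p, 'q, 'p2, 'q2) cfunctor \<Rightarrow> bool" where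
  "exact_functor \<C> \<D> F \<longleftrightarrow> is_functor \<C> \<D> F \<and>
     (\<forall>a b c f g. short_exact \<C> a b c f g \<longrightarrow>
        short_exact \<D> (fob F a) (fob F b) (fob F c) (far F a b f) (far F b c g))"

definition projective :: "('p, 'q) cat \<Rightarrow> 'p \<Rightarrow> bool" where
  "projective \<C> p \<longleftrightarrow> p \<in> Ob \<C> \<and>
     (\<forall>a\<in>Ob \<C>. \<forall>b\<in>Ob \<C>. \<forall>e f. is_epi \<C> a b e \<and> f \<in> Arr \<C> p b \<longrightarrow>
        (\<exists>g\<in>Arr \<C> p a. Cmp \<C> p a b e g = f))"

definition enough_projectives :: "('p, 'q) cat \<Rightarrow> bool" where
  "enough_projectives \<C> \<longleftrightarrow> (\<forall>a\<in>Ob \<C>. \<exists>p f. projective \<C> p \<and> is_epi \<C> p a f)"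

text \<open>
  Freyd's definition of an abelian category: the additive structure on the hom-sets is not extra
  data, it is determined by the category.
\<close>

definition abelian_cat :: "('p, 'q) cat \<Rightarrow> bool" where
  "abelian_cat \<C> \<longleftrightarrow> is_cat \<C> \<and>
     (\<exists>z. zero_object \<C> z) \<and>
     (\<forall>F :: bool \<Rightarrow> 'p. (\<forall>i. F i \<in> Ob \<C>) \<longrightarrow>
        (\<exists>c \<iota>. is_coproduct \<C> UNIV F c \<iota>) \<and> (\<exists>c \<pi>. is_product \<C> UNIV F c \<pi>)) \<and>
     (\<forall>a\<in>Ob \<C>. \<forall>b\<in>Ob \<C>. \<forall>f\<in>Arr \<C> a b.
        (\<exists>k i. is_kernel \<C> a b f k i) \<and> (\<exists>q p. is_cokernel \<C> a b f q p)) \<and>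
     (\<forall>a\<in>Ob \<C>. \<forall>b\<in>Ob \<C>. \<forall>f. is_mono \<C> a b f \<longrightarrow>
        (\<exists>c\<in>Ob \<C>. \<exists>g\<in>Arr \<C> b c. is_kernel \<C> b c g a f)) \<and>
     (\<forall>a\<in>Ob \<C>. \<forall>b\<in>Ob \<C>. \<forall>f. is_epi \<C> a b f \<longrightarrow>
        (\<exists>c\<in>Ob \<C>. \<exists>g\<in>Arr \<C> c a. is_cokernel \<C> c a g b f))"

text \<open>
  Sizes are measured against a set \<open>U\<close>: a set is small if its cardinality is smaller than that of
  \<open>U\<close>. For \<open>U\<close> of inaccessible cardinality this is smallness with respect to a Grothendieck
  universe. Every small set is in bijection with a subset of \<open>U\<close>, so it is enough to index
  coproducts and diagrams by sets of elements of the type of \<open>U\<close>.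
\<close>

definition small :: "'u set \<Rightarrow> 'a set \<Rightarrow> bool" where
  "small U A \<longleftrightarrow> |A| <o |U|"

definition small_filtered :: "'u set \<Rightarrow> ('u, 'u) cat \<Rightarrow> bool" where
  "small_filtered U J \<longleftrightarrow> is_cat J \<and>
     small U (Ob J) \<and> (\<forall>i\<in>Ob J. \<forall>j\<in>Ob J. small U (Arr J i j)) \<and>
     Ob J \<noteq> {} \<and>
     (\<forall>i\<in>Ob J. \<forall>j\<in>Ob J. \<exists>k\<in>Ob J. Arr J i k \<noteq> {} \<and> Arr J j k \<noteq> {}) \<and>
     (\<forall>i\<in>Ob J. \<forall>j\<in>Ob J. \<forall>f\<in>Arr J i j. \<forall>g\<in>Arr J i j.
        \<exists>k\<in>Ob J. \<exists>h\<in>Arr J j k. Cmp J i j k h f = Cmp J i j k h g)"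

definition is_cocone ::
  "('i, 'j) cat \<Rightarrow> ('p, 'q) cat \<Rightarrow> ('i, 'j, 'p, 'q) cfunctor \<Rightarrow> 'p \<Rightarrow> ('i \<Rightarrow> 'q) \<Rightarrow> bool" where
  "is_cocone J \<C> D c \<iota> \<longleftrightarrow>
     c \<in> Ob \<C> \<and> (\<forall>i\<in>Ob J. \<iota> i \<in> Arr \<C> (fob D i) c) \<and>
     (\<forall>i\<in>Ob J. \<forall>j\<in>Ob J. \<forall>f\<in>Arr J i j. Cmp \<C> (fob D i) (fob D j) c (\<iota> j) (far D i j f) = \<iota> i)"

definition is_colimit ::
  "('i, 'j) cat \<Rightarrow> ('p, 'q) cat \<Rightarrow> ('i, 'j, 'p, 'q) cfunctor \<Rightarrow> 'p \<Rightarrow> ('i \<Rightarrow> 'q) \<Rightarrow> bool" where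
  "is_colimit J \<C> D c \<iota> \<longleftrightarrow> is_cocone J \<C> D c \<iota> \<and>
     (\<forall>x \<kappa>. is_cocone J \<C> D x \<kappa> \<longrightarrow>
        (\<exists>!u. u \<in> Arr \<C> c x \<and> (\<forall>i\<in>Ob J. Cmp \<C> (fob D i) c x u (\<iota> i) = \<kappa> i)))"

definition has_small_coproducts :: "'u set \<Rightarrow> ('p, 'q) cat \<Rightarrow> bool" where
  "has_small_coproducts U \<C> \<longleftrightarrow>
     (\<forall>(I :: 'u set) F. small U I \<and> (\<forall>i\<in>I. F i \<in> Ob \<C>) \<longrightarrow> (\<exists>c \<iota>. is_coproduct \<C> I F c \<iota>))"

definition exact_filtered_colimits :: "'u set \<Rightarrow> ('p, 'q) cat \<Rightarrow> bool" where
  "exact_filtered_colimits U \<C> \<longleftrightarrow>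
     (\<forall>(J :: ('u, 'u) cat) D E F \<sigma> \<tau> d e f \<iota>d \<iota>e \<iota>f u v.
        small_filtered U J \<and>
        is_functor J \<C> D \<and> is_functor J \<C> E \<and> is_functor J \<C> F \<and>
        nat_trans J \<C> D E \<sigma> \<and> nat_trans J \<C> E F \<tau> \<and>
        (\<forall>j\<in>Ob J. short_exact \<C> (fob D j) (fob E j) (fob F j) (\<sigma> j) (\<tau> j)) \<and>
        is_colimit J \<C> D d \<iota>d \<and> is_colimit J \<C> E e \<iota>e \<and> is_colimit J \<C> F f \<iota>f \<and>
        u \<in> Arr \<C> d e \<and>
        (\<forall>j\<in>Ob J. Cmp \<C> (fob D j) d e u (\<iota>d j) = Cmp \<C> (fob D j) (fob E j) e (\<iota>e j) (\<sigma> j)) \<and>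
        v \<in> Arr \<C> e f \<and>
        (\<forall>j\<in>Ob J. Cmp \<C> (fob E j) e f v (\<iota>e j) = Cmp \<C> (fob E j) (fob F j) f (\<iota>f j) (\<tau> j))
        \<longrightarrow> short_exact \<C> d e f u v)"

definition generator :: "('p, 'q) cat \<Rightarrow> 'p \<Rightarrow> bool" where
  "generator \<C> g \<longleftrightarrow> g \<in> Ob \<C> \<and>
     (\<forall>a\<in>Ob \<C>. \<forall>b\<in>Ob \<C>. \<forall>f\<in>Arr \<C> a b. \<forall>f'\<in>Arr \<C> a b. f \<noteq> f' \<longrightarrow>
        (\<exists>h\<in>Arr \<C> g a. Cmp \<C> g a b f h \<noteq> Cmp \<C> g a b f' h))"

definition grothendieck_cat :: "'u set \<Rightarrow> ('p, 'q) cat \<Rightarrow> bool" where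
  "grothendieck_cat U \<C> \<longleftrightarrow>
     abelian_cat \<C> \<and> has_small_coproducts U \<C> \<and> exact_filtered_colimits U \<C> \<and> (\<exists>g. generator \<C> g)"


section \<open>Vector spaces and tensor products\<close>

text \<open>
  Vector spaces over the field \<open>K\<close> are modules over \<open>K\<close>; the record fields \<open>mult\<close> and \<open>one\<close> of
  a module are irrelevant.
\<close>

definition linear_map ::
  "('k, 'z) ring_scheme \<Rightarrow> ('k, 'a, 'y) module_scheme \<Rightarrow> ('k, 'b, 'w) module_scheme \<Rightarrow> ('a \<Rightarrow> 'b) \<Rightarrow> bool"
  where
  "linear_map K V W f \<longleftrightarrow>
     f \<in> carrier V \<rightarrow> carrier W \<and>
     (\<forall>x\<in>carrier V. \<forall>y\<in>carrier V. f (x \<oplus>\<^bsub>V\<^esub> y) = f x \<oplus>\<^bsub>W\<^esub> f y) \<and>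
     (\<forall>a\<in>carrier K. \<forall>x\<in>carrier V. f (a \<odot>\<^bsub>V\<^esub> x) = a \<odot>\<^bsub>W\<^esub> f x)"

definition bilinear_map ::
  "('k, 'z) ring_scheme \<Rightarrow> ('k, 'a) module \<Rightarrow> ('k, 'b) module \<Rightarrow> ('k, 'c) module \<Rightarrow> ('a \<Rightarrow> 'b \<Rightarrow> 'c) \<Rightarrow> bool"
  where
  "bilinear_map K V W Z \<beta> \<longleftrightarrow>
     (\<forall>x\<in>carrier V. linear_map K W Z (\<beta> x)) \<and> (\<forall>y\<in>carrier W. linear_map K V Z (\<lambda>x. \<beta> x y))"

definition scalars :: "('k, 'z) ring_scheme \<Rightarrow> ('k, 'k) module" where
  "scalars K = \<lparr>carrier = carrier K, mult = mult K, one = one K, zero = zero K, add = add K,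
                smult = mult K\<rparr>"

definition free_mod :: "('k, 'z) ring_scheme \<Rightarrow> 's set \<Rightarrow> ('k, 's \<Rightarrow> 'k) module" where
  "free_mod K S =
     \<lparr>carrier = {\<phi>. (\<forall>p. \<phi> p \<in> carrier K) \<and> (\<forall>p. p \<notin> S \<longrightarrow> \<phi> p = \<zero>\<^bsub>K\<^esub>) \<and> finite {p. \<phi> p \<noteq> \<zero>\<^bsub>K\<^esub>}},
      mult = undefined, one = undefined,
      zero = (\<lambda>p. \<zero>\<^bsub>K\<^esub>), add = (\<lambda>\<phi> \<chi> p. \<phi> p \<oplus>\<^bsub>K\<^esub> \<chi> p), smult = (\<lambda>a \<phi> p. a \<otimes>\<^bsub>K\<^esub> \<phi> p)\<rparr>"

definition basis_vec :: "('k, 'z) ring_scheme \<Rightarrow> 's \<Rightarrow> ('s \<Rightarrow> 'k)" where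
  "basis_vec K p = (\<lambda>q. if q = p then \<one>\<^bsub>K\<^esub> else \<zero>\<^bsub>K\<^esub>)"

definition lin_span :: "('k, 'z) ring_scheme \<Rightarrow> ('k, 'a) module \<Rightarrow> 'a set \<Rightarrow> 'a set" where
  "lin_span K V S = \<Inter>{N. submodule N K V \<and> S \<subseteq> N}"

definition quot_mod :: "('k, 'a) module \<Rightarrow> 'a set \<Rightarrow> ('k, 'a set) module" where
  "quot_mod V N =
     \<lparr>carrier = a_rcosets\<^bsub>V\<^esub> N, mult = undefined, one = undefined,
      zero = N, add = set_add V, smult = (\<lambda>a X. \<Union>x\<in>X. N +>\<^bsub>V\<^esub> (a \<odot>\<^bsub>V\<^esub> x))\<rparr>"

definition dsum_mod :: "'i set \<Rightarrow> ('i \<Rightarrow> ('k, 'a) module) \<Rightarrow> ('k, 'i \<Rightarrow> 'a) module" where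
  "dsum_mod I V =
     \<lparr>carrier = {u \<in> (\<Pi>\<^sub>E i\<in>I. carrier (V i)). finite {i \<in> I. u i \<noteq> \<zero>\<^bsub>V i\<^esub>}},
      mult = undefined, one = undefined,
      zero = (\<lambda>i\<in>I. \<zero>\<^bsub>V i\<^esub>), add = (\<lambda>u w. \<lambda>i\<in>I. u i \<oplus>\<^bsub>V i\<^esub> w i), smult = (\<lambda>a u. \<lambda>i\<in>I. a \<odot>\<^bsub>V i\<^esub> u i)\<rparr>"

definition dsum_inj :: "'i set \<Rightarrow> ('i \<Rightarrow> ('k, 'a) module) \<Rightarrow> 'i \<Rightarrow> 'a \<Rightarrow> ('i \<Rightarrow> 'a)" where
  "dsum_inj I V i v = (\<lambda>j\<in>I. if j = i then v else \<zero>\<^bsub>V j\<^esub>)"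

type_synonym ('k, 'a, 'b) tens = "('a \<times> 'b \<Rightarrow> 'k) set"

definition tensor_rels ::
  "('k, 'z) ring_scheme \<Rightarrow> ('k, 'a) module \<Rightarrow> ('k, 'b) module \<Rightarrow> ('a \<times> 'b \<Rightarrow> 'k) set" where
  "tensor_rels K V W =
     (let F = free_mod K (carrier V \<times> carrier W); e = (\<lambda>v w. basis_vec K (v, w)) in
       {e (v \<oplus>\<^bsub>V\<^esub> v') w \<ominus>\<^bsub>F\<^esub> (e v w \<oplus>\<^bsub>F\<^esub> e v' w) | v v' w.
          v \<in> carrier V \<and> v' \<in> carrier V \<and> w \<in> carrier W} \<union>
       {e v (w \<oplus>\<^bsub>W\<^esub> w') \<ominus>\<^bsub>F\<^esub> (e v w \<oplus>\<^bsub>F\<^esub> e v w') | v w w'.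
          v \<in> carrier V \<and> w \<in> carrier W \<and> w' \<in> carrier W} \<union>
       {e (a \<odot>\<^bsub>V\<^esub> v) w \<ominus>\<^bsub>F\<^esub> (a \<odot>\<^bsub>F\<^esub> e v w) | a v w.
          a \<in> carrier K \<and> v \<in> carrier V \<and> w \<in> carrier W} \<union>
       {e v (a \<odot>\<^bsub>W\<^esub> w) \<ominus>\<^bsub>F\<^esub> (a \<odot>\<^bsub>F\<^esub> e v w) | a v w.
          a \<in> carrier K \<and> v \<in> carrier V \<and> w \<in> carrier W})"

definition tensor_null ::
  "('k, 'z) ring_scheme \<Rightarrow> ('k, 'a) module \<Rightarrow> ('k, 'b) module \<Rightarrow> ('a \<times> 'b \<Rightarrow> 'k) set" where
  "tensor_null K V W = lin_span K (free_mod K (carrier V \<times> carrier W)) (tensor_rels K V W)"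

definition tensor ::
  "('k, 'z) ring_scheme \<Rightarrow> ('k, 'a) module \<Rightarrow> ('k, 'b) module \<Rightarrow> ('k, ('k, 'a, 'b) tens) module" where
  "tensor K V W = quot_mod (free_mod K (carrier V \<times> carrier W)) (tensor_null K V W)"

definition tens ::
  "('k, 'z) ring_scheme \<Rightarrow> ('k, 'a) module \<Rightarrow> ('k, 'b) module \<Rightarrow> 'a \<Rightarrow> 'b \<Rightarrow> ('k, 'a, 'b) tens" where
  "tens K V W v w =
     tensor_null K V W +>\<^bsub>free_mod K (carrier V \<times> carrier W)\<^esub> basis_vec K (v, w)"

text \<open>
  Sweedler summation: if \<open>t = \<Sum> v\<^sub>i \<otimes> w\<^sub>i\<close> then \<open>tsum K Z t \<beta> = \<Sum> \<beta> v\<^sub>i w\<^sub>i\<close>, a sum in \<open>Z\<close>. For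
  bilinear \<open>\<beta>\<close>, the only ones it is applied to, the choice of the representing sum is immaterial
  and \<open>tsum K Z t \<beta>\<close> is the value at \<open>t\<close> of the linear map induced by \<open>\<beta>\<close>.
\<close>

definition tsum ::
  "('k, 'z) ring_scheme \<Rightarrow> ('k, 'c) module \<Rightarrow> ('k, 'a, 'b) tens \<Rightarrow> ('a \<Rightarrow> 'b \<Rightarrow> 'c) \<Rightarrow> 'c" where
  "tsum K Z t \<beta> =
     (let \<phi> = (SOME \<phi>. \<phi> \<in> t) in
       (\<Oplus>\<^bsub>Z\<^esub>p\<in>{p. \<phi> p \<noteq> \<zero>\<^bsub>K\<^esub>}. \<phi> p \<odot>\<^bsub>Z\<^esub> \<beta> (fst p) (snd p)))"


section \<open>Coalgebras and comodules\<close>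

record ('k, 'c) coalgebra =
  csp   :: "('k, 'c) module"
  delta :: "'c \<Rightarrow> ('k, 'c, 'c) tens"
  eps   :: "'c \<Rightarrow> 'k"

definition is_coalgebra :: "('k, 'z) ring_scheme \<Rightarrow> ('k, 'c) coalgebra \<Rightarrow> bool" where
  "is_coalgebra K C \<longleftrightarrow>
     (let V = csp C; VV = tensor K V V; VVV = tensor K V VV in
       module K V \<and> linear_map K V VV (delta C) \<and> linear_map K V (scalars K) (eps C) \<and>
       (\<forall>c\<in>carrier V.
          tsum K VVV (delta C c) (\<lambda>c1 c2. tens K V VV c1 (delta C c2)) =
          tsum K VVV (delta C c) (\<lambda>c1 c2.
            tsum K VVV (delta C c1) (\<lambda>c11 c12. tens K V VV c11 (tens K V V c12 c2)))) \<and>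
       (\<forall>c\<in>carrier V.
          tsum K V (delta C c) (\<lambda>c1 c2. eps C c1 \<odot>\<^bsub>V\<^esub> c2) = c \<and>
          tsum K V (delta C c) (\<lambda>c1 c2. eps C c2 \<odot>\<^bsub>V\<^esub> c1) = c))"

definition is_comodule ::
  "('k, 'z) ring_scheme \<Rightarrow> ('k, 'c) coalgebra \<Rightarrow> ('k, 'v) module \<Rightarrow> ('v \<Rightarrow> ('k, 'v, 'c) tens) \<Rightarrow> bool"
  where
  "is_comodule K C M \<rho> \<longleftrightarrow>
     (let V = csp C; VV = tensor K V V; MV = tensor K M V; MVV = tensor K M VV in
       module K M \<and> linear_map K M MV \<rho> \<and>
       (\<forall>m\<in>carrier M.
          tsum K MVV (\<rho> m) (\<lambda>m0 m1. tens K M VV m0 (delta C m1)) =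
          tsum K MVV (\<rho> m) (\<lambda>m0 m1.
            tsum K MVV (\<rho> m0) (\<lambda>m00 m01. tens K M VV m00 (tens K V V m01 m1)))) \<and>
       (\<forall>m\<in>carrier M. tsum K M (\<rho> m) (\<lambda>m0 m1. eps C m1 \<odot>\<^bsub>M\<^esub> m0) = m))"

definition colinear_map ::
  "('k, 'z) ring_scheme \<Rightarrow> ('k, 'c) coalgebra \<Rightarrow> ('k, 'v) module \<Rightarrow> ('v \<Rightarrow> ('k, 'v, 'c) tens) \<Rightarrow>
   ('k, 'w) module \<Rightarrow> ('w \<Rightarrow> ('k, 'w, 'c) tens) \<Rightarrow> ('v \<Rightarrow> 'w) \<Rightarrow> bool" where
  "colinear_map K C M \<rho> N \<sigma> f \<longleftrightarrow> linear_map K M N f \<and>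
     (\<forall>m\<in>carrier M.
        \<sigma> (f m) = tsum K (tensor K N (csp C)) (\<rho> m) (\<lambda>m0 m1. tens K N (csp C) (f m0) m1))"

definition comod_cat ::
  "'v set \<Rightarrow> ('k, 'z) ring_scheme \<Rightarrow> ('k, 'c) coalgebra
     \<Rightarrow> (('k, 'v) module \<times> ('v \<Rightarrow> ('k, 'v, 'c) tens), 'v \<Rightarrow> 'v) cat" where
  "comod_cat U K C =
     \<lparr>Ob = {(M, \<rho>). is_comodule K C M \<rho> \<and> small U (carrier M)},
      Arr = (\<lambda>(M, \<rho>) (N, \<sigma>). {f \<in> extensional (carrier M). colinear_map K C M \<rho> N \<sigma> f}),
      Idn = (\<lambda>(M, \<rho>). \<lambda>m\<in>carrier M. m),
      Cmp = (\<lambda>(M, \<rho>) N P g f. compose (carrier M) g f)\<rparr>"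

definition right_semiperfect ::
  "'v set \<Rightarrow> ('k, 'z) ring_scheme \<Rightarrow> ('k, 'c) coalgebra \<Rightarrow> bool" where
  "right_semiperfect U K C \<longleftrightarrow> enough_projectives (comod_cat U K C)"


section \<open>Entwining structures\<close>

text \<open>\<open>lcomp R r s t g f\<close> is the composite of \<open>f \<in> R(r,s)\<close> followed by \<open>g \<in> R(s,t)\<close>.\<close>

record ('k, 'o, 'm) lincat =
  lobj  :: "'o set"
  lhom  :: "'o \<Rightarrow> 'o \<Rightarrow> ('k, 'm) module"
  lid   :: "'o \<Rightarrow> 'm"
  lcomp :: "'o \<Rightarrow> 'o \<Rightarrow> 'o \<Rightarrow> 'm \<Rightarrow> 'm \<Rightarrow> 'm"

definition is_lincat :: "('k, 'z) ring_scheme \<Rightarrow> ('k, 'o, 'm, 'y) lincat_scheme \<Rightarrow> bool" where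
  "is_lincat K R \<longleftrightarrow>
     (\<forall>r\<in>lobj R. \<forall>s\<in>lobj R. module K (lhom R r s)) \<and>
     (\<forall>r\<in>lobj R. lid R r \<in> carrier (lhom R r r)) \<and>
     (\<forall>r\<in>lobj R. \<forall>s\<in>lobj R. \<forall>t\<in>lobj R.
        bilinear_map K (lhom R s t) (lhom R r s) (lhom R r t) (lcomp R r s t)) \<and>
     (\<forall>r\<in>lobj R. \<forall>s\<in>lobj R. \<forall>f\<in>carrier (lhom R r s).
        lcomp R r r s f (lid R r) = f \<and> lcomp R r s s (lid R s) f = f) \<and>
     (\<forall>q\<in>lobj R. \<forall>r\<in>lobj R. \<forall>s\<in>lobj R. \<forall>t\<in>lobj R.
        \<forall>f\<in>carrier (lhom R q r). \<forall>g\<in>carrier (lhom R r s). \<forall>h\<in>carrier (lhom R s t).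
          lcomp R q s t h (lcomp R q r s g f) = lcomp R q r t (lcomp R r s t h g) f)"

record ('k, 'o, 'm, 'c) entwining = "('k, 'o, 'm) lincat" +
  psi :: "'o \<Rightarrow> 'o \<Rightarrow> ('k, 'c, 'm) tens \<Rightarrow> ('k, 'm, 'c) tens"

abbreviation psit ::
  "('k, 'z) ring_scheme \<Rightarrow> ('k, 'c) coalgebra \<Rightarrow> ('k, 'o, 'm, 'c) entwining
     \<Rightarrow> 'o \<Rightarrow> 'o \<Rightarrow> 'c \<Rightarrow> 'm \<Rightarrow> ('k, 'm, 'c) tens" where
  "psit K C R r s c f \<equiv> psi R r s (tens K (csp C) (lhom R r s) c f)"

definition is_entwining ::
  "('k, 'z) ring_scheme \<Rightarrow> ('k, 'c) coalgebra \<Rightarrow> ('k, 'o, 'm, 'c) entwining \<Rightarrow> bool" where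
  "is_entwining K C R \<longleftrightarrow>
     (let V = csp C; VV = tensor K V V; H = lhom R; HV = (\<lambda>r s. tensor K (H r s) V);
          HVV = (\<lambda>r s. tensor K (H r s) VV); \<psi> = psit K C R in
       is_lincat K R \<and>
       (\<forall>r\<in>lobj R. \<forall>s\<in>lobj R. linear_map K (tensor K V (H r s)) (HV r s) (psi R r s)) \<and>
       (\<forall>r\<in>lobj R. \<forall>s\<in>lobj R. \<forall>t\<in>lobj R.
          \<forall>f\<in>carrier (H r s). \<forall>g\<in>carrier (H s t). \<forall>c\<in>carrier V.
            \<psi> r t c (lcomp R r s t g f) =
            tsum K (HV r t) (\<psi> s t c g) (\<lambda>g' c'.
              tsum K (HV r t) (\<psi> r s c' f) (\<lambda>f' c''. tens K (H r t) V (lcomp R r s t g' f') c''))) \<and>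
       (\<forall>r\<in>lobj R. \<forall>s\<in>lobj R. \<forall>f\<in>carrier (H r s). \<forall>c\<in>carrier V.
          tsum K (H r s) (\<psi> r s c f) (\<lambda>f' c'. eps C c' \<odot>\<^bsub>H r s\<^esub> f') = eps C c \<odot>\<^bsub>H r s\<^esub> f) \<and>
       (\<forall>r\<in>lobj R. \<forall>s\<in>lobj R. \<forall>f\<in>carrier (H r s). \<forall>c\<in>carrier V.
          tsum K (HVV r s) (\<psi> r s c f) (\<lambda>f' c'. tens K (H r s) VV f' (delta C c')) =
          tsum K (HVV r s) (delta C c) (\<lambda>c1 c2.
            tsum K (HVV r s) (\<psi> r s c2 f) (\<lambda>f' c2'.
              tsum K (HVV r s) (\<psi> r s c1 f') (\<lambda>f'' c1'. tens K (H r s) VV f'' (tens K V V c1' c2'))))) \<and>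
       (\<forall>r\<in>lobj R. \<forall>c\<in>carrier V. \<psi> r r c (lid R r) = tens K (H r r) V (lid R r) c))"

record ('o, 'm, 'o2, 'm2) linfun =
  lfob :: "'o \<Rightarrow> 'o2"
  lfar :: "'o \<Rightarrow> 'o \<Rightarrow> 'm \<Rightarrow> 'm2"

definition is_linfun ::
  "('k, 'z) ring_scheme \<Rightarrow> ('k, 'o, 'm, 'y) lincat_scheme \<Rightarrow> ('k, 'o2, 'm2, 'w) lincat_scheme
     \<Rightarrow> ('o, 'm, 'o2, 'm2) linfun \<Rightarrow> bool" where
  "is_linfun K R S \<alpha> \<longleftrightarrow>
     (\<forall>r\<in>lobj R. lfob \<alpha> r \<in> lobj S) \<and>
     (\<forall>r\<in>lobj R. \<forall>s\<in>lobj R.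
        linear_map K (lhom R r s) (lhom S (lfob \<alpha> r) (lfob \<alpha> s)) (lfar \<alpha> r s)) \<and>
     (\<forall>r\<in>lobj R. lfar \<alpha> r r (lid R r) = lid S (lfob \<alpha> r)) \<and>
     (\<forall>r\<in>lobj R. \<forall>s\<in>lobj R. \<forall>t\<in>lobj R. \<forall>f\<in>carrier (lhom R r s). \<forall>g\<in>carrier (lhom R s t).
        lfar \<alpha> r t (lcomp R r s t g f) =
        lcomp S (lfob \<alpha> r) (lfob \<alpha> s) (lfob \<alpha> t) (lfar \<alpha> s t g) (lfar \<alpha> r s f))"

definition linfun_restrict ::
  "('k, 'o, 'm, 'y) lincat_scheme \<Rightarrow> ('o, 'm, 'o2, 'm2) linfun \<Rightarrow> ('o, 'm, 'o2, 'm2) linfun" where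
  "linfun_restrict R \<alpha> =
     \<lparr>lfob = (\<lambda>r\<in>lobj R. lfob \<alpha> r),
      lfar = (\<lambda>r\<in>lobj R. \<lambda>s\<in>lobj R. \<lambda>f\<in>carrier (lhom R r s). lfar \<alpha> r s f)\<rparr>"

definition is_entwining_mor ::
  "('k, 'z) ring_scheme \<Rightarrow> ('k, 'c) coalgebra \<Rightarrow> ('k, 'o, 'm, 'c) entwining \<Rightarrow> ('k, 'o2, 'm2, 'c) entwining
     \<Rightarrow> ('o, 'm, 'o2, 'm2) linfun \<Rightarrow> bool" where
  "is_entwining_mor K C R S \<alpha> \<longleftrightarrow> is_linfun K R S \<alpha> \<and>
     (\<forall>r\<in>lobj R. \<forall>s\<in>lobj R. \<forall>f\<in>carrier (lhom R r s). \<forall>c\<in>carrier (csp C).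
        let H' = lhom S (lfob \<alpha> r) (lfob \<alpha> s) in
        tsum K (tensor K H' (csp C)) (psit K C R r s c f) (\<lambda>f' c'. tens K H' (csp C) (lfar \<alpha> r s f') c') =
        psit K C S (lfob \<alpha> r) (lfob \<alpha> s) c (lfar \<alpha> r s f))"

text \<open>
  Functors are normalised to be \<open>undefined\<close> outside their domain, so that equality of arrows in
  \<open>ent_cat\<close> is equality of functors.
\<close>

definition ent_cat ::
  "('k, 'z) ring_scheme \<Rightarrow> ('k, 'c) coalgebra
     \<Rightarrow> (('k, 'o, 'm, 'c) entwining, ('o, 'm, 'o, 'm) linfun) cat" where
  "ent_cat K C =
     \<lparr>Ob = {R. is_entwining K C R},
      Arr = (\<lambda>R S. {\<alpha>. is_entwining_mor K C R S \<alpha> \<and> linfun_restrict R \<alpha> = \<alpha>}),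
      Idn = (\<lambda>R. linfun_restrict R \<lparr>lfob = (\<lambda>r. r), lfar = (\<lambda>r s f. f)\<rparr>),
      Cmp = (\<lambda>R S T \<beta> \<alpha>. linfun_restrict R
               \<lparr>lfob = (\<lambda>r. lfob \<beta> (lfob \<alpha> r)),
                lfar = (\<lambda>r s f. lfar \<beta> (lfob \<alpha> r) (lfob \<alpha> s) (lfar \<alpha> r s f))\<rparr>)\<rparr>"


section \<open>Entwined modules\<close>

text \<open>\<open>eact M s r m f\<close> is \<open>mf \<in> M(s)\<close> for \<open>m \<in> M(r)\<close> and \<open>f \<in> R(s,r)\<close>.\<close>

record ('k, 'o, 'm, 'c, 'v) entmod =
  esp   :: "'o \<Rightarrow> ('k, 'v) module"
  eact  :: "'o \<Rightarrow> 'o \<Rightarrow> 'v \<Rightarrow> 'm \<Rightarrow> 'v"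
  ecoact :: "'o \<Rightarrow> 'v \<Rightarrow> ('k, 'v, 'c) tens"

definition is_entmod ::
  "('k, 'z) ring_scheme \<Rightarrow> ('k, 'c) coalgebra \<Rightarrow> ('k, 'o, 'm, 'c) entwining
     \<Rightarrow> ('k, 'o, 'm, 'c, 'v) entmod \<Rightarrow> bool" where
  "is_entmod K C R M \<longleftrightarrow>
     (\<forall>r\<in>lobj R. is_comodule K C (esp M r) (ecoact M r)) \<and>
     (\<forall>s\<in>lobj R. \<forall>r\<in>lobj R. bilinear_map K (esp M r) (lhom R s r) (esp M s) (eact M s r)) \<and>
     (\<forall>r\<in>lobj R. \<forall>m\<in>carrier (esp M r). eact M r r m (lid R r) = m) \<and>
     (\<forall>t\<in>lobj R. \<forall>s\<in>lobj R. \<forall>r\<in>lobj R.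
        \<forall>m\<in>carrier (esp M r). \<forall>f\<in>carrier (lhom R s r). \<forall>g\<in>carrier (lhom R t s).
          eact M t r m (lcomp R t s r f g) = eact M t s (eact M s r m f) g) \<and>
     (\<forall>s\<in>lobj R. \<forall>r\<in>lobj R. \<forall>m\<in>carrier (esp M r). \<forall>f\<in>carrier (lhom R s r).
        let MV = tensor K (esp M s) (csp C) in
        ecoact M s (eact M s r m f) =
        tsum K MV (ecoact M r m) (\<lambda>m0 m1.
          tsum K MV (psit K C R s r m1 f) (\<lambda>f' c'. tens K (esp M s) (csp C) (eact M s r m0 f') c')))"

text \<open>The two modules may have different carrier types.\<close>

definition entmod_hom ::
  "('k, 'z) ring_scheme \<Rightarrow> ('k, 'c) coalgebra \<Rightarrow> ('k, 'o, 'm, 'c) entwining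
     \<Rightarrow> ('k, 'o, 'm, 'c, 'v) entmod \<Rightarrow> ('k, 'o, 'm, 'c, 'w) entmod \<Rightarrow> ('o \<Rightarrow> 'v \<Rightarrow> 'w) set" where
  "entmod_hom K C R M N =
     {\<eta> \<in> extensional (lobj R).
        (\<forall>r\<in>lobj R. \<eta> r \<in> extensional (carrier (esp M r)) \<and>
           colinear_map K C (esp M r) (ecoact M r) (esp N r) (ecoact N r) (\<eta> r)) \<and>
        (\<forall>s\<in>lobj R. \<forall>r\<in>lobj R. \<forall>m\<in>carrier (esp M r). \<forall>f\<in>carrier (lhom R s r).
           \<eta> s (eact M s r m f) = eact N s r (\<eta> r m) f)}"

definition entmod_id ::
  "('k, 'o, 'm, 'c) entwining \<Rightarrow> ('k, 'o, 'm, 'c, 'v) entmod \<Rightarrow> ('o \<Rightarrow> 'v \<Rightarrow> 'v)" where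
  "entmod_id R M = (\<lambda>r\<in>lobj R. \<lambda>m\<in>carrier (esp M r). m)"

definition entmod_comp ::
  "('k, 'o, 'm, 'c) entwining \<Rightarrow> ('k, 'o, 'm, 'c, 'v) entmod
     \<Rightarrow> ('o \<Rightarrow> 'w \<Rightarrow> 'u) \<Rightarrow> ('o \<Rightarrow> 'v \<Rightarrow> 'w) \<Rightarrow> ('o \<Rightarrow> 'v \<Rightarrow> 'u)" where
  "entmod_comp R M \<zeta> \<eta> = (\<lambda>r\<in>lobj R. compose (carrier (esp M r)) (\<zeta> r) (\<eta> r))"

definition entmod_iso ::
  "('k, 'z) ring_scheme \<Rightarrow> ('k, 'c) coalgebra \<Rightarrow> ('k, 'o, 'm, 'c) entwining
     \<Rightarrow> ('k, 'o, 'm, 'c, 'v) entmod \<Rightarrow> ('k, 'o, 'm, 'c, 'w) entmod \<Rightarrow> ('o \<Rightarrow> 'v \<Rightarrow> 'w) \<Rightarrow> bool" where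
  "entmod_iso K C R M N \<eta> \<longleftrightarrow> \<eta> \<in> entmod_hom K C R M N \<and>
     (\<exists>\<zeta>\<in>entmod_hom K C R N M. entmod_comp R M \<zeta> \<eta> = entmod_id R M \<and> entmod_comp R N \<eta> \<zeta> = entmod_id R N)"

definition entmod_cat ::
  "'u set \<Rightarrow> ('k, 'z) ring_scheme \<Rightarrow> ('k, 'c) coalgebra \<Rightarrow> ('k, 'o, 'm, 'c) entwining
     \<Rightarrow> (('k, 'o, 'm, 'c, 'v) entmod, 'o \<Rightarrow> 'v \<Rightarrow> 'v) cat" where
  "entmod_cat U K C R =
     \<lparr>Ob = {M. is_entmod K C R M \<and> (\<forall>r\<in>lobj R. small U (carrier (esp M r)))},
      Arr = entmod_hom K C R,
      Idn = entmod_id R,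
      Cmp = (\<lambda>M N P. entmod_comp R M)\<rparr>"


section \<open>Restriction and extension along a morphism of entwining structures\<close>

definition res_mod ::
  "('o, 'm, 'o2, 'm2) linfun \<Rightarrow> ('k, 'o2, 'm2, 'c, 'v) entmod \<Rightarrow> ('k, 'o, 'm, 'c, 'v) entmod" where
  "res_mod \<alpha> N =
     \<lparr>esp = (\<lambda>r. esp N (lfob \<alpha> r)),
      eact = (\<lambda>s r m f. eact N (lfob \<alpha> s) (lfob \<alpha> r) m (lfar \<alpha> s r f)),
      ecoact = (\<lambda>r. ecoact N (lfob \<alpha> r))\<rparr>"

definition res_map ::
  "('k, 'o, 'm, 'c) entwining \<Rightarrow> ('o, 'm, 'o2, 'm2) linfun \<Rightarrow> ('o2 \<Rightarrow> 'v \<Rightarrow> 'w) \<Rightarrow> ('o \<Rightarrow> 'v \<Rightarrow> 'w)" where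
  "res_map R \<alpha> \<eta> = (\<lambda>r\<in>lobj R. \<eta> (lfob \<alpha> r))"

type_synonym ('k, 'o, 'v, 'm2) extel = "('o \<Rightarrow> ('k, 'v, 'm2) tens) set"

definition ext_summand ::
  "('k, 'z) ring_scheme \<Rightarrow> ('k, 'o2, 'm2, 'c) entwining \<Rightarrow> ('o, 'm, 'o2, 'm2) linfun
     \<Rightarrow> ('k, 'o, 'm, 'c, 'v) entmod \<Rightarrow> 'o2 \<Rightarrow> 'o \<Rightarrow> ('k, ('k, 'v, 'm2) tens) module" where
  "ext_summand K S \<alpha> M s r = tensor K (esp M r) (lhom S s (lfob \<alpha> r))"

definition ext_sum ::
  "('k, 'z) ring_scheme \<Rightarrow> ('k, 'o, 'm, 'c) entwining \<Rightarrow> ('k, 'o2, 'm2, 'c) entwining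
     \<Rightarrow> ('o, 'm, 'o2, 'm2) linfun \<Rightarrow> ('k, 'o, 'm, 'c, 'v) entmod \<Rightarrow> 'o2
     \<Rightarrow> ('k, 'o \<Rightarrow> ('k, 'v, 'm2) tens) module" where
  "ext_sum K R S \<alpha> M s = dsum_mod (lobj R) (ext_summand K S \<alpha> M s)"

definition ext_pre ::
  "('k, 'z) ring_scheme \<Rightarrow> ('k, 'o, 'm, 'c) entwining \<Rightarrow> ('k, 'o2, 'm2, 'c) entwining
     \<Rightarrow> ('o, 'm, 'o2, 'm2) linfun \<Rightarrow> ('k, 'o, 'm, 'c, 'v) entmod \<Rightarrow> 'o2
     \<Rightarrow> 'o \<Rightarrow> 'v \<Rightarrow> 'm2 \<Rightarrow> ('o \<Rightarrow> ('k, 'v, 'm2) tens)" where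
  "ext_pre K R S \<alpha> M s r m f =
     dsum_inj (lobj R) (ext_summand K S \<alpha> M s) r (tens K (esp M r) (lhom S s (lfob \<alpha> r)) m f)"

definition ext_null ::
  "('k, 'z) ring_scheme \<Rightarrow> ('k, 'o, 'm, 'c) entwining \<Rightarrow> ('k, 'o2, 'm2, 'c) entwining
     \<Rightarrow> ('o, 'm, 'o2, 'm2) linfun \<Rightarrow> ('k, 'o, 'm, 'c, 'v) entmod \<Rightarrow> 'o2
     \<Rightarrow> ('o \<Rightarrow> ('k, 'v, 'm2) tens) set" where
  "ext_null K R S \<alpha> M s =
     lin_span K (ext_sum K R S \<alpha> M s)
       {ext_pre K R S \<alpha> M s r' m' (lcomp S s (lfob \<alpha> r) (lfob \<alpha> r') (lfar \<alpha> r r' g) f)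
          \<ominus>\<^bsub>ext_sum K R S \<alpha> M s\<^esub> ext_pre K R S \<alpha> M s r (eact M r r' m' g) f | r r' m' g f.
        r \<in> lobj R \<and> r' \<in> lobj R \<and> m' \<in> carrier (esp M r') \<and> g \<in> carrier (lhom R r r') \<and>
        f \<in> carrier (lhom S s (lfob \<alpha> r))}"

definition ext_sp ::
  "('k, 'z) ring_scheme \<Rightarrow> ('k, 'o, 'm, 'c) entwining \<Rightarrow> ('k, 'o2, 'm2, 'c) entwining
     \<Rightarrow> ('o, 'm, 'o2, 'm2) linfun \<Rightarrow> ('k, 'o, 'm, 'c, 'v) entmod \<Rightarrow> 'o2
     \<Rightarrow> ('k, ('k, 'o, 'v, 'm2) extel) module" where
  "ext_sp K R S \<alpha> M s = quot_mod (ext_sum K R S \<alpha> M s) (ext_null K R S \<alpha> M s)"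

definition ext_cls ::
  "('k, 'z) ring_scheme \<Rightarrow> ('k, 'o, 'm, 'c) entwining \<Rightarrow> ('k, 'o2, 'm2, 'c) entwining
     \<Rightarrow> ('o, 'm, 'o2, 'm2) linfun \<Rightarrow> ('k, 'o, 'm, 'c, 'v) entmod \<Rightarrow> 'o2
     \<Rightarrow> 'o \<Rightarrow> 'v \<Rightarrow> 'm2 \<Rightarrow> ('k, 'o, 'v, 'm2) extel" where
  "ext_cls K R S \<alpha> M s r m f =
     ext_null K R S \<alpha> M s +>\<^bsub>ext_sum K R S \<alpha> M s\<^esub> ext_pre K R S \<alpha> M s r m f"

text \<open>
  If \<open>q\<close> is the class of \<open>\<Sum> m\<^sub>i \<otimes> f\<^sub>i\<close> with \<open>m\<^sub>i \<in> M(r\<^sub>i)\<close> and \<open>f\<^sub>i \<in> S(s, \<alpha>(r\<^sub>i))\<close>, then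
  \<open>qsum K R S \<alpha> M s Z q \<beta> = \<Sum> \<beta> r\<^sub>i m\<^sub>i f\<^sub>i\<close>. As for \<open>tsum\<close>, it is only applied to families \<open>\<beta>\<close> for
  which the sum does not depend on the representative.
\<close>

definition qsum ::
  "('k, 'z) ring_scheme \<Rightarrow> ('k, 'o, 'm, 'c) entwining \<Rightarrow> ('k, 'o2, 'm2, 'c) entwining
     \<Rightarrow> ('o, 'm, 'o2, 'm2) linfun \<Rightarrow> ('k, 'o, 'm, 'c, 'v) entmod \<Rightarrow> 'o2
     \<Rightarrow> ('k, 'w) module \<Rightarrow> ('k, 'o, 'v, 'm2) extel \<Rightarrow> ('o \<Rightarrow> 'v \<Rightarrow> 'm2 \<Rightarrow> 'w) \<Rightarrow> 'w" where
  "qsum K R S \<alpha> M s Z q \<beta> =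
     (let u = (SOME u. u \<in> q) in
       (\<Oplus>\<^bsub>Z\<^esub>r\<in>{r \<in> lobj R. u r \<noteq> \<zero>\<^bsub>ext_summand K S \<alpha> M s r\<^esub>}. tsum K Z (u r) (\<beta> r)))"

definition ext_mod ::
  "('k, 'z) ring_scheme \<Rightarrow> ('k, 'c) coalgebra \<Rightarrow> ('k, 'o, 'm, 'c) entwining \<Rightarrow> ('k, 'o2, 'm2, 'c) entwining
     \<Rightarrow> ('o, 'm, 'o2, 'm2) linfun \<Rightarrow> ('k, 'o, 'm, 'c, 'v) entmod
     \<Rightarrow> ('k, 'o2, 'm2, 'c, ('k, 'o, 'v, 'm2) extel) entmod" where
  "ext_mod K C R S \<alpha> M =
     \<lparr>esp = ext_sp K R S \<alpha> M,
      eact = (\<lambda>t s q h. qsum K R S \<alpha> M s (ext_sp K R S \<alpha> M t) q (\<lambda>r m f.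
                ext_cls K R S \<alpha> M t r m (lcomp S t s (lfob \<alpha> r) f h))),
      ecoact = (\<lambda>s q.
        let E = ext_sp K R S \<alpha> M s; EV = tensor K E (csp C) in
        qsum K R S \<alpha> M s EV q (\<lambda>r m f.
          tsum K EV (ecoact M r m) (\<lambda>m0 m1.
            tsum K EV (psit K C S s (lfob \<alpha> r) m1 f) (\<lambda>f' c'.
              tens K E (csp C) (ext_cls K R S \<alpha> M s r m0 f') c'))))\<rparr>"

definition ext_map ::
  "('k, 'z) ring_scheme \<Rightarrow> ('k, 'o, 'm, 'c) entwining \<Rightarrow> ('k, 'o2, 'm2, 'c) entwining
     \<Rightarrow> ('o, 'm, 'o2, 'm2) linfun \<Rightarrow> ('k, 'o, 'm, 'c, 'v) entmod \<Rightarrow> ('k, 'o, 'm, 'c, 'w) entmod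
     \<Rightarrow> ('o \<Rightarrow> 'v \<Rightarrow> 'w) \<Rightarrow> ('o2 \<Rightarrow> ('k, 'o, 'v, 'm2) extel \<Rightarrow> ('k, 'o, 'w, 'm2) extel)" where
  "ext_map K R S \<alpha> M N \<eta> =
     (\<lambda>s\<in>lobj S. \<lambda>q\<in>carrier (ext_sp K R S \<alpha> M s).
        qsum K R S \<alpha> M s (ext_sp K R S \<alpha> N s) q (\<lambda>r m f. ext_cls K R S \<alpha> N s r (\<eta> r m) f))"

definition ext_functor ::
  "('k, 'z) ring_scheme \<Rightarrow> ('k, 'c) coalgebra \<Rightarrow> ('k, 'o, 'm, 'c) entwining \<Rightarrow> ('k, 'o2, 'm2, 'c) entwining
     \<Rightarrow> ('o, 'm, 'o2, 'm2) linfun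
     \<Rightarrow> (('k, 'o, 'm, 'c, 'v) entmod, 'o \<Rightarrow> 'v \<Rightarrow> 'v,
         ('k, 'o2, 'm2, 'c, ('k, 'o, 'v, 'm2) extel) entmod,
         'o2 \<Rightarrow> ('k, 'o, 'v, 'm2) extel \<Rightarrow> ('k, 'o, 'v, 'm2) extel) cfunctor" where
  "ext_functor K C R S \<alpha> =
     \<lparr>fob = ext_mod K C R S \<alpha>, far = (\<lambda>M N \<eta>. ext_map K R S \<alpha> M N \<eta>)\<rparr>"

text \<open>The map \<open>ext_mod \<alpha> M \<rightarrow> N\<close> that corresponds to \<open>\<eta> : M \<rightarrow> res_mod \<alpha> N\<close> under the adjunction.\<close>

definition ext_transpose ::
  "('k, 'z) ring_scheme \<Rightarrow> ('k, 'o, 'm, 'c) entwining \<Rightarrow> ('k, 'o2, 'm2, 'c) entwining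
     \<Rightarrow> ('o, 'm, 'o2, 'm2) linfun \<Rightarrow> ('k, 'o, 'm, 'c, 'v) entmod \<Rightarrow> ('k, 'o2, 'm2, 'c, 'w) entmod
     \<Rightarrow> ('o \<Rightarrow> 'v \<Rightarrow> 'w) \<Rightarrow> ('o2 \<Rightarrow> ('k, 'o, 'v, 'm2) extel \<Rightarrow> 'w)" where
  "ext_transpose K R S \<alpha> M N \<eta> =
     (\<lambda>s\<in>lobj S. \<lambda>q\<in>carrier (ext_sp K R S \<alpha> M s).
        qsum K R S \<alpha> M s (esp N s) q (\<lambda>r m f. eact N s (lfob \<alpha> r) (\<eta> r m) f))"


section \<open>Entwined representations and their modules\<close>

type_synonym ('x, 'a, 'k, 'o, 'm, 'c) rep =
  "('x, 'a, ('k, 'o, 'm, 'c) entwining, ('o, 'm, 'o, 'm) linfun) cfunctor"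

definition entwined_rep ::
  "('k, 'z) ring_scheme \<Rightarrow> ('k, 'c) coalgebra \<Rightarrow> ('x, 'a) cat \<Rightarrow> ('x, 'a, 'k, 'o, 'm, 'c) rep \<Rightarrow> bool"
  where
  "entwined_rep K C \<X> \<R> \<longleftrightarrow> is_functor \<X> (ent_cat K C) \<R>"

text \<open>
  The elements of \<open>\<alpha>\<^sup>*M\<close> are classes of formal sums and do not live in the carrier type of \<open>M\<close>;
  its carriers are again small with respect to \<open>U\<close>, though.
\<close>

definition flat_rep ::
  "'v set \<Rightarrow> ('k, 'z) ring_scheme \<Rightarrow> ('k, 'c) coalgebra \<Rightarrow> ('x, 'a) cat
     \<Rightarrow> ('x, 'a, 'k, 'o, 'm, 'c) rep \<Rightarrow> bool" where
  "flat_rep U K C \<X> \<R> \<longleftrightarrow>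
     (\<forall>x\<in>Ob \<X>. \<forall>y\<in>Ob \<X>. \<forall>\<alpha>\<in>Arr \<X> x y.
        exact_functor
          (entmod_cat U K C (fob \<R> x) :: (('k, 'o, 'm, 'c, 'v) entmod, 'o \<Rightarrow> 'v \<Rightarrow> 'v) cat)
          (entmod_cat U K C (fob \<R> y))
          (ext_functor K C (fob \<R> x) (fob \<R> y) (far \<R> x y \<alpha>)))"

record ('x, 'a, 'k, 'o, 'm, 'c, 'v) repmod =
  rat :: "'x \<Rightarrow> ('k, 'o, 'm, 'c, 'v) entmod"
  rtr :: "'x \<Rightarrow> 'x \<Rightarrow> 'a \<Rightarrow> ('o \<Rightarrow> 'v \<Rightarrow> 'v)"

definition is_repmod ::
  "'v set \<Rightarrow> ('k, 'z) ring_scheme \<Rightarrow> ('k, 'c) coalgebra \<Rightarrow> ('x, 'a) cat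
     \<Rightarrow> ('x, 'a, 'k, 'o, 'm, 'c) rep \<Rightarrow> ('x, 'a, 'k, 'o, 'm, 'c, 'v) repmod \<Rightarrow> bool" where
  "is_repmod U K C \<X> \<R> \<M> \<longleftrightarrow>
     (\<forall>x\<in>Ob \<X>. rat \<M> x \<in> Ob (entmod_cat U K C (fob \<R> x))) \<and>
     (\<forall>x\<in>Ob \<X>. \<forall>y\<in>Ob \<X>. \<forall>\<alpha>\<in>Arr \<X> x y.
        rtr \<M> x y \<alpha> \<in> entmod_hom K C (fob \<R> x) (rat \<M> x) (res_mod (far \<R> x y \<alpha>) (rat \<M> y))) \<and>
     (\<forall>x\<in>Ob \<X>. rtr \<M> x x (Idn \<X> x) = entmod_id (fob \<R> x) (rat \<M> x)) \<and>
     (\<forall>x\<in>Ob \<X>. \<forall>y\<in>Ob \<X>. \<forall>z\<in>Ob \<X>. \<forall>\<alpha>\<in>Arr \<X> x y. \<forall>\<beta>\<in>Arr \<X> y z.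
        rtr \<M> x z (Cmp \<X> x y z \<beta> \<alpha>) =
        entmod_comp (fob \<R> x) (rat \<M> x) (res_map (fob \<R> x) (far \<R> x y \<alpha>) (rtr \<M> y z \<beta>)) (rtr \<M> x y \<alpha>))"

definition repmod_hom ::
  "('k, 'z) ring_scheme \<Rightarrow> ('k, 'c) coalgebra \<Rightarrow> ('x, 'a) cat
     \<Rightarrow> ('x, 'a, 'k, 'o, 'm, 'c) rep \<Rightarrow> ('x, 'a, 'k, 'o, 'm, 'c, 'v) repmod
     \<Rightarrow> ('x, 'a, 'k, 'o, 'm, 'c, 'v) repmod \<Rightarrow> ('x \<Rightarrow> 'o \<Rightarrow> 'v \<Rightarrow> 'v) set" where
  "repmod_hom K C \<X> \<R> \<M> \<N> =
     {\<eta> \<in> extensional (Ob \<X>).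
        (\<forall>x\<in>Ob \<X>. \<eta> x \<in> entmod_hom K C (fob \<R> x) (rat \<M> x) (rat \<N> x)) \<and>
        (\<forall>x\<in>Ob \<X>. \<forall>y\<in>Ob \<X>. \<forall>\<alpha>\<in>Arr \<X> x y.
           entmod_comp (fob \<R> x) (rat \<M> x) (rtr \<N> x y \<alpha>) (\<eta> x) =
           entmod_comp (fob \<R> x) (rat \<M> x) (res_map (fob \<R> x) (far \<R> x y \<alpha>) (\<eta> y)) (rtr \<M> x y \<alpha>))}"

definition repmod_cat ::
  "'v set \<Rightarrow> ('k, 'z) ring_scheme \<Rightarrow> ('k, 'c) coalgebra \<Rightarrow> ('x, 'a) cat
     \<Rightarrow> ('x, 'a, 'k, 'o, 'm, 'c) rep
     \<Rightarrow> (('x, 'a, 'k, 'o, 'm, 'c, 'v) repmod, 'x \<Rightarrow> 'o \<Rightarrow> 'v \<Rightarrow> 'v) cat" where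
  "repmod_cat U K C \<X> \<R> =
     \<lparr>Ob = {\<M>. is_repmod U K C \<X> \<R> \<M>},
      Arr = repmod_hom K C \<X> \<R>,
      Idn = (\<lambda>\<M>. \<lambda>x\<in>Ob \<X>. entmod_id (fob \<R> x) (rat \<M> x)),
      Cmp = (\<lambda>\<M> \<N> \<P> \<zeta> \<eta>. \<lambda>x\<in>Ob \<X>. entmod_comp (fob \<R> x) (rat \<M> x) (\<zeta> x) (\<eta> x))\<rparr>"

definition cartesian ::
  "('k, 'z) ring_scheme \<Rightarrow> ('k, 'c) coalgebra \<Rightarrow> ('x, 'a) cat
     \<Rightarrow> ('x, 'a, 'k, 'o, 'm, 'c) rep \<Rightarrow> ('x, 'a, 'k, 'o, 'm, 'c, 'v) repmod \<Rightarrow> bool" where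
  "cartesian K C \<X> \<R> \<M> \<longleftrightarrow>
     (\<forall>x\<in>Ob \<X>. \<forall>y\<in>Ob \<X>. \<forall>\<alpha>\<in>Arr \<X> x y.
        entmod_iso K C (fob \<R> y)
          (ext_mod K C (fob \<R> x) (fob \<R> y) (far \<R> x y \<alpha>) (rat \<M> x)) (rat \<M> y)
          (ext_transpose K (fob \<R> x) (fob \<R> y) (far \<R> x y \<alpha>) (rat \<M> x) (rat \<M> y) (rtr \<M> x y \<alpha>)))"

definition cart_cat ::
  "'v set \<Rightarrow> ('k, 'z) ring_scheme \<Rightarrow> ('k, 'c) coalgebra \<Rightarrow> ('x, 'a) cat
     \<Rightarrow> ('x, 'a, 'k, 'o, 'm, 'c) rep
     \<Rightarrow> (('x, 'a, 'k, 'o, 'm, 'c, 'v) repmod, 'x \<Rightarrow> 'o \<Rightarrow> 'v \<Rightarrow> 'v) cat" where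
  "cart_cat U K C \<X> \<R> =
     (repmod_cat U K C \<X> \<R>)\<lparr>Ob := {\<M>. is_repmod U K C \<X> \<R> \<M> \<and> cartesian K C \<X> \<R> \<M>}\<rparr>"


section \<open>Universes\<close>

text \<open>
  A universe containing the data \<open>K, C, \<X>, \<R>\<close> as small objects is rendered by its cardinality. For
  a Grothendieck universe this is an inaccessible cardinal, whose existence cannot be proved in HOL.
  It suffices that \<open>U\<close> is regular and larger than the power set of some infinite set that bounds
  the data. Every inaccessible cardinal above the data has this property (\<open>universe_forI\<close>), and so
  has the successor of the cardinality of such a power set.
\<close>

definition universe_for ::
  "'u set \<Rightarrow> ('k, 'z) ring_scheme \<Rightarrow> ('k, 'c) coalgebra \<Rightarrow> ('x, 'a) cat
     \<Rightarrow> ('x, 'a, 'k, 'o, 'm, 'c) rep \<Rightarrow> bool" where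
  "universe_for U K C \<X> \<R> \<longleftrightarrow> regularCard |U| \<and>
     (\<exists>D :: 'u set. infinite D \<and> small U (Pow D) \<and>
        |carrier K| \<le>o |D| \<and> |carrier (csp C)| \<le>o |D| \<and>
        |Ob \<X>| \<le>o |D| \<and> (\<forall>x\<in>Ob \<X>. \<forall>y\<in>Ob \<X>. |Arr \<X> x y| \<le>o |D| ) \<and>
        (\<forall>x\<in>Ob \<X>. |lobj (fob \<R> x)| \<le>o |D| \<and>
           (\<forall>r\<in>lobj (fob \<R> x). \<forall>s\<in>lobj (fob \<R> x). |carrier (lhom (fob \<R> x) r s)| \<le>o |D| )))"

lemma universe_forI:
  fixes U :: "'u set" and C :: "('k, 'c) coalgebra" and \<R> :: "('x, 'a, 'k, 'o, 'm, 'c) rep"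
  assumes reg: "regularCard |U|"
    and inf: "small U (UNIV :: nat set)"
    and lim: "\<And>A :: 'u set. small U A \<Longrightarrow> small U (Pow A)"
    and K: "small U (carrier K)" and C: "small U (carrier (csp C))"
    and X: "small U (Ob \<X>)" "\<And>x y. x \<in> Ob \<X> \<Longrightarrow> y \<in> Ob \<X> \<Longrightarrow> small U (Arr \<X> x y)"
    and R: "\<And>x. x \<in> Ob \<X> \<Longrightarrow> small U (lobj (fob \<R> x))"
      "\<And>x r s. x \<in> Ob \<X> \<Longrightarrow> r \<in> lobj (fob \<R> x) \<Longrightarrow> s \<in> lobj (fob \<R> x) \<Longrightarrow>
         small U (carrier (lhom (fob \<R> x) r s))"
  shows "universe_for U K C \<X> \<R>"
proof -
  have infU: "infinite U"
    by (rule card_of_ordLeq_infinite[OF ordLess_imp_ordLeq[OF inf[unfolded small_def]]]) simp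
  have st: "stable |U|"
    by (rule regularCard_stable[OF card_of_Card_order _ reg]) (simp only: Field_card_of infU not_False_eq_True)
  have plus: "small U (Sum_Type.Plus A B)" if "small U A" "small U B" for A :: "'s set" and B :: "'t set"
    using that infU unfolding small_def by (rule_tac card_of_Plus_ordLess_infinite)
  have sig: "small U (Sigma A B)" if "small U A" "\<And>a. a \<in> A \<Longrightarrow> small U (B a)"
    for A :: "'s set" and B :: "'s \<Rightarrow> 't set"
    using stable_elim[OF st] that unfolding small_def by blast
  define S1 where "S1 = (SIGMA x:Ob \<X>. SIGMA y:Ob \<X>. Arr \<X> x y)"
  define S2 where "S2 = (SIGMA x:Ob \<X>. lobj (fob \<R> x))"
  define S3 where "S3 = (SIGMA x:Ob \<X>. SIGMA r:lobj (fob \<R> x). SIGMA s:lobj (fob \<R> x).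
                            carrier (lhom (fob \<R> x) r s))"
  define S where "S = Sum_Type.Plus (UNIV :: nat set) (Sum_Type.Plus (carrier K) (Sum_Type.Plus (carrier (csp C))
                         (Sum_Type.Plus (Ob \<X>) (Sum_Type.Plus S1 (Sum_Type.Plus S2 S3)))))"
  have smS: "small U S"
    unfolding S_def S1_def S2_def S3_def by (intro plus sig inf K C X R)
  obtain D where D: "D \<subset> U" "|S| =o |D|" "|D| <o |U|"
    using iffD1[OF internalize_card_of_ordLess smS[unfolded small_def]] by (auto simp only: Field_card_of)
  have le: "|A| \<le>o |D|" if "inj_on f A" "f ` A \<subseteq> S" for A :: "'t set" and f
  proof -
    have "|A| \<le>o |S|" using that card_of_ordLeq[of A S] by blast
    then show ?thesis using D(2) by (rule ordLeq_ordIso_trans)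
  qed
  have "|UNIV :: nat set| \<le>o |D|" by (rule le[of Inl]) (auto simp: S_def)
  then have i: "infinite D" by (rule card_of_ordLeq_infinite) simp
  have "|carrier K| \<le>o |D|" by (rule le[of "Inr \<circ> Inl"]) (auto simp: S_def inj_on_def)
  moreover have "|carrier (csp C)| \<le>o |D|"
    by (rule le[of "Inr \<circ> Inr \<circ> Inl"]) (auto simp: S_def inj_on_def)
  moreover have "|Ob \<X>| \<le>o |D|"
    by (rule le[of "Inr \<circ> Inr \<circ> Inr \<circ> Inl"]) (auto simp: S_def inj_on_def)
  moreover have "|Arr \<X> x y| \<le>o |D|" if "x \<in> Ob \<X>" "y \<in> Ob \<X>" for x y
    by (rule le[of "\<lambda>f. Inr (Inr (Inr (Inr (Inl (x, y, f)))))"])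
      (use that in \<open>auto simp: S_def S1_def inj_on_def\<close>)
  moreover have "|lobj (fob \<R> x)| \<le>o |D|" if "x \<in> Ob \<X>" for x
    by (rule le[of "\<lambda>r. Inr (Inr (Inr (Inr (Inr (Inl (x, r))))))"])
      (use that in \<open>auto simp: S_def S2_def inj_on_def\<close>)
  moreover have "|carrier (lhom (fob \<R> x) r s)| \<le>o |D|"
    if "x \<in> Ob \<X>" "r \<in> lobj (fob \<R> x)" "s \<in> lobj (fob \<R> x)" for x r s
    by (rule le[of "\<lambda>f. Inr (Inr (Inr (Inr (Inr (Inr (x, r, s, f))))))"])
      (use that in \<open>auto simp: S_def S3_def inj_on_def\<close>)
  moreover have "small U (Pow D)" using lim D(3) unfolding small_def by blast
  ultimately show ?thesis unfolding universe_for_def using reg i by blast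
qed

end

theory Submission
  imports Defs
begin

text \<open>
 A cartesian module is a family of vector spaces \<open>M(x, r)\<close>, and kernels, cokernels and direct sums
 can be formed componentwise: the result is cartesian because \<open>\<alpha>\<^sup>*\<close> preserves cokernels and direct
 sums, and, by flatness, kernels. So the category is abelian with coproducts, and filtered colimits
 can be computed with elements, which makes them exact.

 For a generator, take an element of a cartesian module and close it under all operations, under
 the finitely many left components of its coaction and, as \<open>\<alpha>\<^sup>*M\<^sub>x \<rightarrow> M\<^sub>y\<close> is onto, under the finitely
 many elements that occur in a preimage. By flatness \<open>\<alpha>\<^sup>*\<close> is injective on submodules, so the closure is
 again cartesian, and its size is bounded by that of the data. Up to isomorphism there is only a small
 set of such modules, and their coproduct is a generator.

 The action and coaction of \<open>\<alpha>\<^sup>*M\<close> are never unfolded: flatness contains the statement that \<open>\<alpha>\<^sup>*\<close>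
 is a functor into entwined modules, and that the map \<open>\<alpha>\<^sup>*Q\<^sub>x \<rightarrow> Q\<^sub>y\<close> of a newly formed module is
 colinear can be tested after composing with maps that jointly span \<open>\<alpha>\<^sup>*Q\<^sub>x\<close>.
\<close>

text \<open>Two obstacles shape the constructions. All modules of the category have carriers in one
  type \<open>'v\<close>, so a quotient cannot be a set of cosets and a direct sum cannot be a set
  of functions: quotients are realised as images of idempotent linear maps, direct sums are moved
  along an injection. The former rests on the generalised inverses of linear maps over a field, the
  latter on smallness. The same splittings show that tensoring with \<open>C\<close> preserves
  injections, so that kernels and the laws of coactions pass to subspaces.

  The size of the generator is controlled by a set \<open>D\<close> that bounds the data. A
  cartesian module of bounded size can be labelled by elements of \<open>D\<close>, and its
  structure becomes a tuple of subsets of sets no larger than \<open>D\<close>. The smallness of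
  \<open>Pow D\<close> makes the set of these tuples small.

  Exactness, products and the passage to a generator are treated for abstract families of vector
  spaces; only kernels, cokernels, direct sums and a separating family are specific to cartesian
  modules.\<close>

abbreviation (input) module_add ("(_ +[_] _)" [65, 0, 66] 65) where "x +[V] y \<equiv> add V x y"
abbreviation (input) module_minus ("(_ -[_] _)" [65, 0, 66] 65) where "x -[V] y \<equiv> a_minus V x y"
abbreviation (input) module_smult ("(_ *[_] _)" [70, 0, 71] 70) where "a *[V] x \<equiv> smult V a x"
abbreviation (input) module_zero ("0[_]") where "0[V] \<equiv> zero V"
abbreviation (input) module_elem (infix "<:" 50) where "x <: V \<equiv> x \<in> carrier V"
abbreviation (input) lincat_obj (infix "<." 50) where "r <. R \<equiv> r \<in> lobj R"
abbreviation (input) "rsp M x r \<equiv> esp (rat M x) r"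

section \<open>Linear algebra\<close>

text \<open>The vector spaces are arguments of every statement and not fixed by the locale, because
  a single statement often involves carriers of several types.\<close>

locale ground =
 fixes K :: "('k, 'z) ring_scheme" (structure)
 assumes field_K: "field K"
begin

abbreviation lin :: "('k, 'a) module => ('k, 'b) module => ('a => 'b) => bool" where
 "lin V W f \<equiv> linear_map K V W f"

lemma cring_K: "cring K"
 using field_K by (simp add: field_def domain_def)

lemma ring_K: "ring K"
 using cring_K by (rule cring.axioms)

lemma K_closed [simp]:
 "a <: K ==> b <: K ==> a \<otimes> b <: K"
 "a <: K ==> b <: K ==> a \<oplus> b <: K"
 "\<one> <: K" "\<zero> <: K" "a <: K ==> \<ominus> a <: K"
 using ring.ring_simprules[OF ring_K] by auto

lemma K_minus_one [simp]: "\<one> \<oplus> \<ominus> \<one> = \<zero>" "\<ominus> \<one> \<oplus> \<one> = \<zero>"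
 using ring.ring_simprules[OF ring_K] by auto

lemma K_one_neq_zero: "\<one> ~= \<zero>"
 using field_K by (simp add: field_def domain_def domain_axioms_def)

lemma mod_closed [simp]:
 assumes "module K V"
 shows "x <: V ==> y <: V ==> x +[V] y <: V"
  "0[V] <: V" "x <: V ==> \<ominus>\<^bsub>V\<^esub> x <: V"
  "x <: V ==> y <: V ==> x -[V] y <: V"
  "a <: K ==> x <: V ==> a *[V] x <: V"
proof -
 interpret module K V by fact
 show "x <: V ==> y <: V ==> x +[V] y <: V"
  "0[V] <: V" "x <: V ==> \<ominus>\<^bsub>V\<^esub> x <: V"
  "x <: V ==> y <: V ==> x -[V] y <: V"
  "a <: K ==> x <: V ==> a *[V] x <: V" by simp_all
qed

lemma mod_simps [simp]:
 assumes "module K V"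
 shows "x <: V ==> x +[V] 0[V] = x" "x <: V ==> 0[V] +[V] x = x"
  "x <: V ==> x +[V] \<ominus>\<^bsub>V\<^esub> x = 0[V]" "x <: V ==> \<ominus>\<^bsub>V\<^esub> x +[V] x = 0[V]"
  "x <: V ==> \<one> *[V] x = x" "x <: V ==> \<zero> *[V] x = 0[V]"
  "a <: K ==> a *[V] 0[V] = 0[V]"
  "x <: V ==> x -[V] x = 0[V]" "x <: V ==> \<ominus>\<^bsub>V\<^esub> (\<ominus>\<^bsub>V\<^esub> x) = x"
  "\<ominus>\<^bsub>V\<^esub> 0[V] = 0[V]" "x <: V ==> x -[V] 0[V] = x"
proof -
 interpret module K V by fact
 show "x <: V ==> x +[V] 0[V] = x" "x <: V ==> 0[V] +[V] x = x"
  "x <: V ==> x +[V] \<ominus>\<^bsub>V\<^esub> x = 0[V]" "x <: V ==> \<ominus>\<^bsub>V\<^esub> x +[V] x = 0[V]"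
  "x <: V ==> \<one> *[V] x = x" "x <: V ==> \<zero> *[V] x = 0[V]"
  "a <: K ==> a *[V] 0[V] = 0[V]"
  "x <: V ==> \<ominus>\<^bsub>V\<^esub> (\<ominus>\<^bsub>V\<^esub> x) = x" "\<ominus>\<^bsub>V\<^esub> 0[V] = 0[V]"
  by (simp_all add: M.r_neg M.l_neg)
 show "x <: V ==> x -[V] x = 0[V]" "x <: V ==> x -[V] 0[V] = x"
  by (simp_all add: M.r_neg a_minus_def)
qed

lemma mod_ac:
 assumes "module K V"
 shows "x <: V ==> y <: V ==> z <: V ==>
   x +[V] y +[V] z = x +[V] (y +[V] z)"
  "x <: V ==> y <: V ==> x +[V] y = y +[V] x"
  "x <: V ==> y <: V ==> z <: V ==>
   x +[V] (y +[V] z) = y +[V] (x +[V] z)"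
proof -
 interpret module K V by fact
 show "x <: V ==> y <: V ==> z <: V ==>
   x +[V] y +[V] z = x +[V] (y +[V] z)"
  "x <: V ==> y <: V ==> x +[V] y = y +[V] x"
  "x <: V ==> y <: V ==> z <: V ==>
   x +[V] (y +[V] z) = y +[V] (x +[V] z)" by (simp_all add: M.a_ac)
qed

lemma mod_distr:
 assumes "module K V"
 shows "a <: K ==> x <: V ==> y <: V ==>
   a *[V] (x +[V] y) = a *[V] x +[V] a *[V] y"
  "a <: K ==> b <: K ==> x <: V ==>
   (a \<oplus> b) *[V] x = a *[V] x +[V] b *[V] x"
  "a <: K ==> b <: K ==> x <: V ==>
   (a \<otimes> b) *[V] x = a *[V] (b *[V] x)"
proof -
 interpret module K V by fact
 show "a <: K ==> x <: V ==> y <: V ==>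
   a *[V] (x +[V] y) = a *[V] x +[V] a *[V] y"
  "a <: K ==> b <: K ==> x <: V ==>
   (a \<oplus> b) *[V] x = a *[V] x +[V] b *[V] x"
  "a <: K ==> b <: K ==> x <: V ==>
   (a \<otimes> b) *[V] x = a *[V] (b *[V] x)"
  by (simp_all add: smult_l_distr smult_r_distr smult_assoc1)
qed

lemma mod_neg:
 assumes "module K V"
 shows "x <: V ==> \<ominus>\<^bsub>V\<^esub> x = (\<ominus> \<one>) *[V] x"
  "x <: V ==> x -[V] y = x +[V] \<ominus>\<^bsub>V\<^esub> y"
proof -
 interpret module K V by fact
 show "x <: V ==> \<ominus>\<^bsub>V\<^esub> x = (\<ominus> \<one>) *[V] x" by (simp add: smult_l_minus)
 show "x <: V ==> x -[V] y = x +[V] \<ominus>\<^bsub>V\<^esub> y" by (simp add: a_minus_def)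
qed

lemma mod_neg_add:
 assumes "module K V" "x <: V" "y <: V"
 shows "\<ominus>\<^bsub>V\<^esub> (x +[V] y) = \<ominus>\<^bsub>V\<^esub> x +[V] \<ominus>\<^bsub>V\<^esub> y"
 using assms by (simp add: mod_neg(1) mod_distr)

lemma mod_diff_eq_0:
 assumes "module K V" "x <: V" "y <: V"
 shows "x -[V] y = 0[V] \<longleftrightarrow> x = y"
proof -
 interpret module K V by fact
 show ?thesis using assms(2,3)
  by (metis M.add.inv_closed M.minus_equality M.minus_minus M.r_neg M.a_comm a_minus_def)
qed

lemma mod_cancel:
 assumes "module K V" "x <: V" "y <: V"
 shows "(x -[V] y) +[V] y = x" "y +[V] (x -[V] y) = x" "(x +[V] y) -[V] y = x"
  "(y +[V] x) -[V] y = x"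
proof -
 interpret module K V by fact
 show *: "(x -[V] y) +[V] y = x" "(x +[V] y) -[V] y = x"
  using assms(2,3) by (simp_all add: a_minus_def M.a_assoc M.l_neg M.r_neg)
 show "y +[V] (x -[V] y) = x" "(y +[V] x) -[V] y = x"
  using * assms(2,3) by (simp_all add: M.a_comm)
qed

lemma add4:
 assumes "module K V" "x <: V" "y <: V" "x' <: V" "y' <: V"
 shows "(x +[V] y) +[V] (x' +[V] y') = (x +[V] x') +[V] (y +[V] y')"
 using assms by (simp add: mod_ac[OF assms(1)])

lemma diff_add4:
 assumes "module K V" "x <: V" "y <: V" "x' <: V" "y' <: V"
 shows "(x -[V] y) +[V] (x' -[V] y') = (x +[V] x') -[V] (y +[V] y')"
 using assms by (simp add: mod_neg(2) mod_neg_add add4)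

lemma smult_diff:
 assumes "module K V" "a <: K" "x <: V" "y <: V"
 shows "a *[V] (x -[V] y) = a *[V] x -[V] a *[V] y"
 using assms by (simp add: mod_neg(2) mod_distr module.smult_r_minus[OF assms(1)])

text \<open>Additive inverses are not among the axioms to be checked: the law for
  \<open>\<zero> *[V] x\<close> makes \<open>(\<ominus> \<one>) *[V] x\<close> an inverse of
  \<open>x\<close>.\<close>

lemma moduleI':
 assumes "!!x y. x <: V ==> y <: V ==> x +[V] y <: V"
  and "0[V] <: V"
  and "!!a x. a <: K ==> x <: V ==> a *[V] x <: V"
  and "!!x y z. x <: V ==> y <: V ==> z <: V ==>
   x +[V] y +[V] z = x +[V] (y +[V] z)"
  and "!!x y. x <: V ==> y <: V ==> x +[V] y = y +[V] x"
  and "!!x. x <: V ==> 0[V] +[V] x = x"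
  and "!!x. x <: V ==> \<zero> *[V] x = 0[V]"
  and "!!x. x <: V ==> \<one> *[V] x = x"
  and "!!a x y. a <: K ==> x <: V ==> y <: V ==>
   a *[V] (x +[V] y) = a *[V] x +[V] a *[V] y"
  and "!!a b x. a <: K ==> b <: K ==> x <: V ==>
   (a \<oplus> b) *[V] x = a *[V] x +[V] b *[V] x"
  and "!!a b x. a <: K ==> b <: K ==> x <: V ==>
   (a \<otimes> b) *[V] x = a *[V] (b *[V] x)"
 shows "module K V"
proof (rule moduleI[OF cring_K])
 show "abelian_group V"
 proof (rule abelian_groupI)
  fix x assume "x <: V"
  then have "(\<ominus> \<one>) *[V] x +[V] x = (\<ominus> \<one> \<oplus> \<one>) *[V] x"
   using assms(8)[of x] assms(10)[of "\<ominus> \<one>" \<one> x] by simp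
  also have "\<dots> = 0[V]" using assms(7) \<open>x <: V\<close> by simp
  finally show "EX y:carrier V. y +[V] x = 0[V]"
   using assms(3) \<open>x <: V\<close> by (meson K_closed(3,5))
 qed (use assms in auto)
qed (use assms in auto)

text \<open>Every law is an equation between operations, and \<open>p\<close> carries it from
  \<open>V\<close> to its image. It serves for quotients, with \<open>p\<close> the projection, and
  for copies of a space in another type, with \<open>p\<close> a bijection.\<close>

lemma module_image:
 assumes V: "module K V" and im: "p ` carrier V = carrier Q"
  and add: "!!x y. x <: V ==> y <: V ==> p (x +[V] y) = p x +[Q] p y"
  and smult: "!!a x. a <: K ==> x <: V ==> p (a *[V] x) = a *[Q] p x"
  and zero: "p 0[V] = 0[Q]"
 shows "module K Q" "lin V Q p"
proof -
 show "lin V Q p" unfolding linear_map_def using im add smult by auto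
 have *: "!!x. x <: Q ==> EX v:carrier V. x = p v" using im by auto
 have cl: "p x <: Q" if "x <: V" for x using that im by auto
 show "module K Q"
 proof (rule moduleI')
  fix x y z assume x: "x <: Q" and y: "y <: Q" and z: "z <: Q"
  obtain u v w where e: "u <: V" "x = p u" "v <: V" "y = p v" "w <: V" "z = p w"
   using * x y z by metis
  show "x +[Q] y +[Q] z = x +[Q] (y +[Q] z)"
   using e V by (simp add: add[symmetric] mod_ac)
 next
  fix a x y assume x: "x <: Q" and y: "y <: Q" and a: "a <: K"
  obtain u v where e: "u <: V" "x = p u" "v <: V" "y = p v"
   using * x y by metis
  show "a *[Q] (x +[Q] y) = a *[Q] x +[Q] a *[Q] y"
   using e V a by (simp add: add[symmetric] smult[symmetric] mod_distr)
 next
  fix x y assume x: "x <: Q" and y: "y <: Q"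
  obtain u v where e: "u <: V" "x = p u" "v <: V" "y = p v"
   using * x y by metis
  show "x +[Q] y <: Q" using e V cl by (simp add: add[symmetric])
  show "x +[Q] y = y +[Q] x" using e V by (simp add: add[symmetric] mod_ac)
 next
  fix a b x assume a: "a <: K" "b <: K" and x: "x <: Q"
  obtain u where e: "u <: V" "x = p u" using * x by metis
  show "(a \<oplus> b) *[Q] x = a *[Q] x +[Q] b *[Q] x" "(a \<otimes> b) *[Q] x = a *[Q] (b *[Q] x)"
   using e V a by (simp_all add: add[symmetric] smult[symmetric] mod_distr)
  show "a *[Q] x <: Q" using e V a cl by (simp add: smult[symmetric])
 next
  fix x assume x: "x <: Q"
  obtain u where e: "u <: V" "x = p u" using * x by metis
  show "0[Q] +[Q] x = x" "\<zero> *[Q] x = 0[Q]" "\<one> *[Q] x = x"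
   using e V by (simp_all add: add[symmetric] smult[symmetric] zero[symmetric])
 next
  show "0[Q] <: Q" using cl V zero[symmetric] by simp
 qed
qed

section \<open>Linear maps\<close>

lemma linI:
 assumes "!!x. x <: V ==> f x <: W"
  and "!!x y. x <: V ==> y <: V ==> f (x +[V] y) = f x +[W] f y"
  and "!!a x. a <: K ==> x <: V ==> f (a *[V] x) = a *[W] f x"
 shows "lin V W f"
 using assms by (auto simp: linear_map_def)

lemma lin_closed: "lin V W f ==> x <: V ==> f x <: W"
 by (auto simp: linear_map_def)

lemma lin_add: "lin V W f ==> x <: V ==> y <: V ==> f (x +[V] y) = f x +[W] f y"
 by (auto simp: linear_map_def)

lemma lin_smult: "lin V W f ==> a <: K ==> x <: V ==> f (a *[V] x) = a *[W] f x"
 by (auto simp: linear_map_def)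

lemma lin_zero: "module K V ==> module K W ==> lin V W f ==> f 0[V] = 0[W]"
 using lin_smult[of V W f \<zero> "0[V]"] lin_closed[of V W f "0[V]"] by simp

lemma lin_diff:
 "module K V ==> module K W ==> lin V W f ==> x <: V ==> y <: V ==>
  f (x -[V] y) = f x -[W] f y"
 by (simp add: mod_neg lin_add lin_smult lin_closed)

lemma lin_cong: "lin V W f ==> module K V ==> (!!x. x <: V ==> f x = g x) ==> lin V W g"
 by (auto simp: linear_map_def Pi_def)

lemma lin_comp: "lin V W f ==> lin W Z g ==> lin V Z (%x. g (f x))"
 by (rule linI) (auto simp: lin_closed lin_add lin_smult)

lemma lin_id: "lin V V (%x. x)"
 by (rule linI) auto

lemma lin_const_zero: "module K W ==> lin V W (%x. 0[W])"
 by (rule linI) auto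

lemma lin_plus: "module K W ==> lin V W f ==> lin V W g ==> lin V W (%x. f x +[W] g x)"
 by (rule linI) (simp_all add: lin_closed lin_add lin_smult add4 mod_distr)

lemma lin_minus: "module K W ==> lin V W f ==> lin V W g ==> lin V W (%x. f x -[W] g x)"
 by (rule linI) (simp_all add: lin_closed lin_add lin_smult diff_add4 smult_diff)

lemma smult_swap:
 assumes "module K W" "a <: K" "b <: K" "x <: W"
 shows "a *[W] (b *[W] x) = b *[W] (a *[W] x)"
 using cring.cring_simprules(14)[OF cring_K assms(2,3)] mod_distr(3)[OF assms(1,2,3,4)]
  mod_distr(3)[OF assms(1,3,2,4)] by simp

lemma lin_scale: "module K W ==> a <: K ==> lin V W f ==> lin V W (%x. a *[W] f x)"
 by (rule linI) (simp_all add: lin_closed lin_add lin_smult mod_distr smult_swap[of W a])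

text \<open>The injective map \<open>i\<close> reflects the equations to be shown, so it is
  irrelevant how the values of \<open>u\<close> were found.\<close>

lemma lin_factor_inj:
 assumes "module K W" "lin W Z i" "inj_on i (carrier W)" "lin V Z h" "module K V"
  "!!x. x <: V ==> u x <: W" "!!x. x <: V ==> i (u x) = h x"
 shows "lin V W u"
proof (rule linI)
 fix x y assume xy: "x <: V" "y <: V"
 show "u (x +[V] y) = u x +[W] u y"
  by (rule inj_onD[OF assms(3)]) (use assms xy in \<open>simp_all add: lin_add\<close>)
next
 fix a x assume xy: "a <: K" "x <: V"
 show "u (a *[V] x) = a *[W] u x"
  by (rule inj_onD[OF assms(3)]) (use assms xy in \<open>simp_all add: lin_smult\<close>)
qed (use assms in auto)

text \<open>The values \<open>p x\<close> exhaust \<open>W\<close>, and the equation for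
  \<open>u\<close> already contains that \<open>h\<close> is constant on the fibres of
  \<open>p\<close>.\<close>

lemma lin_factor_surj:
 assumes "module K V" "lin V W p" "p ` carrier V = carrier W" "lin V Z h"
  "!!x. x <: V ==> u (p x) = h x"
 shows "lin W Z u"
proof (rule linI)
 fix x assume "x <: W"
 then obtain v where "v <: V" "x = p v" using assms(3) by blast
 then show "u x <: Z" using assms(5) by (simp add: lin_closed[OF assms(4)])
next
 fix x y assume "x <: W" "y <: W"
 then obtain v w where "v <: V" "x = p v" "w <: V" "y = p w" using assms(3) by blast
 then show "u (x +[W] y) = u x +[Z] u y"
  using assms(1,5) by (simp add: lin_add[OF assms(2), symmetric] lin_add[OF assms(4)])
next
 fix a x assume "x <: W" and a: "a <: K"
 then obtain v where "v <: V" "x = p v" using assms(3) by blast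
 then show "u (a *[W] x) = a *[Z] u x" using assms(1,5) a by (simp add: lin_smult[OF assms(2), symmetric] lin_smult[OF assms(4)])
qed

lemma lin_inj_iff:
 assumes "module K V" "module K W" "lin V W f"
 shows "inj_on f (carrier V) \<longleftrightarrow> (ALL x:carrier V. f x = 0[W] --> x = 0[V])"
proof
 assume "inj_on f (carrier V)"
 then show "ALL x:carrier V. f x = 0[W] --> x = 0[V]"
  using lin_zero[OF assms] assms(1) by (metis inj_onD mod_closed(2))
next
 assume *: "ALL x:carrier V. f x = 0[W] --> x = 0[V]"
 show "inj_on f (carrier V)"
 proof (rule inj_onI)
  fix x y assume xy: "x <: V" "y <: V" "f x = f y"
  then have "f (x -[V] y) = 0[W]" using assms by (simp add: lin_diff lin_closed)
  then have "x -[V] y = 0[V]" using * xy assms by simp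
  then show "x = y" using mod_diff_eq_0[OF assms(1) xy(1,2)] by simp
 qed
qed

lemma finsum_closed':
 assumes "module K V" "!!i. i : A ==> f i <: V"
 shows "finsum V f A <: V"
proof -
 interpret module K V by fact
 show ?thesis using assms(2) by (auto intro: M.finsum_closed)
qed

lemma lin_finsum:
 assumes "module K V" "module K W" "lin V W f" "finite A" "!!i. i : A ==> g i <: V"
 shows "f (finsum V g A) = finsum W (%i. f (g i)) A"
proof -
 interpret V: module K V by fact
 interpret W: module K W by fact
 show ?thesis using assms(4,5)
 proof (induction A)
  case empty show ?case using lin_zero[OF assms(1-3)] by (simp add: V.finsum_empty W.finsum_empty)
 next
  case (insert x F)
  then have "g : F \<rightarrow> carrier V" "(%i. f (g i)) : F \<rightarrow> carrier W" "f (g x) <: W"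
   using lin_closed[OF assms(3)] by auto
  then show ?case using insert assms(3)
   by (simp add: V.finsum_insert W.finsum_insert lin_add finsum_closed')
 qed
qed

text \<open>Sums over supports have index sets that vary with the element; they become comparable
  after enlargement to a common finite set.\<close>

lemma finsum_mono_neutral:
 assumes "module K V" "finite B" "A \<subseteq> B" "!!i. i : B - A ==> f i = 0[V]" "!!i. i : A ==> f i <: V"
 shows "finsum V f A = finsum V f B"
proof -
 interpret V: module K V by fact
 have 0: "f i <: V" if "i : B" for i using assms(4)[of i] assms(5)[of i] that assms(1) by (cases "i : A") auto
 have "finsum V f B = finsum V f (A \<union> (B - A))" using assms(3) by (simp add: Un_absorb1)
 also have "\<dots> = finsum V f A +[V] finsum V f (B - A)"
  by (rule V.finsum_Un_disjoint) (use assms(2,3) 0 finite_subset in auto)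
 also have "finsum V f (B - A) = finsum V (%_. 0[V]) (B - A)"
  by (rule V.finsum_cong') (use assms(4) in auto)
 finally show ?thesis using assms(1) finsum_closed'[of V A f] assms(5) by (simp add: V.finsum_zero)
qed

section \<open>Subspaces and spans\<close>

definition subspace :: "('k, 'a) module => 'a set => bool" where
 "subspace V H \<longleftrightarrow> H \<subseteq> carrier V & 0[V] : H & (ALL x:H. ALL y:H. x +[V] y : H) &
   (ALL a:carrier K. ALL x:H. a *[V] x : H)"

lemma subspaceI:
 assumes "H \<subseteq> carrier V" "0[V] : H" "!!x y. x : H ==> y : H ==> x +[V] y : H"
  "!!a x. a <: K ==> x : H ==> a *[V] x : H"
 shows "subspace V H"
 using assms by (auto simp: subspace_def)

lemma subspaceD:
 assumes "subspace V H"
 shows "x : H ==> x <: V" "0[V] : H" "x : H ==> y : H ==> x +[V] y : H"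
  "a <: K ==> x : H ==> a *[V] x : H"
 using assms by (auto simp: subspace_def)

lemma subspace_diff:
 assumes "module K V" "subspace V H" "x : H" "y : H"
 shows "x -[V] y : H"
 using assms by (simp add: mod_neg subspaceD)

lemma submodule_iff: "module K V ==> submodule H K V \<longleftrightarrow> subspace V H"
proof
 assume V: "module K V" and H: "submodule H K V"
 note s = module.submoduleE[OF V H]
 obtain h where "h : H" using s(2) by auto
 then have "\<zero> *[V] h : H" "h <: V" using s by auto
 then have "0[V] : H" using V by simp
 then show "subspace V H" using s by (intro subspaceI) auto
next
 assume V: "module K V" and H: "subspace V H"
 show "submodule H K V"
  by (rule module.submoduleI[OF V]) (use subspaceD[OF H] V in \<open>auto simp: mod_neg\<close>)
qed

lemma submodule_module: "module K V ==> subspace V H ==> module K (V\<lparr>carrier := H\<rparr>)"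
 using submodule.submodule_is_module submodule_iff by blast

lemma subspace_image:
 assumes "module K V" "module K W" "lin V W f"
 shows "subspace W (f ` carrier V)"
proof (rule subspaceI)
 show "0[W] : f ` carrier V" using lin_zero[OF assms] assms(1) by (metis mod_closed(2) imageI)
next
 fix x y assume "x : f ` carrier V" "y : f ` carrier V"
 then show "x +[W] y : f ` carrier V"
  using lin_add[OF assms(3), symmetric] assms(1) by auto
next
 fix a x assume "a <: K" "x : f ` carrier V"
 then show "a *[W] x : f ` carrier V"
  using lin_smult[OF assms(3), symmetric] assms(1) by auto
qed (use lin_closed[OF assms(3)] in auto)

lemma subspace_vimage:
 assumes "module K V" "module K W" "lin V W f" "subspace W H"
 shows "subspace V {x : carrier V. f x : H}"
 by (rule subspaceI)
  (use assms lin_zero[OF assms(1-3)] in \<open>auto simp: lin_add lin_smult subspaceD\<close>)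

lemma subspace_carrier: "module K V ==> subspace V (carrier V)"
 by (rule subspaceI) auto

lemma subspace_zero: "module K V ==> subspace V {0[V]}"
 by (rule subspaceI) auto

lemma subspace_kernel:
 assumes "module K V" "module K W" "lin V W f"
 shows "subspace V {x : carrier V. f x = 0[W]}"
 using subspace_vimage[OF assms subspace_zero[OF assms(2)]] by simp

text \<open>The standard way below to show that two linear maps agree: the set on which they agree
  is a subspace, hence everything as soon as it contains generators. The laws of newly formed
  modules are proved in this way, too.\<close>

lemma subspace_equalizer:
 assumes "module K V" "module K W" "lin V W f" "lin V W g"
 shows "subspace V {x : carrier V. f x = g x}"
 by (rule subspaceI)
  (use assms lin_zero[OF assms(1,2,3)] lin_zero[OF assms(1,2,4)] in \<open>auto simp: lin_add lin_smult\<close>)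

lemma finsum_subspace:
 assumes "module K V" "subspace V H" "finite A" "!!i. i : A ==> f i : H"
 shows "finsum V f A : H"
proof -
 interpret V: module K V by fact
 show ?thesis using assms(3,4)
 proof (induction A)
  case empty then show ?case using assms(2) by (simp add: subspaceD)
 next
  case (insert x F)
  then have "f : F \<rightarrow> carrier V" "f x <: V" using subspaceD(1)[OF assms(2)] by auto
  then show ?case using insert assms(2) by (simp add: V.finsum_insert subspaceD)
 qed
qed

lemma span_subspace: "module K V ==> S \<subseteq> carrier V ==> subspace V (lin_span K V S)"
 using subspace_carrier[of V]
 by (auto simp: lin_span_def submodule_iff subspace_def)

lemma span_superset: "S \<subseteq> lin_span K V S"
 by (auto simp: lin_span_def)

lemma span_least: "module K V ==> subspace V H ==> S \<subseteq> H ==> lin_span K V S \<subseteq> H"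
 by (auto simp: lin_span_def submodule_iff)

subsection \<open>Quotients\<close>

lemma coset_eq: "N +>\<^bsub>V\<^esub> v = {n +[V] v | n. n : N}"
 by (auto simp: a_r_coset_def')

lemma coset_mem:
 assumes "module K V" "subspace V N" "v <: V"
 shows "x : N +>\<^bsub>V\<^esub> v \<longleftrightarrow> x <: V & x -[V] v : N"
proof
 assume "x : N +>\<^bsub>V\<^esub> v"
 then obtain n where "n : N" "x = n +[V] v" by (auto simp: coset_eq)
 then show "x <: V & x -[V] v : N"
  using assms subspaceD(1)[OF assms(2)] by (simp add: mod_cancel)
next
 assume x: "x <: V & x -[V] v : N"
 then have "x = (x -[V] v) +[V] v" using assms by (simp add: mod_cancel)
 then show "x : N +>\<^bsub>V\<^esub> v" using x unfolding coset_eq by blast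
qed

lemma coset_self: "module K V ==> subspace V N ==> v <: V ==> v : N +>\<^bsub>V\<^esub> v"
 by (simp add: coset_mem subspaceD)

lemma coset_eq_iff:
 assumes "module K V" "subspace V N" "v <: V" "w <: V"
 shows "N +>\<^bsub>V\<^esub> v = N +>\<^bsub>V\<^esub> w \<longleftrightarrow> v -[V] w : N"
proof
 assume "N +>\<^bsub>V\<^esub> v = N +>\<^bsub>V\<^esub> w"
 then have "v : N +>\<^bsub>V\<^esub> w" using coset_self[OF assms(1-3)] by simp
 then show "v -[V] w : N" using assms by (simp add: coset_mem)
next
 assume d: "v -[V] w : N"
 have e1: "x -[V] w = (x -[V] v) +[V] (v -[V] w)" if x: "x <: V" for x
 proof -
  have "(x -[V] v) +[V] (v +[V] \<ominus>\<^bsub>V\<^esub> w) = ((x -[V] v) +[V] v) +[V] \<ominus>\<^bsub>V\<^esub> w"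
   by (rule mod_ac(1)[OF assms(1), symmetric]) (use assms x in simp_all)
  also have "(x -[V] v) +[V] v = x" by (rule mod_cancel(1)[OF assms(1) x assms(3)])
  finally show ?thesis by (simp only: mod_neg(2)[OF assms(1) x] mod_neg(2)[OF assms(1,3)])
 qed
 have "x -[V] v : N \<longleftrightarrow> x -[V] w : N" if x: "x <: V" for x
 proof
  assume "x -[V] v : N"
  then have "(x -[V] v) +[V] (v -[V] w) : N" by (rule subspaceD(3)[OF assms(2) _ d])
  then show "x -[V] w : N" by (simp only: e1[OF x])
 next
  assume "x -[V] w : N"
  then have "(x -[V] w) -[V] (v -[V] w) : N" by (rule subspace_diff[OF assms(1,2) _ d])
  moreover have "(x -[V] w) -[V] (v -[V] w) = x -[V] v"
   unfolding e1[OF x] by (rule mod_cancel(3)[OF assms(1)]) (use assms x in simp_all)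
  ultimately show "x -[V] v : N" by simp
 qed
 then show "N +>\<^bsub>V\<^esub> v = N +>\<^bsub>V\<^esub> w" by (auto simp: coset_mem[OF assms(1,2,3)] coset_mem[OF assms(1,2,4)])
qed

lemma quot_carrier: "carrier (quot_mod V N) = (%v. N +>\<^bsub>V\<^esub> v) ` carrier V"
 by (auto simp: quot_mod_def A_RCOSETS_def')

text \<open>\<open>quot_mod\<close> is given by operations on sets of vectors. Once these are
  matched with operations on representatives, all laws come from \<open>V\<close> by
  \<open>module_image\<close>.\<close>

lemma quot_module_lin:
 assumes V: "module K V" and N: "subspace V N"
 shows quot_module: "module K (quot_mod V N)" and quot_lin: "lin V (quot_mod V N) (%v. N +>\<^bsub>V\<^esub> v)"
proof -
 let ?p = "%v. N +>\<^bsub>V\<^esub> v"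
 have 1: "?p (x +[V] y) = ?p x +[quot_mod V N] ?p y" if xy: "x <: V" "y <: V" for x y
 proof -
  have "set_add V (?p x) (?p y) = ?p (x +[V] y)"
  proof (intro equalityI subsetI)
   fix z assume "z : set_add V (?p x) (?p y)"
   then obtain n m where "n : N" "m : N" "z = (n +[V] x) +[V] (m +[V] y)"
    by (auto simp: set_add_def' coset_eq)
   then have "z = (n +[V] m) +[V] (x +[V] y)" "n +[V] m : N"
    using V xy subspaceD[OF N] by (auto simp: add4)
   then show "z : ?p (x +[V] y)" by (auto simp: coset_eq)
  next
   fix z assume "z : ?p (x +[V] y)"
   then obtain n where n: "n : N" "z = n +[V] (x +[V] y)" by (auto simp: coset_eq)
   then have "z = (n +[V] x) +[V] (0[V] +[V] y)"
    using V xy subspaceD[OF N] by (simp add: mod_ac)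
   then show "z : set_add V (?p x) (?p y)"
    using n(1) subspaceD(2)[OF N] by (auto simp: set_add_def' coset_eq)
  qed
  then show ?thesis by (simp add: quot_mod_def)
 qed
 have 2: "?p (a *[V] x) = a *[quot_mod V N] ?p x" if ax: "a <: K" "x <: V" for a x
 proof -
  have "N +>\<^bsub>V\<^esub> (a *[V] y) = N +>\<^bsub>V\<^esub> (a *[V] x)" if "y : ?p x" for y
   using that ax V N subspaceD[OF N]
   by (simp add: coset_mem coset_eq_iff smult_diff[symmetric])
  then have "(\<Union>y\<in>?p x. N +>\<^bsub>V\<^esub> (a *[V] y)) = ?p (a *[V] x)"
   using coset_self[OF V N ax(2)] by blast
  then show ?thesis by (simp add: quot_mod_def)
 qed
 have "n +[V] 0[V] = n" if "n : N" for n
  using mod_simps(1)[OF V] subspaceD(1)[OF N that] by simp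
 then have "(%n. n +[V] 0[V]) ` N = N" by simp
 then have "?p 0[V] = N" unfolding coset_eq by (simp add: setcompr_eq_image)
 then have 3: "?p 0[V] = 0[quot_mod V N]" by (simp add: quot_mod_def)
 show "module K (quot_mod V N)" "lin V (quot_mod V N) ?p"
  by (rule module_image[where p = ?p, OF V quot_carrier[symmetric] 1 2 3]; assumption)+
qed

text \<open>\<open>tsum\<close> and \<open>qsum\<close> evaluate at a representative picked by
  \<open>SOME\<close>. A linear map that vanishes on \<open>N\<close> does not see which element of
  the coset was picked.\<close>

lemma quot_some:
 assumes V: "module K V" and N: "subspace V N" and Z: "module K Z" and L: "lin V Z L"
  and kill: "!!n. n : N ==> L n = 0[Z]" and v: "v <: V"
 shows "L (SOME u. u : N +>\<^bsub>V\<^esub> v) = L v" "(SOME u. u : N +>\<^bsub>V\<^esub> v) <: V"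
proof -
 have "(SOME u. u : N +>\<^bsub>V\<^esub> v) : N +>\<^bsub>V\<^esub> v"
  by (rule someI) (rule coset_self[OF V N v])
 then have *: "(SOME u. u : N +>\<^bsub>V\<^esub> v) <: V" "(SOME u. u : N +>\<^bsub>V\<^esub> v) -[V] v : N"
  using coset_mem[OF V N v] by auto
 show "(SOME u. u : N +>\<^bsub>V\<^esub> v) <: V" by fact
 have "L (SOME u. u : N +>\<^bsub>V\<^esub> v) -[Z] L v = 0[Z]"
  using kill[OF *(2)] * v by (simp add: lin_diff[OF V Z L])
 then show "L (SOME u. u : N +>\<^bsub>V\<^esub> v) = L v"
  using mod_diff_eq_0[OF Z lin_closed[OF L *(1)] lin_closed[OF L v]] by simp
qed

subsection \<open>Free modules and tensor products\<close>

lemma free_mod_sel [simp]: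
 "zero (free_mod K S) = (%p. \<zero>)" "\<phi> +[free_mod K S] \<chi> = (%p. \<phi> p \<oplus> \<chi> p)"
 "a *[free_mod K S] \<phi> = (%p. a \<otimes> \<phi> p)"
 by (simp_all add: free_mod_def)

lemma free_carrier:
 "\<phi> <: free_mod K S \<longleftrightarrow> (ALL p. \<phi> p <: K) & (ALL p. p \<notin> S --> \<phi> p = \<zero>) & finite {p. \<phi> p ~= \<zero>}"
 by (simp add: free_mod_def)

lemma free_carrierD:
 assumes "\<phi> <: free_mod K S"
 shows "\<phi> p <: K" "\<phi> p ~= \<zero> ==> p : S" "finite {p. \<phi> p ~= \<zero>}"
 using assms unfolding free_carrier by blast+

lemma free_module: "module K (free_mod K S)"
proof -
 note r = ring.ring_simprules[OF ring_K] cring.cring_simprules(14)[OF cring_K]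
 have z: "\<zero> \<oplus> \<zero> = \<zero>" "a <: K ==> a \<otimes> \<zero> = \<zero>" for a using r by auto
 show ?thesis
 proof (rule moduleI')
  fix x y assume x: "x <: free_mod K S" and y: "y <: free_mod K S"
  have "{p. x p \<oplus> y p ~= \<zero>} \<subseteq> {p. x p ~= \<zero>} \<union> {p. y p ~= \<zero>}" using z by auto
  then have "finite {p. x p \<oplus> y p ~= \<zero>}" using x y by (auto simp: free_carrier intro: finite_subset)
  then show "x +[free_mod K S] y <: free_mod K S" using x y z by (auto simp: free_carrier)
 next
  fix a x assume a: "a <: K" and x: "x <: free_mod K S"
  have "{p. a \<otimes> x p ~= \<zero>} \<subseteq> {p. x p ~= \<zero>}" using z(2)[OF a] by auto
  then have "finite {p. a \<otimes> x p ~= \<zero>}" using x by (auto simp: free_carrier intro: finite_subset)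
  then show "a *[free_mod K S] x <: free_mod K S" using x z a by (auto simp: free_carrier)
 qed (use r in \<open>auto simp: free_carrier fun_eq_iff\<close>)
qed

lemma basis_closed: "p : S ==> basis_vec K p <: free_mod K S"
 by (auto simp: free_carrier basis_vec_def)

text \<open>Induction over a finite set that contains the support: removing one coordinate subtracts
  a multiple of a basis vector.\<close>

lemma free_subspace_all:
 assumes H: "subspace (free_mod K S) H" and b: "!!p. p : S ==> basis_vec K p : H"
 shows "carrier (free_mod K S) \<subseteq> H"
proof
 have r: "\<zero> \<oplus> a = a" "a \<oplus> \<zero> = a" "a \<otimes> \<one> = a" "a \<otimes> \<zero> = \<zero>" if "a <: K" for a
 proof -
  interpret K: cring K by (rule cring_K)
  show "\<zero> \<oplus> a = a" "a \<oplus> \<zero> = a" "a \<otimes> \<one> = a" "a \<otimes> \<zero> = \<zero>" using that by simp_all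
 qed
 fix \<phi> assume "\<phi> <: free_mod K S"
 moreover have "finite F ==> \<phi> <: free_mod K S ==> {p. \<phi> p ~= \<zero>} \<subseteq> F ==> \<phi> : H" for F
 proof (induction F arbitrary: \<phi> rule: finite_induct)
  case empty
  then have "\<phi> = (%p. \<zero>)" by auto
  then show ?case using subspaceD(2)[OF H] by simp
 next
  case (insert p F)
  show ?case
  proof (cases "\<phi> p = \<zero>")
   case True then show ?thesis using insert by blast
  next
   case False
   let ?\<chi> = "\<phi>(p := \<zero>)"
   have pS: "p : S" using False insert.prems(1) by (auto simp: free_carrier)
   have "{q. ?\<chi> q ~= \<zero>} \<subseteq> {q. \<phi> q ~= \<zero>}" by auto
   then have "finite {q. ?\<chi> q ~= \<zero>}" using insert.prems(1) finite_subset unfolding free_carrier by blast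
   then have "?\<chi> : H" using insert by (intro insert.IH) (auto simp: free_carrier)
   moreover have "\<phi> p *[free_mod K S] basis_vec K p : H"
    using subspaceD(4)[OF H _ b[OF pS]] insert.prems(1) by (simp only: free_carrier)
   ultimately have "?\<chi> +[free_mod K S] (\<phi> p *[free_mod K S] basis_vec K p) : H"
    by (rule subspaceD(3)[OF H])
   moreover have "?\<chi> +[free_mod K S] (\<phi> p *[free_mod K S] basis_vec K p) = \<phi>"
    using insert.prems(1) r unfolding free_carrier by (auto simp: fun_eq_iff basis_vec_def)
   ultimately show ?thesis by simp
  qed
 qed
 ultimately show "\<phi> : H" by (auto simp: free_carrier)
qed

text \<open>The linear extension of \<open>\<beta>\<close> to the free module, written as a sum over
  the support because this is the sum inside \<open>tsum\<close>.\<close>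

definition free_ev :: "('k, 'w) module => ('s => 'w) => ('s => 'k) => 'w" where
 "free_ev Z \<beta> \<phi> = (\<Oplus>\<^bsub>Z\<^esub>p\<in>{p. \<phi> p ~= \<zero>}. \<phi> p *[Z] \<beta> p)"

lemma free_ev_eq:
 assumes Z: "module K Z" and \<beta>: "!!p. p : S ==> \<beta> p <: Z" and \<phi>: "\<phi> <: free_mod K S"
  and F: "finite F" "{p. \<phi> p ~= \<zero>} \<subseteq> F" "F \<subseteq> S"
 shows "free_ev Z \<beta> \<phi> = finsum Z (%p. \<phi> p *[Z] \<beta> p) F"
 unfolding free_ev_def
proof (rule finsum_mono_neutral[OF Z F(1,2)])
 fix p assume "p : F - {p. \<phi> p ~= \<zero>}"
 then have "\<phi> p = \<zero>" "\<beta> p <: Z" using F(3) \<beta> by auto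
 then show "\<phi> p *[Z] \<beta> p = 0[Z]" using Z by simp
next
 fix p assume "p : {p. \<phi> p ~= \<zero>}"
 then have "\<phi> p <: K" "\<beta> p <: Z" using F \<beta> \<phi> by (auto simp: free_carrier)
 then show "\<phi> p *[Z] \<beta> p <: Z" using Z by simp
qed

text \<open>Additivity compares sums over three different supports; the union of the supports of
  \<open>x\<close> and \<open>y\<close> serves for all of them.\<close>

lemma free_ev_lin:
 assumes Z: "module K Z" and \<beta>: "!!p. p : S ==> \<beta> p <: Z"
 shows "lin (free_mod K S) Z (free_ev Z \<beta>)"
proof -
 interpret Z: module K Z by fact
 note M = free_module[of S]
 have supp: "finite {p. \<phi> p ~= \<zero>}" "{p. \<phi> p ~= \<zero>} \<subseteq> S" "!!p. \<phi> p <: K"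
  if "\<phi> <: free_mod K S" for \<phi> using that by (auto simp: free_carrier)
 show ?thesis
 proof (rule linI)
  fix x assume x: "x <: free_mod K S"
  show "free_ev Z \<beta> x <: Z" unfolding free_ev_def
   by (rule finsum_closed'[OF Z]) (use supp[OF x] \<beta> Z in auto)
 next
  fix x y assume x: "x <: free_mod K S" and y: "y <: free_mod K S"
  let ?F = "{p. x p ~= \<zero>} \<union> {p. y p ~= \<zero>}"
  have xy: "x +[free_mod K S] y <: free_mod K S" using M x y by (rule mod_closed(1))
  have F: "finite ?F" "?F \<subseteq> S" using supp[OF x] supp[OF y] by auto
  have "\<zero> \<oplus> \<zero> = \<zero>" using ring.ring_simprules[OF ring_K] by auto
  then have F': "{p. (x +[free_mod K S] y) p ~= \<zero>} \<subseteq> ?F" by auto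
  have "free_ev Z \<beta> (x +[free_mod K S] y) = finsum Z (%p. (x +[free_mod K S] y) p *[Z] \<beta> p) ?F"
   by (rule free_ev_eq[OF Z \<beta> xy F(1) F' F(2)])
  also have "\<dots> = finsum Z (%p. x p *[Z] \<beta> p +[Z] y p *[Z] \<beta> p) ?F"
  proof (rule Z.finsum_cong')
   show "(%p. x p *[Z] \<beta> p +[Z] y p *[Z] \<beta> p) : ?F \<rightarrow> carrier Z"
    using F(2) supp(3)[OF x] supp(3)[OF y] \<beta> by auto
   fix p assume "p : ?F"
   then have "\<beta> p <: Z" using F(2) \<beta> by blast
   then show "(x +[free_mod K S] y) p *[Z] \<beta> p = x p *[Z] \<beta> p +[Z] y p *[Z] \<beta> p"
    using supp(3)[OF x] supp(3)[OF y] by (simp add: Z.smult_l_distr)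
  qed simp
  also have "\<dots> = finsum Z (%p. x p *[Z] \<beta> p) ?F +[Z] finsum Z (%p. y p *[Z] \<beta> p) ?F"
   by (rule Z.finsum_addf) (use F(2) supp(3)[OF x] supp(3)[OF y] \<beta> in auto)
  also have "finsum Z (%p. x p *[Z] \<beta> p) ?F = free_ev Z \<beta> x"
   by (rule free_ev_eq[OF Z \<beta> x F(1) _ F(2), symmetric]) auto
  also have "finsum Z (%p. y p *[Z] \<beta> p) ?F = free_ev Z \<beta> y"
   by (rule free_ev_eq[OF Z \<beta> y F(1) _ F(2), symmetric]) auto
  finally show "free_ev Z \<beta> (x +[free_mod K S] y) = free_ev Z \<beta> x +[Z] free_ev Z \<beta> y" .
 next
  fix a x assume a: "a <: K" and x: "x <: free_mod K S"
  let ?F = "{p. x p ~= \<zero>}"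
  have ax: "a *[free_mod K S] x <: free_mod K S" using M a x by (rule mod_closed(5))
  have "a \<otimes> \<zero> = \<zero>" using ring.ring_simprules[OF ring_K] a by auto
  then have F': "{p. (a *[free_mod K S] x) p ~= \<zero>} \<subseteq> ?F" by auto
  have "free_ev Z \<beta> (a *[free_mod K S] x) = finsum Z (%p. (a *[free_mod K S] x) p *[Z] \<beta> p) ?F"
   by (rule free_ev_eq[OF Z \<beta> ax supp(1)[OF x] F' supp(2)[OF x]])
  also have "\<dots> = finsum Z (%p. a *[Z] (x p *[Z] \<beta> p)) ?F"
  proof (rule Z.finsum_cong')
   show "(%p. a *[Z] (x p *[Z] \<beta> p)) : ?F \<rightarrow> carrier Z"
    using supp(2,3)[OF x] \<beta> a by auto
   fix p assume "p : ?F"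
   then have "\<beta> p <: Z" using supp(2)[OF x] \<beta> by blast
   then show "(a *[free_mod K S] x) p *[Z] \<beta> p = a *[Z] (x p *[Z] \<beta> p)"
    using supp(3)[OF x] a by (simp add: Z.smult_assoc1)
  qed simp
  also have "\<dots> = a *[Z] free_ev Z \<beta> x" unfolding free_ev_def
   by (rule Z.finsum_smult_ldistr[symmetric]) (use a supp[OF x] \<beta> in auto)
  finally show "free_ev Z \<beta> (a *[free_mod K S] x) = a *[Z] free_ev Z \<beta> x" .
 qed
qed

lemma free_ev_basis:
 assumes Z: "module K Z" and \<beta>: "\<beta> p <: Z"
 shows "free_ev Z \<beta> (basis_vec K p) = \<beta> p"
proof -
 interpret Z: module K Z by fact
 have "{q. basis_vec K p q ~= \<zero>} = {p}" using K_one_neq_zero by (auto simp: basis_vec_def)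
 then show ?thesis using \<beta> by (simp add: free_ev_def basis_vec_def Z.finsum_insert)
qed

section \<open>Tensor products by generators and relations\<close>

abbreviation bilin :: "('k, 'a) module => ('k, 'b) module => ('k, 'c) module => ('a => 'b => 'c) => bool" where
 "bilin V W Z \<beta> \<equiv> bilinear_map K V W Z \<beta>"

lemma bilinI:
 "(!!x. x <: V ==> lin W Z (\<beta> x)) ==> (!!y. y <: W ==> lin V Z (%x. \<beta> x y)) ==> bilin V W Z \<beta>"
 by (simp add: bilinear_map_def)

lemma bilinD:
 assumes "bilin V W Z \<beta>"
 shows "x <: V ==> lin W Z (\<beta> x)" "y <: W ==> lin V Z (%x. \<beta> x y)"
  "x <: V ==> y <: W ==> \<beta> x y <: Z"
proof -
 show *: "x <: V ==> lin W Z (\<beta> x)" "y <: W ==> lin V Z (%x. \<beta> x y)" for x y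
  using assms by (auto simp: bilinear_map_def)
 show "x <: V ==> y <: W ==> \<beta> x y <: Z"
  using lin_closed[OF *(1)] by blast
qed

lemma bilin_lin: "bilin V W Z \<beta> ==> lin Z Z' L ==> bilin V W Z' (%v w. L (\<beta> v w))"
 by (rule bilinI) (auto intro: lin_comp dest: bilinD)

lemma tensor_rels_cases:
 fixes V :: "('k, 'a) module" and W :: "('k, 'b) module"
 defines "F \<equiv> free_mod K (carrier V \<times> carrier W)" and "e \<equiv> %v w. basis_vec K (v, w)"
 shows "v <: V ==> v' <: V ==> w <: W ==>
   e (v +[V] v') w -[F] (e v w +[F] e v' w) : tensor_rels K V W"
  "v <: V ==> w <: W ==> w' <: W ==>
   e v (w +[W] w') -[F] (e v w +[F] e v w') : tensor_rels K V W"
  "a <: K ==> v <: V ==> w <: W ==>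
   e (a *[V] v) w -[F] (a *[F] e v w) : tensor_rels K V W"
  "a <: K ==> v <: V ==> w <: W ==>
   e v (a *[W] w) -[F] (a *[F] e v w) : tensor_rels K V W"
 unfolding tensor_rels_def Let_def F_def e_def by blast+

lemma tensor_rels_subset:
 assumes V: "module K V" and W: "module K W"
 shows "tensor_rels K V W \<subseteq> carrier (free_mod K (carrier V \<times> carrier W))"
proof -
 let ?F = "free_mod K (carrier V \<times> carrier W)"
 have F: "module K ?F" by (rule free_module)
 have b: "basis_vec K (v, w) <: ?F" if "v <: V" "w <: W" for v w
  using that by (auto intro: basis_closed)
 note cl = mod_closed(1,4,5)[OF F] b
 show ?thesis unfolding tensor_rels_def Let_def using V W
  by (auto simp del: free_mod_sel intro!: cl)
qed

lemma tensor_null_subspace: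
 assumes V: "module K V" and W: "module K W"
 shows "subspace (free_mod K (carrier V \<times> carrier W)) (tensor_null K V W)"
 unfolding tensor_null_def by (rule span_subspace[OF free_module tensor_rels_subset[OF assms]])

lemma tensor_module [simp]: "module K V ==> module K W ==> module K (tensor K V W)"
 unfolding tensor_def by (rule quot_module[OF free_module tensor_null_subspace])

lemma tens_closed:
 "module K V ==> module K W ==> v <: V ==> w <: W ==> tens K V W v w <: tensor K V W"
 unfolding tens_def tensor_def quot_carrier by (auto intro: basis_closed)

text \<open>Each law of bilinearity is one of the four families of relations, read modulo their
  span.\<close>

lemma tens_bilin:
 assumes V: "module K V" and W: "module K W"
 shows "bilin V W (tensor K V W) (tens K V W)"
proof -
 let ?F = "free_mod K (carrier V \<times> carrier W)" and ?N = "tensor_null K V W"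
 let ?b = "%v w. basis_vec K (v, w)"
 have F: "module K ?F" by (rule free_module)
 have N: "subspace ?F ?N" by (rule tensor_null_subspace[OF V W])
 have p: "lin ?F (tensor K V W) (%\<phi>. ?N +>\<^bsub>?F\<^esub> \<phi>)" unfolding tensor_def by (rule quot_lin[OF F N])
 have b: "?b v w <: ?F" if "v <: V" "w <: W" for v w
  using that by (auto intro: basis_closed)
 have rel: "r : ?N" if "r : tensor_rels K V W" for r
  unfolding tensor_null_def by (rule subsetD[OF span_superset that])
 note cl = mod_closed(1,4,5)[OF F]
 have eq: "?N +>\<^bsub>?F\<^esub> x = ?N +>\<^bsub>?F\<^esub> y" if "x -[?F] y : tensor_rels K V W" "x <: ?F" "y <: ?F" for x y
  using coset_eq_iff[OF F N that(2,3)] rel[OF that(1)] by simp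
 show ?thesis
 proof (rule bilinI; rule linI)
  fix v w w' assume v: "v <: V" and w: "w <: W" "w' <: W"
  have "tens K V W v (w +[W] w') = ?N +>\<^bsub>?F\<^esub> (?b v w +[?F] ?b v w')" unfolding tens_def
   by (rule eq) (intro tensor_rels_cases(2) cl b mod_closed(1)[OF W] v w)+
  then show "tens K V W v (w +[W] w') = tens K V W v w +[tensor K V W] tens K V W v w'"
   using lin_add[OF p b[OF v w(1)] b[OF v w(2)]] by (simp only: tens_def)
 next
  fix v v' w assume v: "v <: V" "v' <: V" and w: "w <: W"
  have "tens K V W (v +[V] v') w = ?N +>\<^bsub>?F\<^esub> (?b v w +[?F] ?b v' w)" unfolding tens_def
   by (rule eq) (intro tensor_rels_cases(1) cl b mod_closed(1)[OF V] v w)+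
  then show "tens K V W (v +[V] v') w = tens K V W v w +[tensor K V W] tens K V W v' w"
   using lin_add[OF p b[OF v(1) w] b[OF v(2) w]] by (simp only: tens_def)
 next
  fix v a w assume v: "v <: V" and w: "w <: W" and a: "a <: K"
  have "tens K V W v (a *[W] w) = ?N +>\<^bsub>?F\<^esub> (a *[?F] ?b v w)" unfolding tens_def
   by (rule eq) (intro tensor_rels_cases(4) cl b mod_closed(5)[OF W] v w a)+
  then show "tens K V W v (a *[W] w) = a *[tensor K V W] tens K V W v w"
   using lin_smult[OF p a b[OF v w]] by (simp only: tens_def)
  have "tens K V W (a *[V] v) w = ?N +>\<^bsub>?F\<^esub> (a *[?F] ?b v w)" unfolding tens_def
   by (rule eq) (intro tensor_rels_cases(3) cl b mod_closed(5)[OF V] v w a)+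
  then show "tens K V W (a *[V] v) w = a *[tensor K V W] tens K V W v w"
   using lin_smult[OF p a b[OF v w]] by (simp only: tens_def)
 qed (use tens_closed[OF V W] in auto)
qed

lemma tensor_subspace_all:
 assumes V: "module K V" and W: "module K W" and H: "subspace (tensor K V W) H"
  and t: "!!v w. v <: V ==> w <: W ==> tens K V W v w : H"
 shows "carrier (tensor K V W) \<subseteq> H"
proof -
 let ?F = "free_mod K (carrier V \<times> carrier W)" and ?N = "tensor_null K V W"
 have p: "lin ?F (tensor K V W) (%\<phi>. ?N +>\<^bsub>?F\<^esub> \<phi>)"
  unfolding tensor_def by (rule quot_lin[OF free_module tensor_null_subspace[OF V W]])
 have "carrier ?F \<subseteq> {\<phi> : carrier ?F. ?N +>\<^bsub>?F\<^esub> \<phi> : H}"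
  by (rule free_subspace_all[OF subspace_vimage[OF free_module tensor_module[OF V W] p H]])
   (use t in \<open>auto simp: tens_def intro: basis_closed\<close>)
 then show ?thesis unfolding tensor_def quot_carrier by auto
qed

text \<open>Pure tensors span, and the set on which two linear maps agree is a subspace.\<close>

lemma tensor_eqI:
 assumes "module K V" "module K W" "module K Z" "lin (tensor K V W) Z f" "lin (tensor K V W) Z g"
  "!!v w. v <: V ==> w <: W ==> f (tens K V W v w) = g (tens K V W v w)"
  "t <: tensor K V W"
 shows "f t = g t"
proof -
 have "carrier (tensor K V W) \<subseteq> {x : carrier (tensor K V W). f x = g x}"
  by (rule tensor_subspace_all[OF assms(1,2) subspace_equalizer[OF tensor_module[OF assms(1,2)] assms(3-5)]])
   (use assms(6) tens_closed[OF assms(1,2)] in auto)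
 then show ?thesis using assms(7) by auto
qed

section \<open>Sweedler sums\<close>

lemma tsum_eq_free_ev: "tsum K Z t \<beta> = free_ev Z (%p. \<beta> (fst p) (snd p)) (SOME \<phi>. \<phi> : t)"
 by (simp add: tsum_def free_ev_def Let_def)

text \<open>The universal property of the tensor product: for bilinear \<open>\<beta>\<close> the
  linear extension to the free module kills the relations, hence their span, so its value at a
  representative depends only on the coset.\<close>

lemma tsum_coset:
 assumes V: "module K V" and W: "module K W" and Z: "module K Z" and \<beta>: "bilin V W Z \<beta>"
  and \<phi>: "\<phi> <: (free_mod K (carrier V \<times> carrier W))"
 shows "tsum K Z (tensor_null K V W +>\<^bsub>free_mod K (carrier V \<times> carrier W)\<^esub> \<phi>) \<beta> =
  free_ev Z (%p. \<beta> (fst p) (snd p)) \<phi>"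
proof -
 let ?F = "free_mod K (carrier V \<times> carrier W)" and ?N = "tensor_null K V W"
 let ?L = "free_ev Z (%p. \<beta> (fst p) (snd p))"
 have F: "module K ?F" by (rule free_module)
 have L: "lin ?F Z ?L" by (rule free_ev_lin[OF Z]) (use bilinD(3)[OF \<beta>] in auto)
 have b: "basis_vec K (v, w) <: ?F" "?L (basis_vec K (v, w)) = \<beta> v w"
  if "v <: V" "w <: W" for v w
  using that free_ev_basis[OF Z, of "%p. \<beta> (fst p) (snd p)" "(v, w)"] bilinD(3)[OF \<beta>]
  by (auto intro: basis_closed)
 have z: "x -[Z] y = 0[Z]" if "x = y" "y <: Z" for x y using that Z by simp
 have "r <: ?F & ?L r = 0[Z]" if "r : tensor_rels K V W" for r
 proof
  show "r <: ?F" using tensor_rels_subset[OF V W] that by blast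
  have l: "?L (x -[?F] y) = 0[Z]" if "?L x = ?L y" "x <: ?F" "y <: ?F" for x y
   using that lin_closed[OF L] z by (simp add: lin_diff[OF F Z L])
  note ad = lin_add[OF L] lin_smult[OF L] b mod_closed(1,5)[OF F] mod_closed(1,5)[OF V] mod_closed(1,5)[OF W]
   lin_add[OF bilinD(1)[OF \<beta>]] lin_add[OF bilinD(2)[OF \<beta>]] lin_smult[OF bilinD(1)[OF \<beta>]] lin_smult[OF bilinD(2)[OF \<beta>]]
  \<comment> \<open>In each of the four families the two terms of the relation have the same value
    under \<open>?L\<close>, which \<open>l\<close> turns into a vanishing difference.\<close>
  show "?L r = 0[Z]" using that unfolding tensor_rels_def Let_def
   by (elim UnE CollectE exE conjE; hypsubst; intro l; simp only: ad)
 qed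
 then have "?N \<subseteq> {r : carrier ?F. ?L r = 0[Z]}"
  unfolding tensor_null_def by (intro span_least[OF F subspace_kernel[OF F Z L]]) auto
 then show ?thesis unfolding tsum_eq_free_ev
  by (intro quot_some(1)[OF F tensor_null_subspace[OF V W] Z L _ \<phi>]) auto
qed

lemma tsum_lin:
 assumes V: "module K V" and W: "module K W" and Z: "module K Z" and \<beta>: "bilin V W Z \<beta>"
 shows "lin (tensor K V W) Z (%t. tsum K Z t \<beta>)"
proof -
 let ?F = "free_mod K (carrier V \<times> carrier W)" and ?N = "tensor_null K V W"
 have p: "lin ?F (tensor K V W) (%\<phi>. ?N +>\<^bsub>?F\<^esub> \<phi>)"
  unfolding tensor_def by (rule quot_lin[OF free_module tensor_null_subspace[OF V W]])
 have L: "lin ?F Z (free_ev Z (%p. \<beta> (fst p) (snd p)))"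
  by (rule free_ev_lin[OF Z]) (use bilinD(3)[OF \<beta>] in auto)
 show ?thesis
 proof (rule lin_factor_surj[OF free_module p _ L])
  show "(%\<phi>. ?N +>\<^bsub>?F\<^esub> \<phi>) ` carrier ?F = carrier (tensor K V W)" by (simp only: tensor_def quot_carrier)
 qed (rule tsum_coset[OF assms])
qed

lemma tsum_tens:
 assumes V: "module K V" and W: "module K W" and Z: "module K Z" and \<beta>: "bilin V W Z \<beta>"
  and v: "v <: V" "w <: W"
 shows "tsum K Z (tens K V W v w) \<beta> = \<beta> v w"
 unfolding tens_def using v free_ev_basis[OF Z, of "%p. \<beta> (fst p) (snd p)" "(v, w)"] bilinD(3)[OF \<beta> v]
 by (subst tsum_coset[OF V W Z \<beta>]) (auto intro: basis_closed)

lemma tsum_closed: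
 "module K V ==> module K W ==> module K Z ==> bilin V W Z \<beta> ==> t <: tensor K V W ==>
  tsum K Z t \<beta> <: Z"
 by (rule lin_closed[OF tsum_lin])

lemma tensor_rep:
 assumes V: "module K V" and W: "module K W" and t: "t <: tensor K V W"
 defines "\<phi> \<equiv> SOME \<phi>. \<phi> : t"
 shows "\<phi> <: (free_mod K (carrier V \<times> carrier W))"
  "t = tensor_null K V W +>\<^bsub>free_mod K (carrier V \<times> carrier W)\<^esub> \<phi>"
proof -
 let ?F = "free_mod K (carrier V \<times> carrier W)" and ?N = "tensor_null K V W"
 have F: "module K ?F" and N: "subspace ?F ?N"
  using free_module tensor_null_subspace[OF V W] by auto
 obtain \<chi> where \<chi>: "\<chi> <: ?F" "t = ?N +>\<^bsub>?F\<^esub> \<chi>" using t unfolding tensor_def quot_carrier by auto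
 have "\<chi> : t" unfolding \<chi>(2) by (rule coset_self[OF F N \<chi>(1)])
 then have "\<phi> : t" unfolding \<phi>_def using someI[of "%\<phi>. \<phi> : t" \<chi>] by simp
 then have *: "\<phi> <: ?F" "\<phi> -[?F] \<chi> : ?N" unfolding \<chi>(2) coset_mem[OF F N \<chi>(1)] by auto
 show "\<phi> <: ?F" by fact
 show "t = ?N +>\<^bsub>?F\<^esub> \<phi>" using coset_eq_iff[OF F N *(1) \<chi>(1)] *(2) \<chi>(2) by simp
qed

text \<open>Both sums run over the same chosen representative, whose support consists of pairs from
  the two carriers; agreement on the carriers is therefore enough.\<close>

lemma tsum_cong:
 assumes V: "module K V" and W: "module K W" and Z: "module K Z"
  and t: "t <: tensor K V W"
  and eq: "!!v w. v <: V ==> w <: W ==> \<beta> v w = \<beta>' v w"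
  and cl: "!!v w. v <: V ==> w <: W ==> \<beta>' v w <: Z"
 shows "tsum K Z t \<beta> = tsum K Z t \<beta>'"
proof -
 interpret Z: module K Z by fact
 have \<phi>: "(SOME \<phi>. \<phi> : t) <: (free_mod K (carrier V \<times> carrier W))" (is "?\<phi> : _")
  by (rule tensor_rep(1)[OF V W t])
 then have *: "fst p <: V" "snd p <: W" "?\<phi> p <: K" if "?\<phi> p ~= \<zero>" for p
  using free_carrierD(2)[OF \<phi> that] free_carrierD(1)[OF \<phi>] by (auto simp: mem_Times_iff)
 show ?thesis unfolding tsum_def Let_def
  by (rule Z.finsum_cong') (use * eq cl in auto)
qed

lemma lin_tsum:
 assumes "module K V" "module K W" "module K Z" "module K Z'" "bilin V W Z \<beta>" "lin Z Z' L"
  "t <: tensor K V W"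
 shows "L (tsum K Z t \<beta>) = tsum K Z' t (%v w. L (\<beta> v w))"
 by (rule tensor_eqI[OF assms(1,2,4) lin_comp[OF tsum_lin[OF assms(1,2,3,5)] assms(6)]
    tsum_lin[OF assms(1,2,4) bilin_lin[OF assms(5,6)]] _ assms(7)])
  (simp add: tsum_tens[OF assms(1,2,3,5)] tsum_tens[OF assms(1,2,4) bilin_lin[OF assms(5,6)]])

text \<open>Meant for nested sums, as in coassociativity and in the entwined coaction, where the
  inner summand contains a variable of the outer sum. For fixed parameters, additivity and
  homogeneity are identities between linear maps in \<open>t\<close>, so pure tensors
  suffice.\<close>

lemma tsum_param_lin:
 assumes "module K V" "module K W" "module K Z" "t <: tensor K V W"
  and b: "!!x. x <: X ==> bilin V W Z (\<beta> x)"
  and l: "!!v w. v <: V ==> w <: W ==> lin X Z (%x. \<beta> x v w)"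
  and X: "module K X"
 shows "lin X Z (%x. tsum K Z t (\<beta> x))"
proof (rule linI)
 fix x y assume xy: "x <: X" "y <: X"
 have "tsum K Z t (\<beta> (x +[X] y)) = (%t. tsum K Z t (\<beta> x) +[Z] tsum K Z t (\<beta> y)) t"
  by (rule tensor_eqI[OF assms(1-3) tsum_lin[OF assms(1-3) b[OF mod_closed(1)[OF X xy]]]
     lin_plus[OF assms(3) tsum_lin[OF assms(1-3) b[OF xy(1)]] tsum_lin[OF assms(1-3) b[OF xy(2)]]] _ assms(4)])
   (simp add: tsum_tens[OF assms(1-3) b] X xy lin_add[OF l])
 then show "tsum K Z t (\<beta> (x +[X] y)) = tsum K Z t (\<beta> x) +[Z] tsum K Z t (\<beta> y)" .
next
 fix a x assume ax: "a <: K" "x <: X"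
 have "tsum K Z t (\<beta> (a *[X] x)) = (%t. a *[Z] tsum K Z t (\<beta> x)) t"
  by (rule tensor_eqI[OF assms(1-3) tsum_lin[OF assms(1-3) b[OF mod_closed(5)[OF X ax]]]
     lin_scale[OF assms(3) ax(1) tsum_lin[OF assms(1-3) b[OF ax(2)]]] _ assms(4)])
   (simp add: tsum_tens[OF assms(1-3) b] X ax lin_smult[OF l])
 then show "tsum K Z t (\<beta> (a *[X] x)) = a *[Z] tsum K Z t (\<beta> x)" .
qed (rule tsum_closed[OF assms(1-3) b assms(4)])

section \<open>The functor that tensors with a fixed space\<close>

definition tmap :: "('k, 'b) module => ('k, 'c) module => ('a => 'b) => ('k, 'a, 'c) tens => ('k, 'b, 'c) tens" where
 "tmap V' W f t = tsum K (tensor K V' W) t (%v w. tens K V' W (f v) w)"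

lemma bilin_tens_lin:
 assumes "module K V" "module K V'" "module K W" "lin V V' f"
 shows "bilin V W (tensor K V' W) (%v w. tens K V' W (f v) w)"
 by (rule bilinI)
  (use bilinD(1)[OF tens_bilin[OF assms(2,3)]] lin_closed[OF assms(4)]
   lin_comp[OF assms(4) bilinD(2)[OF tens_bilin[OF assms(2,3)]]] in auto)

lemma bilin_precomp:
 assumes "bilin V' W Z \<beta>" "lin V V' f"
 shows "bilin V W Z (%v w. \<beta> (f v) w)"
 by (rule bilinI) (use bilinD(1)[OF assms(1)] lin_closed[OF assms(2)] lin_comp[OF assms(2) bilinD(2)[OF assms(1)]] in auto)

lemma tmap_lin:
 "module K V ==> module K V' ==> module K W ==> lin V V' f ==> lin (tensor K V W) (tensor K V' W) (tmap V' W f)"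
 unfolding tmap_def by (rule tsum_lin[OF _ _ tensor_module bilin_tens_lin])

lemma tmap_closed:
 "module K V ==> module K V' ==> module K W ==> lin V V' f ==> t <: tensor K V W ==>
  tmap V' W f t <: tensor K V' W"
 by (rule lin_closed[OF tmap_lin])

lemma tmap_tens:
 "module K V ==> module K V' ==> module K W ==> lin V V' f ==> v <: V ==> w <: W ==>
  tmap V' W f (tens K V W v w) = tens K V' W (f v) w"
 unfolding tmap_def by (rule tsum_tens[OF _ _ tensor_module bilin_tens_lin])

lemma tsum_tmap:
 assumes "module K V" "module K V'" "module K W" "module K Z" "lin V V' f" "bilin V' W Z \<beta>"
  "t <: tensor K V W"
 shows "tsum K Z (tmap V' W f t) \<beta> = tsum K Z t (%v w. \<beta> (f v) w)"
 by (rule tensor_eqI[OF assms(1,3,4) lin_comp[OF tmap_lin[OF assms(1-3,5)] tsum_lin[OF assms(2-4,6)]]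
    tsum_lin[OF assms(1,3,4) bilin_precomp[OF assms(6,5)]] _ assms(7)])
  (simp add: tmap_tens[OF assms(1-3,5)] tsum_tens[OF assms(2-4,6)] lin_closed[OF assms(5)]
   tsum_tens[OF assms(1,3,4) bilin_precomp[OF assms(6,5)]])

lemma tmap_comp:
 assumes "module K V" "module K V'" "module K V''" "module K W" "lin V V' f" "lin V' V'' g"
  "t <: tensor K V W"
 shows "tmap V'' W g (tmap V' W f t) = tmap V'' W (%x. g (f x)) t"
 unfolding tmap_def[of V'' W]
 by (rule tsum_tmap[OF assms(1,2,4) tensor_module[OF assms(3,4)] assms(5) bilin_tens_lin[OF assms(2-4,6)] assms(7)])

lemma tmap_id:
 assumes "module K V" "module K W" "!!x. x <: V ==> f x = x" "t <: tensor K V W"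
 shows "tmap V W f t = t"
proof -
 have f: "lin V V f" by (rule lin_cong[OF lin_id]) (use assms in auto)
 show ?thesis
  by (rule tensor_eqI[OF assms(1,2) tensor_module[OF assms(1,2)] tmap_lin[OF assms(1,1,2) f] lin_id _ assms(4)])
   (simp add: tmap_tens[OF assms(1,1,2) f] assms(3))
qed

lemma tmap_cong:
 assumes "module K V" "module K V'" "module K W" "lin V V' g" "!!x. x <: V ==> f x = g x"
  "t <: tensor K V W"
 shows "tmap V' W f t = tmap V' W g t"
 unfolding tmap_def
 by (rule tsum_cong[OF assms(1,3) tensor_module[OF assms(2,3)] assms(6)])
  (simp_all add: assms(5) tens_closed[OF assms(2,3)] lin_closed[OF assms(4)])

lemma tmap_zero:
 assumes "module K V" "module K V'" "module K W" "!!x. x <: V ==> f x = 0[V']"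
  "t <: tensor K V W"
 shows "tmap V' W f t = 0[tensor K V' W]"
proof -
 have f: "lin V V' f" using lin_cong[OF lin_const_zero[OF assms(2)] assms(1), of f] assms(4) by auto
 have "tens K V' W 0[V'] w = 0[tensor K V' W]" if "w <: W" for w
  using lin_zero[OF assms(2) tensor_module[OF assms(2,3)] bilinD(2)[OF tens_bilin[OF assms(2,3)] that]] .
 then show ?thesis
  by (intro tensor_eqI[OF assms(1,3) tensor_module[OF assms(2,3)] tmap_lin[OF assms(1-3) f]
     lin_const_zero[OF tensor_module[OF assms(2,3)]] _ assms(5)])
    (simp add: tmap_tens[OF assms(1-3) f] assms(4))
qed

lemma tmap_diff:
 assumes "module K V" "module K V'" "module K W" "lin V V' f" "lin V V' g" "t <: tensor K V W"
 shows "tmap V' W (%x. f x -[V'] g x) t = tmap V' W f t -[tensor K V' W] tmap V' W g t"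
proof -
 note T = tensor_module[OF assms(2,3)] and m = lin_minus[OF assms(2,4,5)]
 have "tens K V' W (x -[V'] y) w = tens K V' W x w -[tensor K V' W] tens K V' W y w"
  if "w <: W" "x <: V'" "y <: V'" for w x y
  using lin_diff[OF assms(2) T bilinD(2)[OF tens_bilin[OF assms(2,3)] that(1)] that(2,3)] .
 then show ?thesis
  by (intro tensor_eqI[OF assms(1,3) T tmap_lin[OF assms(1-3) m]
     lin_minus[OF T tmap_lin[OF assms(1-3,4)] tmap_lin[OF assms(1-3,5)]] _ assms(6)])
    (simp add: tmap_tens[OF assms(1-3)] m assms(4,5) lin_closed[OF assms(4)] lin_closed[OF assms(5)])
qed

subsection \<open>Complements and direct sums\<close>

text \<open>By Zorn's lemma there is a maximal subspace \<open>B\<close> that meets \<open>A\<close>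
  trivially. If some \<open>v\<close> were not in \<open>A + B\<close>, then \<open>B + K v\<close>
  would still meet \<open>A\<close> trivially, because nonzero scalars are invertible.\<close>

lemma complement:
 assumes V: "module K V" and A: "subspace V A"
 obtains B where "subspace V B" "A \<inter> B = {0[V]}" "!!v. v <: V ==> EX a:A. EX b:B. v = a +[V] b"
proof -
 let ?\<C> = "{B. subspace V B & A \<inter> B = {0[V]}}"
 have "EX B:?\<C>. ALL X:?\<C>. B \<subseteq> X --> X = B"
 proof (rule subset_Zorn_nonempty)
  show "?\<C> ~= {}" using subspace_zero[OF V] subspaceD(2)[OF A] by blast
 next
  fix \<D> assume ne: "\<D> ~= {}" and ch: "subset.chain ?\<C> \<D>"
  have sub: "subspace V B" "A \<inter> B = {0[V]}" if "B : \<D>" for B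
   using ch that by (auto simp: subset.chain_def)
  have "subspace V (\<Union>\<D>)"
  proof (rule subspaceI)
   fix x y assume "x : \<Union>\<D>" "y : \<Union>\<D>"
   then obtain B B' where "B : \<D>" "B' : \<D>" "x : B" "y : B'" by blast
   moreover then have "B \<subseteq> B' \<or> B' \<subseteq> B" using ch by (auto simp: subset.chain_def)
   ultimately obtain B where "B : \<D>" "x : B" "y : B" by blast
   then show "x +[V] y : \<Union>\<D>" using subspaceD(3)[OF sub(1)] by blast
  next
   obtain B where "B : \<D>" using ne by blast
   then show "0[V] : \<Union>\<D>" using subspaceD(2)[OF sub(1)] by blast
  next
   fix x assume "x : \<Union>\<D>"
   then obtain B where B: "B : \<D>" "x : B" by blast
   show "a *[V] x : \<Union>\<D>" if "a <: K" for a
    using subspaceD(4)[OF sub(1)[OF B(1)] that B(2)] B(1) by blast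
  next
   show "\<Union>\<D> \<subseteq> carrier V" using subspaceD(1)[OF sub(1)] by blast
  qed
  moreover have "A \<inter> \<Union>\<D> = {0[V]}" using ne sub(2) by blast
  ultimately show "\<Union>\<D> \<in> ?\<C>" by blast
 qed
 then obtain B where B0: "B : ?\<C>" "ALL X:?\<C>. B \<subseteq> X --> X = B" by (elim bexE)
 have B: "subspace V B" "A \<inter> B = {0[V]}" using B0(1) by simp_all
 have max: "X = B" if "subspace V X" "A \<inter> X = {0[V]}" "B \<subseteq> X" for X
  using B0(2) that by simp
 have "EX a:A. EX b:B. v = a +[V] b" if v: "v <: V" for v
 proof (rule ccontr)
  assume no: "\<not> (EX a:A. EX b:B. v = a +[V] b)"
  \<comment> \<open>This is \<open>B + K v\<close>. Once it is seen to meet \<open>A\<close>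
    trivially, maximality forces \<open>v\<close> into \<open>B\<close>, where it has an excluded
    decomposition.\<close>
  let ?X = "{b +[V] k *[V] v | b k. b : B & k <: K}"
  have Bc: "b <: V" if "b : B" for b using subspaceD(1)[OF B(1) that] .
  have Ac: "a <: V" if "a : A" for a using subspaceD(1)[OF A that] .
  have BX: "B \<subseteq> ?X"
  proof
   fix b assume b: "b : B"
   then have "b = b +[V] \<zero> *[V] v" using V v Bc by simp
   then show "b : ?X" using b K_closed(4) by blast
  qed
  have "subspace V ?X"
  proof (rule subspaceI)
   show "?X \<subseteq> carrier V" using V v Bc by auto
   show "0[V] : ?X" using BX subspaceD(2)[OF B(1)] by (rule subsetD)
  next
   fix x y assume "x : ?X" "y : ?X"
   then obtain b k b' k' where e: "b : B" "k <: K" "x = b +[V] k *[V] v"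
    "b' : B" "k' <: K" "y = b' +[V] k' *[V] v" by blast
   then have "x +[V] y = (b +[V] b') +[V] (k \<oplus> k') *[V] v"
    using V v Bc by (simp add: add4 mod_distr)
   then show "x +[V] y : ?X" using subspaceD(3)[OF B(1) e(1,4)] K_closed(2)[OF e(2,5)] by blast
  next
   fix a x assume a: "a <: K" and "x : ?X"
   then obtain b k where e: "b : B" "k <: K" "x = b +[V] k *[V] v" by blast
   then have "a *[V] x = a *[V] b +[V] (a \<otimes> k) *[V] v" using V v Bc a by (simp add: mod_distr)
   then show "a *[V] x : ?X" using subspaceD(4)[OF B(1) a e(1)] K_closed(1)[OF a e(2)] by blast
  qed
  moreover have "A \<inter> ?X = {0[V]}"
  proof (intro equalityI subsetI)
   fix x assume "x : A \<inter> ?X"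
   then obtain b k where e: "x : A" "b : B" "k <: K" "x = b +[V] k *[V] v" by blast
   show "x : {0[V]}"
   proof (cases "k = \<zero>")
    case True
    then have "x = b" using e(4) V v Bc[OF e(2)] by simp
    then show ?thesis using B(2) e(1,2) by blast
   next
    case False
    \<comment> \<open>From \<open>x = b + k v\<close> with \<open>x\<close> in \<open>A\<close> and
      \<open>k\<close> invertible follows that \<open>v\<close> is the difference of
      \<open>inv k\<close> times \<open>x\<close> and \<open>inv k\<close> times \<open>b\<close>,
      again an excluded decomposition.\<close>
    have inv: "inv k <: K" "inv k \<otimes> k = \<one>"
    proof -
     interpret field K by (rule field_K)
     have "k : Units K" using e(3) False field_Units by blast
     then show "inv k <: K" "inv k \<otimes> k = \<one>" by simp_all
    qed
    have kv: "k *[V] v = x -[V] b" unfolding e(4)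
     by (rule mod_cancel(4)[OF V, symmetric]) (use V v e(3) Bc[OF e(2)] in simp_all)
    have "v = inv k *[V] (k *[V] v)" using inv V v e(3) by (simp add: mod_distr(3)[symmetric])
    also have "\<dots> = inv k *[V] x -[V] inv k *[V] b"
     unfolding kv using V inv(1) Ac[OF e(1)] Bc[OF e(2)] by (rule smult_diff)
    also have "\<dots> = inv k *[V] x +[V] (\<ominus> \<one>) *[V] (inv k *[V] b)"
     using V inv(1) Ac[OF e(1)] Bc[OF e(2)] by (simp add: mod_neg)
    finally show ?thesis
     using no subspaceD(4)[OF A inv(1) e(1)] subspaceD(4)[OF B(1) K_closed(5)[OF K_closed(3)] subspaceD(4)[OF B(1) inv(1) e(2)]]
     by blast
   qed
  next
   fix x assume "x : {0[V]}"
   then show "x : A \<inter> ?X" using subspaceD(2)[OF A] subsetD[OF BX subspaceD(2)[OF B(1)]] by blast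
  qed
  ultimately have "?X = B" using max BX by blast
  moreover have "v = 0[V] +[V] \<one> *[V] v" using V v by simp
  then have "v : ?X" using subspaceD(2)[OF B(1)] K_closed(3) by blast
  ultimately have "v : B" by simp
  moreover have "v = 0[V] +[V] v" using V v by simp
  ultimately show False using no subspaceD(2)[OF A] by blast
 qed
 then show ?thesis using that B by blast
qed

text \<open>Take a complement \<open>T\<close> of the kernel and a complement \<open>T'\<close> of
  the image; \<open>g\<close> projects to the image along \<open>T'\<close> and then inverts
  \<open>f\<close> on \<open>T\<close>. One statement covers retractions of injections, projections
  onto kernels and projections modulo images.\<close>

lemma generalized_inverse:
 assumes V: "module K V" and W: "module K W" and f: "lin V W f"
 obtains g where "lin W V g" "!!v. v <: V ==> f (g (f v)) = f v"
proof -
 let ?N = "{x : carrier V. f x = 0[W]}"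
 obtain T where T: "subspace V T" "?N \<inter> T = {0[V]}" "!!v. v <: V ==> EX a:?N. EX b:T. v = a +[V] b"
  using complement[OF V subspace_kernel[OF V W f]] by blast
 obtain T' where T': "subspace W T'" "f ` carrier V \<inter> T' = {0[W]}"
  "!!w. w <: W ==> EX a:f ` carrier V. EX b:T'. w = a +[W] b"
  using complement[OF W subspace_image[OF V W f]] by blast
 have Tc: "t <: V" if "t : T" for t using subspaceD(1)[OF T(1) that] .
 have T'c: "t <: W" if "t : T'" for t using subspaceD(1)[OF T'(1) that] .
 have fT: "EX t:T. f v = f t" if v: "v <: V" for v
 proof -
  obtain a b where ab: "a <: V" "f a = 0[W]" "b : T" "v = a +[V] b" using T(3)[OF v] by blast
  then have "f v = f b" using lin_add[OF f ab(1) Tc[OF ab(3)]] W lin_closed[OF f Tc[OF ab(3)]] by simp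
  then show ?thesis using ab by blast
 qed
 \<comment> \<open>\<open>P w t\<close> will mean that \<open>t\<close> is the value of
   \<open>g\<close> at \<open>w\<close>: the component of \<open>w\<close> in the image is
   \<open>f t\<close>, the other one lies in \<open>T'\<close>.\<close>
 define P where "P w t \<longleftrightarrow> t : T & w -[W] f t : T'" for w t
 have ex: "EX t. P w t" if w: "w <: W" for w
 proof -
  obtain v b where vb: "v <: V" "b : T'" "w = f v +[W] b" using T'(3)[OF w] by blast
  obtain t where t: "t : T" "f v = f t" using fT[OF vb(1)] by blast
  have "w -[W] f t = b" unfolding vb(3) t(2)
   by (rule mod_cancel(4)[OF W T'c[OF vb(2)] lin_closed[OF f Tc[OF t(1)]]])
  then show ?thesis using t vb P_def by auto
 qed
 have uniq: "t = t'" if w: "w <: W" and P: "P w t" "P w t'" for w t t'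
 proof -
  have t: "t : T" "t' : T" "w -[W] f t : T'" "w -[W] f t' : T'" using P by (auto simp: P_def)
  note c = Tc[OF t(1)] Tc[OF t(2)]
  note fc = lin_closed[OF f c(1)] lin_closed[OF f c(2)]
  have "(w -[W] f t) +[W] f t = (w -[W] f t') +[W] f t'"
   using mod_cancel(1)[OF W w fc(1)] mod_cancel(1)[OF W w fc(2)] by simp
  then have "((w -[W] f t) +[W] f t) -[W] ((w -[W] f t') +[W] f t') = 0[W]"
   using W w fc by simp
  then have "((w -[W] f t) -[W] (w -[W] f t')) +[W] (f t -[W] f t') = 0[W]"
   using W w fc by (simp add: diff_add4)
  then have "((w -[W] f t) -[W] (w -[W] f t')) +[W] f (t -[V] t') = 0[W]"
   using lin_diff[OF V W f c] by simp
  moreover have d: "(w -[W] f t) -[W] (w -[W] f t') : T'" (is "?d : _")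
   by (rule subspace_diff[OF W T'(1) t(3,4)])
  have tt: "t -[V] t' : T" by (rule subspace_diff[OF V T(1) t(1,2)])
  note z = T'c[OF d] lin_closed[OF f Tc[OF tt]]
  ultimately have "?d = 0[W] -[W] f (t -[V] t')" using mod_cancel(3)[OF W z] by simp
  also have "\<dots> = f (0[V] -[V] (t -[V] t'))"
   using lin_diff[OF V W f mod_closed(2)[OF V] Tc[OF tt]] lin_zero[OF V W f] by simp
  \<comment> \<open>The difference lies both in \<open>T'\<close> and in the image, so it vanishes.
    What remains, \<open>t -[V] t'\<close>, lies both in \<open>T\<close> and in the kernel.\<close>
  finally have "?d : f ` carrier V" using V Tc[OF tt] by simp
  then have "?d = 0[W]" using d T'(2) by blast
  then have "f (t -[V] t') = 0[W]"
   using \<open>?d +[W] f (t -[V] t') = 0[W]\<close> W z by simp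
  then have "t -[V] t' = 0[V]" using tt T(2) Tc[OF tt] by blast
  then show "t = t'" using mod_diff_eq_0[OF V c] by simp
 qed
 define g where "g w = (SOME t. P w t)" for w
 have gP: "P w (g w)" if "w <: W" for w
  unfolding g_def by (rule someI_ex[OF ex[OF that]])
 have geq: "g w = t" if "w <: W" "P w t" for w t
  using uniq[OF that(1) gP[OF that(1)] that(2)] .
 have gT: "g w : T" "w -[W] f (g w) : T'" if "w <: W" for w
  using gP[OF that] by (auto simp: P_def)
 have "lin W V g"
 proof (rule linI)
  fix x assume "x <: W" then show "g x <: V" using Tc gT by blast
 next
  fix x y assume x: "x <: W" and y: "y <: W"
  note c = Tc[OF gT(1)[OF x]] Tc[OF gT(1)[OF y]]
  have "(x +[W] y) -[W] f (g x +[V] g y) = (x -[W] f (g x)) +[W] (y -[W] f (g y))"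
   using W x y lin_closed[OF f c(1)] lin_closed[OF f c(2)] by (simp add: lin_add[OF f c] diff_add4)
  then have "P (x +[W] y) (g x +[V] g y)"
   using subspaceD(3)[OF T'(1) gT(2)[OF x] gT(2)[OF y]] subspaceD(3)[OF T(1) gT(1)[OF x] gT(1)[OF y]]
   by (simp add: P_def)
  then show "g (x +[W] y) = g x +[V] g y" using geq W x y by simp
 next
  fix a x assume a: "a <: K" and x: "x <: W"
  note c = Tc[OF gT(1)[OF x]]
  have "a *[W] x -[W] f (a *[V] g x) = a *[W] (x -[W] f (g x))"
   using W x a lin_closed[OF f c] by (simp add: lin_smult[OF f a c] smult_diff)
  then have "P (a *[W] x) (a *[V] g x)"
   using subspaceD(4)[OF T'(1) a gT(2)[OF x]] subspaceD(4)[OF T(1) a gT(1)[OF x]] by (simp add: P_def)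
  then show "g (a *[W] x) = a *[V] g x" using geq W x a by simp
 qed
 moreover have "f (g (f v)) = f v" if v: "v <: V" for v
 proof -
  obtain t where t: "t : T" "f v = f t" using fT[OF v] by blast
  have "P (f v) t" unfolding P_def t(2)
   using t(1) W lin_closed[OF f Tc[OF t(1)]] subspaceD(2)[OF T'(1)] by simp
  then show ?thesis using geq[OF lin_closed[OF f v]] t by simp
 qed
 ultimately show ?thesis using that by blast
qed

lemma left_inverse:
 assumes "module K V" "module K W" "lin V W f" "inj_on f (carrier V)"
 obtains g where "lin W V g" "!!v. v <: V ==> g (f v) = v"
proof -
 obtain g where g: "lin W V g" "!!v. v <: V ==> f (g (f v)) = f v"
  using generalized_inverse[OF assms(1-3)] by blast
 have "g (f v) = v" if "v <: V" for v
  by (rule inj_onD[OF assms(4) g(2)[OF that]]) (use that lin_closed[OF assms(3)] lin_closed[OF g(1)] in auto)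
 then show ?thesis using that g(1) by blast
qed

text \<open>A linear left inverse of \<open>f\<close> yields one of \<open>tmap W X f\<close>. All
  arguments about subobjects of comodules rest on this exactness of the tensor product over a
  field.\<close>

lemma tmap_inj:
 assumes "module K V" "module K W" "module K X" "lin V W f" "inj_on f (carrier V)"
 shows "inj_on (tmap W X f) (carrier (tensor K V X))"
proof -
 obtain g where g: "lin W V g" "!!v. v <: V ==> g (f v) = v"
  using left_inverse[OF assms(1,2,4,5)] by blast
 have "tmap V X g (tmap W X f t) = t" if "t <: tensor K V X" for t
  using tmap_comp[OF assms(1,2,1,3,4) g(1) that] tmap_id[OF assms(1,3) g(2) that] by simp
 then show ?thesis by (rule inj_on_inverseI)
qed

text \<open>The linear map with components \<open>L i\<close> out of a direct sum. The projections
  are a parameter, so that it also applies to copies of the direct sum in another type.\<close>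

definition dev :: "'i set => ('i => ('k, 'a) module) => ('i => 'p => 'a) => ('k, 'b) module => ('i => 'a => 'b) => 'p => 'b" where
 "dev I V \<pi> Z L u = (\<Oplus>\<^bsub>Z\<^esub>i\<in>{i : I. \<pi> i u ~= 0[V i]}. L i (\<pi> i u))"

lemma dev_eq:
 assumes V: "!!i. i : I ==> module K (V i)" and Z: "module K Z"
  and \<pi>: "!!i. i : I ==> \<pi> i u <: V i"
  and L: "!!i. i : I ==> lin (V i) Z (L i)"
  and F: "finite F" "{i : I. \<pi> i u ~= 0[V i]} \<subseteq> F" "F \<subseteq> I"
 shows "dev I V \<pi> Z L u = finsum Z (%i. L i (\<pi> i u)) F"
 unfolding dev_def
proof (rule finsum_mono_neutral[OF Z F(1,2)])
 fix i assume "i : F - {i : I. \<pi> i u ~= 0[V i]}"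
 then have "i : I" "\<pi> i u = 0[V i]" using F(3) by auto
 then show "L i (\<pi> i u) = 0[Z]" using lin_zero[OF V Z L] by simp
next
 fix i assume "i : {i : I. \<pi> i u ~= 0[V i]}"
 then show "L i (\<pi> i u) <: Z" using lin_closed[OF L \<pi>] by simp
qed

lemma dev_lin:
 assumes V: "!!i. i : I ==> module K (V i)" and Z: "module K Z" and P: "module K P"
  and \<pi>: "!!i. i : I ==> lin P (V i) (\<pi> i)"
  and fin: "!!u. u <: P ==> finite {i : I. \<pi> i u ~= 0[V i]}"
  and L: "!!i. i : I ==> lin (V i) Z (L i)"
 shows "lin P Z (dev I V \<pi> Z L)"
proof -
 interpret Z: module K Z by fact
 let ?S = "%u. {i : I. \<pi> i u ~= 0[V i]}"
 have c: "L i (\<pi> i u) <: Z" if "i : I" "u <: P" for i u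
  using lin_closed[OF L[OF that(1)] lin_closed[OF \<pi>[OF that(1)] that(2)]] .
 have eq: "dev I V \<pi> Z L u = finsum Z (%i. L i (\<pi> i u)) F"
  if "u <: P" "finite F" "?S u \<subseteq> F" "F \<subseteq> I" for u F
  by (rule dev_eq[where V = V and \<pi> = \<pi> and L = L and I = I, OF V Z lin_closed[OF \<pi> that(1)] L that(2-4)])
 show ?thesis
 proof (rule linI)
  fix u assume u: "u <: P"
  show "dev I V \<pi> Z L u <: Z" unfolding dev_def
   by (rule finsum_closed'[OF Z]) (use c u in auto)
 next
  fix u w assume u: "u <: P" and w: "w <: P"
  let ?F = "?S u \<union> ?S w"
  have F: "finite ?F" "?F \<subseteq> I" using fin[OF u] fin[OF w] by auto
  have uw: "u +[P] w <: P" using P u w by simp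
  have "\<pi> i (u +[P] w) = 0[V i]" if "i : I" "\<pi> i u = 0[V i]" "\<pi> i w = 0[V i]" for i
   using that V lin_add[OF \<pi> u w] by simp
  then have F': "?S (u +[P] w) \<subseteq> ?F" by blast
  have "dev I V \<pi> Z L (u +[P] w) = finsum Z (%i. L i (\<pi> i (u +[P] w))) ?F"
   by (rule eq[OF uw F(1) F' F(2)])
  also have "\<dots> = finsum Z (%i. L i (\<pi> i u) +[Z] L i (\<pi> i w)) ?F"
  proof (rule Z.finsum_cong')
   show "(%i. L i (\<pi> i u) +[Z] L i (\<pi> i w)) : ?F \<rightarrow> carrier Z" using c u w by auto
   fix i assume "i : ?F"
   then have i: "i : I" by blast
   show "L i (\<pi> i (u +[P] w)) = L i (\<pi> i u) +[Z] L i (\<pi> i w)"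
    using lin_add[OF \<pi>[OF i] u w] lin_add[OF L[OF i] lin_closed[OF \<pi>[OF i] u] lin_closed[OF \<pi>[OF i] w]] by simp
  qed simp
  also have "\<dots> = finsum Z (%i. L i (\<pi> i u)) ?F +[Z] finsum Z (%i. L i (\<pi> i w)) ?F"
   by (rule Z.finsum_addf) (use c u w in auto)
  also have "finsum Z (%i. L i (\<pi> i u)) ?F = dev I V \<pi> Z L u" by (rule eq[OF u F(1) _ F(2), symmetric]) auto
  also have "finsum Z (%i. L i (\<pi> i w)) ?F = dev I V \<pi> Z L w" by (rule eq[OF w F(1) _ F(2), symmetric]) auto
  finally show "dev I V \<pi> Z L (u +[P] w) = dev I V \<pi> Z L u +[Z] dev I V \<pi> Z L w" .
 next
  fix a u assume a: "a <: K" and u: "u <: P"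
  have F: "finite (?S u)" "?S u \<subseteq> I" using fin[OF u] by auto
  have au: "a *[P] u <: P" using P a u by simp
  have "\<pi> i (a *[P] u) = 0[V i]" if "i : I" "\<pi> i u = 0[V i]" for i
   using that V a lin_smult[OF \<pi> a u] by simp
  then have F': "?S (a *[P] u) \<subseteq> ?S u" by blast
  have "dev I V \<pi> Z L (a *[P] u) = finsum Z (%i. L i (\<pi> i (a *[P] u))) (?S u)"
   by (rule eq[OF au F(1) F' F(2)])
  also have "\<dots> = finsum Z (%i. a *[Z] L i (\<pi> i u)) (?S u)"
  proof (rule Z.finsum_cong')
   show "(%i. a *[Z] L i (\<pi> i u)) : ?S u \<rightarrow> carrier Z" using c u a by auto
   fix i assume "i : ?S u"
   then have i: "i : I" by blast
   show "L i (\<pi> i (a *[P] u)) = a *[Z] L i (\<pi> i u)"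
    using lin_smult[OF \<pi>[OF i] a u] lin_smult[OF L[OF i] a lin_closed[OF \<pi>[OF i] u]] by simp
  qed simp
  also have "\<dots> = a *[Z] dev I V \<pi> Z L u" unfolding dev_def
   by (rule Z.finsum_smult_ldistr[symmetric]) (use F c u a in auto)
  finally show "dev I V \<pi> Z L (a *[P] u) = a *[Z] dev I V \<pi> Z L u" .
 qed
qed

text \<open>Direct sums are recognised by their injections and projections, whatever the carrier is.
  Finite support and joint injectivity of the projections stand in for generation by the summands,
  which follows in \<open>dsum_span\<close>.\<close>

definition is_dsum :: "'i set => ('i => ('k, 'a) module) => ('k, 'p) module => ('i => 'a => 'p) => ('i => 'p => 'a) => bool" where
 "is_dsum I V P \<iota> \<pi> \<longleftrightarrow> module K P & (ALL i:I. module K (V i)) &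
   (ALL i:I. lin (V i) P (\<iota> i)) & (ALL i:I. lin P (V i) (\<pi> i)) &
   (ALL i:I. ALL v:carrier (V i). \<pi> i (\<iota> i v) = v) &
   (ALL i:I. ALL j:I. ALL v:carrier (V i). i ~= j --> \<pi> j (\<iota> i v) = 0[V j]) &
   (ALL u:carrier P. finite {i : I. \<pi> i u ~= 0[V i]}) &
   (ALL u:carrier P. (ALL i:I. \<pi> i u = 0[V i]) --> u = 0[P])"

lemma is_dsumD:
 assumes "is_dsum I V P \<iota> \<pi>"
 shows "module K P" "i : I ==> module K (V i)" "i : I ==> lin (V i) P (\<iota> i)" "i : I ==> lin P (V i) (\<pi> i)"
  "i : I ==> v <: V i ==> \<pi> i (\<iota> i v) = v"
  "i : I ==> j : I ==> v <: V i ==> i ~= j ==> \<pi> j (\<iota> i v) = 0[V j]"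
  "u <: P ==> finite {i : I. \<pi> i u ~= 0[V i]}"
  "u <: P ==> (!!i. i : I ==> \<pi> i u = 0[V i]) ==> u = 0[P]"
 using assms by (auto simp: is_dsum_def)

lemma dsum_dev_lin:
 assumes "is_dsum I V P \<iota> \<pi>" "module K Z" "!!i. i : I ==> lin (V i) Z (L i)"
 shows "lin P Z (dev I V \<pi> Z L)"
 by (rule dev_lin[where V = V and \<pi> = \<pi> and L = L and I = I, OF is_dsumD(2)[OF assms(1)] assms(2) is_dsumD(1)[OF assms(1)] is_dsumD(4)[OF assms(1)]
    is_dsumD(7)[OF assms(1)] assms(3)])

lemma dsum_dev_inj:
 assumes d: "is_dsum I V P \<iota> \<pi>" and Z: "module K Z" and L: "!!i. i : I ==> lin (V i) Z (L i)"
  and i: "i : I" and v: "v <: V i"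
 shows "dev I V \<pi> Z L (\<iota> i v) = L i v"
proof -
 interpret Z: module K Z by fact
 note D = is_dsumD[OF d]
 have c: "\<iota> i v <: P" by (rule lin_closed[OF D(3)[OF i] v])
 have "{j : I. \<pi> j (\<iota> i v) ~= 0[V j]} \<subseteq> {i}" using D(6)[OF i _ v] by auto
 then have "dev I V \<pi> Z L (\<iota> i v) = finsum Z (%j. L j (\<pi> j (\<iota> i v))) {i}"
  using i by (intro dev_eq[where V = V and \<pi> = \<pi> and L = L and I = I, OF D(2) Z lin_closed[OF D(4) c] L]) auto
 also have "\<dots> = L i v" using D(5)[OF i v] lin_closed[OF L[OF i] v] by (simp add: Z.finsum_insert)
 finally show ?thesis .
qed

text \<open>Both sides have the same components, and the projections are jointly injective.\<close>

lemma dsum_decomp: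
 assumes d: "is_dsum I V P \<iota> \<pi>" and u: "u <: P"
 shows "dev I V \<pi> P \<iota> u = u"
proof -
 note D = is_dsumD[OF d]
 interpret P: module K P by (rule D(1))
 let ?S = "{i : I. \<pi> i u ~= 0[V i]}"
 have l: "lin P P (dev I V \<pi> P \<iota>)" by (rule dsum_dev_lin[OF d D(1) D(3)])
 have c: "dev I V \<pi> P \<iota> u <: P" by (rule lin_closed[OF l u])
 have pc: "\<iota> i (\<pi> i u) <: P" if "i : I" for i
  using lin_closed[OF D(3)[OF that] lin_closed[OF D(4)[OF that] u]] .
 have "\<pi> j (dev I V \<pi> P \<iota> u) = \<pi> j u" if j: "j : I" for j
 proof -
  interpret Vj: module K "V j" by (rule D(2)[OF j])
  have "\<pi> j (dev I V \<pi> P \<iota> u) = finsum (V j) (%i. \<pi> j (\<iota> i (\<pi> i u))) ?S"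
   unfolding dev_def by (rule lin_finsum[OF D(1) D(2)[OF j] D(4)[OF j] D(7)[OF u] pc]) simp
  also have "\<dots> = finsum (V j) (%i. if j = i then \<pi> i u else 0[V j]) ?S"
   by (rule Vj.finsum_cong') (use D(5,6) j lin_closed[OF D(4) u] in auto)
  also have "\<dots> = \<pi> j u"
  proof (cases "j : ?S")
   case True
   have "finsum (V j) (%i. if j = i then \<pi> j u else 0[V j]) ?S = \<pi> j u"
    by (rule Vj.finsum_singleton[OF True D(7)[OF u]]) (use lin_closed[OF D(4)[OF j] u] in auto)
   moreover have "finsum (V j) (%i. if j = i then \<pi> i u else 0[V j]) ?S
     = finsum (V j) (%i. if j = i then \<pi> j u else 0[V j]) ?S"
    by (rule Vj.finsum_cong') (use lin_closed[OF D(4)[OF j] u] in auto)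
   ultimately show ?thesis by simp
  next
   case False
   have "finsum (V j) (%i. if j = i then \<pi> i u else 0[V j]) ?S = finsum (V j) (%i. 0[V j]) ?S"
    by (rule Vj.finsum_cong') (use False in auto)
   then show ?thesis using False j by (simp add: Vj.finsum_zero)
  qed
  finally show ?thesis .
 qed
 then have "\<pi> j (dev I V \<pi> P \<iota> u -[P] u) = 0[V j]" if "j : I" for j
  using that lin_diff[OF D(1) D(2)[OF that] D(4)[OF that] c u] D(2)[OF that] lin_closed[OF D(4)[OF that] u] by simp
 then have "dev I V \<pi> P \<iota> u -[P] u = 0[P]" using D(8) D(1) c u by simp
 then show ?thesis using mod_diff_eq_0[OF D(1) c u] by simp
qed

lemma dsum_span:
 assumes d: "is_dsum I V P \<iota> \<pi>" and H: "subspace P H"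
  and i: "!!i v. i : I ==> v <: V i ==> \<iota> i v : H"
 shows "carrier P \<subseteq> H"
proof
 fix u assume u: "u <: P"
 note D = is_dsumD[OF d]
 have "dev I V \<pi> P \<iota> u : H" unfolding dev_def
  by (rule finsum_subspace[OF D(1) H D(7)[OF u]]) (use i lin_closed[OF D(4) u] in auto)
 then show "u : H" using dsum_decomp[OF d u] by simp
qed

lemma dsum_mod_is_dsum:
 fixes V :: "'i => ('k, 'a) module"
 assumes V: "!!i. i : I ==> module K (V i)"
 shows "is_dsum I V (dsum_mod I V) (dsum_inj I V) (%i u. u i)"
proof -
 let ?P = "dsum_mod I V"
 have sel: "zero ?P = (\<lambda>i\<in>I. 0[V i])" "u +[?P] w = (\<lambda>i\<in>I. u i +[V i] w i)"
  "a *[?P] u = (\<lambda>i\<in>I. a *[V i] u i)" for a u w by (simp_all add: dsum_mod_def)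
 have carI: "u <: ?P" if "!!i. i : I ==> u i <: V i" "u : extensional I"
  "finite F" "!!i. i : I ==> u i ~= 0[V i] ==> i : F" for u F
  using that finite_subset[of "{i : I. u i ~= 0[V i]}" F]
  by (auto simp: dsum_mod_def PiE_def)
 have carD: "i : I ==> u i <: V i" "u : extensional I" "finite {i : I. u i ~= 0[V i]}"
  if "u <: ?P" for u i
  using that by (auto simp: dsum_mod_def PiE_def)
 have ext: "(!!i. i : I ==> u i = w i) ==> u : extensional I ==> w : extensional I ==> u = w" for u w :: "'i => 'a"
  by (rule extensionalityI)
 have P: "module K ?P"
 proof (rule moduleI')
  fix x y assume x: "x <: ?P" and y: "y <: ?P"
  show "x +[?P] y <: ?P" unfolding sel
  proof (rule carI)
   show "finite ({i : I. x i ~= 0[V i]} \<union> {i : I. y i ~= 0[V i]})" using carD(3) x y by auto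
  qed (use carD(1)[OF x] carD(1)[OF y] V in auto)
  show "x +[?P] y = y +[?P] x" unfolding sel
   by (rule restrict_ext) (use mod_ac(2)[OF V] carD(1)[OF x] carD(1)[OF y] in auto)
 next
  fix a x assume a: "a <: K" and x: "x <: ?P"
  show "a *[?P] x <: ?P" unfolding sel
   by (rule carI[OF _ _ carD(3)[OF x]]) (use carD(1)[OF x] V a in auto)
 next
  show "0[?P] <: ?P" unfolding sel by (rule carI[of _ "{}"]) (use V in auto)
 next
  fix x y z assume x: "x <: ?P" and y: "y <: ?P" and z: "z <: ?P"
  show "x +[?P] y +[?P] z = x +[?P] (y +[?P] z)" unfolding sel
   by (rule restrict_ext) (use mod_ac(1)[OF V] carD(1)[OF x] carD(1)[OF y] carD(1)[OF z] in auto)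
 next
  fix x assume x: "x <: ?P"
  show "0[?P] +[?P] x = x" "\<zero> *[?P] x = 0[?P]" "\<one> *[?P] x = x"
   by (rule ext; use V carD(1)[OF x] carD(2)[OF x] in \<open>simp add: sel\<close>)+
 next
  fix a x y assume a: "a <: K" and x: "x <: ?P" and y: "y <: ?P"
  show "a *[?P] (x +[?P] y) = a *[?P] x +[?P] a *[?P] y" unfolding sel
   by (rule restrict_ext) (use mod_distr(1)[OF V] carD(1)[OF x] carD(1)[OF y] a in auto)
 next
  fix a b x assume a: "a <: K" "b <: K" and x: "x <: ?P"
  show "(a \<oplus> b) *[?P] x = a *[?P] x +[?P] b *[?P] x" unfolding sel
   by (rule restrict_ext) (use mod_distr(2)[OF V] carD(1)[OF x] a in auto)
  show "(a \<otimes> b) *[?P] x = a *[?P] (b *[?P] x)" unfolding sel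
   by (rule restrict_ext) (use mod_distr(3)[OF V] carD(1)[OF x] a in auto)
 qed
 have inj: "lin (V i) ?P (dsum_inj I V i)" if i: "i : I" for i
 proof (rule linI)
  fix v assume v: "v <: V i"
  show "dsum_inj I V i v <: ?P" unfolding dsum_inj_def
   by (rule carI[of _ "{i}"]) (use v V in \<open>auto split: if_splits\<close>)
 next
  fix v w assume "v <: V i" "w <: V i"
  show "dsum_inj I V i (v +[V i] w) = dsum_inj I V i v +[?P] dsum_inj I V i w"
   unfolding sel dsum_inj_def by (rule restrict_ext) (use V in auto)
 next
  fix a v assume "a <: K" "v <: V i"
  then show "dsum_inj I V i (a *[V i] v) = a *[?P] dsum_inj I V i v"
   unfolding sel dsum_inj_def by (intro restrict_ext) (use V in auto)
 qed
 have proj: "lin ?P (V i) (%u. u i)" if i: "i : I" for i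
  by (rule linI) (use i carD(1) in \<open>auto simp: sel\<close>)
 show ?thesis unfolding is_dsum_def
 proof (intro conjI ballI impI)
  fix u assume u: "u <: ?P" and z: "ALL i:I. u i = 0[V i]"
  show "u = 0[?P]" by (rule ext) (use z carD(2)[OF u] in \<open>auto simp: sel\<close>)
 qed (use P V inj proj carD(3) in \<open>auto simp: dsum_inj_def\<close>)
qed

text \<open>The carrier of a direct sum is moved into the type of the summands by an arbitrary injection.\<close>

lemma dsum_transport:
 fixes \<theta> :: "'p => 'q"
 assumes d: "is_dsum I V P \<iota> \<pi>" and \<theta>: "inj_on \<theta> (carrier P)"
 obtains P' :: "('k, 'q) module" and \<iota>' \<pi>' where "is_dsum I V P' \<iota>' \<pi>'" "carrier P' = \<theta> ` carrier P"
proof -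
 note D = is_dsumD[OF d]
 define \<kappa> where "\<kappa> = the_inv_into (carrier P) \<theta>"
 have \<kappa>: "\<kappa> (\<theta> u) = u" if "u <: P" for u
  unfolding \<kappa>_def by (rule the_inv_into_f_f[OF \<theta> that])
 define P' :: "('k, 'q) module" where "P' = \<lparr>carrier = \<theta> ` carrier P, mult = undefined, one = undefined, zero = \<theta> 0[P],
   add = (%x y. \<theta> (\<kappa> x +[P] \<kappa> y)), smult = (%a x. \<theta> (a *[P] \<kappa> x))\<rparr>"
 have sel: "carrier P' = \<theta> ` carrier P" "zero P' = \<theta> 0[P]" "x +[P'] y = \<theta> (\<kappa> x +[P] \<kappa> y)"
  "a *[P'] x = \<theta> (a *[P] \<kappa> x)" for x y a by (simp_all add: P'_def)
 have P': "module K P'" "lin P P' \<theta>"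
  by (rule module_image[OF D(1)]; use \<kappa> in \<open>simp add: sel\<close>)+
 have k: "lin P' P \<kappa>"
  by (rule lin_factor_surj[OF D(1) P'(2) sel(1)[symmetric] lin_id]) (rule \<kappa>)
 have kc: "\<kappa> u <: P" "\<theta> (\<kappa> u) = u" if "u <: P'" for u
  using that \<kappa> by (auto simp: sel(1))
 have "is_dsum I V P' (%i v. \<theta> (\<iota> i v)) (%i u. \<pi> i (\<kappa> u))"
  unfolding is_dsum_def
 proof (intro conjI ballI impI)
  fix i assume i: "i : I"
  show "module K (V i)" by (rule D(2)[OF i])
  show "lin (V i) P' (%v. \<theta> (\<iota> i v))" by (rule lin_comp[OF D(3)[OF i] P'(2)])
  show "lin P' (V i) (%u. \<pi> i (\<kappa> u))" by (rule lin_comp[OF k D(4)[OF i]])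
  fix v assume v: "v <: V i"
  show "\<pi> i (\<kappa> (\<theta> (\<iota> i v))) = v" using \<kappa>[OF lin_closed[OF D(3)[OF i] v]] D(5)[OF i v] by simp
 next
  fix i j v assume i: "i : I" "j : I" and v: "v <: V i" and ne: "i ~= j"
  show "\<pi> j (\<kappa> (\<theta> (\<iota> i v))) = 0[V j]"
   using \<kappa>[OF lin_closed[OF D(3)[OF i(1)] v]] D(6)[OF i v ne] by simp
 next
  fix u assume u: "u <: P'"
  show "finite {i : I. \<pi> i (\<kappa> u) ~= 0[V i]}" by (rule D(7)[OF kc(1)[OF u]])
  assume "ALL i:I. \<pi> i (\<kappa> u) = 0[V i]"
  then have "\<kappa> u = 0[P]" using D(8)[OF kc(1)[OF u]] by blast
  then show "u = 0[P']" using kc(2)[OF u] by (simp add: sel(2))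
 qed (rule P'(1))
 then show ?thesis using that sel(1) by blast
qed

end

section \<open>Comodules and entwined modules\<close>

locale coalg = ground K for K :: "('k, 'z) ring_scheme" (structure) +
 fixes C :: "('k, 'c) coalgebra"
 assumes coalgebra_C: "is_coalgebra K C"
begin

abbreviation V :: "('k, 'c) module" where "V \<equiv> csp C"
abbreviation VV :: "('k, ('k, 'c, 'c) tens) module" where "VV \<equiv> tensor K V V"

lemma V_module [simp]: "module K V"
 and delta_lin: "lin V VV (delta C)"
 and eps_lin: "lin V (scalars K) (eps C)"
 using coalgebra_C by (simp_all add: is_coalgebra_def Let_def)

lemma VV_module [simp]: "module K VV"
 by simp

text \<open>This and the next two definitions are the two sides of coassociativity and the left side
  of the counit law, as maps on \<open>M\<close>. In this form the laws are equalities of linear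
  maps, which can be tested on generators or after an injection.\<close>

definition coassL :: "('k, 'm) module => ('m => ('k, 'm, 'c) tens) => 'm => ('k, 'm, ('k, 'c, 'c) tens) tens" where
 "coassL M \<rho> m = tsum K (tensor K M VV) (\<rho> m) (%m0 m1. tens K M VV m0 (delta C m1))"

definition coassR :: "('k, 'm) module => ('m => ('k, 'm, 'c) tens) => 'm => ('k, 'm, ('k, 'c, 'c) tens) tens" where
 "coassR M \<rho> m = tsum K (tensor K M VV) (\<rho> m) (%m0 m1.
   tsum K (tensor K M VV) (\<rho> m0) (%m00 m01. tens K M VV m00 (tens K V V m01 m1)))"

definition counL :: "('k, 'm) module => ('m => ('k, 'm, 'c) tens) => 'm => 'm" where
 "counL M \<rho> m = tsum K M (\<rho> m) (%m0 m1. eps C m1 *[M] m0)"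

lemma is_comodule_iff:
 "is_comodule K C M \<rho> \<longleftrightarrow> module K M & lin M (tensor K M V) \<rho> &
  (ALL m:carrier M. coassL M \<rho> m = coassR M \<rho> m) & (ALL m:carrier M. counL M \<rho> m = m)"
 by (simp add: is_comodule_def Let_def coassL_def coassR_def counL_def)

lemma colinear_iff:
 "colinear_map K C M \<rho> N \<sigma> f \<longleftrightarrow> lin M N f & (ALL m:carrier M. \<sigma> (f m) = tmap N V f (\<rho> m))"
 by (simp add: colinear_map_def tmap_def)

lemma bilin_postcomp:
 assumes "bilin M W' Z \<beta>" "lin W W' g"
 shows "bilin M W Z (%v w. \<beta> v (g w))"
 by (rule bilinI) (use bilinD(2)[OF assms(1)] lin_closed[OF assms(2)] lin_comp[OF assms(2) bilinD(1)[OF assms(1)]] in auto)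

lemma coassL_bilin: "module K M ==> bilin M V (tensor K M VV) (%m0 m1. tens K M VV m0 (delta C m1))"
 by (rule bilin_postcomp[OF tens_bilin[OF _ VV_module] delta_lin])

lemma tens3_bilin:
 "module K M ==> c <: V ==> bilin M V (tensor K M VV) (%m0 m1. tens K M VV m0 (tens K V V m1 c))"
 by (rule bilin_postcomp[OF tens_bilin[OF _ VV_module] bilinD(2)[OF tens_bilin[OF V_module V_module]]])

text \<open>The inner sum depends on \<open>m0\<close> through \<open>\<rho>\<close> and on
  \<open>m1\<close> as a parameter, so the two variables call for the two different linearity
  principles of Sweedler sums.\<close>

lemma coassR_bilin:
 assumes M: "module K M" and \<rho>: "lin M (tensor K M V) \<rho>"
 shows "bilin M V (tensor K M VV) (%m0 m1. tsum K (tensor K M VV) (\<rho> m0)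
  (%m00 m01. tens K M VV m00 (tens K V V m01 m1)))"
proof -
 note T = tensor_module[OF M VV_module]
 show ?thesis
 proof (rule bilinI)
  fix c assume c: "c <: V"
  show "lin M (tensor K M VV) (%m0. tsum K (tensor K M VV) (\<rho> m0) (%m00 m01. tens K M VV m00 (tens K V V m01 c)))"
   by (rule lin_comp[OF \<rho> tsum_lin[OF M V_module T tens3_bilin[OF M c]]])
 next
  fix m assume m: "m <: M"
  show "lin V (tensor K M VV) (%m1. tsum K (tensor K M VV) (\<rho> m) (%m00 m01. tens K M VV m00 (tens K V V m01 m1)))"
  proof (rule tsum_param_lin[OF M V_module T lin_closed[OF \<rho> m] tens3_bilin[OF M] _ V_module])
   fix v w assume v: "v <: M" and w: "w <: V"
   show "lin V (tensor K M VV) (%x. tens K M VV v (tens K V V w x))"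
    by (rule lin_comp[OF bilinD(1)[OF tens_bilin[OF V_module V_module] w] bilinD(1)[OF tens_bilin[OF M VV_module] v]])
  qed
 qed
qed

lemma counL_bilin:
 assumes M: "module K M"
 shows "bilin M V M (%m0 m1. eps C m1 *[M] m0)"
proof -
 have e: "eps C c <: K" if "c <: V" for c
  using lin_closed[OF eps_lin that] by (simp add: scalars_def)
 have ea: "eps C (c +[V] d) = eps C c \<oplus> eps C d" if "c <: V" "d <: V" for c d
  using lin_add[OF eps_lin that] by (simp add: scalars_def)
 have es: "eps C (a *[V] c) = a \<otimes> eps C c" if "a <: K" "c <: V" for a c
  using lin_smult[OF eps_lin that] by (simp add: scalars_def)
 show ?thesis
 proof (rule bilinI; rule linI)
  fix m a c assume "m <: M" "a <: K" "c <: V"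
  then show "eps C (a *[V] c) *[M] m = a *[M] (eps C c *[M] m)"
   "eps C c *[M] (a *[M] m) = a *[M] (eps C c *[M] m)"
   using M e by (simp_all add: es mod_distr smult_swap[of M "eps C c"])
 qed (use M e in \<open>simp_all add: ea mod_distr\<close>)
qed

lemma coass_lin:
 assumes M: "module K M" and \<rho>: "lin M (tensor K M V) \<rho>"
 shows "lin M (tensor K M VV) (coassL M \<rho>)" "lin M (tensor K M VV) (coassR M \<rho>)" "lin M M (counL M \<rho>)"
 unfolding coassL_def coassR_def counL_def
 using lin_comp[OF \<rho> tsum_lin[OF M V_module tensor_module[OF M VV_module] coassL_bilin[OF M]]]
  lin_comp[OF \<rho> tsum_lin[OF M V_module tensor_module[OF M VV_module] coassR_bilin[OF M \<rho>]]]
  lin_comp[OF \<rho> tsum_lin[OF M V_module M counL_bilin[OF M]]] by simp_all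

text \<open>Both sides of the comodule laws are natural in colinear maps:
  \<open>\<sigma> (f m)\<close> is \<open>tmap\<close> applied to \<open>\<rho> m\<close>, and the
  linear map \<open>f\<close> moves out of the Sweedler sums, in \<open>coassR\<close> out of the
  inner and the outer one.\<close>

lemma coass_transport:
 assumes M: "module K M" and N: "module K N" and \<rho>: "lin M (tensor K M V) \<rho>" and \<sigma>: "lin N (tensor K N V) \<sigma>"
  and f: "colinear_map K C M \<rho> N \<sigma> f" and m: "m <: M"
 shows "coassL N \<sigma> (f m) = tmap N VV f (coassL M \<rho> m)" "coassR N \<sigma> (f m) = tmap N VV f (coassR M \<rho> m)"
  "counL N \<sigma> (f m) = f (counL M \<rho> m)"
proof -
 note TM = tensor_module[OF M VV_module] and TN = tensor_module[OF N VV_module]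
 have l: "lin M N f" and c: "!!m. m <: M ==> \<sigma> (f m) = tmap N V f (\<rho> m)"
  using f by (auto simp: colinear_iff)
 note fc = lin_closed[OF l]
 note tl = tmap_lin[OF M N VV_module l]
 have "coassL N \<sigma> (f m) = tsum K (tensor K N VV) (\<rho> m) (%m0 m1. tens K N VV (f m0) (delta C m1))"
  unfolding coassL_def c[OF m]
  by (rule tsum_tmap[OF M N V_module TN l coassL_bilin[OF N] lin_closed[OF \<rho> m]])
 also have "\<dots> = tsum K (tensor K N VV) (\<rho> m) (%m0 m1. tmap N VV f (tens K M VV m0 (delta C m1)))"
  by (rule tsum_cong[OF M V_module TN lin_closed[OF \<rho> m]])
   (simp_all add: tmap_tens[OF M N VV_module l] lin_closed[OF delta_lin] tens_closed[OF N VV_module] fc)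
 also have "\<dots> = tmap N VV f (coassL M \<rho> m)" unfolding coassL_def
  by (rule lin_tsum[OF M V_module TM TN coassL_bilin[OF M] tl lin_closed[OF \<rho> m], symmetric])
 finally show "coassL N \<sigma> (f m) = tmap N VV f (coassL M \<rho> m)" .
 have "coassR N \<sigma> (f m) = tsum K (tensor K N VV) (\<rho> m) (%m0 m1. tsum K (tensor K N VV) (\<sigma> (f m0))
   (%m00 m01. tens K N VV m00 (tens K V V m01 m1)))"
  unfolding coassR_def c[OF m]
  by (rule tsum_tmap[OF M N V_module TN l coassR_bilin[OF N \<sigma>] lin_closed[OF \<rho> m]])
 also have "\<dots> = tsum K (tensor K N VV) (\<rho> m) (%m0 m1. tmap N VV f
   (tsum K (tensor K M VV) (\<rho> m0) (%m00 m01. tens K M VV m00 (tens K V V m01 m1))))"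
 proof (rule tsum_cong[OF M V_module TN lin_closed[OF \<rho> m]])
  fix v w assume v: "v <: M" and w: "w <: V"
  have "tsum K (tensor K N VV) (\<sigma> (f v)) (%m00 m01. tens K N VV m00 (tens K V V m01 w)) =
    tsum K (tensor K N VV) (\<rho> v) (%m00 m01. tens K N VV (f m00) (tens K V V m01 w))"
   unfolding c[OF v] by (rule tsum_tmap[OF M N V_module TN l tens3_bilin[OF N w] lin_closed[OF \<rho> v]])
  also have "\<dots> = tsum K (tensor K N VV) (\<rho> v) (%m00 m01. tmap N VV f (tens K M VV m00 (tens K V V m01 w)))"
   by (rule tsum_cong[OF M V_module TN lin_closed[OF \<rho> v]])
    (simp_all add: tmap_tens[OF M N VV_module l] tens_closed[OF V_module V_module] tens_closed[OF N VV_module] fc w)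
  also have "\<dots> = tmap N VV f (tsum K (tensor K M VV) (\<rho> v) (%m00 m01. tens K M VV m00 (tens K V V m01 w)))"
   by (rule lin_tsum[OF M V_module TM TN tens3_bilin[OF M w] tl lin_closed[OF \<rho> v], symmetric])
  finally show *: "tsum K (tensor K N VV) (\<sigma> (f v)) (%m00 m01. tens K N VV m00 (tens K V V m01 w)) = \<dots>" .
  show "\<dots> <: tensor K N VV"
   unfolding *[symmetric] by (rule bilinD(3)[OF coassR_bilin[OF N \<sigma>] fc[OF v] w])
 qed
 also have "\<dots> = tmap N VV f (coassR M \<rho> m)" unfolding coassR_def
  by (rule lin_tsum[OF M V_module TM TN coassR_bilin[OF M \<rho>] tl lin_closed[OF \<rho> m], symmetric])
 finally show "coassR N \<sigma> (f m) = tmap N VV f (coassR M \<rho> m)" .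
 have e: "eps C c <: K" if "c <: V" for c
  using lin_closed[OF eps_lin that] by (simp add: scalars_def)
 have "counL N \<sigma> (f m) = tsum K N (\<rho> m) (%m0 m1. eps C m1 *[N] f m0)"
  unfolding counL_def c[OF m]
  by (rule tsum_tmap[OF M N V_module N l counL_bilin[OF N] lin_closed[OF \<rho> m]])
 also have "\<dots> = tsum K N (\<rho> m) (%m0 m1. f (eps C m1 *[M] m0))"
  by (rule tsum_cong[OF M V_module N lin_closed[OF \<rho> m]]) (simp_all add: lin_smult[OF l] e fc N)
 also have "\<dots> = f (counL M \<rho> m)" unfolding counL_def
  by (rule lin_tsum[OF M V_module M N counL_bilin[OF M] l lin_closed[OF \<rho> m], symmetric])
 finally show "counL N \<sigma> (f m) = f (counL M \<rho> m)" .
qed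

text \<open>By naturality the two sides of each law agree after \<open>f\<close> or after
  \<open>f\<close> tensored with an identity, and both of these maps are injective.\<close>

lemma comodule_inj:
 assumes N: "module K N" and \<sigma>: "lin N (tensor K N V) \<sigma>" and M: "is_comodule K C M \<rho>"
  and f: "colinear_map K C N \<sigma> M \<rho> f" and inj: "inj_on f (carrier N)"
 shows "is_comodule K C N \<sigma>"
proof -
 have m: "module K M" and \<rho>: "lin M (tensor K M V) \<rho>" and l: "lin N M f"
  using M f by (auto simp: is_comodule_iff colinear_iff)
 note t = coass_transport[OF N m \<sigma> \<rho> f]
 note c = coass_lin[OF N \<sigma>]
 have "coassL N \<sigma> n = coassR N \<sigma> n & counL N \<sigma> n = n" if n: "n <: N" for n
 proof
  show "coassL N \<sigma> n = coassR N \<sigma> n"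
   by (rule inj_onD[OF tmap_inj[OF N m VV_module l inj]])
    (use t[OF n] M lin_closed[OF l n] lin_closed[OF c(1) n] lin_closed[OF c(2) n] in \<open>simp_all add: is_comodule_iff\<close>)
  show "counL N \<sigma> n = n"
   by (rule inj_onD[OF inj])
    (use t[OF n] M lin_closed[OF l n] lin_closed[OF c(3) n] n in \<open>simp_all add: is_comodule_iff\<close>)
 qed
 then show ?thesis using N \<sigma> by (simp add: is_comodule_iff)
qed

text \<open>By naturality the laws hold at every value of a colinear map out of a comodule, and the
  elements at which they hold form a subspace.\<close>

lemma comodule_gen:
 assumes N: "module K N" and \<sigma>: "lin N (tensor K N V) \<sigma>"
  and S: "!!H. subspace N H ==> S \<subseteq> H ==> carrier N \<subseteq> H" "S \<subseteq> carrier N"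
  and gen: "!!n. n : S ==> EX (M :: ('k, 'm) module) \<rho> f m. is_comodule K C M \<rho> & colinear_map K C M \<rho> N \<sigma> f &
    m <: M & n = f m"
 shows "is_comodule K C N \<sigma>"
proof -
 note c = coass_lin[OF N \<sigma>]
 have "coassL N \<sigma> n = coassR N \<sigma> n & counL N \<sigma> n = n" if nS: "n : S" for n
 proof -
  obtain M :: "('k, 'm) module" and \<rho> f m where M: "is_comodule K C M \<rho>" and f: "colinear_map K C M \<rho> N \<sigma> f"
   and m: "m <: M" and n: "n = f m" using gen[OF nS] by blast
  have mm: "module K M" "lin M (tensor K M V) \<rho>" using M by (auto simp: is_comodule_iff)
  show ?thesis unfolding n using coass_transport[OF mm(1) N mm(2) \<sigma> f m] M m by (simp add: is_comodule_iff)
 qed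
 then have "S \<subseteq> {n : carrier N. coassL N \<sigma> n = coassR N \<sigma> n}" "S \<subseteq> {n : carrier N. counL N \<sigma> n = n}"
  using S(2) by auto
 then have "carrier N \<subseteq> {n : carrier N. coassL N \<sigma> n = coassR N \<sigma> n}" "carrier N \<subseteq> {n : carrier N. counL N \<sigma> n = n}"
  using S(1)[OF subspace_equalizer[OF N tensor_module[OF N VV_module] c(1,2)]]
   S(1)[OF subspace_equalizer[OF N N c(3) lin_id]] by auto
 then show ?thesis using N \<sigma> by (auto simp: is_comodule_iff)
qed

section \<open>Colinear maps\<close>

lemma colinear_comp:
 assumes "module K M" "module K N" "module K P" "lin M (tensor K M V) \<rho>"
  "colinear_map K C M \<rho> N \<sigma> f" "colinear_map K C N \<sigma> P \<tau> g"
 shows "colinear_map K C M \<rho> P \<tau> (%x. g (f x))"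
 using assms(5,6) lin_comp[of M N f P g] lin_closed[of M N f]
  tmap_comp[OF assms(1-3) V_module _ _ lin_closed[OF assms(4)], of f g]
 by (auto simp: colinear_iff)

lemma colinear_cong:
 assumes "module K M" "module K N" "lin M (tensor K M V) \<rho>" "colinear_map K C M \<rho> N \<sigma> f"
  "!!x. x <: M ==> g x = f x"
 shows "colinear_map K C M \<rho> N \<sigma> g"
proof -
 have f: "lin M N f" using assms(4) by (simp add: colinear_iff)
 have g: "lin M N g" by (rule lin_cong[OF f assms(1)]) (simp add: assms(5))
 show ?thesis using assms(4) g tmap_cong[OF assms(1,2) V_module f assms(5) lin_closed[OF assms(3)]] assms(5)
  by (simp add: colinear_iff)
qed

lemma colinear_id:
 assumes "module K M" "lin M (tensor K M V) \<rho>"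
 shows "colinear_map K C M \<rho> M \<rho> (%x. x)"
 using tmap_id[OF assms(1) V_module _ lin_closed[OF assms(2)], of "%x. x"] by (simp add: colinear_iff lin_id)

lemma colinear_zero:
 assumes "module K M" "module K N" "lin M (tensor K M V) \<rho>" "lin N (tensor K N V) \<sigma>"
 shows "colinear_map K C M \<rho> N \<sigma> (%x. 0[N])"
 using tmap_zero[OF assms(1,2) V_module _ lin_closed[OF assms(3)], of "%x. 0[N]"]
  lin_zero[OF assms(2) tensor_module[OF assms(2) V_module] assms(4)] lin_const_zero[OF assms(2)]
 by (simp add: colinear_iff)

lemma colinear_minus:
 assumes "module K M" "module K N" "lin M (tensor K M V) \<rho>" "lin N (tensor K N V) \<sigma>"
  "colinear_map K C M \<rho> N \<sigma> f" "colinear_map K C M \<rho> N \<sigma> g"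
 shows "colinear_map K C M \<rho> N \<sigma> (%x. f x -[N] g x)"
proof -
 have fg: "lin M N f" "lin M N g" using assms(5,6) by (auto simp: colinear_iff)
 show ?thesis
  using assms(5,6) lin_minus[OF assms(2) fg] tmap_diff[OF assms(1,2) V_module fg lin_closed[OF assms(3)]]
   lin_diff[OF assms(2) tensor_module[OF assms(2) V_module] assms(4)] lin_closed[OF fg(1)] lin_closed[OF fg(2)]
  by (simp add: colinear_iff)
qed

text \<open>The two ways around the square for \<open>u\<close> agree after
  \<open>tmap N V i\<close>, which is injective because \<open>i\<close> is.\<close>

lemma colinear_factor_inj:
 assumes L: "module K L" "lin L (tensor K L V) \<tau>" and M: "module K M" "lin M (tensor K M V) \<rho>"
  and N: "module K N"
  and i: "colinear_map K C M \<rho> N \<sigma> i" "inj_on i (carrier M)" and h: "colinear_map K C L \<tau> N \<sigma> h"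
  and u: "!!x. x <: L ==> u x <: M" "!!x. x <: L ==> i (u x) = h x"
 shows "colinear_map K C L \<tau> M \<rho> u"
proof -
 have il: "lin M N i" and hl: "lin L N h" using i h by (auto simp: colinear_iff)
 have ul: "lin L M u" by (rule lin_factor_inj[OF M(1) il i(2) hl L(1) u])
 have "\<rho> (u x) = tmap M V u (\<tau> x)" if x: "x <: L" for x
 proof (rule inj_onD[OF tmap_inj[OF M(1) N V_module il i(2)]])
  have "tmap N V i (\<rho> (u x)) = \<sigma> (i (u x))" using i(1) u(1)[OF x] by (simp add: colinear_iff)
  also have "\<dots> = tmap N V h (\<tau> x)" using h x u(2)[OF x] by (simp add: colinear_iff)
  also have "\<dots> = tmap N V (%x. i (u x)) (\<tau> x)"
   by (rule tmap_cong[OF L(1) N V_module lin_comp[OF ul il] _ lin_closed[OF L(2) x]]) (simp add: u(2))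
  also have "\<dots> = tmap N V i (tmap M V u (\<tau> x))"
   by (rule tmap_comp[OF L(1) M(1) N V_module ul il lin_closed[OF L(2) x], symmetric])
  finally show "tmap N V i (\<rho> (u x)) = tmap N V i (tmap M V u (\<tau> x))" .
 qed (use lin_closed[OF M(2) u(1)[OF x]] tmap_closed[OF L(1) M(1) V_module ul lin_closed[OF L(2) x]] in auto)
 then show ?thesis using ul by (simp add: colinear_iff)
qed

lemma colinear_gen:
 assumes N: "module K N" "lin N (tensor K N V) \<sigma>" and P: "module K P" "lin P (tensor K P V) \<tau>"
  and u: "lin N P u"
  and S: "!!H. subspace N H ==> S \<subseteq> H ==> carrier N \<subseteq> H" "S \<subseteq> carrier N"
  and gen: "!!n. n : S ==> EX (M :: ('k, 'm) module) \<rho> f m. module K M & lin M (tensor K M V) \<rho> &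
    colinear_map K C M \<rho> N \<sigma> f & colinear_map K C M \<rho> P \<tau> (%x. u (f x)) & m <: M & n = f m"
 shows "colinear_map K C N \<sigma> P \<tau> u"
proof -
 have "\<tau> (u n) = tmap P V u (\<sigma> n)" if nS: "n : S" for n
 proof -
  obtain M :: "('k, 'm) module" and \<rho> f m where M: "module K M" "lin M (tensor K M V) \<rho>"
   and f: "colinear_map K C M \<rho> N \<sigma> f" "colinear_map K C M \<rho> P \<tau> (%x. u (f x))"
   and m: "m <: M" and n: "n = f m" using gen[OF nS] by blast
  have fl: "lin M N f" using f by (simp add: colinear_iff)
  have "\<tau> (u n) = tmap P V (%x. u (f x)) (\<rho> m)" using f(2) m n by (simp add: colinear_iff)
  also have "\<dots> = tmap P V u (tmap N V f (\<rho> m))"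
   by (rule tmap_comp[OF M(1) N(1) P(1) V_module fl u lin_closed[OF M(2) m], symmetric])
  also have "\<dots> = tmap P V u (\<sigma> n)" using f(1) m n by (simp add: colinear_iff)
  finally show ?thesis .
 qed
 then have "S \<subseteq> {n : carrier N. \<tau> (u n) = tmap P V u (\<sigma> n)}" using S(2) by auto
 then have "carrier N \<subseteq> {n : carrier N. \<tau> (u n) = tmap P V u (\<sigma> n)}"
  using S(1)[OF subspace_equalizer[OF N(1) tensor_module[OF P(1) V_module] lin_comp[OF u P(2)]
   lin_comp[OF N(2) tmap_lin[OF N(1) P(1) V_module u]]]] by auto
 then show ?thesis using u by (auto simp: colinear_iff)
qed

end

locale entw = coalg K C for K :: "('k, 'z) ring_scheme" (structure) and C :: "('k, 'c) coalgebra" +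
 fixes R :: "('k, 'o, 'm, 'c) entwining"
 assumes entwining_R: "is_entwining K C R"
begin

abbreviation H :: "'o => 'o => ('k, 'm) module" where "H \<equiv> lhom R"

lemma lincat_R: "is_lincat K R"
 and psi_lin: "r <. R ==> s <. R ==> lin (tensor K V (H r s)) (tensor K (H r s) V) (psi R r s)"
 using entwining_R by (auto simp: is_entwining_def Let_def)

lemma H_module [simp]: "r <. R ==> s <. R ==> module K (H r s)"
 and lid_closed: "r <. R ==> lid R r <: H r r"
 and lcomp_bilin: "r <. R ==> s <. R ==> t <. R ==> bilin (H s t) (H r s) (H r t) (lcomp R r s t)"
 using lincat_R by (auto simp: is_lincat_def)

lemma lcomp_closed:
 "r <. R ==> s <. R ==> t <. R ==> g <: H s t ==> f <: H r s ==>
  lcomp R r s t g f <: H r t"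
 by (rule bilinD(3)[OF lcomp_bilin])

text \<open>The linear data of an entwined module without its laws. New structures are first shown
  to be of this kind; the laws then come through an injection into an entwined module or from
  generators.\<close>

definition preent :: "('k, 'o, 'm, 'c, 'v) entmod => bool" where
 "preent M \<longleftrightarrow> (ALL r:lobj R. module K (esp M r) & lin (esp M r) (tensor K (esp M r) V) (ecoact M r)) &
   (ALL s:lobj R. ALL r:lobj R. bilin (esp M r) (H s r) (esp M s) (eact M s r))"

text \<open>The right side of the compatibility of coaction and action, as a function of the module
  element.\<close>

definition actR :: "('k, 'o, 'm, 'c, 'v) entmod => 'o => 'o => 'm => 'v => ('k, 'v, 'c) tens" where
 "actR M s r f m = tsum K (tensor K (esp M s) V) (ecoact M r m) (%m0 m1.
   tsum K (tensor K (esp M s) V) (psit K C R s r m1 f) (%f' c'. tens K (esp M s) V (eact M s r m0 f') c'))"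

text \<open>Morphisms without extensionality, so that they can be given by formulas;
  \<open>eres\<close> turns them into arrows of the category.\<close>

definition ehom :: "('k, 'o, 'm, 'c, 'v) entmod => ('k, 'o, 'm, 'c, 'w) entmod => ('o => 'v => 'w) => bool" where
 "ehom M N \<eta> \<longleftrightarrow> (ALL r:lobj R. colinear_map K C (esp M r) (ecoact M r) (esp N r) (ecoact N r) (\<eta> r)) &
   (ALL s:lobj R. ALL r:lobj R. ALL m:carrier (esp M r). ALL f:carrier (H s r).
    \<eta> s (eact M s r m f) = eact N s r (\<eta> r m) f)"

definition eres :: "('k, 'o, 'm, 'c, 'v) entmod => ('o => 'v => 'w) => ('o => 'v => 'w)" where
 "eres M \<eta> = (\<lambda>r\<in>lobj R. \<lambda>m\<in>carrier (esp M r). \<eta> r m)"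

lemma preentD:
 assumes "preent M"
 shows "r <. R ==> module K (esp M r)" "r <. R ==> lin (esp M r) (tensor K (esp M r) V) (ecoact M r)"
  "s <. R ==> r <. R ==> bilin (esp M r) (H s r) (esp M s) (eact M s r)"
 using assms by (auto simp: preent_def)

lemma is_entmod_iff:
 "is_entmod K C R M \<longleftrightarrow> preent M & (ALL r:lobj R. is_comodule K C (esp M r) (ecoact M r)) &
   (ALL r:lobj R. ALL m:carrier (esp M r). eact M r r m (lid R r) = m) &
   (ALL t:lobj R. ALL s:lobj R. ALL r:lobj R.
    ALL m:carrier (esp M r). ALL f:carrier (H s r). ALL g:carrier (H t s).
     eact M t r m (lcomp R t s r f g) = eact M t s (eact M s r m f) g) &
   (ALL s:lobj R. ALL r:lobj R. ALL m:carrier (esp M r). ALL f:carrier (H s r).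
    ecoact M s (eact M s r m f) = actR M s r f m)"
 by (auto simp: is_entmod_def preent_def actR_def Let_def is_comodule_iff)

lemma entmodD:
 assumes "is_entmod K C R M"
 shows "preent M" "r <. R ==> is_comodule K C (esp M r) (ecoact M r)"
  "r <. R ==> m <: esp M r ==> eact M r r m (lid R r) = m"
  "t <. R ==> s <. R ==> r <. R ==> m <: esp M r ==> f <: H s r ==>
   g <: H t s ==> eact M t r m (lcomp R t s r f g) = eact M t s (eact M s r m f) g"
  "s <. R ==> r <. R ==> m <: esp M r ==> f <: H s r ==>
   ecoact M s (eact M s r m f) = actR M s r f m"
 using assms by (auto simp: is_entmod_iff)

lemmas entmod_module = preentD(1)[OF entmodD(1)]
 and entmod_coact_lin = preentD(2)[OF entmodD(1)]
 and entmod_act_bilin = preentD(3)[OF entmodD(1)]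

lemma ehomD:
 assumes "ehom M N \<eta>"
 shows "r <. R ==> colinear_map K C (esp M r) (ecoact M r) (esp N r) (ecoact N r) (\<eta> r)"
  "r <. R ==> lin (esp M r) (esp N r) (\<eta> r)"
  "r <. R ==> m <: esp M r ==> \<eta> r m <: esp N r"
  "r <. R ==> m <: esp M r ==> ecoact N r (\<eta> r m) = tmap (esp N r) V (\<eta> r) (ecoact M r m)"
  "s <. R ==> r <. R ==> m <: esp M r ==> f <: H s r ==>
   \<eta> s (eact M s r m f) = eact N s r (\<eta> r m) f"
proof -
 show l: "r <. R ==> lin (esp M r) (esp N r) (\<eta> r)" for r using assms by (simp add: ehom_def colinear_iff)
 show "r <. R ==> m <: esp M r ==> \<eta> r m <: esp N r" for r m by (rule lin_closed[OF l])
qed (use assms in \<open>simp_all add: ehom_def colinear_iff\<close>)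

lemma entmod_hom_iff:
 "\<eta> : entmod_hom K C R M N \<longleftrightarrow> ehom M N \<eta> & eres M \<eta> = \<eta>"
proof -
 have "(\<eta> : extensional (lobj R) & (ALL r:lobj R. \<eta> r : extensional (carrier (esp M r)))) \<longleftrightarrow> eres M \<eta> = \<eta>"
 proof
  assume a: "\<eta> : extensional (lobj R) & (ALL r:lobj R. \<eta> r : extensional (carrier (esp M r)))"
  show "eres M \<eta> = \<eta>"
  proof (rule ext)+
   fix r m show "eres M \<eta> r m = \<eta> r m"
    using a by (cases "r <. R"; cases "m <: esp M r") (auto simp: eres_def extensional_def)
  qed
 next
  assume a: "eres M \<eta> = \<eta>"
  have "eres M \<eta> : extensional (lobj R)" "!!r. r <. R ==> eres M \<eta> r : extensional (carrier (esp M r))"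
   by (simp_all add: eres_def)
  then show "\<eta> : extensional (lobj R) & (ALL r:lobj R. \<eta> r : extensional (carrier (esp M r)))"
   unfolding a by blast
 qed
 then show ?thesis unfolding entmod_hom_def ehom_def by blast
qed

section \<open>Morphisms of entwined modules\<close>

lemma eres_apply [simp]: "r <. R ==> m <: esp M r ==> eres M \<eta> r m = \<eta> r m"
 by (simp add: eres_def)

lemma eres_cong: "(!!r m. r <. R ==> m <: esp M r ==> \<eta> r m = \<zeta> r m) ==> eres M \<eta> = eres M \<zeta>"
 unfolding eres_def by (intro restrict_ext) simp

lemma eres_idem [simp]: "eres M (eres M \<eta>) = eres M \<eta>"
 by (rule eres_cong) simp

lemma ehom_cong:
 assumes "preent M" "preent N" "ehom M N \<eta>" "!!r m. r <. R ==> m <: esp M r ==> \<zeta> r m = \<eta> r m"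
 shows "ehom M N \<zeta>"
 unfolding ehom_def
proof (intro conjI ballI)
 fix r assume r: "r <. R"
 show "colinear_map K C (esp M r) (ecoact M r) (esp N r) (ecoact N r) (\<zeta> r)"
  by (rule colinear_cong[OF preentD(1)[OF assms(1) r] preentD(1)[OF assms(2) r] preentD(2)[OF assms(1) r] ehomD(1)[OF assms(3) r]])
   (rule assms(4)[OF r])
next
 fix s r m f assume a: "s <. R" "r <. R" "m <: esp M r" "f <: H s r"
 show "\<zeta> s (eact M s r m f) = eact N s r (\<zeta> r m) f"
  using ehomD(5)[OF assms(3) a] assms(4)[OF a(2,3)] assms(4)[OF a(1) bilinD(3)[OF preentD(3)[OF assms(1) a(1,2)] a(3,4)]]
  by simp
qed

lemma ehom_eres: "preent M ==> preent N ==> ehom M N \<eta> ==> eres M \<eta> : entmod_hom K C R M N"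
 by (auto simp: entmod_hom_iff intro: ehom_cong)

lemma ehom_comp:
 assumes "preent M" "preent N" "preent P" "ehom M N \<eta>" "ehom N P \<zeta>"
 shows "ehom M P (%r m. \<zeta> r (\<eta> r m))"
 unfolding ehom_def
proof (intro conjI ballI)
 fix r assume r: "r <. R"
 show "colinear_map K C (esp M r) (ecoact M r) (esp P r) (ecoact P r) (%m. \<zeta> r (\<eta> r m))"
  by (rule colinear_comp[OF preentD(1)[OF assms(1) r] preentD(1)[OF assms(2) r] preentD(1)[OF assms(3) r]
     preentD(2)[OF assms(1) r] ehomD(1)[OF assms(4) r] ehomD(1)[OF assms(5) r]])
next
 fix s r m f assume a: "s <. R" "r <. R" "m <: esp M r" "f <: H s r"
 show "\<zeta> s (\<eta> s (eact M s r m f)) = eact P s r (\<zeta> r (\<eta> r m)) f"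
  using ehomD(5)[OF assms(4) a] ehomD(5)[OF assms(5) a(1,2) ehomD(3)[OF assms(4) a(2,3)] a(4)] by simp
qed

lemma ehom_id: "preent M ==> ehom M M (%r m. m)"
 unfolding ehom_def by (auto intro: colinear_id preentD)

lemma ehom_zero:
 assumes M: "preent M" and N: "preent N"
 shows "ehom M N (%r m. 0[esp N r])"
 unfolding ehom_def
proof (intro conjI ballI)
 fix r assume r: "r <. R"
 show "colinear_map K C (esp M r) (ecoact M r) (esp N r) (ecoact N r) (%m. 0[esp N r])"
  by (rule colinear_zero) (use r M N in \<open>auto intro: preentD\<close>)
next
 fix s r m f assume a: "s <. R" "r <. R" "m <: esp M r" "f <: H s r"
 show "0[esp N s] = eact N s r 0[esp N r] f"
  using lin_zero[OF preentD(1)[OF N a(2)] preentD(1)[OF N a(1)] bilinD(2)[OF preentD(3)[OF N a(1,2)] a(4)]] by simp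
qed

lemma ehom_minus:
 assumes M: "preent M" and N: "preent N" and \<eta>: "ehom M N \<eta>" and \<zeta>: "ehom M N \<zeta>"
 shows "ehom M N (%r m. \<eta> r m -[esp N r] \<zeta> r m)"
 unfolding ehom_def
proof (intro conjI ballI)
 fix r assume r: "r <. R"
 show "colinear_map K C (esp M r) (ecoact M r) (esp N r) (ecoact N r) (%m. \<eta> r m -[esp N r] \<zeta> r m)"
  by (rule colinear_minus[OF preentD(1)[OF M r] preentD(1)[OF N r] preentD(2)[OF M r] preentD(2)[OF N r] ehomD(1)[OF \<eta> r] ehomD(1)[OF \<zeta> r]])
next
 fix s r m f assume a: "s <. R" "r <. R" "m <: esp M r" "f <: H s r"
 show "\<eta> s (eact M s r m f) -[esp N s] \<zeta> s (eact M s r m f) = eact N s r (\<eta> r m -[esp N r] \<zeta> r m) f"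
  using lin_diff[OF preentD(1)[OF N a(2)] preentD(1)[OF N a(1)] bilinD(2)[OF preentD(3)[OF N a(1,2)] a(4)]
   ehomD(3)[OF \<eta> a(2,3)] ehomD(3)[OF \<zeta> a(2,3)]] ehomD(5)[OF \<eta> a] ehomD(5)[OF \<zeta> a] by simp
qed

lemma ehom_factor_inj:
 assumes L: "preent L" and M: "preent M" and N: "preent N"
  and i: "ehom M N i" "!!r. r <. R ==> inj_on (i r) (carrier (esp M r))" and h: "ehom L N h"
  and u: "!!r x. r <. R ==> x <: esp L r ==> u r x <: esp M r"
   "!!r x. r <. R ==> x <: esp L r ==> i r (u r x) = h r x"
 shows "ehom L M u"
 unfolding ehom_def
proof (intro conjI ballI)
 fix r assume r: "r <. R"
 show "colinear_map K C (esp L r) (ecoact L r) (esp M r) (ecoact M r) (u r)"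
  by (rule colinear_factor_inj[OF preentD(1)[OF L r] preentD(2)[OF L r] preentD(1)[OF M r] preentD(2)[OF M r]
    preentD(1)[OF N r] ehomD(1)[OF i(1) r] i(2)[OF r] ehomD(1)[OF h r] u(1)[OF r] u(2)[OF r]])
next
 fix s r m f assume a: "s <. R" "r <. R" "m <: esp L r" "f <: H s r"
 note lc = bilinD(3)[OF preentD(3)[OF L a(1,2)] a(3,4)]
 show "u s (eact L s r m f) = eact M s r (u r m) f"
 proof (rule inj_onD[OF i(2)[OF a(1)]])
  show "u s (eact L s r m f) <: esp M s" by (rule u(1)[OF a(1) lc])
  show "eact M s r (u r m) f <: esp M s" by (rule bilinD(3)[OF preentD(3)[OF M a(1,2)] u(1)[OF a(2,3)] a(4)])
  show "i s (u s (eact L s r m f)) = i s (eact M s r (u r m) f)"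
   using u(2)[OF a(1) lc] ehomD(5)[OF h a] ehomD(5)[OF i(1) a(1,2) u(1)[OF a(2,3)] a(4)] u(2)[OF a(2,3)] by simp
 qed
qed

text \<open>Being a morphism is a collection of equalities between linear maps on \<open>N\<close>,
  and these hold at the values of any morphism \<open>f\<close> whose composite with
  \<open>u\<close> is known to be a morphism. The modules \<open>M\<close> may have a carrier type
  of their own.\<close>

lemma ehom_gen:
 assumes N: "preent N" and P: "preent P" and u: "!!r. r <. R ==> lin (esp N r) (esp P r) (u r)"
  and S: "!!r H. r <. R ==> subspace (esp N r) H ==> S r \<subseteq> H ==> carrier (esp N r) \<subseteq> H"
   "!!r. r <. R ==> S r \<subseteq> carrier (esp N r)"
  and gen: "!!r n. r <. R ==> n : S r ==> EX (M :: ('k, 'o, 'm, 'c, 'v) entmod) f m. preent M &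
    ehom M N f & ehom M P (%r x. u r (f r x)) & m <: esp M r & n = f r m"
 shows "ehom N P u"
 unfolding ehom_def
proof (intro conjI ballI)
 fix r assume r: "r <. R"
 show "colinear_map K C (esp N r) (ecoact N r) (esp P r) (ecoact P r) (u r)"
 proof (rule colinear_gen[OF preentD(1)[OF N r] preentD(2)[OF N r] preentD(1)[OF P r] preentD(2)[OF P r] u[OF r] S(1)[OF r] S(2)[OF r]])
  fix n assume "n : S r"
  then obtain M :: "('k, 'o, 'm, 'c, 'v) entmod" and f m where M: "preent M" "ehom M N f"
   "ehom M P (%r x. u r (f r x))" "m <: esp M r" "n = f r m" using gen[OF r] by blast
  show "EX (M :: ('k, 'v) module) \<rho> f m. module K M & lin M (tensor K M V) \<rho> &
    colinear_map K C M \<rho> (esp N r) (ecoact N r) f & colinear_map K C M \<rho> (esp P r) (ecoact P r) (%x. u r (f x)) &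
    m <: M & n = f m"
   using preentD(1)[OF M(1) r] preentD(2)[OF M(1) r] ehomD(1)[OF M(2) r] ehomD(1)[OF M(3) r] M(4,5) by blast
 qed
next
 fix s r x f assume a: "s <. R" "r <. R" "x <: esp N r" "f <: H s r"
 let ?H = "{n : carrier (esp N r). u s (eact N s r n f) = eact P s r (u r n) f}"
 have sub: "subspace (esp N r) ?H"
  by (rule subspace_equalizer[OF preentD(1)[OF N a(2)] preentD(1)[OF P a(1)]
   lin_comp[OF bilinD(2)[OF preentD(3)[OF N a(1,2)] a(4)] u[OF a(1)]]
   lin_comp[OF u[OF a(2)] bilinD(2)[OF preentD(3)[OF P a(1,2)] a(4)]]])
 have "S r \<subseteq> ?H"
 proof
  fix n assume n: "n : S r"
  then obtain M :: "('k, 'o, 'm, 'c, 'v) entmod" and g m where M: "preent M" "ehom M N g"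
   "ehom M P (%r x. u r (g r x))" "m <: esp M r" "n = g r m" using gen[OF a(2)] by blast
  have "u s (eact N s r n f) = eact P s r (u r n) f"
   using ehomD(5)[OF M(2) a(1,2) M(4) a(4)] ehomD(5)[OF M(3) a(1,2) M(4) a(4)] M(5) by simp
  then show "n : ?H" using n S(2)[OF a(2)] by blast
 qed
 then show "u s (eact N s r x f) = eact P s r (u r x) f" using S(1)[OF a(2) sub] a(3) by blast
qed

lemma ehom_factor_surj:
 fixes N :: "('k, 'o, 'm, 'c, 'v) entmod"
 assumes N: "preent N" and Q: "preent Q" and P: "preent P" and p: "ehom N Q p"
  "!!r. r <. R ==> p r ` carrier (esp N r) = carrier (esp Q r)" and h: "ehom N P h"
  and u: "!!r x. r <. R ==> x <: esp N r ==> u r (p r x) = h r x"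
 shows "ehom Q P u"
proof (rule ehom_gen[OF Q P, where S = "%r. carrier (esp Q r)" and ?'v = 'v])
 fix r assume r: "r <. R"
 show "lin (esp Q r) (esp P r) (u r)"
  by (rule lin_factor_surj[OF preentD(1)[OF N r] ehomD(2)[OF p(1) r] p(2)[OF r] ehomD(2)[OF h r] u[OF r]])
 fix n assume "n <: esp Q r"
 then obtain m where m: "m <: esp N r" "n = p r m" using p(2)[OF r] by blast
 have "ehom N P (%r x. u r (p r x))" by (rule ehom_cong[OF N P h u])
 then show "EX (M :: ('k, 'o, 'm, 'c, 'v) entmod) f m. preent M & ehom M Q f & ehom M P (%r x. u r (f r x)) &
    m <: esp M r & n = f r m" using N p(1) m by blast
qed simp_all

lemma psit_closed:
 "s <. R ==> r <. R ==> c <: V ==> f <: H s r ==> psit K C R s r c f <: tensor K (H s r) V"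
 by (rule lin_closed[OF psi_lin tens_closed[OF V_module H_module]])

lemma act_tens_bilin:
 assumes M: "preent M" and s: "s <. R" and r: "r <. R" and m: "m <: esp M r"
 shows "bilin (H s r) V (tensor K (esp M s) V) (%f' c'. tens K (esp M s) V (eact M s r m f') c')"
 by (rule bilin_precomp[OF tens_bilin[OF preentD(1)[OF M s] V_module] bilinD(1)[OF preentD(3)[OF M s r] m]])

lemma actR_bilin:
 assumes M: "preent M" and s: "s <. R" and r: "r <. R" and f: "f <: H s r"
 shows "bilin (esp M r) V (tensor K (esp M s) V) (%m0 m1.
   tsum K (tensor K (esp M s) V) (psit K C R s r m1 f) (%f' c'. tens K (esp M s) V (eact M s r m0 f') c'))"
proof -
 note T = tensor_module[OF preentD(1)[OF M s] V_module] and HM = H_module[OF s r]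
 show ?thesis
 proof (rule bilinI)
  fix m assume m: "m <: esp M r"
  show "lin V (tensor K (esp M s) V) (%m1. tsum K (tensor K (esp M s) V) (psit K C R s r m1 f)
    (%f' c'. tens K (esp M s) V (eact M s r m f') c'))"
   by (rule lin_comp[OF lin_comp[OF bilinD(2)[OF tens_bilin[OF V_module HM] f] psi_lin[OF s r]]
      tsum_lin[OF HM V_module T act_tens_bilin[OF M s r m]]])
 next
  fix c assume c: "c <: V"
  show "lin (esp M r) (tensor K (esp M s) V) (%m0. tsum K (tensor K (esp M s) V) (psit K C R s r c f)
    (%f' c'. tens K (esp M s) V (eact M s r m0 f') c'))"
  proof (rule tsum_param_lin[OF HM V_module T psit_closed[OF s r c f] act_tens_bilin[OF M s r] _ preentD(1)[OF M r]])
   fix v w assume v: "v <: H s r" and w: "w <: V"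
   show "lin (esp M r) (tensor K (esp M s) V) (%x. tens K (esp M s) V (eact M s r x v) w)"
    by (rule lin_comp[OF bilinD(2)[OF preentD(3)[OF M s r] v] bilinD(2)[OF tens_bilin[OF preentD(1)[OF M s] V_module] w]])
  qed
 qed
qed

lemma actR_lin:
 assumes M: "preent M" and s: "s <. R" and r: "r <. R" and f: "f <: H s r"
 shows "lin (esp M r) (tensor K (esp M s) V) (actR M s r f)"
 unfolding actR_def
 by (rule lin_comp[OF preentD(2)[OF M r] tsum_lin[OF preentD(1)[OF M r] V_module
    tensor_module[OF preentD(1)[OF M s] V_module] actR_bilin[OF assms]]])

text \<open>Naturality of the right side of the compatibility law, shown like that of
  coassociativity: the morphism moves out of the inner and then out of the outer Sweedler
  sum.\<close>

lemma actR_transport: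
 assumes M: "preent M" and N: "preent N" and h: "ehom M N \<eta>" and s: "s <. R" and r: "r <. R"
  and f: "f <: H s r" and m: "m <: esp M r"
 shows "actR N s r f (\<eta> r m) = tmap (esp N s) V (\<eta> s) (actR M s r f m)"
proof -
 note Mr = preentD(1)[OF M r] and Ms = preentD(1)[OF M s] and Nr = preentD(1)[OF N r] and Ns = preentD(1)[OF N s]
 note T = tensor_module[OF Ns V_module] and HM = H_module[OF s r] and TM = tensor_module[OF Ms V_module]
 note \<rho> = lin_closed[OF preentD(2)[OF M r] m]
 note tl = tmap_lin[OF Ms Ns V_module ehomD(2)[OF h s]]
 have "actR N s r f (\<eta> r m) = tsum K (tensor K (esp N s) V) (ecoact M r m) (%m0 m1.
   tsum K (tensor K (esp N s) V) (psit K C R s r m1 f) (%f' c'. tens K (esp N s) V (eact N s r (\<eta> r m0) f') c'))"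
  unfolding actR_def ehomD(4)[OF h r m]
  by (rule tsum_tmap[OF Mr Nr V_module T ehomD(2)[OF h r] actR_bilin[OF N s r f] \<rho>])
 also have "\<dots> = tsum K (tensor K (esp N s) V) (ecoact M r m) (%m0 m1. tmap (esp N s) V (\<eta> s)
   (tsum K (tensor K (esp M s) V) (psit K C R s r m1 f) (%f' c'. tens K (esp M s) V (eact M s r m0 f') c')))"
 proof (rule tsum_cong[OF Mr V_module T \<rho>])
  fix v w assume v: "v <: esp M r" and w: "w <: V"
  note p = psit_closed[OF s r w f]
  have "tsum K (tensor K (esp N s) V) (psit K C R s r w f) (%f' c'. tens K (esp N s) V (eact N s r (\<eta> r v) f') c')
   = tsum K (tensor K (esp N s) V) (psit K C R s r w f) (%f' c'. tmap (esp N s) V (\<eta> s) (tens K (esp M s) V (eact M s r v f') c'))"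
  proof (rule tsum_cong[OF HM V_module T p])
   fix g c assume g: "g <: H s r" and c: "c <: V"
   note ac = bilinD(3)[OF preentD(3)[OF M s r] v g]
   show "tens K (esp N s) V (eact N s r (\<eta> r v) g) c = tmap (esp N s) V (\<eta> s) (tens K (esp M s) V (eact M s r v g) c)"
    using tmap_tens[OF Ms Ns V_module ehomD(2)[OF h s] ac c] ehomD(5)[OF h s r v g] by simp
   show "tmap (esp N s) V (\<eta> s) (tens K (esp M s) V (eact M s r v g) c) <: tensor K (esp N s) V"
    by (rule lin_closed[OF tl tens_closed[OF Ms V_module ac c]])
  qed
  also have "\<dots> = tmap (esp N s) V (\<eta> s) (tsum K (tensor K (esp M s) V) (psit K C R s r w f)
    (%f' c'. tens K (esp M s) V (eact M s r v f') c'))"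
   by (rule lin_tsum[OF HM V_module TM T act_tens_bilin[OF M s r v] tl p, symmetric])
  finally show *: "tsum K (tensor K (esp N s) V) (psit K C R s r w f) (%f' c'. tens K (esp N s) V (eact N s r (\<eta> r v) f') c') = \<dots>" .
  show "\<dots> <: tensor K (esp N s) V" unfolding *[symmetric]
   by (rule bilinD(3)[OF actR_bilin[OF N s r f] ehomD(3)[OF h r v] w])
 qed
 also have "\<dots> = tmap (esp N s) V (\<eta> s) (actR M s r f m)" unfolding actR_def
  by (rule lin_tsum[OF Mr V_module TM T actR_bilin[OF M s r f] tl \<rho>, symmetric])
 finally show ?thesis .
qed

text \<open>Each law holds after the injective maps \<open>i\<close>; the compatibility law lives in
  a tensor product and holds after the injective \<open>tmap\<close> of \<open>i\<close>.\<close>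

lemma entmod_inj:
 assumes N: "preent N" and M: "is_entmod K C R M" and i: "ehom N M i"
  and inj: "!!r. r <. R ==> inj_on (i r) (carrier (esp N r))"
 shows "is_entmod K C R N"
 unfolding is_entmod_iff
proof (intro conjI ballI)
 note MD = entmodD[OF M] and ND = preentD[OF N]
 note act = bilinD(3)[OF ND(3)]
 fix r assume r: "r <. R"
 show "is_comodule K C (esp N r) (ecoact N r)"
  by (rule comodule_inj[OF ND(1)[OF r] ND(2)[OF r] MD(2)[OF r] ehomD(1)[OF i r] inj[OF r]])
 fix m assume m: "m <: esp N r"
 show "eact N r r m (lid R r) = m"
  by (rule inj_onD[OF inj[OF r] _ act[OF r r m lid_closed[OF r]] m])
   (simp add: ehomD(5)[OF i r r m lid_closed[OF r]] MD(3)[OF r ehomD(3)[OF i r m]])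
next
 note MD = entmodD[OF M] and ND = preentD[OF N]
 note act = bilinD(3)[OF ND(3)]
 fix t s r m f g assume a: "t <. R" "s <. R" "r <. R" "m <: esp N r"
  "f <: H s r" "g <: H t s"
 note c = lcomp_closed[OF a(1,2,3,5,6)]
 show "eact N t r m (lcomp R t s r f g) = eact N t s (eact N s r m f) g"
  by (rule inj_onD[OF inj[OF a(1)] _ act[OF a(1,3,4) c] act[OF a(1,2) act[OF a(2-5)] a(6)]])
   (simp add: ehomD(5)[OF i a(1,3,4) c] MD(4)[OF a(1-3) ehomD(3)[OF i a(3,4)] a(5,6)]
    ehomD(5)[OF i a(1,2) act[OF a(2-5)] a(6)] ehomD(5)[OF i a(2-5)])
next
 note MD = entmodD[OF M] and ND = preentD[OF N]
 note act = bilinD(3)[OF ND(3)]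
 fix s r m f assume a: "s <. R" "r <. R" "m <: esp N r" "f <: H s r"
 note Ns = ND(1)[OF a(1)] and Ms = preentD(1)[OF MD(1) a(1)]
 show "ecoact N s (eact N s r m f) = actR N s r f m"
 proof (rule inj_onD[OF tmap_inj[OF Ns Ms V_module ehomD(2)[OF i a(1)] inj[OF a(1)]]])
  show "tmap (esp M s) V (i s) (ecoact N s (eact N s r m f)) = tmap (esp M s) V (i s) (actR N s r f m)"
   using ehomD(4)[OF i a(1) act[OF a]] ehomD(5)[OF i a] MD(5)[OF a(1,2) ehomD(3)[OF i a(2,3)] a(4)]
    actR_transport[OF N MD(1) i a(1,2,4,3)] by simp
  show "ecoact N s (eact N s r m f) <: tensor K (esp N s) V" by (rule lin_closed[OF ND(2)[OF a(1)] act[OF a]])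
  show "actR N s r f m <: tensor K (esp N s) V" by (rule lin_closed[OF actR_lin[OF N a(1,2,4)] a(3)])
 qed
qed (rule N)

text \<open>Each law is an equality of maps that are linear in the module element, and it holds at
  the values of morphisms from entwined modules. Quotients and direct sums inherit their laws in
  this way.\<close>

lemma entmod_gen:
 assumes N: "preent N"
  and S: "!!r H. r <. R ==> subspace (esp N r) H ==> S r \<subseteq> H ==> carrier (esp N r) \<subseteq> H"
   "!!r. r <. R ==> S r \<subseteq> carrier (esp N r)"
  and gen: "!!r n. r <. R ==> n : S r ==> EX (M :: ('k, 'o, 'm, 'c, 'v) entmod) f m. is_entmod K C R M &
    ehom M N f & m <: esp M r & n = f r m"
 shows "is_entmod K C R N"
 unfolding is_entmod_iff
proof (intro conjI ballI)
 note ND = preentD[OF N]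
 fix r assume r: "r <. R"
 show "is_comodule K C (esp N r) (ecoact N r)"
 proof (rule comodule_gen[OF ND(1)[OF r] ND(2)[OF r] S(1)[OF r] S(2)[OF r]])
  fix n assume "n : S r"
  then obtain M :: "('k, 'o, 'm, 'c, 'v) entmod" and f m where M: "is_entmod K C R M" "ehom M N f"
   "m <: esp M r" "n = f r m" using gen[OF r] by blast
  show "EX (M :: ('k, 'v) module) \<rho> f m. is_comodule K C M \<rho> &
    colinear_map K C M \<rho> (esp N r) (ecoact N r) f & m <: M & n = f m"
   using entmodD(2)[OF M(1) r] ehomD(1)[OF M(2) r] M(3,4) by blast
 qed
 fix x assume x: "x <: esp N r"
 let ?H = "{n : carrier (esp N r). eact N r r n (lid R r) = n}"
 have sub: "subspace (esp N r) ?H"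
  by (rule subspace_equalizer[OF ND(1)[OF r] ND(1)[OF r] bilinD(2)[OF ND(3)[OF r r] lid_closed[OF r]] lin_id])
 have "S r \<subseteq> ?H"
 proof
  fix n assume n: "n : S r"
  then obtain M :: "('k, 'o, 'm, 'c, 'v) entmod" and f m where M: "is_entmod K C R M" "ehom M N f"
   "m <: esp M r" "n = f r m" using gen[OF r] by blast
  then show "n : ?H" using ehomD(5)[OF M(2) r r M(3) lid_closed[OF r]] entmodD(3)[OF M(1) r M(3)] n S(2)[OF r] by auto
 qed
 then show "eact N r r x (lid R r) = x" using S(1)[OF r sub] x by blast
next
 note ND = preentD[OF N]
 fix t s r x f g assume a: "t <. R" "s <. R" "r <. R" "x <: esp N r"
  "f <: H s r" "g <: H t s"
 note c = lcomp_closed[OF a(1,2,3,5,6)]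
 let ?H = "{n : carrier (esp N r). eact N t r n (lcomp R t s r f g) = eact N t s (eact N s r n f) g}"
 have sub: "subspace (esp N r) ?H"
  by (rule subspace_equalizer[OF ND(1)[OF a(3)] ND(1)[OF a(1)] bilinD(2)[OF ND(3)[OF a(1,3)] c]
    lin_comp[OF bilinD(2)[OF ND(3)[OF a(2,3)] a(5)] bilinD(2)[OF ND(3)[OF a(1,2)] a(6)]]])
 have "S r \<subseteq> ?H"
 proof
  fix n assume n: "n : S r"
  then obtain M :: "('k, 'o, 'm, 'c, 'v) entmod" and h m where M: "is_entmod K C R M" "ehom M N h"
   "m <: esp M r" "n = h r m" using gen[OF a(3)] by blast
  note ac = bilinD(3)[OF entmod_act_bilin[OF M(1) a(2,3)] M(3) a(5)]
  show "n : ?H" using ehomD(5)[OF M(2) a(1,3) M(3) c] entmodD(4)[OF M(1) a(1-3) M(3) a(5,6)]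
   ehomD(5)[OF M(2) a(1,2) ac a(6)] ehomD(5)[OF M(2) a(2,3) M(3) a(5)] M(4) n S(2)[OF a(3)] by auto
 qed
 then show "eact N t r x (lcomp R t s r f g) = eact N t s (eact N s r x f) g" using S(1)[OF a(3) sub] a(4) by blast
next
 note ND = preentD[OF N]
 fix s r x f assume a: "s <. R" "r <. R" "x <: esp N r" "f <: H s r"
 let ?H = "{n : carrier (esp N r). ecoact N s (eact N s r n f) = actR N s r f n}"
 have sub: "subspace (esp N r) ?H"
  by (rule subspace_equalizer[OF ND(1)[OF a(2)] tensor_module[OF ND(1)[OF a(1)] V_module]
   lin_comp[OF bilinD(2)[OF ND(3)[OF a(1,2)] a(4)] ND(2)[OF a(1)]] actR_lin[OF N a(1,2,4)]])
 have "S r \<subseteq> ?H"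
 proof
  fix n assume n: "n : S r"
  then obtain M :: "('k, 'o, 'm, 'c, 'v) entmod" and h m where M: "is_entmod K C R M" "ehom M N h"
   "m <: esp M r" "n = h r m" using gen[OF a(2)] by blast
  note ac = bilinD(3)[OF entmod_act_bilin[OF M(1) a(1,2)] M(3) a(4)]
  show "n : ?H" using ehomD(5)[OF M(2) a(1,2) M(3) a(4)] entmodD(5)[OF M(1) a(1,2) M(3) a(4)]
   ehomD(4)[OF M(2) a(1) ac] actR_transport[OF entmodD(1)[OF M(1)] N M(2) a(1,2,4) M(3)] M(4) n S(2)[OF a(2)] by auto
 qed
 then show "ecoact N s (eact N s r x f) = actR N s r f x" using S(1)[OF a(2) sub] a(3) by blast
qed (rule N)

end

section \<open>Subobjects, quotients and direct sums of entwined modules\<close>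

context ground
begin

lemma sub_lin: "subspace W N ==> lin (W\<lparr>carrier := N\<rparr>) W (%x. x)"
 by (rule linI) (simp_all add: subspaceD)

lemma lin_into_sub: "lin Z W f ==> (!!x. x <: Z ==> f x : N) ==> lin Z (W\<lparr>carrier := N\<rparr>) f"
 by (rule linI) (simp_all add: lin_add lin_smult)

lemma lin_from_sub: "lin W Z f ==> subspace W N ==> lin (W\<lparr>carrier := N\<rparr>) Z f"
 by (rule linI) (simp_all add: lin_add lin_smult lin_closed subspaceD)

lemma bilin_zero:
 assumes "module K V" "module K W" "module K Z" "bilin V W Z \<beta>" "y <: W"
 shows "\<beta> 0[V] y = 0[Z]"
 using lin_zero[OF assms(1,3) bilinD(2)[OF assms(4,5)]] .

end

context entw
begin

text \<open>\<open>N r\<close> receives the coaction of \<open>M\<close> followed by a linear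
  retraction \<open>g r\<close> tensored with the identity. By \<open>coact\<close> the old coaction
  takes values in the image of the smaller tensor product, where the retraction inverts the
  inclusion, so the inclusion is colinear.\<close>

lemma entmod_sub:
 fixes M :: "('k, 'o, 'm, 'c, 'v) entmod"
 assumes M: "is_entmod K C R M" and N: "!!r. r <. R ==> subspace (esp M r) (N r)"
  and act: "!!s r m f. s <. R ==> r <. R ==> m : N r ==> f <: H s r ==> eact M s r m f : N s"
  and coact: "!!r m. r <. R ==> m : N r ==>
   ecoact M r m : tmap (esp M r) V (%x. x) ` carrier (tensor K ((esp M r)\<lparr>carrier := N r\<rparr>) V)"
 obtains L :: "('k, 'o, 'm, 'c, 'v) entmod" where "is_entmod K C R L" "!!r. carrier (esp L r) = N r" "ehom L M (%r x. x)"
  "!!r. zero (esp L r) = zero (esp M r)"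
proof -
 note MD = preentD[OF entmodD(1)[OF M]]
 let ?S = "%r. (esp M r)\<lparr>carrier := N r\<rparr>"
 have S: "module K (?S r)" "lin (?S r) (esp M r) (%x. x)" if "r <. R" for r
  using submodule_module[OF MD(1) N] sub_lin[OF N] that by auto
 have "ALL r:lobj R. EX g. lin (esp M r) (?S r) g & (ALL x:N r. g x = x)"
 proof
  fix r assume r: "r <. R"
  obtain g where "lin (esp M r) (?S r) g" "!!v. v <: ?S r ==> g v = v"
   using left_inverse[OF S(1)[OF r] MD(1)[OF r] S(2)[OF r] inj_on_id2] by blast
  then show "EX g. lin (esp M r) (?S r) g & (ALL x:N r. g x = x)" by auto
 qed
 then obtain g where g: "!!r. r <. R ==> lin (esp M r) (?S r) (g r)" "!!r x. r <. R ==> x : N r ==> g r x = x"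
  by (auto simp: bchoice_iff)
 define L :: "('k, 'o, 'm, 'c, 'v) entmod" where
  "L = \<lparr>esp = ?S, eact = eact M, ecoact = (%r m. tmap (?S r) V (g r) (ecoact M r m))\<rparr>"
 have sel: "esp L = ?S" "eact L = eact M" "ecoact L r m = tmap (?S r) V (g r) (ecoact M r m)" for r m
  by (simp_all add: L_def)
 have pre: "preent L" unfolding preent_def sel(1,2)
 proof (intro conjI ballI)
  fix r assume r: "r <. R"
  show "module K (?S r)" by (rule S(1)[OF r])
  show "lin (?S r) (tensor K (?S r) V) (ecoact L r)"
   using lin_comp[OF lin_comp[OF S(2)[OF r] MD(2)[OF r]] tmap_lin[OF MD(1)[OF r] S(1)[OF r] V_module g(1)[OF r]]]
   by (simp add: sel(3)[abs_def])
 next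
  fix s r assume s: "s <. R" and r: "r <. R"
  show "bilin (?S r) (H s r) (?S s) (eact M s r)"
  proof (rule bilinI)
   fix x assume "x <: ?S r"
   then have x: "x : N r" by simp
   show "lin (H s r) (?S s) (eact M s r x)"
    by (rule lin_into_sub[OF bilinD(1)[OF MD(3)[OF s r] subspaceD(1)[OF N[OF r] x]] act[OF s r x]])
  next
   fix f assume f: "f <: H s r"
   show "lin (?S r) (?S s) (%x. eact M s r x f)"
    by (rule lin_into_sub[OF lin_from_sub[OF bilinD(2)[OF MD(3)[OF s r] f] N[OF r]]]) (simp add: act[OF s r _ f])
  qed
 qed
 have hom: "ehom L M (%r x. x)" unfolding ehom_def colinear_iff sel(1,2)
 proof (intro conjI ballI)
  fix r assume r: "r <. R"
  show "lin (?S r) (esp M r) (%x. x)" by (rule S(2)[OF r])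
  fix m assume "m <: ?S r"
  then have "m : N r" by simp
  then obtain t where t: "t <: tensor K (?S r) V" "ecoact M r m = tmap (esp M r) V (%x. x) t"
   using coact[OF r] by blast
  have "tmap (?S r) V (g r) (tmap (esp M r) V (%x. x) t) = tmap (?S r) V (%x. g r x) t"
   by (rule tmap_comp[OF S(1)[OF r] MD(1)[OF r] S(1)[OF r] V_module S(2)[OF r] g(1)[OF r] t(1)])
  also have "\<dots> = t" by (rule tmap_id[OF S(1)[OF r] V_module _ t(1)]) (simp add: g(2)[OF r])
  finally show "ecoact M r m = tmap (esp M r) V (%x. x) (ecoact L r m)" by (simp add: sel(3) t(2))
 qed simp
 have "is_entmod K C R L" by (rule entmod_inj[OF pre M hom]) simp
 then show ?thesis using that[OF _ _ hom] by (simp add: sel(1))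
qed

text \<open>With a generalised inverse \<open>g\<close> of \<open>\<eta> r\<close> the map
  \<open>x - g (\<eta> r x)\<close> sends \<open>esp M r\<close> into the kernel. Tensored with the
  identity it fixes the coaction of an element \<open>m\<close> of the kernel, since the correction
  term factors through the coaction of \<open>\<eta> r m\<close>, which is zero. So the coaction
  stays in the kernel.\<close>

lemma entmod_kernel:
 fixes M :: "('k, 'o, 'm, 'c, 'v) entmod"
 assumes M: "is_entmod K C R M" and N: "is_entmod K C R N" and \<eta>: "ehom M N \<eta>"
 obtains L :: "('k, 'o, 'm, 'c, 'v) entmod" where "is_entmod K C R L"
  "!!r. carrier (esp L r) = {m : carrier (esp M r). \<eta> r m = 0[esp N r]}" "ehom L M (%r x. x)"
proof -
 note MD = preentD[OF entmodD(1)[OF M]] and ND = preentD[OF entmodD(1)[OF N]]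
 let ?N = "%r. {m : carrier (esp M r). \<eta> r m = 0[esp N r]}"
 let ?S = "%r. (esp M r)\<lparr>carrier := ?N r\<rparr>"
 have sub: "subspace (esp M r) (?N r)" if r: "r <. R" for r
  by (rule subspace_kernel[OF MD(1)[OF r] ND(1)[OF r] ehomD(2)[OF \<eta> r]])
 have 1: "eact M s r m f : ?N s" if a: "s <. R" "r <. R" "m : ?N r" "f <: H s r" for s r m f
 proof -
  have m: "m <: esp M r" "\<eta> r m = 0[esp N r]" using a(3) by auto
  show ?thesis
   using ehomD(5)[OF \<eta> a(1,2) m(1) a(4)] m(2) bilinD(3)[OF MD(3)[OF a(1,2)] m(1) a(4)]
    bilin_zero[OF ND(1)[OF a(2)] H_module[OF a(1,2)] ND(1)[OF a(1)] ND(3)[OF a(1,2)] a(4)] by simp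
 qed
 have 2: "ecoact M r m : tmap (esp M r) V (%x. x) ` carrier (tensor K (?S r) V)"
  if r: "r <. R" and m: "m : ?N r" for r m
 proof -
  note Mr = MD(1)[OF r] and Nr = ND(1)[OF r] and l = ehomD(2)[OF \<eta> r]
  have Sr: "module K (?S r)" by (rule submodule_module[OF Mr sub[OF r]])
  obtain g where g: "lin (esp N r) (esp M r) g" "!!v. v <: esp M r ==> \<eta> r (g (\<eta> r v)) = \<eta> r v"
   using generalized_inverse[OF Mr Nr l] by blast
  let ?e = "%x. x -[esp M r] g (\<eta> r x)"
  have gl: "lin (esp M r) (esp M r) (%x. g (\<eta> r x))" by (rule lin_comp[OF l g(1)])
  have el: "lin (esp M r) (esp M r) ?e" by (rule lin_minus[OF Mr lin_id gl])
  have es: "lin (esp M r) (?S r) ?e"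
  proof (rule lin_into_sub[OF el])
   fix x assume x: "x <: esp M r"
   then show "?e x : ?N r"
    using lin_diff[OF Mr Nr l x lin_closed[OF gl x]] g(2)[OF x] Nr lin_closed[OF l x] lin_closed[OF el x] by simp
  qed
  have mc: "m <: esp M r" "\<eta> r m = 0[esp N r]" using m by auto
  note \<rho> = lin_closed[OF MD(2)[OF r] mc(1)]
  note T = tensor_module[OF Mr V_module] and TN = tensor_module[OF Nr V_module]
  have "tmap (esp M r) V (%x. x) (tmap (?S r) V ?e (ecoact M r m)) = tmap (esp M r) V ?e (ecoact M r m)"
   by (rule tmap_comp[OF Mr Sr Mr V_module es sub_lin[OF sub[OF r]] \<rho>])
  also have "\<dots> = tmap (esp M r) V (%x. x) (ecoact M r m) -[tensor K (esp M r) V] tmap (esp M r) V (%x. g (\<eta> r x)) (ecoact M r m)"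
   by (rule tmap_diff[OF Mr Mr V_module lin_id gl \<rho>])
  also have "tmap (esp M r) V (%x. x) (ecoact M r m) = ecoact M r m" by (rule tmap_id[OF Mr V_module _ \<rho>]) simp
  also have "tmap (esp M r) V (%x. g (\<eta> r x)) (ecoact M r m) = tmap (esp M r) V g (tmap (esp N r) V (\<eta> r) (ecoact M r m))"
   by (rule tmap_comp[OF Mr Nr Mr V_module l g(1) \<rho>, symmetric])
  also have "tmap (esp N r) V (\<eta> r) (ecoact M r m) = 0[tensor K (esp N r) V]"
   using ehomD(4)[OF \<eta> r mc(1)] mc(2) lin_zero[OF Nr TN ND(2)[OF r]] by simp
  also have "tmap (esp M r) V g 0[tensor K (esp N r) V] = 0[tensor K (esp M r) V]"
   by (rule lin_zero[OF TN T tmap_lin[OF Nr Mr V_module g(1)]])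
  finally have "ecoact M r m = tmap (esp M r) V (%x. x) (tmap (?S r) V ?e (ecoact M r m))"
   using T \<rho> by simp
  then show ?thesis using tmap_closed[OF Mr Sr V_module es \<rho>] by (rule image_eqI)
 qed
 obtain L :: "('k, 'o, 'm, 'c, 'v) entmod" where L: "is_entmod K C R L" "!!r. carrier (esp L r) = ?N r" "ehom L M (%r x. x)"
  by (rule entmod_sub[where N = ?N, OF M sub 1 2]; (assumption | (rule that; assumption)))
 show ?thesis by (rule that[OF L])
qed

text \<open>To keep the carrier type, the quotient by the kernel of an idempotent \<open>e\<close>
  is realised on the image of \<open>e\<close>, with \<open>e\<close> applied after every operation.
  The hypotheses \<open>act\<close> and \<open>coact\<close> say that the kernel is stable.\<close>

lemma entmod_quotient:
 fixes M :: "('k, 'o, 'm, 'c, 'v) entmod"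
 assumes M: "is_entmod K C R M" and e: "!!r. r <. R ==> lin (esp M r) (esp M r) (e r)"
  "!!r m. r <. R ==> m <: esp M r ==> e r (e r m) = e r m"
  and act: "!!s r m f. s <. R ==> r <. R ==> m <: esp M r ==> e r m = 0[esp M r] ==>
   f <: H s r ==> e s (eact M s r m f) = 0[esp M s]"
  and coact: "!!r m. r <. R ==> m <: esp M r ==> e r m = 0[esp M r] ==>
   tmap (esp M r) V (e r) (ecoact M r m) = 0[tensor K (esp M r) V]"
 obtains Q :: "('k, 'o, 'm, 'c, 'v) entmod" where "is_entmod K C R Q" "!!r. carrier (esp Q r) = e r ` carrier (esp M r)"
  "ehom M Q e" "!!r. zero (esp Q r) = zero (esp M r)"
proof -
 note MD = preentD[OF entmodD(1)[OF M]]
 let ?S = "%r. (esp M r)\<lparr>carrier := e r ` carrier (esp M r)\<rparr>"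
 have sub: "subspace (esp M r) (e r ` carrier (esp M r))" if r: "r <. R" for r
  by (rule subspace_image[OF MD(1)[OF r] MD(1)[OF r] e(1)[OF r]])
 have S: "module K (?S r)" "lin (?S r) (esp M r) (%x. x)" "lin (esp M r) (?S r) (e r)" if "r <. R" for r
  using submodule_module[OF MD(1) sub] sub_lin[OF sub] lin_into_sub[OF e(1)] that by auto
 define Q :: "('k, 'o, 'm, 'c, 'v) entmod" where
  "Q = \<lparr>esp = ?S, eact = (%s r m f. e s (eact M s r m f)), ecoact = (%r m. tmap (?S r) V (e r) (ecoact M r m))\<rparr>"
 have sel: "esp Q = ?S" "eact Q s r m f = e s (eact M s r m f)" "ecoact Q r m = tmap (?S r) V (e r) (ecoact M r m)" for s r m f
  by (simp_all add: Q_def)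
 have pre: "preent Q" unfolding preent_def sel(1)
 proof (intro conjI ballI)
  fix r assume r: "r <. R"
  show "module K (?S r)" by (rule S(1)[OF r])
  show "lin (?S r) (tensor K (?S r) V) (ecoact Q r)"
   using lin_comp[OF lin_comp[OF S(2)[OF r] MD(2)[OF r]] tmap_lin[OF MD(1)[OF r] S(1)[OF r] V_module S(3)[OF r]]]
   by (simp add: sel(3)[abs_def])
 next
  fix s r assume s: "s <. R" and r: "r <. R"
  have "bilin (esp M r) (H s r) (?S s) (%m f. e s (eact M s r m f))"
   by (rule bilin_lin[OF MD(3)[OF s r] S(3)[OF s]])
  from bilin_precomp[OF this S(2)[OF r]]
  show "bilin (?S r) (H s r) (?S s) (eact Q s r)" by (simp add: sel(2)[abs_def])
 qed
 \<comment> \<open>Every \<open>x\<close> differs from \<open>e r x\<close> by an element of the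
   kernel, and it is to this difference that \<open>act\<close> and \<open>coact\<close> are
   applied.\<close>
 have diff: "x -[esp M r] e r x <: esp M r" "e r (x -[esp M r] e r x) = 0[esp M r]"
  if "r <. R" "x <: esp M r" for r x
  using that MD(1)[OF that(1)] lin_closed[OF e(1) that(2)] e(2)[OF that]
   lin_diff[OF MD(1)[OF that(1)] MD(1)[OF that(1)] e(1)[OF that(1)] that(2)] by simp_all
 have hom: "ehom M Q e" unfolding ehom_def colinear_iff sel(1,2)
 proof (intro conjI ballI)
  fix r assume r: "r <. R"
  note T = tensor_module[OF MD(1)[OF r] V_module] and TS = tensor_module[OF S(1)[OF r] V_module]
  note tl = tmap_lin[OF MD(1)[OF r] S(1)[OF r] V_module S(3)[OF r]]
  show "lin (esp M r) (?S r) (e r)" by (rule S(3)[OF r])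
  fix m assume m: "m <: esp M r"
  note em = lin_closed[OF e(1)[OF r] m]
  note \<rho> = lin_closed[OF MD(2)[OF r] m] lin_closed[OF MD(2)[OF r] em] lin_closed[OF MD(2)[OF r] diff(1)[OF r m]]
  \<comment> \<open>\<open>coact\<close> is a statement in the tensor product with the whole of
    \<open>esp M r\<close>; it descends to the image of \<open>e r\<close> because the inclusion
    stays injective after tensoring.\<close>
  have "tmap (?S r) V (e r) (ecoact M r (m -[esp M r] e r m)) = 0[tensor K (?S r) V]"
  proof (rule inj_onD[OF tmap_inj[OF S(1)[OF r] MD(1)[OF r] V_module S(2)[OF r] inj_on_id2]])
   have "tmap (esp M r) V (%x. x) (tmap (?S r) V (e r) (ecoact M r (m -[esp M r] e r m)))
     = tmap (esp M r) V (e r) (ecoact M r (m -[esp M r] e r m))"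
    by (rule tmap_comp[OF MD(1)[OF r] S(1)[OF r] MD(1)[OF r] V_module S(3)[OF r] S(2)[OF r] \<rho>(3)])
   also have "\<dots> = 0[tensor K (esp M r) V]" by (rule coact[OF r diff[OF r m]])
   also have "\<dots> = tmap (esp M r) V (%x. x) 0[tensor K (?S r) V]"
    by (rule lin_zero[OF TS T tmap_lin[OF S(1)[OF r] MD(1)[OF r] V_module S(2)[OF r]], symmetric])
   finally show "tmap (esp M r) V (%x. x) (tmap (?S r) V (e r) (ecoact M r (m -[esp M r] e r m)))
     = tmap (esp M r) V (%x. x) 0[tensor K (?S r) V]" .
  qed (use lin_closed[OF tl \<rho>(3)] TS in simp_all)
  then have "tmap (?S r) V (e r) (ecoact M r m) -[tensor K (?S r) V] tmap (?S r) V (e r) (ecoact M r (e r m)) = 0[tensor K (?S r) V]"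
   by (simp add: lin_diff[OF MD(1)[OF r] T MD(2)[OF r] m em] lin_diff[OF T TS tl \<rho>(1,2)])
  then show "ecoact Q r (e r m) = tmap (?S r) V (e r) (ecoact M r m)"
   using mod_diff_eq_0[OF TS lin_closed[OF tl \<rho>(1)] lin_closed[OF tl \<rho>(2)]] by (simp add: sel(3))
 next
  fix s r m f assume a: "s <. R" "r <. R" "m <: esp M r" "f <: H s r"
  note em = lin_closed[OF e(1)[OF a(2)] a(3)]
  note l = lin_comp[OF bilinD(2)[OF MD(3)[OF a(1,2)] a(4)] e(1)[OF a(1)]]
  have "e s (eact M s r m f) -[esp M s] e s (eact M s r (e r m) f) = 0[esp M s]"
   using act[OF a(1,2) diff[OF a(2,3)] a(4)] lin_diff[OF MD(1)[OF a(2)] MD(1)[OF a(1)] l a(3) em] by simp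
  then show "e s (eact M s r m f) = e s (eact M s r (e r m) f)"
   using mod_diff_eq_0[OF MD(1)[OF a(1)] lin_closed[OF l a(3)] lin_closed[OF l em]] by simp
 qed
 have "is_entmod K C R Q"
 proof (rule entmod_gen[OF pre, where S = "%r. e r ` carrier (esp M r)" and ?'v = 'v])
  fix r n assume "r <. R" "n : e r ` carrier (esp M r)"
  then show "EX (M :: ('k, 'o, 'm, 'c, 'v) entmod) f m. is_entmod K C R M & ehom M Q f & m <: esp M r & n = f r m"
   using M hom by blast
 qed (simp_all add: sel(1))
 then show ?thesis using that[OF _ _ hom] by (simp add: sel(1))
qed

text \<open>With a generalised inverse \<open>g\<close> of \<open>\<eta> r\<close> the map
  \<open>x - \<eta> r (g r x)\<close> is idempotent, and its kernel is exactly the image of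
  \<open>\<eta> r\<close>. Stability of the kernel follows by writing its elements as values of the
  morphism \<open>\<eta>\<close>.\<close>

lemma entmod_cokernel:
 fixes M :: "('k, 'o, 'm, 'c, 'v) entmod" and A :: "('k, 'o, 'm, 'c, 'w) entmod"
 assumes A: "is_entmod K C R A" and M: "is_entmod K C R M" and \<eta>: "ehom A M \<eta>"
 obtains Q :: "('k, 'o, 'm, 'c, 'v) entmod" and e where "is_entmod K C R Q" "ehom M Q e"
  "!!r. carrier (esp Q r) = e r ` carrier (esp M r)"
  "!!r. r <. R ==> {m : carrier (esp M r). e r m = 0[esp Q r]} = \<eta> r ` carrier (esp A r)"
proof -
 note MD = preentD[OF entmodD(1)[OF M]] and AD = preentD[OF entmodD(1)[OF A]]
 have "ALL r:lobj R. EX g. lin (esp M r) (esp A r) g & (ALL x:carrier (esp A r). \<eta> r (g (\<eta> r x)) = \<eta> r x)"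
 proof
  fix r assume r: "r <. R"
  obtain g where "lin (esp M r) (esp A r) g" "!!v. v <: esp A r ==> \<eta> r (g (\<eta> r v)) = \<eta> r v"
   using generalized_inverse[OF AD(1)[OF r] MD(1)[OF r] ehomD(2)[OF \<eta> r]] by blast
  then show "EX g. lin (esp M r) (esp A r) g & (ALL x:carrier (esp A r). \<eta> r (g (\<eta> r x)) = \<eta> r x)" by auto
 qed
 then obtain g where g: "!!r. r <. R ==> lin (esp M r) (esp A r) (g r)"
  "!!r x. r <. R ==> x <: esp A r ==> \<eta> r (g r (\<eta> r x)) = \<eta> r x"
  by (auto simp: bchoice_iff)
 let ?e = "%r x. x -[esp M r] \<eta> r (g r x)"
 have gl: "lin (esp M r) (esp M r) (%x. \<eta> r (g r x))" if r: "r <. R" for r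
  by (rule lin_comp[OF g(1)[OF r] ehomD(2)[OF \<eta> r]])
 have el: "lin (esp M r) (esp M r) (?e r)" if r: "r <. R" for r by (rule lin_minus[OF MD(1)[OF r] lin_id gl[OF r]])
 have ea: "?e r (\<eta> r a) = 0[esp M r]" if r: "r <. R" and a: "a <: esp A r" for r a
  using g(2)[OF r a] MD(1)[OF r] ehomD(3)[OF \<eta> r a] by simp
 have ker: "x = \<eta> r (g r x)" if r: "r <. R" and x: "x <: esp M r" and z: "?e r x = 0[esp M r]" for r x
  using mod_diff_eq_0[OF MD(1)[OF r] x lin_closed[OF gl[OF r] x]] z by simp
 have idem: "?e r (?e r x) = ?e r x" if r: "r <. R" and x: "x <: esp M r" for r x
  using lin_diff[OF MD(1)[OF r] MD(1)[OF r] el[OF r] x lin_closed[OF gl[OF r] x]]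
   ea[OF r lin_closed[OF g(1)[OF r] x]] lin_closed[OF el[OF r] x] MD(1)[OF r] by simp
 have act: "?e s (eact M s r m f) = 0[esp M s]"
  if a: "s <. R" "r <. R" "m <: esp M r" "?e r m = 0[esp M r]" "f <: H s r" for s r m f
 proof -
  note ga = lin_closed[OF g(1)[OF a(2)] a(3)]
  have "eact M s r m f = \<eta> s (eact A s r (g r m) f)"
   using ker[OF a(2-4)] ehomD(5)[OF \<eta> a(1,2) ga a(5)] by simp
  then show ?thesis using ea[OF a(1) bilinD(3)[OF AD(3)[OF a(1,2)] ga a(5)]] by simp
 qed
 have coact: "tmap (esp M r) V (?e r) (ecoact M r m) = 0[tensor K (esp M r) V]"
  if a: "r <. R" "m <: esp M r" "?e r m = 0[esp M r]" for r m
 proof -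
  note ga = lin_closed[OF g(1)[OF a(1)] a(2)] and Mr = MD(1)[OF a(1)] and Ar = AD(1)[OF a(1)]
  note \<rho> = lin_closed[OF AD(2)[OF a(1)] ga]
  have "ecoact M r m = tmap (esp M r) V (\<eta> r) (ecoact A r (g r m))"
   using ker[OF a] ehomD(4)[OF \<eta> a(1) ga] by simp
  also have "tmap (esp M r) V (?e r) \<dots> = tmap (esp M r) V (%x. ?e r (\<eta> r x)) (ecoact A r (g r m))"
   by (rule tmap_comp[OF Ar Mr Mr V_module ehomD(2)[OF \<eta> a(1)] el[OF a(1)] \<rho>])
  also have "\<dots> = 0[tensor K (esp M r) V]"
   by (rule tmap_zero[OF Ar Mr V_module ea[OF a(1)] \<rho>])
  finally show ?thesis .
 qed
 obtain Q :: "('k, 'o, 'm, 'c, 'v) entmod" where Q: "is_entmod K C R Q"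
  "!!r. carrier (esp Q r) = ?e r ` carrier (esp M r)" "ehom M Q ?e" "!!r. zero (esp Q r) = zero (esp M r)"
  by (rule entmod_quotient[where e = ?e, OF M el idem act coact]; (assumption | (rule that; assumption)))
 have "{m : carrier (esp M r). ?e r m = 0[esp Q r]} = \<eta> r ` carrier (esp A r)" if r: "r <. R" for r
 proof (intro equalityI subsetI)
  fix m assume "m : {m : carrier (esp M r). ?e r m = 0[esp Q r]}"
  then have m: "m <: esp M r" "?e r m = 0[esp M r]" using Q(4)[of r] by auto
  show "m : \<eta> r ` carrier (esp A r)"
   using ker[OF r m] lin_closed[OF g(1)[OF r] m(1)] by (rule image_eqI[where f = "\<eta> r" and x = "g r m"])
 next
  fix m assume "m : \<eta> r ` carrier (esp A r)"
  then obtain a where "a <: esp A r" "m = \<eta> r a" by blast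
  then show "m : {m : carrier (esp M r). ?e r m = 0[esp Q r]}"
   using ea[OF r] ehomD(3)[OF \<eta> r] Q(4)[of r] by simp
 qed
 then show ?thesis by (rule that[OF Q(1,3,2)])
qed

text \<open>Action and coaction are the linear extensions of those of the summands. The direct sums
  \<open>P r\<close> are prescribed, possibly in another carrier type, and are kept as the
  underlying spaces.\<close>

lemma entmod_dsum:
 fixes M :: "'i => ('k, 'o, 'm, 'c, 'v) entmod" and P :: "'o => ('k, 'w) module"
 assumes M: "!!i. i : I ==> is_entmod K C R (M i)"
  and d: "!!r. r <. R ==> is_dsum I (%i. esp (M i) r) (P r) (\<iota> r) (\<pi> r)"
 obtains Q :: "('k, 'o, 'm, 'c, 'w) entmod" where "is_entmod K C R Q" "esp Q = P" "!!i. i : I ==> ehom (M i) Q (%r. \<iota> r i)"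
proof -
 note MD = preentD[OF entmodD(1)[OF M]] and dD = is_dsumD[OF d]
 let ?ev = "%r. dev I (%i. esp (M i) r) (\<pi> r)"
 define Q :: "('k, 'o, 'm, 'c, 'w) entmod" where
  "Q = \<lparr>esp = P, eact = (%s r u f. ?ev r (P s) (%i v. \<iota> s i (eact (M i) s r v f)) u),
   ecoact = (%r. ?ev r (tensor K (P r) V) (%i v. tmap (P r) V (\<iota> r i) (ecoact (M i) r v)))\<rparr>"
 have sel: "esp Q = P" "eact Q s r u f = ?ev r (P s) (%i v. \<iota> s i (eact (M i) s r v f)) u"
  "ecoact Q r = ?ev r (tensor K (P r) V) (%i v. tmap (P r) V (\<iota> r i) (ecoact (M i) r v))" for s r u f
  by (simp_all add: Q_def)
 have cl: "lin (esp (M i) r) (tensor K (P r) V) (%v. tmap (P r) V (\<iota> r i) (ecoact (M i) r v))"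
  if "i : I" "r <. R" for i r
  by (rule lin_comp[OF MD(2)[OF that] tmap_lin[OF MD(1)[OF that] dD(1)[OF that(2)] V_module dD(3)[OF that(2,1)]]])
 have al: "lin (esp (M i) r) (P s) (%v. \<iota> s i (eact (M i) s r v f))"
  if "i : I" "s <. R" "r <. R" "f <: H s r" for i s r f
  by (rule lin_comp[OF bilinD(2)[OF MD(3)[OF that(1-3)] that(4)] dD(3)[OF that(2,1)]])
 have ql: "lin (P r) (tensor K (P r) V) (ecoact Q r)" if r: "r <. R" for r
  unfolding sel by (rule dsum_dev_lin[OF d[OF r] tensor_module[OF dD(1)[OF r] V_module] cl[OF _ r]])
 have qa: "lin (P r) (P s) (%u. eact Q s r u f)" if a: "s <. R" "r <. R" "f <: H s r" for s r f
  unfolding sel by (rule dsum_dev_lin[OF d[OF a(2)] dD(1)[OF a(1)] al[OF _ a]])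
 have qi: "eact Q s r (\<iota> r i v) f = \<iota> s i (eact (M i) s r v f)"
  if i: "i : I" and a: "s <. R" "r <. R" "f <: H s r" and v: "v <: esp (M i) r" for s r f i v
  unfolding sel by (rule dsum_dev_inj[OF d[OF a(2)] dD(1)[OF a(1)] al[OF _ a] i v])
 have qc: "ecoact Q r (\<iota> r i v) = tmap (P r) V (\<iota> r i) (ecoact (M i) r v)"
  if i: "i : I" and r: "r <. R" and v: "v <: esp (M i) r" for r i v
  unfolding sel by (rule dsum_dev_inj[OF d[OF r] tensor_module[OF dD(1)[OF r] V_module] cl[OF _ r] i v])
 have pre: "preent Q" unfolding preent_def sel(1)
 proof (intro conjI ballI)
  fix r assume r: "r <. R"
  show "module K (P r)" "lin (P r) (tensor K (P r) V) (ecoact Q r)" by (rule dD(1)[OF r], rule ql[OF r])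
 next
  fix s r assume s: "s <. R" and r: "r <. R"
  note Ps = dD(1)[OF s] and Pr = dD(1)[OF r]
  show "bilin (P r) (H s r) (P s) (eact Q s r)"
  proof (rule bilinI)
   \<comment> \<open>\<open>qa\<close> gives linearity in the module element only. Linearity in the
     arrow is a condition on that element which is stable under sums and multiples and holds on the
     summands.\<close>
   let ?H = "{u : carrier (P r). lin (H s r) (P s) (eact Q s r u)}"
   have cg: "lin (H s r) (P s) \<beta>" if "lin (H s r) (P s) \<alpha>" "!!f. f <: H s r ==> \<alpha> f = \<beta> f" for \<alpha> \<beta>
    by (rule lin_cong[OF that(1) H_module[OF s r] that(2)])
   have sub: "subspace (P r) ?H"
   proof (rule subspaceI)
    have "lin (H s r) (P s) (eact Q s r 0[P r])"
     by (rule cg[OF lin_const_zero[OF Ps]]) (simp add: lin_zero[OF Pr Ps qa[OF s r]])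
    then show "0[P r] : ?H" using Pr by simp
   next
    fix x y assume xy: "x : ?H" "y : ?H"
    have "lin (H s r) (P s) (eact Q s r (x +[P r] y))"
     by (rule cg[OF lin_plus[OF Ps, of _ "eact Q s r x" "eact Q s r y"]]) (use xy in \<open>simp_all add: lin_add[OF qa[OF s r]]\<close>)
    then show "x +[P r] y : ?H" using Pr xy by simp
   next
    fix a x assume xy: "x : ?H" "a <: K"
    have "lin (H s r) (P s) (eact Q s r (a *[P r] x))"
     by (rule cg[OF lin_scale[OF Ps xy(2), of _ "eact Q s r x"]]) (use xy in \<open>simp_all add: lin_smult[OF qa[OF s r]]\<close>)
    then show "a *[P r] x : ?H" using Pr xy by simp
   qed simp
   have "\<iota> r i v : ?H" if i: "i : I" and v: "v <: esp (M i) r" for i v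
   proof -
    have "lin (H s r) (P s) (eact Q s r (\<iota> r i v))"
     by (rule cg[OF lin_comp[OF bilinD(1)[OF MD(3)[OF i s r] v] dD(3)[OF s i]]]) (simp add: qi[OF i s r _ v])
    then show ?thesis using lin_closed[OF dD(3)[OF r i] v] by simp
   qed
   then have all: "carrier (P r) \<subseteq> ?H" by (rule dsum_span[OF d[OF r] sub])
   fix u assume "u <: P r"
   then show "lin (H s r) (P s) (eact Q s r u)" using all by blast
  qed (rule qa[OF s r])
 qed
 have hom: "ehom (M i) Q (%r. \<iota> r i)" if i: "i : I" for i
  unfolding ehom_def colinear_iff sel(1)
  using dD(3) i qc[OF i] qi[OF i] by auto
 have "is_entmod K C R Q"
 proof (rule entmod_gen[OF pre, where S = "%r. \<Union>i\<in>I. \<iota> r i ` carrier (esp (M i) r)" and ?'v = 'v])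
  fix r H assume r: "r <. R" and "subspace (esp Q r) H" and "(\<Union>i\<in>I. \<iota> r i ` carrier (esp (M i) r)) \<subseteq> H"
  then show "carrier (esp Q r) \<subseteq> H" unfolding sel(1) by (intro dsum_span[OF d[OF r]]) auto
 next
  fix r assume r: "r <. R"
  show "(\<Union>i\<in>I. \<iota> r i ` carrier (esp (M i) r)) \<subseteq> carrier (esp Q r)"
   unfolding sel(1) using lin_closed[OF dD(3)[OF r]] by blast
 next
  fix r n assume r: "r <. R" and "n : (\<Union>i\<in>I. \<iota> r i ` carrier (esp (M i) r))"
  then obtain i v where "i : I" "v <: esp (M i) r" "n = \<iota> r i v" by blast
  then show "EX (M :: ('k, 'o, 'm, 'c, 'v) entmod) f m. is_entmod K C R M & ehom M Q f & m <: esp M r & n = f r m"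
   using M[of i] hom[of i] by (intro exI[of _ "M i"] exI[of _ "%r. \<iota> r i"] exI[of _ v]) simp
 qed
 then show ?thesis by (rule that[OF _ sel(1) hom])
qed

end

section \<open>Concrete abelian categories\<close>

text \<open>
 Objects are families of vector spaces indexed by sorts, arrows act on them by families of linear
 maps, and kernels and cokernels are computed sort by sort.
\<close>

locale conc = ground K for K :: "('k, 'z) ring_scheme" (structure) +
 fixes Cat :: "('p, 'q) cat" and S :: "'s set" and sp :: "'p => 's => ('k, 'v) module"
  and ev :: "'q => 's => 'v => 'v"
 assumes sp_module: "!!a s. a : Ob Cat ==> s : S ==> module K (sp a s)"
  and ev_lin: "!!a b f s. a : Ob Cat ==> b : Ob Cat ==> f : Arr Cat a b ==> s : S ==>
   linear_map K (sp a s) (sp b s) (ev f s)"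
  and ev_eq: "!!a b f g. a : Ob Cat ==> b : Ob Cat ==> f : Arr Cat a b ==> g : Arr Cat a b ==>
   (!!s x. s : S ==> x <: sp a s ==> ev f s x = ev g s x) ==> f = g"
  and idn: "!!a. a : Ob Cat ==> Idn Cat a : Arr Cat a a"
  and ev_idn: "!!a s x. a : Ob Cat ==> s : S ==> x <: sp a s ==> ev (Idn Cat a) s x = x"
  and cmp: "!!a b c f g. a : Ob Cat ==> b : Ob Cat ==> c : Ob Cat ==> f : Arr Cat a b ==> g : Arr Cat b c ==>
   Cmp Cat a b c g f : Arr Cat a c"
  and ev_cmp: "!!a b c f g s x. a : Ob Cat ==> b : Ob Cat ==> c : Ob Cat ==> f : Arr Cat a b ==> g : Arr Cat b c ==>
   s : S ==> x <: sp a s ==> ev (Cmp Cat a b c g f) s x = ev g s (ev f s x)"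
  and zero_ex: "!!a b. a : Ob Cat ==> b : Ob Cat ==>
   EX f:Arr Cat a b. ALL s:S. ALL x:carrier (sp a s). ev f s x = 0[sp b s]"
  and diff_ex: "!!a b f g. a : Ob Cat ==> b : Ob Cat ==> f : Arr Cat a b ==> g : Arr Cat a b ==>
   EX h:Arr Cat a b. ALL s:S. ALL x:carrier (sp a s). ev h s x = ev f s x -[sp b s] ev g s x"
  and factor_inj: "!!a b c i h. a : Ob Cat ==> b : Ob Cat ==> c : Ob Cat ==> i : Arr Cat b c ==>
   (!!s. s : S ==> inj_on (ev i s) (carrier (sp b s))) ==> h : Arr Cat a c ==>
   (!!s x. s : S ==> x <: sp a s ==> ev h s x : ev i s ` carrier (sp b s)) ==>
   EX u:Arr Cat a b. ALL s:S. ALL x:carrier (sp a s). ev i s (ev u s x) = ev h s x"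
  and factor_surj: "!!a b c p h. a : Ob Cat ==> b : Ob Cat ==> c : Ob Cat ==> p : Arr Cat a b ==>
   (!!s. s : S ==> ev p s ` carrier (sp a s) = carrier (sp b s)) ==> h : Arr Cat a c ==>
   (!!s x. s : S ==> x <: sp a s ==> ev p s x = 0[sp b s] ==> ev h s x = 0[sp c s]) ==>
   EX u:Arr Cat b c. ALL s:S. ALL x:carrier (sp a s). ev u s (ev p s x) = ev h s x"
  and kernel_ex: "!!a b f. a : Ob Cat ==> b : Ob Cat ==> f : Arr Cat a b ==>
   EX k:Ob Cat. EX i:Arr Cat k a. ALL s:S. inj_on (ev i s) (carrier (sp k s)) &
    ev i s ` carrier (sp k s) = {x : carrier (sp a s). ev f s x = 0[sp b s]}"
  and cokernel_ex: "!!a b f. a : Ob Cat ==> b : Ob Cat ==> f : Arr Cat a b ==>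
   EX q:Ob Cat. EX p:Arr Cat b q. ALL s:S. ev p s ` carrier (sp b s) = carrier (sp q s) &
    {x : carrier (sp b s). ev p s x = 0[sp q s]} = ev f s ` carrier (sp a s)"
begin

lemma ev_closed:
 "a : Ob Cat ==> b : Ob Cat ==> f : Arr Cat a b ==> s : S ==> x <: sp a s ==> ev f s x <: sp b s"
 by (rule lin_closed[OF ev_lin])

lemma ev_zero: "a : Ob Cat ==> b : Ob Cat ==> f : Arr Cat a b ==> s : S ==> ev f s 0[sp a s] = 0[sp b s]"
 by (rule lin_zero[OF sp_module sp_module ev_lin])

lemma is_cat_Cat: "is_cat Cat"
 unfolding is_cat_def
proof (intro conjI ballI)
 fix a b f assume a: "a : Ob Cat" and b: "b : Ob Cat" and f: "f : Arr Cat a b"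
 show "Cmp Cat a a b f (Idn Cat a) = f"
  by (rule ev_eq[OF a b cmp[OF a a b idn[OF a] f] f]) (simp add: ev_cmp[OF a a b idn[OF a] f] ev_idn[OF a])
 show "Cmp Cat a b b (Idn Cat b) f = f"
  by (rule ev_eq[OF a b cmp[OF a b b f idn[OF b]] f])
   (simp add: ev_cmp[OF a b b f idn[OF b]] ev_idn[OF b] ev_closed[OF a b f])
next
 fix a b c d f g h assume o: "a : Ob Cat" "b : Ob Cat" "c : Ob Cat" "d : Ob Cat"
  and f: "f : Arr Cat a b" and g: "g : Arr Cat b c" and h: "h : Arr Cat c d"
 note gf = cmp[OF o(1-3) f g] and hg = cmp[OF o(2-4) g h]
 show "Cmp Cat a c d h (Cmp Cat a b c g f) = Cmp Cat a b d (Cmp Cat b c d h g) f"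
  by (rule ev_eq[OF o(1,4) cmp[OF o(1,3,4) gf h] cmp[OF o(1,2,4) f hg]])
   (simp add: ev_cmp[OF o(1,3,4) gf h] ev_cmp[OF o(1,2,4) f hg] ev_cmp[OF o(1-3) f g] ev_cmp[OF o(2-4) g h]
    ev_closed[OF o(1,2) f])
qed (rule idn cmp; assumption)+

lemma factor_inj':
 assumes "a : Ob Cat" "b : Ob Cat" "c : Ob Cat" "i : Arr Cat b c" "h : Arr Cat a c"
  "ALL s:S. inj_on (ev i s) (carrier (sp b s))"
  "ALL s:S. ALL x:carrier (sp a s). ev h s x : ev i s ` carrier (sp b s)"
 obtains u where "u : Arr Cat a b" "ALL s:S. ALL x:carrier (sp a s). ev i s (ev u s x) = ev h s x"
proof -
 have "EX u:Arr Cat a b. ALL s:S. ALL x:carrier (sp a s). ev i s (ev u s x) = ev h s x"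
  by (rule factor_inj[OF assms(1-4) _ assms(5)]) (use assms(6,7) in simp_all)
 then show ?thesis using that by (elim bexE)
qed

lemma factor_surj':
 assumes "a : Ob Cat" "b : Ob Cat" "c : Ob Cat" "p : Arr Cat a b" "h : Arr Cat a c"
  "ALL s:S. ev p s ` carrier (sp a s) = carrier (sp b s)"
  "ALL s:S. ALL x:carrier (sp a s). ev p s x = 0[sp b s] --> ev h s x = 0[sp c s]"
 obtains u where "u : Arr Cat b c" "ALL s:S. ALL x:carrier (sp a s). ev u s (ev p s x) = ev h s x"
proof -
 have "EX u:Arr Cat b c. ALL s:S. ALL x:carrier (sp a s). ev u s (ev p s x) = ev h s x"
  by (rule factor_surj[OF assms(1-4) _ assms(5)]) (use assms(6,7) in simp_all)
 then show ?thesis using that by (elim bexE)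
qed

lemma kernel_obtain:
 assumes "a : Ob Cat" "b : Ob Cat" "f : Arr Cat a b"
 obtains k i where "k : Ob Cat" "i : Arr Cat k a" "!!s. s : S ==> inj_on (ev i s) (carrier (sp k s))"
  "!!s. s : S ==> ev i s ` carrier (sp k s) = {x : carrier (sp a s). ev f s x = 0[sp b s]}"
 using kernel_ex[OF assms] by (elim bexE) (rule that; (assumption | (drule (1) bspec, (erule conjunct1 | erule conjunct2))))

lemma cokernel_obtain:
 assumes "a : Ob Cat" "b : Ob Cat" "f : Arr Cat a b"
 obtains q p where "q : Ob Cat" "p : Arr Cat b q" "!!s. s : S ==> ev p s ` carrier (sp b s) = carrier (sp q s)"
  "!!s. s : S ==> {x : carrier (sp b s). ev p s x = 0[sp q s]} = ev f s ` carrier (sp a s)"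
 using cokernel_ex[OF assms] by (elim bexE) (rule that; (assumption | (drule (1) bspec, (erule conjunct1 | erule conjunct2))))

section \<open>Zero arrows, kernels and cokernels, sort by sort\<close>

lemma triv_zero_object:
 assumes z: "z : Ob Cat" "!!s. s : S ==> carrier (sp z s) = {0[sp z s]}"
 shows "zero_object Cat z"
 unfolding zero_object_def
proof (intro conjI ballI)
 fix a assume a: "a : Ob Cat"
 have "f = g" if "f : Arr Cat z a" "g : Arr Cat z a" for f g
  by (rule ev_eq[OF z(1) a that]) (use z a that ev_zero in auto)
 then show "EX! f. f : Arr Cat z a" using zero_ex[OF z(1) a] by blast
 have "f = g" if "f : Arr Cat a z" "g : Arr Cat a z" for f g
  by (rule ev_eq[OF a z(1) that]) (use z(2) ev_closed[OF a z(1) that(1)] ev_closed[OF a z(1) that(2)] in auto)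
 then show "EX! f. f : Arr Cat a z" using zero_ex[OF a z(1)] by blast
qed (rule z(1))

text \<open>The arrow that vanishes everywhere and the identity are both endomorphisms of
  \<open>z\<close>, hence equal.\<close>

lemma zero_object_triv:
 assumes z: "zero_object Cat z" and s: "s : S" and x: "x <: sp z s"
 shows "x = 0[sp z s]"
proof -
 have z': "z : Ob Cat" using z by (simp add: zero_object_def)
 obtain f where f: "f : Arr Cat z z" "!!s x. s : S ==> x <: sp z s ==> ev f s x = 0[sp z s]"
  using zero_ex[OF z' z'] by blast
 have "f = Idn Cat z" using z z' f(1) idn[OF z'] unfolding zero_object_def by blast
 then show ?thesis using f(2)[OF s x] ev_idn[OF z' s x] by simp
qed

text \<open>The kernel of an identity has trivial carriers.\<close>

lemma zero_object_ex:
 assumes a: "a : Ob Cat"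
 shows "EX z. zero_object Cat z"
proof -
 obtain k i where k: "k : Ob Cat" "i : Arr Cat k a" and i: "!!s. s : S ==> inj_on (ev i s) (carrier (sp k s))"
  "!!s. s : S ==> ev i s ` carrier (sp k s) = {x : carrier (sp a s). ev (Idn Cat a) s x = 0[sp a s]}"
  by (rule kernel_obtain[OF a a idn[OF a]]; (assumption | (rule that; assumption)))
 have "carrier (sp k s) = {0[sp k s]}" if s: "s : S" for s
 proof -
  have 0: "0[sp k s] <: sp k s" using sp_module[OF k(1) s] by simp
  have "x = 0[sp k s]" if x: "x <: sp k s" for x
  proof (rule inj_onD[OF i(1)[OF s] _ x 0])
   have "ev i s x <: sp a s" "ev (Idn Cat a) s (ev i s x) = 0[sp a s]" using i(2)[OF s] x by auto
   then show "ev i s x = ev i s 0[sp k s]" using ev_idn[OF a s] ev_zero[OF k(1) a k(2) s] by simp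
  qed
  then show ?thesis using 0 by blast
 qed
 then show ?thesis using triv_zero_object[OF k(1)] by blast
qed

text \<open>An arrow through a zero object vanishes since the carriers of a zero object are trivial.
  Conversely, an arrow that vanishes at all sorts equals any composite through a zero object, since
  arrows are determined by their values.\<close>

lemma zero_arrow_iff:
 assumes a: "a : Ob Cat" and b: "b : Ob Cat"
 shows "zero_arrow Cat a b f \<longleftrightarrow> f : Arr Cat a b & (ALL s:S. ALL x:carrier (sp a s). ev f s x = 0[sp b s])"
proof
 assume "zero_arrow Cat a b f"
 then obtain z g h where z: "zero_object Cat z" and gh: "g : Arr Cat a z" "h : Arr Cat z b" "f = Cmp Cat a z b h g"
  unfolding zero_arrow_def by blast
 have z': "z : Ob Cat" using z by (simp add: zero_object_def)
 have "ev f s x = 0[sp b s]" if s: "s : S" and x: "x <: sp a s" for s x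
  unfolding gh(3) ev_cmp[OF a z' b gh(1,2) s x]
  using zero_object_triv[OF z s ev_closed[OF a z' gh(1) s x]] ev_zero[OF z' b gh(2) s] by simp
 then show "f : Arr Cat a b & (ALL s:S. ALL x:carrier (sp a s). ev f s x = 0[sp b s])"
  using cmp[OF a z' b gh(1,2)] gh(3) by simp
next
 assume f: "f : Arr Cat a b & (ALL s:S. ALL x:carrier (sp a s). ev f s x = 0[sp b s])"
 obtain z where z: "zero_object Cat z" using zero_object_ex[OF a] by blast
 have z': "z : Ob Cat" using z by (simp add: zero_object_def)
 obtain g where g: "g : Arr Cat a z" using zero_ex[OF a z'] by blast
 obtain h where h: "h : Arr Cat z b" "ALL s:S. ALL x:carrier (sp z s). ev h s x = 0[sp b s]" using zero_ex[OF z' b] by blast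
 have "f = Cmp Cat a z b h g"
  by (rule ev_eq[OF a b _ cmp[OF a z' b g h(1)]])
   (use f h(2) in \<open>simp_all add: ev_cmp[OF a z' b g h(1)] ev_closed[OF a z' g]\<close>)
 then show "zero_arrow Cat a b f" unfolding zero_arrow_def using z g h(1) by blast
qed

lemma zero_arrowD: 
 "zero_arrow Cat a b (Cmp Cat a c b g f) ==> a : Ob Cat ==> b : Ob Cat ==> c : Ob Cat ==> f : Arr Cat a c ==>
  g : Arr Cat c b ==> s : S ==> x <: sp a s ==> ev g s (ev f s x) = 0[sp b s]"
 using zero_arrow_iff[of a b "Cmp Cat a c b g f"] ev_cmp[of a c b f g s x] by simp

text \<open>From right to left, \<open>factor_inj\<close> gives the universal property. From left to
  right, the abstract kernel is compared with a concrete one: each factors through the other, and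
  injectivity and image carry over.\<close>

lemma is_kernel_iff:
 assumes a: "a : Ob Cat" and b: "b : Ob Cat" and k: "k : Ob Cat" and f: "f : Arr Cat a b" and i: "i : Arr Cat k a"
 shows "is_kernel Cat a b f k i \<longleftrightarrow> (ALL s:S. inj_on (ev i s) (carrier (sp k s)) &
  ev i s ` carrier (sp k s) = {x : carrier (sp a s). ev f s x = 0[sp b s]})"
proof
 assume p: "ALL s:S. inj_on (ev i s) (carrier (sp k s)) &
  ev i s ` carrier (sp k s) = {x : carrier (sp a s). ev f s x = 0[sp b s]}"
 show "is_kernel Cat a b f k i" unfolding is_kernel_def
 proof (intro conjI ballI impI)
  have p1: "inj_on (ev i s) (carrier (sp k s))"
   and p2: "ev i s ` carrier (sp k s) = {x : carrier (sp a s). ev f s x = 0[sp b s]}" if "s : S" for s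
   using p that by simp_all
  have "ev f s (ev i s x) = 0[sp b s]" if "s : S" "x <: sp k s" for s x
   using imageI[of x "carrier (sp k s)" "ev i s"] that unfolding p2[OF that(1)] by simp
  then show "zero_arrow Cat k b (Cmp Cat k a b f i)"
   using zero_arrow_iff[OF k b] cmp[OF k a b i f] ev_cmp[OF k a b i f] by simp
  fix x h assume x: "x : Ob Cat" and h: "h : Arr Cat x a" and z: "zero_arrow Cat x b (Cmp Cat x a b f h)"
  have "ev h s y : ev i s ` carrier (sp k s)" if s: "s : S" and y: "y <: sp x s" for s y
  proof -
   have "ev f s (ev h s y) = 0[sp b s]" by (rule zero_arrowD[OF z x b a h f s y])
   then show ?thesis unfolding p2[OF s] using ev_closed[OF x a h s y] by simp
  qed
  then have hi: "ALL s:S. ALL y:carrier (sp x s). ev h s y : ev i s ` carrier (sp k s)" by blast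
  have pi': "ALL s:S. inj_on (ev i s) (carrier (sp k s))" using p1 by simp
  obtain u where u: "u : Arr Cat x k" "ALL s:S. ALL y:carrier (sp x s). ev i s (ev u s y) = ev h s y"
   by (rule factor_inj'[OF x k a i h pi' hi])
  have e: "Cmp Cat x k a i u = h"
   by (rule ev_eq[OF x a cmp[OF x k a u(1) i] h]) (use u(2) in \<open>simp add: ev_cmp[OF x k a u(1) i]\<close>)
  show "EX! u. u : Arr Cat x k & Cmp Cat x k a i u = h"
  proof (rule ex1I[of _ u])
   fix w assume w: "w : Arr Cat x k & Cmp Cat x k a i w = h"
   show "w = u"
   proof (rule ev_eq[OF x k _ u(1)])
    fix s y assume s: "s : S" and y: "y <: sp x s"
    have "ev i s (ev w s y) = ev i s (ev u s y)"
     using w ev_cmp[OF x k a _ i s y, of w] u(2) s y by simp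
    then show "ev w s y = ev u s y"
     by (rule inj_onD[OF p1[OF s]]) (use ev_closed[OF x k _ s y, of w] ev_closed[OF x k u(1) s y] w in simp_all)
   qed (use w in simp)
  qed (use u e in simp)
 qed (use k i in simp_all)
next
 assume ker: "is_kernel Cat a b f k i"
 obtain k' i' where k': "k' : Ob Cat" "i' : Arr Cat k' a"
  and i': "!!s. s : S ==> inj_on (ev i' s) (carrier (sp k' s))"
  "!!s. s : S ==> ev i' s ` carrier (sp k' s) = {x : carrier (sp a s). ev f s x = 0[sp b s]}"
  by (rule kernel_obtain[OF a b f]; (assumption | (rule that; assumption)))
 have "ev f s (ev i' s x) = 0[sp b s]" if "s : S" "x <: sp k' s" for s x
  using imageI[OF that(2), of "ev i' s"] unfolding i'(2)[OF that(1)] by simp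
 then have "zero_arrow Cat k' b (Cmp Cat k' a b f i')"
  unfolding zero_arrow_iff[OF k'(1) b] using cmp[OF k'(1) a b k'(2) f] ev_cmp[OF k'(1) a b k'(2) f] by simp
 then obtain u where u: "u : Arr Cat k' k" "Cmp Cat k' k a i u = i'"
  using ker k' unfolding is_kernel_def by blast
 have z: "ev f s (ev i s x) = 0[sp b s]" if "s : S" "x <: sp k s" for s x
  by (rule zero_arrowD[OF _ k b a i f that]) (use ker in \<open>simp add: is_kernel_def\<close>)
 then have "ev i s x : ev i' s ` carrier (sp k' s)" if "s : S" "x <: sp k s" for s x
  using that i'(2)[OF that(1)] ev_closed[OF k a i that] by simp
 then have hi: "ALL s:S. ALL x:carrier (sp k s). ev i s x : ev i' s ` carrier (sp k' s)" by blast
 have pi': "ALL s:S. inj_on (ev i' s) (carrier (sp k' s))" using i'(1) by blast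
 obtain w where w: "w : Arr Cat k k'" "ALL s:S. ALL x:carrier (sp k s). ev i' s (ev w s x) = ev i s x"
  by (rule factor_inj'[OF k k'(1) a k'(2) i pi' hi])
 have ui: "ev i s (ev u s x) = ev i' s x" if "s : S" "x <: sp k' s" for s x
  using ev_cmp[OF k'(1) k a u(1) i that] u(2) by simp
 have uw: "Cmp Cat k k' k u w : Arr Cat k k" by (rule cmp[OF k k'(1) k w(1) u(1)])
 \<comment> \<open>Injectivity of \<open>i\<close> is still to be shown, so it is the uniqueness of
   the factorisation of \<open>i\<close> through itself that identifies \<open>u\<close> after
   \<open>w\<close> with the identity.\<close>
 have "Cmp Cat k k a i (Cmp Cat k k' k u w) = i"
  by (rule ev_eq[OF k a cmp[OF k k a uw i] i])
   (use w(2) in \<open>simp add: ev_cmp[OF k k a uw i] ev_cmp[OF k k'(1) k w(1) u(1)] ui ev_closed[OF k k'(1) w(1)]\<close>)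
 moreover have "Cmp Cat k k a i (Idn Cat k) = i"
  by (rule ev_eq[OF k a cmp[OF k k a idn[OF k] i] i]) (simp add: ev_cmp[OF k k a idn[OF k] i] ev_idn[OF k])
 moreover have "EX! u. u : Arr Cat k k & Cmp Cat k k a i u = i"
  using ker k i unfolding is_kernel_def by blast
 ultimately have id: "Cmp Cat k k' k u w = Idn Cat k" using uw idn[OF k] by blast
 show "ALL s:S. inj_on (ev i s) (carrier (sp k s)) &
  ev i s ` carrier (sp k s) = {x : carrier (sp a s). ev f s x = 0[sp b s]}"
 proof (intro ballI conjI)
  fix s assume s: "s : S"
  have r: "ev u s (ev w s x) = x" if "x <: sp k s" for x
   using ev_cmp[OF k k'(1) k w(1) u(1) s that] id ev_idn[OF k s that] by simp
  show "inj_on (ev i s) (carrier (sp k s))"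
  proof (rule inj_onI)
   fix x y assume x: "x <: sp k s" and y: "y <: sp k s" and e: "ev i s x = ev i s y"
   then have "ev i' s (ev w s x) = ev i' s (ev w s y)" using w(2) s by simp
   then have "ev w s x = ev w s y"
    by (rule inj_onD[OF i'(1)[OF s] _ ev_closed[OF k k'(1) w(1) s x] ev_closed[OF k k'(1) w(1) s y]])
   then have "ev u s (ev w s x) = ev u s (ev w s y)" by (rule arg_cong)
   then show "x = y" unfolding r[OF x] r[OF y] .
  qed
  show "ev i s ` carrier (sp k s) = {x : carrier (sp a s). ev f s x = 0[sp b s]}"
  proof (intro equalityI subsetI)
   fix x assume "x : ev i s ` carrier (sp k s)"
   then show "x : {x : carrier (sp a s). ev f s x = 0[sp b s]}" using z[OF s] ev_closed[OF k a i s] by blast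
  next
   fix x assume "x : {x : carrier (sp a s). ev f s x = 0[sp b s]}"
   then obtain y where y: "y <: sp k' s" "x = ev i' s y" using i'(2)[OF s] by blast
   then have "x = ev i s (ev u s y)" using ui[OF s y(1)] by (simp only:)
   then show "x : ev i s ` carrier (sp k s)" using ev_closed[OF k'(1) k u(1) s y(1)] by (rule image_eqI)
  qed
 qed
qed

text \<open>Dual to kernels: an abstract cokernel is compared with a concrete one, and uniqueness of
  the factorisation of \<open>p\<close> through itself shows that \<open>w\<close> after
  \<open>u\<close> is the identity.\<close>

lemma is_cokernel_iff:
 assumes a: "a : Ob Cat" and b: "b : Ob Cat" and q: "q : Ob Cat" and f: "f : Arr Cat a b" and p: "p : Arr Cat b q"
 shows "is_cokernel Cat a b f q p \<longleftrightarrow> (ALL s:S. ev p s ` carrier (sp b s) = carrier (sp q s) &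
  {x : carrier (sp b s). ev p s x = 0[sp q s]} = ev f s ` carrier (sp a s))"
proof
 assume P: "ALL s:S. ev p s ` carrier (sp b s) = carrier (sp q s) &
  {x : carrier (sp b s). ev p s x = 0[sp q s]} = ev f s ` carrier (sp a s)"
 show "is_cokernel Cat a b f q p" unfolding is_cokernel_def
 proof (intro conjI ballI impI)
  have P1: "ev p s ` carrier (sp b s) = carrier (sp q s)"
   and P2: "{x : carrier (sp b s). ev p s x = 0[sp q s]} = ev f s ` carrier (sp a s)" if "s : S" for s
   using P that by simp_all
  have "ev p s (ev f s x) = 0[sp q s]" if "s : S" "x <: sp a s" for s x
   using imageI[of x "carrier (sp a s)" "ev f s"] that unfolding P2[OF that(1), symmetric] by simp
  then show "zero_arrow Cat a q (Cmp Cat a b q p f)"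
   using zero_arrow_iff[OF a q] cmp[OF a b q f p] ev_cmp[OF a b q f p] by simp
  fix x h assume x: "x : Ob Cat" and h: "h : Arr Cat b x" and z: "zero_arrow Cat a x (Cmp Cat a b x h f)"
  have ps: "ALL s:S. ev p s ` carrier (sp b s) = carrier (sp q s)" using P1 by simp
  have hz: "ev h s y = 0[sp x s]" if s: "s : S" and y: "y <: sp b s" "ev p s y = 0[sp q s]" for s y
  proof -
   have "y : ev f s ` carrier (sp a s)" unfolding P2[OF s, symmetric] using y by simp
   then obtain w where w: "w <: sp a s" "y = ev f s w" by blast
   show ?thesis using zero_arrowD[OF z a x b f h s w(1)] w(2) by simp
  qed
  then have hz: "ALL s:S. ALL y:carrier (sp b s). ev p s y = 0[sp q s] --> ev h s y = 0[sp x s]" by blast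
  obtain u where u: "u : Arr Cat q x" "ALL s:S. ALL y:carrier (sp b s). ev u s (ev p s y) = ev h s y"
   by (rule factor_surj'[OF b q x p h ps hz])
  have e: "Cmp Cat b q x u p = h"
   by (rule ev_eq[OF b x cmp[OF b q x p u(1)] h]) (use u(2) in \<open>simp add: ev_cmp[OF b q x p u(1)]\<close>)
  show "EX! u. u : Arr Cat q x & Cmp Cat b q x u p = h"
  proof (rule ex1I[of _ u])
   fix w assume w: "w : Arr Cat q x & Cmp Cat b q x w p = h"
   show "w = u"
   proof (rule ev_eq[OF q x _ u(1)])
    fix s y assume s: "s : S" and "y <: sp q s"
    then obtain v where v: "v <: sp b s" "y = ev p s v" using P1[OF s] by blast
    show "ev w s y = ev u s y"
     using w ev_cmp[OF b q x p _ s v(1), of w] u(2) s v by simp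
   qed (use w in simp)
  qed (use u e in simp)
 qed (use q p in simp_all)
next
 assume cok: "is_cokernel Cat a b f q p"
 obtain q' p' where q': "q' : Ob Cat" "p' : Arr Cat b q'"
  and p': "!!s. s : S ==> ev p' s ` carrier (sp b s) = carrier (sp q' s)"
  "!!s. s : S ==> {x : carrier (sp b s). ev p' s x = 0[sp q' s]} = ev f s ` carrier (sp a s)"
  by (rule cokernel_obtain[OF a b f]; (assumption | (rule that; assumption)))
 have "ev p' s (ev f s x) = 0[sp q' s]" if "s : S" "x <: sp a s" for s x
  using imageI[OF that(2), of "ev f s"] unfolding p'(2)[OF that(1), symmetric] by simp
 then have "zero_arrow Cat a q' (Cmp Cat a b q' p' f)"
  unfolding zero_arrow_iff[OF a q'(1)] using cmp[OF a b q'(1) f q'(2)] ev_cmp[OF a b q'(1) f q'(2)] by simp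
 then obtain u where u: "u : Arr Cat q q'" "Cmp Cat b q q' u p = p'"
  using cok q' unfolding is_cokernel_def by blast
 have z: "ev p s (ev f s x) = 0[sp q s]" if "s : S" "x <: sp a s" for s x
  by (rule zero_arrowD[OF _ a q b f p that]) (use cok in \<open>simp add: is_cokernel_def\<close>)
 have pz: "ev p s y = 0[sp q s]" if s: "s : S" and y: "y <: sp b s" "ev p' s y = 0[sp q' s]" for s y
 proof -
  have "y : ev f s ` carrier (sp a s)" unfolding p'(2)[OF s, symmetric] using y by simp
  then show ?thesis using z[OF s] by auto
 qed
 then have hz: "ALL s:S. ALL y:carrier (sp b s). ev p' s y = 0[sp q' s] --> ev p s y = 0[sp q s]" by blast
 have ps: "ALL s:S. ev p' s ` carrier (sp b s) = carrier (sp q' s)" using p'(1) by blast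
 obtain w where w: "w : Arr Cat q' q" "ALL s:S. ALL x:carrier (sp b s). ev w s (ev p' s x) = ev p s x"
  by (rule factor_surj'[OF b q'(1) q q'(2) p ps hz])
 have up: "ev u s (ev p s x) = ev p' s x" if "s : S" "x <: sp b s" for s x
  using ev_cmp[OF b q q'(1) p u(1) that] u(2) by simp
 have wu: "Cmp Cat q q' q w u : Arr Cat q q" by (rule cmp[OF q q'(1) q u(1) w(1)])
 have "Cmp Cat b q q (Cmp Cat q q' q w u) p = p"
  by (rule ev_eq[OF b q cmp[OF b q q p wu] p])
   (use w(2) in \<open>simp add: ev_cmp[OF b q q p wu] ev_cmp[OF q q'(1) q u(1) w(1)] up ev_closed[OF b q p]\<close>)
 moreover have "Cmp Cat b q q (Idn Cat q) p = p"
  by (rule ev_eq[OF b q cmp[OF b q q p idn[OF q]] p]) (simp add: ev_cmp[OF b q q p idn[OF q]] ev_idn[OF q] ev_closed[OF b q p])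
 moreover have "zero_arrow Cat a q (Cmp Cat a b q p f)" using cok unfolding is_cokernel_def by blast
 then have "EX! u. u : Arr Cat q q & Cmp Cat b q q u p = p"
  using cok q p unfolding is_cokernel_def by blast
 ultimately have id: "Cmp Cat q q' q w u = Idn Cat q" using wu idn[OF q] by blast
 show "ALL s:S. ev p s ` carrier (sp b s) = carrier (sp q s) &
  {x : carrier (sp b s). ev p s x = 0[sp q s]} = ev f s ` carrier (sp a s)"
 proof (intro ballI conjI)
  fix s assume s: "s : S"
  have r: "ev w s (ev u s x) = x" if "x <: sp q s" for x
   using ev_cmp[OF q q'(1) q u(1) w(1) s that] id ev_idn[OF q s that] by simp
  show "ev p s ` carrier (sp b s) = carrier (sp q s)"
  proof (intro equalityI subsetI)
   fix x assume x: "x <: sp q s"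
   then obtain y where y: "y <: sp b s" "ev u s x = ev p' s y"
    using p'(1)[OF s] ev_closed[OF q q'(1) u(1) s x] by blast
   have "ev w s (ev p' s y) = ev p s y" using w(2) s y(1) by blast
   then have "x = ev p s y" using r[OF x] unfolding y(2) by (simp only:)
   then show "x : ev p s ` carrier (sp b s)" using y(1) by (rule image_eqI)
  qed (use ev_closed[OF b q p s] in blast)
  show "{x : carrier (sp b s). ev p s x = 0[sp q s]} = ev f s ` carrier (sp a s)"
  proof (intro equalityI subsetI)
   fix x assume "x : {x : carrier (sp b s). ev p s x = 0[sp q s]}"
   then have x: "x <: sp b s" "ev p' s x = 0[sp q' s]"
    using up[OF s, of x] ev_zero[OF q q'(1) u(1) s] by auto
   then show "x : ev f s ` carrier (sp a s)" using p'(2)[OF s] by blast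
  next
   fix x assume "x : ev f s ` carrier (sp a s)"
   then show "x : {x : carrier (sp b s). ev p s x = 0[sp q s]}" using z[OF s] ev_closed[OF a b f s] by blast
  qed
 qed
qed

text \<open>The inclusion of the concrete kernel and the zero arrow have the same composite with
  \<open>f\<close>, so they are equal and the kernel is trivial.\<close>

lemma mono_inj:
 assumes a: "a : Ob Cat" and b: "b : Ob Cat" and m: "is_mono Cat a b f" and s: "s : S"
 shows "inj_on (ev f s) (carrier (sp a s))"
proof -
 have f: "f : Arr Cat a b" using m by (simp add: is_mono_def)
 obtain k i where k: "k : Ob Cat" "i : Arr Cat k a"
  and i: "!!s. s : S ==> ev i s ` carrier (sp k s) = {x : carrier (sp a s). ev f s x = 0[sp b s]}"
  by (rule kernel_obtain[OF a b f]; (assumption | (rule that; assumption)))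
 obtain z where z: "z : Arr Cat k a" "ALL s:S. ALL x:carrier (sp k s). ev z s x = 0[sp a s]" using zero_ex[OF k(1) a] by blast
 have "ev f s (ev i s x) = ev f s (ev z s x)" if s: "s : S" "x <: sp k s" for s x
 proof -
  have "ev f s (ev i s x) = 0[sp b s]"
   using imageI[OF s(2), of "ev i s"] unfolding i[OF s(1)] by simp
  then show ?thesis using z(2) s ev_zero[OF a b f s(1)] by simp
 qed
 then have "Cmp Cat k a b f i = Cmp Cat k a b f z"
  by (intro ev_eq[OF k(1) b cmp[OF k(1) a b k(2) f] cmp[OF k(1) a b z(1) f]])
   (simp add: ev_cmp[OF k(1) a b k(2) f] ev_cmp[OF k(1) a b z(1) f])
 then have iz: "i = z" using m k z(1) unfolding is_mono_def by blast
 show ?thesis unfolding lin_inj_iff[OF sp_module[OF a s] sp_module[OF b s] ev_lin[OF a b f s]]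
 proof (intro ballI impI)
  fix x assume "x <: sp a s" "ev f s x = 0[sp b s]"
  then obtain y where "y <: sp k s" "x = ev i s y" using i[OF s] by blast
  then show "x = 0[sp a s]" using iz z(2) s by simp
 qed
qed

text \<open>The projection to the concrete cokernel and the zero arrow agree after \<open>f\<close>,
  so they are equal and the image of \<open>f\<close> is everything.\<close>

lemma epi_surj:
 assumes a: "a : Ob Cat" and b: "b : Ob Cat" and m: "is_epi Cat a b f" and s: "s : S"
 shows "ev f s ` carrier (sp a s) = carrier (sp b s)"
proof -
 have f: "f : Arr Cat a b" using m by (simp add: is_epi_def)
 obtain q p where q: "q : Ob Cat" "p : Arr Cat b q"
  and p: "!!s. s : S ==> {x : carrier (sp b s). ev p s x = 0[sp q s]} = ev f s ` carrier (sp a s)"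
  by (rule cokernel_obtain[OF a b f]; (assumption | (rule that; assumption)))
 obtain z where z: "z : Arr Cat b q" "ALL s:S. ALL x:carrier (sp b s). ev z s x = 0[sp q s]" using zero_ex[OF b q(1)] by blast
 have "ev p s (ev f s x) = ev z s (ev f s x)" if s: "s : S" "x <: sp a s" for s x
 proof -
  have "ev p s (ev f s x) = 0[sp q s]"
   using imageI[OF s(2), of "ev f s"] unfolding p[OF s(1), symmetric] by simp
  then show ?thesis using z(2) s ev_closed[OF a b f s] by simp
 qed
 then have "Cmp Cat a b q p f = Cmp Cat a b q z f"
  by (intro ev_eq[OF a q(1) cmp[OF a b q(1) f q(2)] cmp[OF a b q(1) f z(1)]])
   (simp add: ev_cmp[OF a b q(1) f q(2)] ev_cmp[OF a b q(1) f z(1)])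
 then have iz: "p = z" using m q z(1) unfolding is_epi_def by blast
 then show ?thesis using p[OF s] z(2) s by auto
qed

text \<open>Turns exactness into a statement about elements, the form in which filtered colimits and
  the extension functor are treated.\<close>

lemma short_exact_iff:
 "short_exact Cat a b c f g \<longleftrightarrow> a : Ob Cat & b : Ob Cat & c : Ob Cat & f : Arr Cat a b & g : Arr Cat b c &
  (ALL s:S. inj_on (ev f s) (carrier (sp a s)) & ev g s ` carrier (sp b s) = carrier (sp c s) &
   ev f s ` carrier (sp a s) = {x : carrier (sp b s). ev g s x = 0[sp c s]})"
 unfolding short_exact_def
proof (intro conj_cong refl)
 assume *: "a : Ob Cat" "b : Ob Cat" "c : Ob Cat" "f : Arr Cat a b" "g : Arr Cat b c"
 show "is_kernel Cat b c g a f & is_cokernel Cat a b f c g \<longleftrightarrow>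
  (ALL s:S. inj_on (ev f s) (carrier (sp a s)) & ev g s ` carrier (sp b s) = carrier (sp c s) &
   ev f s ` carrier (sp a s) = {x : carrier (sp b s). ev g s x = 0[sp c s]})"
  unfolding is_kernel_iff[OF *(2,3,1,5,4)] is_cokernel_iff[OF *(1,2,3,4,5)] by blast
qed

text \<open>A monomorphism is injective, and its image is the kernel of its concrete
  cokernel.\<close>

lemma mono_is_kernel:
 assumes a: "a : Ob Cat" and b: "b : Ob Cat" and m: "is_mono Cat a b f"
 shows "EX c:Ob Cat. EX g:Arr Cat b c. is_kernel Cat b c g a f"
proof -
 have f: "f : Arr Cat a b" using m by (simp add: is_mono_def)
 obtain q p where q: "q : Ob Cat" "p : Arr Cat b q"
  and p: "!!s. s : S ==> {x : carrier (sp b s). ev p s x = 0[sp q s]} = ev f s ` carrier (sp a s)"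
  by (rule cokernel_obtain[OF a b f]; (assumption | (rule that; assumption)))
 have "is_kernel Cat b q p a f"
  unfolding is_kernel_iff[OF b q(1) a q(2) f] using p mono_inj[OF a b m] by blast
 then show ?thesis using q by blast
qed

lemma epi_is_cokernel:
 assumes a: "a : Ob Cat" and b: "b : Ob Cat" and m: "is_epi Cat a b f"
 shows "EX c:Ob Cat. EX g:Arr Cat c a. is_cokernel Cat c a g b f"
proof -
 have f: "f : Arr Cat a b" using m by (simp add: is_epi_def)
 obtain k i where k: "k : Ob Cat" "i : Arr Cat k a"
  and i: "!!s. s : S ==> ev i s ` carrier (sp k s) = {x : carrier (sp a s). ev f s x = 0[sp b s]}"
  by (rule kernel_obtain[OF a b f]; (assumption | (rule that; assumption)))
 have "is_cokernel Cat k a i b f"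
  unfolding is_cokernel_iff[OF k(1) a b k(2) f] using i epi_surj[OF a b m] by blast
 then show ?thesis using k by blast
qed

lemma kernel_cokernel_ex:
 assumes a: "a : Ob Cat" and b: "b : Ob Cat" and f: "f : Arr Cat a b"
 shows "EX k i. is_kernel Cat a b f k i" "EX q p. is_cokernel Cat a b f q p"
proof -
 obtain k i where k: "k : Ob Cat" "i : Arr Cat k a" and i: "!!s. s : S ==> inj_on (ev i s) (carrier (sp k s))"
  "!!s. s : S ==> ev i s ` carrier (sp k s) = {x : carrier (sp a s). ev f s x = 0[sp b s]}"
  by (rule kernel_obtain[OF a b f]; (assumption | (rule that; assumption)))
 have "is_kernel Cat a b f k i" unfolding is_kernel_iff[OF a b k(1) f k(2)] using i by simp
 then show "EX k i. is_kernel Cat a b f k i" by (intro exI)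
 obtain q p where q: "q : Ob Cat" "p : Arr Cat b q" and p: "!!s. s : S ==> ev p s ` carrier (sp b s) = carrier (sp q s)"
  "!!s. s : S ==> {x : carrier (sp b s). ev p s x = 0[sp q s]} = ev f s ` carrier (sp a s)"
  by (rule cokernel_obtain[OF a b f]; (assumption | (rule that; assumption)))
 have "is_cokernel Cat a b f q p" unfolding is_cokernel_iff[OF a b q(1) f q(2)] using p by simp
 then show "EX q p. is_cokernel Cat a b f q p" by (intro exI)
qed

end

subsection \<open>Small sets\<close>

locale universe =
 fixes U :: "'u set"
 assumes regular_U: "regularCard |U|" and small_nat: "small U (UNIV :: nat set)"
begin

lemma infinite_U: "infinite U"
 by (rule card_of_ordLeq_infinite[OF ordLess_imp_ordLeq[OF small_nat[unfolded small_def]]]) simp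

lemma stable_U: "stable |U|"
 by (rule regularCard_stable[OF card_of_Card_order _ regular_U]) (simp only: Field_card_of infinite_U not_False_eq_True)

lemma small_mono: "small U B ==> |A| \<le>o |B| ==> small U A"
 unfolding small_def by (rule ordLeq_ordLess_trans)

lemma small_image: "small U A ==> small U (f ` A)"
 by (rule small_mono[OF _ card_of_image])

lemma small_subset: "small U B ==> A \<subseteq> B ==> small U A"
 by (rule small_mono[OF _ card_of_mono1])

lemma small_inj: "small U B ==> inj_on f A ==> f ` A \<subseteq> B ==> small U A"
 using small_mono card_of_ordLeq by blast

text \<open>Regularity of the cardinal enters through its stability; the bounds for unions, lists
  and direct sums are derived from this one.\<close>

lemma small_Sigma: "small U A ==> (!!a. a : A ==> small U (B a)) ==> small U (Sigma A B)"
 using stable_elim[OF stable_U] unfolding small_def by blast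

lemma small_UN: "small U A ==> (!!a. a : A ==> small U (B a)) ==> small U (\<Union>a\<in>A. B a)"
 by (rule small_mono[OF small_Sigma card_of_UNION_Sigma])

lemma small_finite: "finite A ==> small U A"
 using finite_imp_inj_to_nat_seg[of A] small_inj[OF small_nat, of _ A] by blast

text \<open>The lists of a given length form a small set by induction on the length, and there are
  countably many lengths.\<close>

lemma small_lists: "small U A ==> small U (lists A)"
proof -
 assume A: "small U A"
 have n: "small U {xs : lists A. length xs = n}" for n
 proof (induction n)
  case 0
  have "{xs : lists A. length xs = 0} = {[]}" by auto
  then show ?case using small_finite[OF finite.insertI[OF finite.emptyI]] by (simp only:)
 next
  case (Suc n)
  have "{xs : lists A. length xs = Suc n} \<subseteq> (%(x, xs). x # xs) ` (A \<times> {xs : lists A. length xs = n})"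
  proof
   fix xs assume xs: "xs : {xs : lists A. length xs = Suc n}"
   then obtain y ys where "xs = y # ys" by (cases xs) auto
   then show "xs : (%(x, xs). x # xs) ` (A \<times> {xs : lists A. length xs = n})"
    using xs by (intro image_eqI[of _ _ "(y, ys)"]) auto
  qed
  then show ?case using small_subset[OF small_image[OF small_Sigma[OF A Suc]]] by blast
 qed
 have "lists A = (\<Union>n. {xs : lists A. length xs = n})" by auto
 then show ?thesis using small_UN[OF small_nat, of "%n. {xs : lists A. length xs = n}"] n by simp
qed

lemma small_finite_subsets: "small U A ==> small U {F. F \<subseteq> A & finite F}"
proof -
 assume A: "small U A"
 have "{F. F \<subseteq> A & finite F} \<subseteq> set ` lists A"
 proof
  fix F assume F: "F : {F. F \<subseteq> A & finite F}"
  then obtain xs where "set xs = F" using finite_list by blast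
  then show "F : set ` lists A" using F by auto
 qed
 then show ?thesis using small_subset[OF small_image[OF small_lists[OF A]]] by blast
qed

text \<open>A small set of any type can be replaced by a set in the type of \<open>U\<close>, in
  which coproducts and separators are indexed.\<close>

lemma small_index: "small U A ==> EX e :: 'a => 'u. inj_on e A" for A :: "'a set"
 using iffD2[OF card_of_ordLeq ordLess_imp_ordLeq, of A U] unfolding small_def by blast

end

text \<open>An element is determined by the finite graph of its nonzero components.\<close>

lemma (in ground) small_dsum:
 fixes U :: "'u set"
 assumes U: "universe U" and d: "is_dsum I V P \<iota> \<pi>" and I: "small U I" and V: "!!i. i : I ==> small U (carrier (V i))"
 shows "small U (carrier P)"
proof -
 interpret universe U by fact
 note D = is_dsumD[OF d]
 let ?f = "%u. (%i. (i, \<pi> i u)) ` {i : I. \<pi> i u ~= 0[V i]}"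
 have "inj_on ?f (carrier P)"
 proof (rule inj_onI)
  fix u w assume u: "u <: P" and w: "w <: P" and e: "?f u = ?f w"
  have m: "(i, v) : ?f u \<longleftrightarrow> i : I & \<pi> i u = v & v ~= 0[V i]" for i v u by auto
  have "\<pi> i u = \<pi> i w" if i: "i : I" for i
  proof (cases "\<pi> i u = 0[V i]")
   case True
   then have "(i, \<pi> i w) \<notin> ?f u \<or> \<pi> i w = 0[V i]" using m by blast
   then show ?thesis using e m[of i "\<pi> i w" w] i True by auto
  next
   case False
   then have "(i, \<pi> i u) : ?f w" using e m[of i "\<pi> i u" u] i by simp
   then show ?thesis using m by simp
  qed
  then have "\<pi> i (u -[P] w) = 0[V i]" if i: "i : I" for i
   using lin_diff[OF D(1) D(2)[OF i] D(4)[OF i] u w] D(2)[OF i] lin_closed[OF D(4)[OF i] w] i by simp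
  then have "u -[P] w = 0[P]" using D(8)[OF mod_closed(4)[OF D(1) u w]] by blast
  then show "u = w" using mod_diff_eq_0[OF D(1) u w] by simp
 qed
 moreover have "?f ` carrier P \<subseteq> {F. F \<subseteq> Sigma I (%i. carrier (V i)) & finite F}"
  using D(7) lin_closed[OF D(4)] by auto
 moreover have "small U {F. F \<subseteq> Sigma I (%i. carrier (V i)) & finite F}"
  by (rule small_finite_subsets[OF small_Sigma[OF I V]])
 ultimately show ?thesis by (intro small_inj[where f = ?f])
qed

section \<open>Grothendieck categories\<close>

text \<open>Two further demands on a concrete category: coproducts that are direct sums at every
  sort, and a small family of objects whose arrows into an object together reach each of its
  elements.\<close>

locale groth = conc K Cat S sp ev + universe U
 for K :: "('k, 'z) ring_scheme" (structure) and Cat :: "('p, 'q) cat" and S :: "'s set"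
  and sp :: "'p => 's => ('k, 'v) module" and ev and U :: "'u set" +
 assumes coproduct_ex: "!!(I :: 'u set) F. small U I ==> (!!i. i : I ==> F i : Ob Cat) ==>
   EX c:Ob Cat. EX \<iota> \<pi>. (ALL i:I. \<iota> i : Arr Cat (F i) c) &
    (ALL s:S. ground.is_dsum K I (%i. sp (F i) s) (sp c s) (%i. ev (\<iota> i) s) (\<pi> s)) &
    (ALL x:Ob Cat. ALL h. (ALL i:I. h i : Arr Cat (F i) x) -->
     (EX u:Arr Cat c x. ALL i:I. ALL s:S. ALL v:carrier (sp (F i) s). ev u s (ev (\<iota> i) s v) = ev (h i) s v))"
  and separators_ex: "EX (I :: 'u set) T. small U I & (ALL i:I. T i : Ob Cat) &
   (ALL a:Ob Cat. ALL s:S. ALL x:carrier (sp a s). EX i:I. EX h:Arr Cat (T i) a. x : ev h s ` carrier (sp (T i) s))"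
begin

definition coprod_data :: "'i set => ('i => 'p) => 'p => ('i => 'q) => ('s => 'i => 'v => 'v) => bool" where
 "coprod_data I F c \<iota> \<pi> \<longleftrightarrow> c : Ob Cat & (ALL i:I. F i : Ob Cat) & (ALL i:I. \<iota> i : Arr Cat (F i) c) &
   (ALL s:S. is_dsum I (%i. sp (F i) s) (sp c s) (%i. ev (\<iota> i) s) (\<pi> s)) &
   (ALL x:Ob Cat. ALL h. (ALL i:I. h i : Arr Cat (F i) x) -->
    (EX u:Arr Cat c x. ALL i:I. ALL s:S. ALL v:carrier (sp (F i) s). ev u s (ev (\<iota> i) s v) = ev (h i) s v))"

lemma coprod_dataD:
 assumes "coprod_data I F c \<iota> \<pi>"
 shows "c : Ob Cat" "i : I ==> F i : Ob Cat" "i : I ==> \<iota> i : Arr Cat (F i) c"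
  "s : S ==> is_dsum I (%i. sp (F i) s) (sp c s) (%i. ev (\<iota> i) s) (\<pi> s)"
 using assms by (auto simp: coprod_data_def)

lemma coprod_copair:
 assumes "coprod_data I F c \<iota> \<pi>" "x : Ob Cat" "!!i. i : I ==> h i : Arr Cat (F i) x"
 obtains u where "u : Arr Cat c x" "!!i s v. i : I ==> s : S ==> v <: sp (F i) s ==> ev u s (ev (\<iota> i) s v) = ev (h i) s v"
 using assms unfolding coprod_data_def by meson

text \<open>Index sets of other types, such as sets of arrows of a diagram, are embedded into the
  type of \<open>U\<close>, and the coproduct is reindexed along the embedding.\<close>

lemma coprod_ex:
 fixes I :: "'i set"
 assumes I: "small U I" and F: "!!i. i : I ==> F i : Ob Cat"
 obtains c \<iota> \<pi> where "coprod_data I F c \<iota> \<pi>"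
proof -
 obtain e :: "'i => 'u" where e: "inj_on e I" using small_index[OF I] by blast
 define g where "g = the_inv_into I e"
 have g: "g (e i) = i" if "i : I" for i unfolding g_def by (rule the_inv_into_f_f[OF e that])
 have "EX c:Ob Cat. EX \<iota> \<pi>. (ALL j:e ` I. \<iota> j : Arr Cat (F (g j)) c) &
    (ALL s:S. is_dsum (e ` I) (%j. sp (F (g j)) s) (sp c s) (%j. ev (\<iota> j) s) (\<pi> s)) &
    (ALL x:Ob Cat. ALL h. (ALL j:e ` I. h j : Arr Cat (F (g j)) x) -->
     (EX u:Arr Cat c x. ALL j:e ` I. ALL s:S. ALL v:carrier (sp (F (g j)) s). ev u s (ev (\<iota> j) s v) = ev (h j) s v))"
  by (rule coproduct_ex[OF small_image[OF I]]) (auto simp: g F)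
 then obtain c \<iota> \<pi> where c: "c : Ob Cat" and \<iota>: "ALL j:e ` I. \<iota> j : Arr Cat (F (g j)) c"
  and d: "ALL s:S. is_dsum (e ` I) (%j. sp (F (g j)) s) (sp c s) (%j. ev (\<iota> j) s) (\<pi> s)"
  and u: "ALL x:Ob Cat. ALL h. (ALL j:e ` I. h j : Arr Cat (F (g j)) x) -->
     (EX u:Arr Cat c x. ALL j:e ` I. ALL s:S. ALL v:carrier (sp (F (g j)) s). ev u s (ev (\<iota> j) s v) = ev (h j) s v)"
  by (elim bexE exE conjE)
 have "coprod_data I F c (%i. \<iota> (e i)) (%s i. \<pi> s (e i))"
  unfolding coprod_data_def
 proof (intro conjI ballI allI impI)
  fix i assume i: "i : I"
  show "F i : Ob Cat" by (rule F[OF i])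
  show "\<iota> (e i) : Arr Cat (F i) c" using bspec[OF \<iota> imageI[OF i]] g[OF i] by simp
 next
  fix s assume s: "s : S"
  note D = is_dsumD[OF bspec[OF d s]]
  show "is_dsum I (%i. sp (F i) s) (sp c s) (%i. ev (\<iota> (e i)) s) (%i. \<pi> s (e i))"
   unfolding is_dsum_def
  proof (intro conjI ballI impI)
   fix i assume i: "i : I"
   note D' = D(2-6)[OF imageI[OF i], unfolded g[OF i]]
   show "module K (sp (F i) s)" by (rule D'(1))
   show "linear_map K (sp (F i) s) (sp c s) (ev (\<iota> (e i)) s)" by (rule D'(2))
   show "linear_map K (sp c s) (sp (F i) s) (\<pi> s (e i))" by (rule D'(3))
   fix v assume v: "v <: sp (F i) s"
   show "\<pi> s (e i) (ev (\<iota> (e i)) s v) = v" by (rule D'(4)[OF v])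
   fix j assume j: "j : I" "i ~= j"
   then have "e i ~= e j" using e i by (auto dest: inj_onD)
   then show "\<pi> s (e j) (ev (\<iota> (e i)) s v) = 0[sp (F j) s]"
    using D(6)[OF imageI[OF i] imageI[OF j(1)], unfolded g[OF i] g[OF j(1)], OF v] by blast
  next
   fix w assume w: "w <: sp c s"
   have "{i : I. \<pi> s (e i) w ~= 0[sp (F i) s]} \<subseteq> g ` {j : e ` I. \<pi> s j w ~= 0[sp (F (g j)) s]}"
   proof
    fix i assume i: "i : {i : I. \<pi> s (e i) w ~= 0[sp (F i) s]}"
    then have "i : I" by simp
    then have "e i : {j : e ` I. \<pi> s j w ~= 0[sp (F (g j)) s]}" using i g by simp
    then show "i : g ` {j : e ` I. \<pi> s j w ~= 0[sp (F (g j)) s]}"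
     using g[OF \<open>i : I\<close>] by (metis (no_types, lifting) image_eqI)
   qed
   then show "finite {i : I. \<pi> s (e i) w ~= 0[sp (F i) s]}" by (rule finite_subset[OF _ finite_imageI[OF D(7)[OF w]]])
   assume z: "ALL i:I. \<pi> s (e i) w = 0[sp (F i) s]"
   show "w = 0[sp c s]" by (rule D(8)[OF w]) (use z g in auto)
  qed (rule D(1))
 next
  fix x h assume x: "x : Ob Cat" and h: "ALL i:I. h i : Arr Cat (F i) x"
  have "ALL j:e ` I. h (g j) : Arr Cat (F (g j)) x" using h g by simp
  then have "EX u:Arr Cat c x. ALL j:e ` I. ALL s:S. ALL v:carrier (sp (F (g j)) s). ev u s (ev (\<iota> j) s v) = ev (h (g j)) s v"
   using bspec[OF u x, THEN spec, of "%j. h (g j)"] by (rule rev_mp)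
  then show "EX u:Arr Cat c x. ALL i:I. ALL s:S. ALL v:carrier (sp (F i) s). ev u s (ev (\<iota> (e i)) s v) = ev (h i) s v"
   using g by simp
 qed (rule c)
 then show ?thesis by (rule that)
qed

lemma coprod_eq:
 assumes c: "coprod_data I F c \<iota> \<pi>" and x: "x : Ob Cat" and u: "u : Arr Cat c x" "w : Arr Cat c x"
  and eq: "!!i s v. i : I ==> s : S ==> v <: sp (F i) s ==> ev u s (ev (\<iota> i) s v) = ev w s (ev (\<iota> i) s v)"
 shows "u = w"
proof (rule ev_eq[OF coprod_dataD(1)[OF c] x u])
 fix s y assume s: "s : S" and y: "y <: sp c s"
 note cD = coprod_dataD[OF c]
 have "carrier (sp c s) \<subseteq> {y : carrier (sp c s). ev u s y = ev w s y}"
  by (rule dsum_span[OF cD(4)[OF s] subspace_equalizer[OF sp_module[OF cD(1) s] sp_module[OF x s]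
     ev_lin[OF cD(1) x u(1) s] ev_lin[OF cD(1) x u(2) s]]])
   (use eq s ev_closed[OF cD(2) cD(1) cD(3)] in simp)
 then show "ev u s y = ev w s y" using y by blast
qed

lemma coprod_is_coproduct:
 assumes c: "coprod_data I F c \<iota> \<pi>"
 shows "is_coproduct Cat I F c \<iota>"
 unfolding is_coproduct_def
proof (intro conjI ballI allI impI)
 note cD = coprod_dataD[OF c]
 fix x h assume x: "x : Ob Cat" and h: "ALL i:I. h i : Arr Cat (F i) x"
 obtain u where u: "u : Arr Cat c x" "!!i s v. i : I ==> s : S ==> v <: sp (F i) s ==> ev u s (ev (\<iota> i) s v) = ev (h i) s v"
  by (rule coprod_copair[where h = h, OF c x]; (rule bspec[OF h]; assumption | (rule that; assumption)))
 have e: "Cmp Cat (F i) c x u (\<iota> i) = h i" if i: "i : I" for i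
  by (rule ev_eq[OF cD(2)[OF i] x cmp[OF cD(2)[OF i] cD(1) x cD(3)[OF i] u(1)]])
   (use h i u(2) in \<open>simp_all add: ev_cmp[OF cD(2)[OF i] cD(1) x cD(3)[OF i] u(1)]\<close>)
 show "EX! u. u : Arr Cat c x & (ALL i:I. Cmp Cat (F i) c x u (\<iota> i) = h i)"
 proof (rule ex1I[of _ u])
  fix w assume w: "w : Arr Cat c x & (ALL i:I. Cmp Cat (F i) c x w (\<iota> i) = h i)"
  show "w = u"
  proof (rule coprod_eq[OF c x _ u(1)])
   fix i s v assume i: "i : I" and s: "s : S" and v: "v <: sp (F i) s"
   show "ev w s (ev (\<iota> i) s v) = ev u s (ev (\<iota> i) s v)"
    using ev_cmp[OF cD(2)[OF i] cD(1) x cD(3)[OF i] _ s v, of w] w u(2)[OF i s v] i by simp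
  qed (use w in simp)
 qed (use u e in simp)
qed (use coprod_dataD[OF c] in auto)

section \<open>Coproducts, binary products and a generator\<close>

lemma has_coproducts: "has_small_coproducts U Cat"
 unfolding has_small_coproducts_def
proof (intro allI impI)
 fix I :: "'u set" and F assume a: "small U I & (ALL i:I. F i : Ob Cat)"
 obtain c \<iota> \<pi> where "coprod_data I F c \<iota> \<pi>" by (rule coprod_ex[of I F]) (use a in auto)
 then show "EX c \<iota>. is_coproduct Cat I F c \<iota>" using coprod_is_coproduct by blast
qed

text \<open>The coproduct of two objects is also their product: the projections are copairings of an
  identity and a zero arrow, and the pairing is the sum of the composites of \<open>h True\<close>
  and \<open>h False\<close> with the injections. Joint injectivity of the projections gives
  uniqueness.\<close>

lemma binary:
 fixes F :: "bool => 'p"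
 assumes F: "!!i. F i : Ob Cat"
 shows "EX c \<iota>. is_coproduct Cat UNIV F c \<iota>" "EX c \<pi>. is_product Cat UNIV F c \<pi>"
proof -
 obtain c \<iota> \<pi> where c: "coprod_data UNIV F c \<iota> \<pi>"
  by (rule coprod_ex[OF small_finite[of "UNIV :: bool set"], of F]) (use F in auto)
 then show "EX c \<iota>. is_coproduct Cat UNIV F c \<iota>" using coprod_is_coproduct by blast
 note cO = coprod_dataD(1)[OF c] and \<iota> = coprod_dataD(3)[OF c UNIV_I]
 note D = is_dsumD[OF coprod_dataD(4)[OF c]]
 have "EX p:Arr Cat c (F i). ALL s:S. ALL x:carrier (sp c s). ev p s x = \<pi> s i x" for i
 proof -
  obtain z where z: "z : Arr Cat (F (\<not> i)) (F i)" "ALL s:S. ALL x:carrier (sp (F (\<not> i)) s). ev z s x = 0[sp (F i) s]"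
   using zero_ex[OF F F] by blast
  have h: "(if j = i then Idn Cat (F i) else z) : Arr Cat (F j) (F i)" for j
   using idn[OF F] z(1) by (cases "j = i") auto
  obtain p where p: "p : Arr Cat c (F i)" "!!j s v. j : UNIV ==> s : S ==> v <: sp (F j) s ==>
    ev p s (ev (\<iota> j) s v) = ev (if j = i then Idn Cat (F i) else z) s v"
   by (rule coprod_copair[where h = "%j. if j = i then Idn Cat (F i) else z", OF c F h]; (assumption | (rule that; assumption)))
  have "ev p s x = \<pi> s i x" if s: "s : S" and x: "x <: sp c s" for s x
  proof -
   have "carrier (sp c s) \<subseteq> {x : carrier (sp c s). ev p s x = \<pi> s i x}"
   proof (rule dsum_span[OF coprod_dataD(4)[OF c s] subspace_equalizer[OF D(1)[OF s] D(2)[OF s UNIV_I] ev_lin[OF cO F p(1) s] D(4)[OF s UNIV_I]]])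
    fix j v assume v: "v <: sp (F j) s"
    have "ev p s (ev (\<iota> j) s v) = \<pi> s i (ev (\<iota> j) s v)"
    proof (cases "j = i")
     case True
     then show ?thesis using p(2)[OF UNIV_I s v] D(5)[OF s UNIV_I v] ev_idn[OF F s] v by simp
    next
     case False
     then have "j = (\<not> i)" by auto
     then show ?thesis using p(2)[OF UNIV_I s v] D(6)[OF s UNIV_I UNIV_I v False] z(2) s v False by simp
    qed
    then show "ev (\<iota> j) s v : {x : carrier (sp c s). ev p s x = \<pi> s i x}"
     using ev_closed[OF F cO \<iota> s v] by simp
   qed
   then show ?thesis using x by blast
  qed
  then show ?thesis using p(1) by blast
 qed
 then have "ALL i. EX p. p : Arr Cat c (F i) & (ALL s:S. ALL x:carrier (sp c s). ev p s x = \<pi> s i x)" by blast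
 from choice[OF this] obtain p where p: "!!i. p i : Arr Cat c (F i)"
  "!!i s x. s : S ==> x <: sp c s ==> ev (p i) s x = \<pi> s i x" by blast
 have "is_product Cat UNIV F c p" unfolding is_product_def
 proof (intro conjI ballI allI impI)
  fix x h assume x: "x : Ob Cat" and "ALL i:UNIV. h i : Arr Cat x (F i)"
  then have h: "h i : Arr Cat x (F i)" for i by simp
  let ?g = "%i. Cmp Cat x (F i) c (\<iota> i) (h i)"
  have g: "?g i : Arr Cat x c" for i by (rule cmp[OF x F cO h \<iota>])
  \<comment> \<open>The locale provides zero arrows and differences, so the sum of the two
    composites \<open>a\<close> and \<open>b\<close> is formed as
    \<open>a - (0 - b)\<close>.\<close>
  obtain z where z: "z : Arr Cat x c" "ALL s:S. ALL y:carrier (sp x s). ev z s y = 0[sp c s]" using zero_ex[OF x cO] by blast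
  obtain g' where g': "g' : Arr Cat x c" "ALL s:S. ALL y:carrier (sp x s). ev g' s y = ev z s y -[sp c s] ev (?g False) s y"
   using diff_ex[OF x cO z(1) g[of False]] by blast
  obtain u where u: "u : Arr Cat x c" "ALL s:S. ALL y:carrier (sp x s). ev u s y = ev (?g True) s y -[sp c s] ev g' s y"
   using diff_ex[OF x cO g[of True] g'(1)] by blast
  have pu: "\<pi> s i (ev u s y) = ev (h i) s y" if s: "s : S" and y: "y <: sp x s" for s y i
  proof -
   note m = sp_module[OF cO s] and mi = D(2)[OF s UNIV_I, of i] and l = D(4)[OF s UNIV_I, of i]
   have hc: "ev (h j) s y <: sp (F j) s" for j by (rule ev_closed[OF x F h s y])
   have gc: "ev (?g j) s y <: sp c s" for j by (rule ev_closed[OF x cO g s y])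
   have zc: "0[sp c s] -[sp c s] ev (?g False) s y <: sp c s" using m gc by simp
   have pg: "\<pi> s i (ev (?g j) s y) = (if i = j then ev (h i) s y else 0[sp (F i) s])" for j
   proof (cases "i = j")
    case True then show ?thesis using ev_cmp[OF x F cO h \<iota> s y, of j] D(5)[OF s UNIV_I hc, of i] by simp
   next
    case False
    then have "\<pi> s i (ev (\<iota> j) s (ev (h j) s y)) = 0[sp (F i) s]" by (intro D(6)[OF s UNIV_I UNIV_I hc]) simp
    then show ?thesis using ev_cmp[OF x F cO h \<iota> s y, of j] False by simp
   qed
   have "ev u s y = ev (?g True) s y -[sp c s] (0[sp c s] -[sp c s] ev (?g False) s y)"
    using u(2) g'(2) z(2) s y by simp
   then have "\<pi> s i (ev u s y) = \<pi> s i (ev (?g True) s y) \<ominus>\<^bsub>sp (F i) s\<^esub>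
     (0[sp (F i) s] -[sp (F i) s] \<pi> s i (ev (?g False) s y))"
    using lin_diff[OF m mi l gc zc] lin_diff[OF m mi l mod_closed(2)[OF m] gc] lin_zero[OF m mi l] by simp
   also have "\<dots> = ev (h i) s y"
   proof (cases i)
    case True then show ?thesis using pg[of True] pg[of False] mi hc[of i] by simp
   next
    case False
    have "0[sp (F i) s] -[sp (F i) s] (0[sp (F i) s] -[sp (F i) s] ev (h i) s y) = ev (h i) s y"
     using mi hc[of i] by (simp add: mod_neg(2))
    then show ?thesis using pg[of True] pg[of False] False by simp
   qed
   finally show ?thesis .
  qed
  have e: "Cmp Cat x c (F i) (p i) u = h i" for i
   by (rule ev_eq[OF x F cmp[OF x cO F u(1) p(1)] h])
    (simp add: ev_cmp[OF x cO F u(1) p(1)] p(2) ev_closed[OF x cO u(1)] pu)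
  show "EX! u. u : Arr Cat x c & (ALL i:UNIV. Cmp Cat x c (F i) (p i) u = h i)"
  proof (rule ex1I[of _ u])
   fix w assume w: "w : Arr Cat x c & (ALL i:UNIV. Cmp Cat x c (F i) (p i) w = h i)"
   then have wA: "w : Arr Cat x c" by simp
   show "w = u"
   proof (rule ev_eq[OF x cO wA u(1)])
    fix s y assume s: "s : S" and y: "y <: sp x s"
    note m = sp_module[OF cO s]
    have wc: "ev w s y <: sp c s" and uc: "ev u s y <: sp c s"
     using ev_closed[OF x cO _ s y] wA u(1) by auto
    have "\<pi> s i (ev w s y) = ev (h i) s y" for i
     using ev_cmp[OF x cO F wA p(1) s y, of i] p(2)[OF s wc, of i] w by simp
    then have "\<pi> s i (ev w s y -[sp c s] ev u s y) = 0[sp (F i) s]" for i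
     using lin_diff[OF m D(2)[OF s UNIV_I] D(4)[OF s UNIV_I] wc uc, of i] pu[OF s y, of i]
      D(2)[OF s UNIV_I, of i] ev_closed[OF x F h s y, of i] by simp
    then have "ev w s y -[sp c s] ev u s y = 0[sp c s]" using D(8)[OF s mod_closed(4)[OF m wc uc]] by blast
    then show "ev w s y = ev u s y" using mod_diff_eq_0[OF m wc uc] by simp
   qed
  qed (use u e in simp)
 qed (use cO p in simp_all)
 then show "EX c \<pi>. is_product Cat UNIV F c \<pi>" by blast
qed

text \<open>The empty coproduct is an object.\<close>

lemma Ob_nonempty: "EX a. a : Ob Cat"
proof -
 obtain c \<iota> \<pi> where "coprod_data ({} :: nat set) (%_. undefined) c \<iota> \<pi>"
  by (rule coprod_ex[OF small_finite[of "{} :: nat set"]]) auto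
 then show ?thesis using coprod_dataD(1) by blast
qed

lemma abelian: "abelian_cat Cat"
 unfolding abelian_cat_def
proof (intro conjI ballI allI impI)
 show "is_cat Cat" by (rule is_cat_Cat)
 show "EX z. zero_object Cat z" using Ob_nonempty zero_object_ex by blast
next
 fix F :: "bool => 'p" assume "ALL i. F i : Ob Cat"
 then have F: "!!i. F i : Ob Cat" by simp
 show "EX c \<iota>. is_coproduct Cat UNIV F c \<iota>" "EX c \<pi>. is_product Cat UNIV F c \<pi>" by (rule binary[OF F])+
next
 fix a b f assume "a : Ob Cat" "b : Ob Cat" "f : Arr Cat a b"
 then show "EX k i. is_kernel Cat a b f k i" "EX q p. is_cokernel Cat a b f q p" by (rule kernel_cokernel_ex)+
next
 fix a b f assume "a : Ob Cat" "b : Ob Cat" "is_mono Cat a b f"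
 then show "EX c:Ob Cat. EX g:Arr Cat b c. is_kernel Cat b c g a f" by (rule mono_is_kernel)
next
 fix a b f assume "a : Ob Cat" "b : Ob Cat" "is_epi Cat a b f"
 then show "EX c:Ob Cat. EX g:Arr Cat c a. is_cokernel Cat c a g b f" by (rule epi_is_cokernel)
qed

text \<open>The generator is the coproduct of the separating family. Two different arrows differ at
  some element; a member of the family reaches it, and the arrow that does so extends to the
  coproduct by zero on the other summands.\<close>

lemma generator_ex: "EX g. generator Cat g"
proof -
 obtain I :: "'u set" and T where I: "small U I" and T: "ALL i:I. T i : Ob Cat"
  and sep: "ALL a:Ob Cat. ALL s:S. ALL x:carrier (sp a s). EX i:I. EX h:Arr Cat (T i) a. x : ev h s ` carrier (sp (T i) s)"
  using separators_ex by (elim exE conjE)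
 obtain g \<iota> \<pi> where g: "coprod_data I T g \<iota> \<pi>" by (rule coprod_ex[OF I, of T]) (use T in auto)
 note gD = coprod_dataD[OF g]
 have "generator Cat g" unfolding generator_def
 proof (intro conjI ballI impI)
  fix a b f f' assume a: "a : Ob Cat" and b: "b : Ob Cat" and f: "f : Arr Cat a b" and f': "f' : Arr Cat a b" and ne: "f ~= f'"
  obtain s x where s: "s : S" and x: "x <: sp a s" and nx: "ev f s x ~= ev f' s x"
   using ev_eq[OF a b f f'] ne by blast
  have "EX i:I. EX h:Arr Cat (T i) a. x : ev h s ` carrier (sp (T i) s)" using sep a s x by blast
  then obtain i h y where i: "i : I" and h: "h : Arr Cat (T i) a" and y: "y <: sp (T i) s" "x = ev h s y"
   by (elim bexE imageE)
  have ex: "EX k. k : Arr Cat (T j) a & (j = i --> k = h)" if j: "j : I" for j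
  proof (cases "j = i")
   case True then show ?thesis using h by blast
  next
   case False then show ?thesis using zero_ex[OF gD(2)[OF j] a] by blast
  qed
  define k where "k j = (SOME k. k : Arr Cat (T j) a & (j = i --> k = h))" for j
  have k: "k j : Arr Cat (T j) a" "j = i --> k j = h" if "j : I" for j
   using someI_ex[OF ex[OF that]] unfolding k_def by auto
  obtain u where u: "u : Arr Cat g a" "!!j s v. j : I ==> s : S ==> v <: sp (T j) s ==> ev u s (ev (\<iota> j) s v) = ev (k j) s v"
   by (rule coprod_copair[where h = k, OF g a k(1)]; (assumption | (rule that; assumption)))
  let ?w = "ev (\<iota> i) s y"
  have w: "?w <: sp g s" by (rule ev_closed[OF gD(2)[OF i] gD(1) gD(3)[OF i] s y(1)])
  have "ev u s ?w = x" using u(2)[OF i s y(1)] k(2)[OF i] y(2) by simp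
  then have "ev (Cmp Cat g a b f u) s ?w ~= ev (Cmp Cat g a b f' u) s ?w"
   using nx ev_cmp[OF gD(1) a b u(1) f s w] ev_cmp[OF gD(1) a b u(1) f' s w] by simp
  then have "Cmp Cat g a b f u ~= Cmp Cat g a b f' u" by auto
  then show "EX h:Arr Cat g a. Cmp Cat g a b f h ~= Cmp Cat g a b f' h" using u(1) by blast
 qed (rule gD(1))
 then show ?thesis by blast
qed

subsection \<open>Filtered colimits\<close>

text \<open>An upper bound of \<open>F\<close> is built one object at a time. The arrows in
  \<open>G\<close> are then coequalised one after the other; further composition preserves the
  equations obtained before.\<close>

lemma finite_cocone:
 fixes J :: "('u, 'u) cat"
 assumes J: "small_filtered U J" and F: "finite F" "F \<subseteq> Ob J"
  and G: "finite G" "!!i j f. (i, j, f) : G ==> i : F & j : F & f : Arr J i j"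
 shows "EX k:Ob J. EX g. (ALL j:F. g j : Arr J j k) & (ALL (i, j, f):G. Cmp J i j k (g j) f = g i)"
proof -
 have cat: "is_cat J" and ne: "Ob J ~= {}"
  and ub: "!!i j. i : Ob J ==> j : Ob J ==> EX k:Ob J. Arr J i k ~= {} & Arr J j k ~= {}"
  and eq: "!!i j f g. i : Ob J ==> j : Ob J ==> f : Arr J i j ==> g : Arr J i j ==>
    EX k:Ob J. EX h:Arr J j k. Cmp J i j k h f = Cmp J i j k h g"
  using J unfolding small_filtered_def by simp_all
 have comp: "Cmp J i j k g f : Arr J i k" if "i : Ob J" "j : Ob J" "k : Ob J" "f : Arr J i j" "g : Arr J j k" for i j k f g
  using cat that unfolding is_cat_def by simp
 have assoc: "Cmp J i k l h (Cmp J i j k g f) = Cmp J i j l (Cmp J j k l h g) f"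
  if "i : Ob J" "j : Ob J" "k : Ob J" "l : Ob J" "f : Arr J i j" "g : Arr J j k" "h : Arr J k l" for i j k l f g h
  using cat that unfolding is_cat_def by simp
 have base: "EX k:Ob J. EX g. ALL j:F. g j : Arr J j k" using F
 proof (induction F rule: finite_induct)
  case empty then show ?case using ne by auto
 next
  case (insert x F)
  then obtain k g where k: "k : Ob J" "ALL j:F. g j : Arr J j k" by auto
  obtain l a b where l: "l : Ob J" "a : Arr J k l" "b : Arr J x l" using ub[OF k(1), of x] insert.prems by auto
  have "ALL j:insert x F. (if j = x then b else Cmp J j k l a (g j)) : Arr J j l"
   using l k insert.prems by (auto intro: comp)
  then show ?case using l(1) by (intro bexI[of _ l] exI[of _ "%j. if j = x then b else Cmp J j k l a (g j)"])
 qed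
 show ?thesis using G
 proof (induction G rule: finite_induct)
  case empty then show ?case using base by simp
 next
  case (insert t G)
  have "EX k:Ob J. EX g. (ALL j:F. g j : Arr J j k) & (ALL (i, j, f):G. Cmp J i j k (g j) f = g i)"
   by (rule insert.IH) (use insert.prems in blast)
  then obtain k g where k: "k : Ob J" and g: "ALL j:F. g j : Arr J j k" and gG: "ALL (i, j, f):G. Cmp J i j k (g j) f = g i"
   by (elim bexE exE conjE)
  obtain i j f where t: "t = (i, j, f)" by (cases t) auto
  have ij: "i : F" "j : F" "f : Arr J i j" using insert.prems[of i j f] t by auto
  have o: "x : Ob J" if "x : F" for x using F(2) that by blast
  have gx: "g x : Arr J x k" if "x : F" for x using g that by blast
  obtain l h where l: "l : Ob J" "h : Arr J k l" "Cmp J i k l h (Cmp J i j k (g j) f) = Cmp J i k l h (g i)"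
   using eq[OF o[OF ij(1)] k comp[OF o[OF ij(1)] o[OF ij(2)] k ij(3) gx[OF ij(2)]] gx[OF ij(1)]] by blast
  let ?g = "%x. Cmp J x k l h (g x)"
  have "?g x : Arr J x l" if "x : F" for x by (rule comp[OF o[OF that] k l(1) gx[OF that] l(2)])
  moreover have "Cmp J a b l (?g b) c = ?g a" if m: "(a, b, c) : insert t G" for a b c
  proof -
   have abc: "a : F" "b : F" "c : Arr J a b" using insert.prems[OF m] by auto
   have "Cmp J a b l (?g b) c = Cmp J a k l h (Cmp J a b k (g b) c)"
    by (rule assoc[OF o[OF abc(1)] o[OF abc(2)] k l(1) abc(3) gx[OF abc(2)] l(2), symmetric])
   also have "\<dots> = ?g a"
   proof (cases "(a, b, c) = t")
    case True then show ?thesis using l(3) t by simp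
   next
    case False
    then have "(a, b, c) : G" using m by simp
    then have "Cmp J a b k (g b) c = g a" using gG by auto
    then show ?thesis by simp
   qed
   finally show ?thesis .
  qed
  ultimately have "(ALL j:F. ?g j : Arr J j l) & (ALL (i, j, f):insert t G. Cmp J i j l (?g j) f = ?g i)" by auto
  then show ?case using l(1) by (intro bexI[of _ l] exI[of _ ?g])
 qed
qed

text \<open>The colimit is only known by its universal property, which is tested against two
  cokernels. The first one, of the map from the direct sum of the stages to the colimit, vanishes.
  The second one, of the relations in that direct sum, shows that whatever vanishes in the colimit
  is a combination of relations.\<close>

lemma colimit_elements:
 fixes J :: "('u, 'u) cat"
 assumes J: "small_filtered U J" and D: "is_functor J Cat D" and col: "is_colimit J Cat D c \<iota>" and s: "s : S"
 shows "x <: sp c s ==> EX j:Ob J. EX d:carrier (sp (fob D j) s). x = ev (\<iota> j) s d"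
  and "j0 : Ob J ==> d0 <: sp (fob D j0) s ==> ev (\<iota> j0) s d0 = 0[sp c s] ==>
   EX k:Ob J. EX f:Arr J j0 k. ev (far D j0 k f) s d0 = 0[sp (fob D k) s]"
proof -
 let ?D = "fob D"
 have smJ: "small U (Ob J)" "!!i j. i : Ob J ==> j : Ob J ==> small U (Arr J i j)"
  and ne: "Ob J ~= {}" and cat: "is_cat J"
  and ub: "!!i j. i : Ob J ==> j : Ob J ==> EX k:Ob J. Arr J i k ~= {} & Arr J j k ~= {}"
  using J unfolding small_filtered_def by simp_all
 have DO: "?D j : Ob Cat" if "j : Ob J" for j using D that unfolding is_functor_def by simp
 have DA: "far D i j f : Arr Cat (?D i) (?D j)" if "i : Ob J" "j : Ob J" "f : Arr J i j" for i j f
  using D that unfolding is_functor_def by simp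
 have DC: "far D i k (Cmp J i j k g f) = Cmp Cat (?D i) (?D j) (?D k) (far D j k g) (far D i j f)"
  if "i : Ob J" "j : Ob J" "k : Ob J" "f : Arr J i j" "g : Arr J j k" for i j k f g
  using D that unfolding is_functor_def by simp
 have c: "c : Ob Cat" and \<iota>: "!!j. j : Ob J ==> \<iota> j : Arr Cat (?D j) c"
  and \<iota>c: "!!i j f. i : Ob J ==> j : Ob J ==> f : Arr J i j ==> Cmp Cat (?D i) (?D j) c (\<iota> j) (far D i j f) = \<iota> i"
  using col unfolding is_colimit_def is_cocone_def by simp_all
 have univ: "EX! u. u : Arr Cat c x & (ALL i:Ob J. Cmp Cat (?D i) c x u (\<iota> i) = \<kappa> i)" if "is_cocone J Cat D x \<kappa>" for x \<kappa>
  using col that unfolding is_colimit_def by blast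
 have \<iota>e: "ev (\<iota> j) s (ev (far D i j f) s d) = ev (\<iota> i) s d"
  if "i : Ob J" "j : Ob J" "f : Arr J i j" "d <: sp (?D i) s" for i j f d
  using ev_cmp[OF DO[OF that(1)] DO[OF that(2)] c DA[OF that(1-3)] \<iota>[OF that(2)] s that(4)] \<iota>c[OF that(1-3)] by simp
 obtain P \<kappa> \<pi> where P: "coprod_data (Ob J) ?D P \<kappa> \<pi>" by (rule coprod_ex[OF smJ(1), of ?D]) (use DO in auto)
 note PD = coprod_dataD[OF P] and Pd = coprod_dataD(4)[OF P s]
 show "EX j:Ob J. EX d:carrier (sp (?D j) s). x = ev (\<iota> j) s d" if x: "x <: sp c s"
 proof -
  obtain u where u: "u : Arr Cat P c" "!!i s v. i : Ob J ==> s : S ==> v <: sp (?D i) s ==> ev u s (ev (\<kappa> i) s v) = ev (\<iota> i) s v"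
   by (rule coprod_copair[where h = \<iota>, OF P c \<iota>]; (assumption | (rule that; assumption)))
  \<comment> \<open>\<open>q\<close> measures the elements of the colimit that are not sums of
    elements of stages. Its projection and the zero arrow agree on all stages, so they are equal by
    uniqueness in the universal property.\<close>
  obtain q p where q: "q : Ob Cat" "p : Arr Cat c q" and p: "!!s. s : S ==> ev p s ` carrier (sp c s) = carrier (sp q s)"
   "!!s. s : S ==> {x : carrier (sp c s). ev p s x = 0[sp q s]} = ev u s ` carrier (sp P s)"
   by (rule cokernel_obtain[OF PD(1) c u(1)]; (assumption | (rule that; assumption)))
  obtain z where z: "z : Arr Cat c q" "ALL s:S. ALL x:carrier (sp c s). ev z s x = 0[sp q s]" using zero_ex[OF c q(1)] by blast
  let ?k = "%j. Cmp Cat (?D j) c q z (\<iota> j)"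
  have k: "?k j : Arr Cat (?D j) q" if "j : Ob J" for j by (rule cmp[OF DO[OF that] c q(1) \<iota>[OF that] z(1)])
  have kz: "ev (?k j) s d = 0[sp q s]" if "j : Ob J" "s : S" "d <: sp (?D j) s" for j s d
   using ev_cmp[OF DO[OF that(1)] c q(1) \<iota>[OF that(1)] z(1) that(2,3)] z(2) that(2) ev_closed[OF DO[OF that(1)] c \<iota>[OF that(1)] that(2,3)] by simp
  have "is_cocone J Cat D q ?k" unfolding is_cocone_def
  proof (intro conjI ballI)
   fix i j f assume ij: "i : Ob J" "j : Ob J" "f : Arr J i j"
   show "Cmp Cat (?D i) (?D j) q (?k j) (far D i j f) = ?k i"
    by (rule ev_eq[OF DO[OF ij(1)] q(1) cmp[OF DO[OF ij(1)] DO[OF ij(2)] q(1) DA[OF ij] k[OF ij(2)]] k[OF ij(1)]])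
     (simp add: ev_cmp[OF DO[OF ij(1)] DO[OF ij(2)] q(1) DA[OF ij] k[OF ij(2)]] kz ij ev_closed[OF DO[OF ij(1)] DO[OF ij(2)] DA[OF ij]])
  qed (use q(1) k in auto)
  then have "EX! u. u : Arr Cat c q & (ALL i:Ob J. Cmp Cat (?D i) c q u (\<iota> i) = ?k i)" by (rule univ)
  moreover have "Cmp Cat (?D i) c q p (\<iota> i) = ?k i" if i: "i : Ob J" for i
  proof (rule ev_eq[OF DO[OF i] q(1) cmp[OF DO[OF i] c q(1) \<iota>[OF i] q(2)] k[OF i]])
   fix s v assume s: "s : S" and v: "v <: sp (?D i) s"
   have "ev (\<iota> i) s v : ev u s ` carrier (sp P s)"
    using u(2)[OF i s v] ev_closed[OF DO[OF i] PD(1) PD(3)[OF i] s v] by (intro image_eqI[of _ _ "ev (\<kappa> i) s v"]) simp_all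
   then have "ev p s (ev (\<iota> i) s v) = 0[sp q s]" unfolding p(2)[OF s, symmetric] by simp
   then show "ev (Cmp Cat (?D i) c q p (\<iota> i)) s v = ev (?k i) s v"
    using ev_cmp[OF DO[OF i] c q(1) \<iota>[OF i] q(2) s v] kz[OF i s v] by simp
  qed
  ultimately have "p = z" using q(2) z(1) by blast
  then have "x : ev u s ` carrier (sp P s)" unfolding p(2)[OF s, symmetric] using x z(2) s by simp
  then obtain y where y: "y <: sp P s" "x = ev u s y" by blast
  \<comment> \<open>A sum of elements of different stages is an element of a single one, since any
    two stages map to a common stage.\<close>
  let ?T = "{y : carrier (sp c s). EX j:Ob J. EX d:carrier (sp (?D j) s). y = ev (\<iota> j) s d}"
  have T: "subspace (sp c s) ?T"
  proof (rule subspaceI)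
   obtain j where j: "j : Ob J" using ne by blast
   show "0[sp c s] : ?T"
    using ev_zero[OF DO[OF j] c \<iota>[OF j] s] j mod_closed(2)[OF sp_module[OF DO[OF j] s]] mod_closed(2)[OF sp_module[OF c s]]
    by (intro CollectI conjI bexI[of _ j] bexI[of _ "0[sp (?D j) s]"]) simp_all
  next
   fix a b assume a: "a : ?T" and b: "b : ?T"
   obtain i d where i: "i : Ob J" "d <: sp (?D i) s" "a = ev (\<iota> i) s d" using a by blast
   obtain j e where j: "j : Ob J" "e <: sp (?D j) s" "b = ev (\<iota> j) s e" using b by blast
   obtain k f g where k: "k : Ob J" "f : Arr J i k" "g : Arr J j k" using ub[OF i(1) j(1)] by blast
   let ?x = "ev (far D i k f) s d" and ?y = "ev (far D j k g) s e"
   have xy: "?x <: sp (?D k) s" "?y <: sp (?D k) s"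
    using ev_closed[OF DO[OF i(1)] DO[OF k(1)] DA[OF i(1) k(1,2)] s i(2)] ev_closed[OF DO[OF j(1)] DO[OF k(1)] DA[OF j(1) k(1,3)] s j(2)] by auto
   have "a +[sp c s] b = ev (\<iota> k) s (?x +[sp (?D k) s] ?y)"
    unfolding lin_add[OF ev_lin[OF DO[OF k(1)] c \<iota>[OF k(1)] s] xy]
    using \<iota>e[OF i(1) k(1,2) i(2)] \<iota>e[OF j(1) k(1,3) j(2)] i(3) j(3) by simp
   moreover have "?x +[sp (?D k) s] ?y <: sp (?D k) s" by (rule mod_closed(1)[OF sp_module[OF DO[OF k(1)] s] xy])
   moreover have "a +[sp c s] b <: sp c s" by (rule mod_closed(1)[OF sp_module[OF c s]]) (use a b in simp_all)
   ultimately show "a +[sp c s] b : ?T" using k(1) by blast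
  next
   fix r a assume r: "r <: K" and a: "a : ?T"
   obtain i d where i: "i : Ob J" "d <: sp (?D i) s" "a = ev (\<iota> i) s d" using a by blast
   have "r *[sp c s] a = ev (\<iota> i) s (r *[sp (?D i) s] d)"
    using lin_smult[OF ev_lin[OF DO[OF i(1)] c \<iota>[OF i(1)] s] r i(2)] i(3) by simp
   moreover have "r *[sp (?D i) s] d <: sp (?D i) s" by (rule mod_closed(5)[OF sp_module[OF DO[OF i(1)] s] r i(2)])
   moreover have "r *[sp c s] a <: sp c s" by (rule mod_closed(5)[OF sp_module[OF c s] r]) (use a in simp)
   ultimately show "r *[sp c s] a : ?T" using i(1) by blast
  qed simp
  have "carrier (sp P s) \<subseteq> {y : carrier (sp P s). ev u s y : ?T}"
  proof (rule dsum_span[OF Pd subspace_vimage[OF sp_module[OF PD(1) s] sp_module[OF c s] ev_lin[OF PD(1) c u(1) s] T]])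
   fix i v assume i: "i : Ob J" and v: "v <: sp (?D i) s"
   show "ev (\<kappa> i) s v : {y : carrier (sp P s). ev u s y : ?T}"
    using u(2)[OF i s v] i v ev_closed[OF DO[OF i] c \<iota>[OF i] s v] ev_closed[OF DO[OF i] PD(1) PD(3)[OF i] s v] by auto
  qed
  then have "x : ?T" using y by blast
  then show ?thesis by simp
 qed
 show "EX k:Ob J. EX f:Arr J j0 k. ev (far D j0 k f) s d0 = 0[sp (?D k) s]"
  if j0: "j0 : Ob J" and d0: "d0 <: sp (?D j0) s" and z0: "ev (\<iota> j0) s d0 = 0[sp c s]"
 proof -
  \<comment> \<open>The direct sum \<open>B\<close> has one summand for each arrow \<open>f\<close>
    from \<open>i\<close> to \<open>j\<close>, and \<open>r\<close> sends \<open>v\<close> there to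
    the relation that identifies \<open>v\<close> at stage \<open>i\<close> with its image at stage
    \<open>j\<close>.\<close>
  let ?A = "SIGMA i:Ob J. SIGMA j:Ob J. Arr J i j"
  have smA: "small U ?A" by (intro small_Sigma smJ)
  obtain B \<beta> \<rho> where B: "coprod_data ?A (%t. ?D (fst t)) B \<beta> \<rho>"
   by (rule coprod_ex[OF smA, of "%t. ?D (fst t)"]) (use DO in auto)
  note BD = coprod_dataD[OF B]
  have dh: "EX h. h : Arr Cat (?D (fst t)) P & (ALL s:S. ALL v:carrier (sp (?D (fst t)) s).
    ev h s v = ev (\<kappa> (fst t)) s v -[sp P s] ev (\<kappa> (fst (snd t))) s (ev (far D (fst t) (fst (snd t)) (snd (snd t))) s v))"
   if "t : ?A" for t
  proof -
   obtain i j f where t: "t = (i, j, f)" by (cases t) auto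
   have ij: "i : Ob J" "j : Ob J" "f : Arr J i j" using that t by auto
   note c' = cmp[OF DO[OF ij(1)] DO[OF ij(2)] PD(1) DA[OF ij] PD(3)[OF ij(2)]]
   obtain h where h: "h : Arr Cat (?D i) P" "ALL s:S. ALL v:carrier (sp (?D i) s).
     ev h s v = ev (\<kappa> i) s v -[sp P s] ev (Cmp Cat (?D i) (?D j) P (\<kappa> j) (far D i j f)) s v"
    using diff_ex[OF DO[OF ij(1)] PD(1) PD(3)[OF ij(1)] c'] by blast
   then show ?thesis using ev_cmp[OF DO[OF ij(1)] DO[OF ij(2)] PD(1) DA[OF ij] PD(3)[OF ij(2)]] t by auto
  qed
  define h where "h t = (SOME h. h : Arr Cat (?D (fst t)) P & (ALL s:S. ALL v:carrier (sp (?D (fst t)) s).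
    ev h s v = ev (\<kappa> (fst t)) s v -[sp P s] ev (\<kappa> (fst (snd t))) s (ev (far D (fst t) (fst (snd t)) (snd (snd t))) s v)))" for t
  have hA: "h t : Arr Cat (?D (fst t)) P" if "t : ?A" for t
   using someI_ex[OF dh[OF that]] unfolding h_def by blast
  have he: "ev (h (i, j, f)) s v = ev (\<kappa> i) s v -[sp P s] ev (\<kappa> j) s (ev (far D i j f) s v)"
   if "i : Ob J" "j : Ob J" "f : Arr J i j" "s : S" "v <: sp (?D i) s" for i j f s v
   using someI_ex[OF dh[of "(i, j, f)"]] that unfolding h_def by auto
  obtain r where r: "r : Arr Cat B P" "!!t s v. t : ?A ==> s : S ==> v <: sp (?D (fst t)) s ==> ev r s (ev (\<beta> t) s v) = ev (h t) s v"
   by (rule coprod_copair[where h = h, OF B PD(1) hA]; (assumption | (rule that; assumption)))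
  obtain q p where q: "q : Ob Cat" "p : Arr Cat P q" and p: "!!s. s : S ==> ev p s ` carrier (sp P s) = carrier (sp q s)"
   "!!s. s : S ==> {x : carrier (sp P s). ev p s x = 0[sp q s]} = ev r s ` carrier (sp B s)"
   by (rule cokernel_obtain[OF BD(1) PD(1) r(1)]; (assumption | (rule that; assumption)))
  let ?l = "%j. Cmp Cat (?D j) P q p (\<kappa> j)"
  have l: "?l j : Arr Cat (?D j) q" if "j : Ob J" for j by (rule cmp[OF DO[OF that] PD(1) q(1) PD(3)[OF that] q(2)])
  have le: "ev (?l j) s d = ev p s (ev (\<kappa> j) s d)" if "j : Ob J" "s : S" "d <: sp (?D j) s" for j s d
   by (rule ev_cmp[OF DO[OF that(1)] PD(1) q(1) PD(3)[OF that(1)] q(2) that(2,3)])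
  have "is_cocone J Cat D q ?l" unfolding is_cocone_def
  proof (intro conjI ballI)
   fix i j f assume ij: "i : Ob J" "j : Ob J" "f : Arr J i j"
   show "Cmp Cat (?D i) (?D j) q (?l j) (far D i j f) = ?l i"
   proof (rule ev_eq[OF DO[OF ij(1)] q(1) cmp[OF DO[OF ij(1)] DO[OF ij(2)] q(1) DA[OF ij] l[OF ij(2)]] l[OF ij(1)]])
    fix s v assume s: "s : S" and v: "v <: sp (?D i) s"
    note fv = ev_closed[OF DO[OF ij(1)] DO[OF ij(2)] DA[OF ij] s v]
    let ?a = "ev (\<kappa> i) s v" and ?b = "ev (\<kappa> j) s (ev (far D i j f) s v)"
    have ab: "?a <: sp P s" "?b <: sp P s"
     using ev_closed[OF DO[OF ij(1)] PD(1) PD(3)[OF ij(1)] s v] ev_closed[OF DO[OF ij(2)] PD(1) PD(3)[OF ij(2)] s fv] by auto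
    have t: "(i, j, f) : ?A" "v <: (sp (?D (fst (i, j, f))) s)" using ij v by auto
    have "?a -[sp P s] ?b : ev r s ` carrier (sp B s)"
     using r(2)[OF t(1) s t(2)] he[OF ij s v] ev_closed[OF BD(2)[OF t(1)] BD(1) BD(3)[OF t(1)] s t(2)]
     by (intro image_eqI[of _ _ "ev (\<beta> (i, j, f)) s v"]) simp_all
    then have "ev p s (?a -[sp P s] ?b) = 0[sp q s]" unfolding p(2)[OF s, symmetric] by simp
    then have "ev p s ?a = ev p s ?b"
     unfolding lin_diff[OF sp_module[OF PD(1) s] sp_module[OF q(1) s] ev_lin[OF PD(1) q s] ab]
     using mod_diff_eq_0[OF sp_module[OF q(1) s] ev_closed[OF PD(1) q s ab(1)] ev_closed[OF PD(1) q s ab(2)]] by simp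
    then show "ev (Cmp Cat (?D i) (?D j) q (?l j) (far D i j f)) s v = ev (?l i) s v"
     using ev_cmp[OF DO[OF ij(1)] DO[OF ij(2)] q(1) DA[OF ij] l[OF ij(2)] s v] le[OF ij(2) s fv] le[OF ij(1) s v] by simp
   qed
  qed (use q(1) l in auto)
  \<comment> \<open>The cokernel of the relations is a cocone, so the colimit maps to it. An element
    of a stage that vanishes in the colimit therefore vanishes in the cokernel and is a value of
    \<open>r\<close>.\<close>
  from univ[OF this] obtain w where w: "w : Arr Cat c q" "!!i. i : Ob J ==> Cmp Cat (?D i) c q w (\<iota> i) = ?l i" by blast
  have "ev p s (ev (\<kappa> j0) s d0) = ev w s (ev (\<iota> j0) s d0)"
   using le[OF j0 s d0] w(2)[OF j0] ev_cmp[OF DO[OF j0] c q(1) \<iota>[OF j0] w(1) s d0] by simp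
  also have "\<dots> = 0[sp q s]" using z0 ev_zero[OF c q(1) w(1) s] by simp
  finally have "ev (\<kappa> j0) s d0 : ev r s ` carrier (sp B s)"
   unfolding p(2)[OF s, symmetric] using ev_closed[OF DO[OF j0] PD(1) PD(3)[OF j0] s d0] by simp
  then obtain b where b: "b <: sp B s" "ev (\<kappa> j0) s d0 = ev r s b" by blast
  \<comment> \<open>A combination of relations involves finitely many objects \<open>F\<close> and
    arrows \<open>G\<close>. \<open>Z u\<close> says that, for suitable such sets, \<open>u\<close>
    is killed by every linear map that is given on the summands in \<open>F\<close> by a cocone
    compatible with \<open>G\<close>. Unions of the sets make \<open>Z\<close> closed under
    sums.\<close>
  define good where "good F G \<longleftrightarrow> finite F & F \<subseteq> Ob J & finite G & (ALL (i, j, f):G. i : F & j : F & f : Arr J i j)" for F and G :: "('u \<times> 'u \<times> 'u) set"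
  define cc where "cc F G k g \<longleftrightarrow> k : Ob J & (ALL j:F. g j : Arr J j k) & (ALL (i, j, f):G. Cmp J i j k (g j) f = g i)" for F G k g
  define adm where "adm F k g \<phi> \<longleftrightarrow> lin (sp P s) (sp (?D k) s) \<phi> & (ALL j:F. ALL d:carrier (sp (?D j) s). \<phi> (ev (\<kappa> j) s d) = ev (far D j k (g j)) s d)" for F k g \<phi>
  define Z where "Z u \<longleftrightarrow> (EX F G. good F G & (ALL k g \<phi>. cc F G k g --> adm F k g \<phi> --> \<phi> u = 0[sp (?D k) s]))" for u
  have goodU: "good (F \<union> F') (G \<union> G')" if "good F G" "good F' G'" for F F' G G'
   using that unfolding good_def by auto
  have ccU: "cc F G k g" "cc F' G' k g" if "cc (F \<union> F') (G \<union> G') k g" for F F' G G' k g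
   using that unfolding cc_def by auto
  have admU: "adm F k g \<phi>" "adm F' k g \<phi>" if "adm (F \<union> F') k g \<phi>" for F F' k g \<phi>
   using that unfolding adm_def by auto
  note Pm = sp_module[OF PD(1) s] and Bm = sp_module[OF BD(1) s]
  have rl: "lin (sp B s) (sp P s) (ev r s)" by (rule ev_lin[OF BD(1) PD(1) r(1) s])
  have km: "module K (sp (?D k) s)" if "cc F G k g" for F G k g using that sp_module[OF DO s] unfolding cc_def by blast
  have al: "lin (sp P s) (sp (?D k) s) \<phi>" if "adm F k g \<phi>" for F k g \<phi> using that unfolding adm_def by simp
  have "carrier (sp B s) \<subseteq> {b : carrier (sp B s). Z (ev r s b)}"
  proof (rule dsum_span[OF BD(4)[OF s] subspaceI])
   have "Z 0[sp P s]" unfolding Z_def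
   proof (intro exI conjI allI impI)
    show "good {} {}" by (simp add: good_def)
    fix k g \<phi> assume "cc {} {} k g" and "adm {} k g \<phi>"
    then show "\<phi> 0[sp P s] = 0[sp (?D k) s]" by (intro lin_zero[OF Pm km al])
   qed
   then show "0[sp B s] : {b : carrier (sp B s). Z (ev r s b)}" using lin_zero[OF Bm Pm rl] mod_closed(2)[OF Bm] by simp
  next
   fix x y assume x: "x : {b : carrier (sp B s). Z (ev r s b)}" and y: "y : {b : carrier (sp B s). Z (ev r s b)}"
   then have xy: "x <: sp B s" "y <: sp B s" by auto
   obtain F G where F: "good F G" "!!k g \<phi>. cc F G k g ==> adm F k g \<phi> ==> \<phi> (ev r s x) = 0[sp (?D k) s]" using x unfolding Z_def by blast
   obtain F' G' where F': "good F' G'" "!!k g \<phi>. cc F' G' k g ==> adm F' k g \<phi> ==> \<phi> (ev r s y) = 0[sp (?D k) s]" using y unfolding Z_def by blast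
   have "Z (ev r s (x +[sp B s] y))" unfolding Z_def
   proof (intro exI conjI allI impI)
    show "good (F \<union> F') (G \<union> G')" by (rule goodU[OF F(1) F'(1)])
    fix k g \<phi> assume cc: "cc (F \<union> F') (G \<union> G') k g" and ad: "adm (F \<union> F') k g \<phi>"
    show "\<phi> (ev r s (x +[sp B s] y)) = 0[sp (?D k) s]"
     using F(2)[OF ccU(1)[OF cc] admU(1)[OF ad]] F'(2)[OF ccU(2)[OF cc] admU(2)[OF ad]] km[OF cc]
      lin_add[OF rl xy] lin_add[OF al[OF ad] lin_closed[OF rl xy(1)] lin_closed[OF rl xy(2)]] by simp
   qed
   then show "x +[sp B s] y : {b : carrier (sp B s). Z (ev r s b)}" using mod_closed(1)[OF Bm xy] by simp
  next
   fix a x assume a: "a <: K" and x: "x : {b : carrier (sp B s). Z (ev r s b)}"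
   then have xy: "x <: sp B s" by auto
   obtain F G where F: "good F G" "!!k g \<phi>. cc F G k g ==> adm F k g \<phi> ==> \<phi> (ev r s x) = 0[sp (?D k) s]" using x unfolding Z_def by blast
   have "Z (ev r s (a *[sp B s] x))" unfolding Z_def
   proof (intro exI conjI allI impI)
    show "good F G" by (rule F(1))
    fix k g \<phi> assume cc: "cc F G k g" and ad: "adm F k g \<phi>"
    show "\<phi> (ev r s (a *[sp B s] x)) = 0[sp (?D k) s]"
     using F(2)[OF cc ad] km[OF cc] a lin_smult[OF rl a xy] lin_smult[OF al[OF ad] a lin_closed[OF rl xy]] by simp
   qed
   then show "a *[sp B s] x : {b : carrier (sp B s). Z (ev r s b)}" using mod_closed(5)[OF Bm a xy] by simp
  next
   fix t v assume t: "t : ?A" and v: "v <: sp (?D (fst t)) s"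
   obtain i j f where e: "t = (i, j, f)" by (cases t) auto
   have ij: "i : Ob J" "j : Ob J" "f : Arr J i j" using t e by auto
   have v': "v <: sp (?D i) s" using v e by simp
   note fv = ev_closed[OF DO[OF ij(1)] DO[OF ij(2)] DA[OF ij] s v']
   have "Z (ev r s (ev (\<beta> t) s v))" unfolding Z_def
   proof (intro exI conjI allI impI)
    show "good {i, j} {(i, j, f)}" using ij by (simp add: good_def)
    fix k g \<phi> assume cc: "cc {i, j} {(i, j, f)} k g" and ad: "adm {i, j} k g \<phi>"
    have k: "k : Ob J" "g i : Arr J i k" "g j : Arr J j k" "Cmp J i j k (g j) f = g i" using cc by (auto simp: cc_def)
    have \<phi>: "\<phi> (ev (\<kappa> i) s v) = ev (far D i k (g i)) s v"
     "\<phi> (ev (\<kappa> j) s (ev (far D i j f) s v)) = ev (far D j k (g j)) s (ev (far D i j f) s v)"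
     using ad v' fv by (auto simp: adm_def)
    have "ev (far D i k (g i)) s v = ev (far D j k (g j)) s (ev (far D i j f) s v)"
     using DC[OF ij(1,2) k(1) ij(3) k(3)] k(4)
      ev_cmp[OF DO[OF ij(1)] DO[OF ij(2)] DO[OF k(1)] DA[OF ij] DA[OF ij(2) k(1,3)] s v'] by simp
    moreover have "ev r s (ev (\<beta> t) s v) = ev (\<kappa> i) s v -[sp P s] ev (\<kappa> j) s (ev (far D i j f) s v)"
     using r(2)[OF t s v] he[OF ij s v'] e by simp
    moreover have "ev (far D j k (g j)) s (ev (far D i j f) s v) <: sp (?D k) s"
     by (rule ev_closed[OF DO[OF ij(2)] DO[OF k(1)] DA[OF ij(2) k(1,3)] s fv])
    ultimately show "\<phi> (ev r s (ev (\<beta> t) s v)) = 0[sp (?D k) s]"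
     using lin_diff[OF Pm km[OF cc] al[OF ad] ev_closed[OF DO[OF ij(1)] PD(1) PD(3)[OF ij(1)] s v']
       ev_closed[OF DO[OF ij(2)] PD(1) PD(3)[OF ij(2)] s fv]] \<phi> km[OF cc] by simp
   qed
   then show "ev (\<beta> t) s v : {b : carrier (sp B s). Z (ev r s b)}" using ev_closed[OF BD(2)[OF t] BD(1) BD(3)[OF t] s v] by simp
  qed simp
  then have "Z (ev (\<kappa> j0) s d0)" using b by auto
  then obtain F G where F: "good F G" "!!k g \<phi>. cc F G k g ==> adm F k g \<phi> ==> \<phi> (ev (\<kappa> j0) s d0) = 0[sp (?D k) s]"
   unfolding Z_def by blast
  have "EX k:Ob J. EX g. (ALL j:insert j0 F. g j : Arr J j k) & (ALL (i, j, f):G. Cmp J i j k (g j) f = g i)"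
   by (rule finite_cocone[OF J]) (use F(1) j0 in \<open>auto simp: good_def\<close>)
  then obtain k g where k: "k : Ob J" and g: "ALL j:insert j0 F. g j : Arr J j k" and gG: "ALL (i, j, f):G. Cmp J i j k (g j) f = g i"
   by (elim bexE exE conjE)
  \<comment> \<open>The cocone prescribes the test map on \<open>insert j0 F\<close>; it is
    continued by zero, as \<open>adm\<close> restricts it on \<open>F\<close> alone. The result is
    linear at the sort \<open>s\<close> but no arrow of the category, which is why
    \<open>adm\<close> asks for linearity only.\<close>
  let ?L = "%j d. if j : insert j0 F then ev (far D j k (g j)) s d else 0[sp (?D k) s]"
  have L: "lin (sp (?D j) s) (sp (?D k) s) (?L j)" if j: "j : Ob J" for j
  proof (cases "j : insert j0 F")
   case True
   then have "g j : Arr J j k" using g by blast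
   then show ?thesis using ev_lin[OF DO[OF j] DO[OF k] DA[OF j k] s] True by simp
  next
   case False then show ?thesis using lin_const_zero[OF sp_module[OF DO[OF k] s]] by simp
  qed
  let ?\<phi> = "dev (Ob J) (%j. sp (?D j) s) (\<pi> s) (sp (?D k) s) ?L"
  have \<phi>: "?\<phi> (ev (\<kappa> j) s d) = ?L j d" if "j : Ob J" "d <: sp (?D j) s" for j d
   using dsum_dev_inj[OF Pd sp_module[OF DO[OF k] s] L that] by simp
  have FJ: "F \<subseteq> Ob J" using F(1) by (simp add: good_def)
  have "adm F k g ?\<phi>" unfolding adm_def
   using dsum_dev_lin[OF Pd sp_module[OF DO[OF k] s] L] \<phi> FJ by auto
  moreover have "cc F G k g" using k g gG unfolding cc_def by blast
  ultimately have "?\<phi> (ev (\<kappa> j0) s d0) = 0[sp (?D k) s]" by (intro F(2))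
  then have "ev (far D j0 k (g j0)) s d0 = 0[sp (?D k) s]" using \<phi>[OF j0 d0] by simp
  moreover have "g j0 : Arr J j0 k" using g by blast
  ultimately show ?thesis using k by blast
 qed
qed

text \<open>By \<open>colimit_elements\<close> exactness is a chase of elements: each element is
  lifted to a stage, and an equation with zero that holds in the colimit is realised at a later
  stage, where the given sequence is exact.\<close>

lemma AB5: "exact_filtered_colimits U Cat"
 unfolding exact_filtered_colimits_def
proof (intro allI impI; elim conjE)
 fix J :: "('u, 'u) cat" and D E F \<sigma> \<tau> d e f \<iota>d \<iota>e \<iota>f u v
 assume J: "small_filtered U J" and D: "is_functor J Cat D" and E: "is_functor J Cat E" and F: "is_functor J Cat F"
  and \<sigma>: "nat_trans J Cat D E \<sigma>" and \<tau>: "nat_trans J Cat E F \<tau>"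
  and se: "ALL j:Ob J. short_exact Cat (fob D j) (fob E j) (fob F j) (\<sigma> j) (\<tau> j)"
  and cd: "is_colimit J Cat D d \<iota>d" and ce: "is_colimit J Cat E e \<iota>e" and cf: "is_colimit J Cat F f \<iota>f"
  and u: "u : Arr Cat d e" "ALL j:Ob J. Cmp Cat (fob D j) d e u (\<iota>d j) = Cmp Cat (fob D j) (fob E j) e (\<iota>e j) (\<sigma> j)"
  and v: "v : Arr Cat e f" "ALL j:Ob J. Cmp Cat (fob E j) e f v (\<iota>e j) = Cmp Cat (fob E j) (fob F j) f (\<iota>f j) (\<tau> j)"
 have o: "d : Ob Cat" "e : Ob Cat" "f : Ob Cat" using cd ce cf by (auto simp: is_colimit_def is_cocone_def)
 have io: "\<iota>d j : Arr Cat (fob D j) d" "\<iota>e j : Arr Cat (fob E j) e" "\<iota>f j : Arr Cat (fob F j) f" if "j : Ob J" for j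
  using cd ce cf that by (auto simp: is_colimit_def is_cocone_def)
 have DO: "fob D j : Ob Cat" "fob E j : Ob Cat" "fob F j : Ob Cat" if "j : Ob J" for j
  using D E F that unfolding is_functor_def by simp_all
 have DA: "far D i j f : Arr Cat (fob D i) (fob D j)" "far E i j f : Arr Cat (fob E i) (fob E j)" "far F i j f : Arr Cat (fob F i) (fob F j)"
  if "i : Ob J" "j : Ob J" "f : Arr J i j" for i j f
  using D E F that unfolding is_functor_def by simp_all
 have st: "\<sigma> j : Arr Cat (fob D j) (fob E j)" "\<tau> j : Arr Cat (fob E j) (fob F j)" if "j : Ob J" for j
  using \<sigma> \<tau> that unfolding nat_trans_def by simp_all
 show "short_exact Cat d e f u v"
  unfolding short_exact_iff
 proof (intro conjI ballI o u(1) v(1))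
  fix s assume s: "s : S"
  have inj: "inj_on (ev (\<sigma> j) s) (carrier (sp (fob D j) s))" and surj: "ev (\<tau> j) s ` carrier (sp (fob E j) s) = carrier (sp (fob F j) s)"
   and ex: "ev (\<sigma> j) s ` carrier (sp (fob D j) s) = {x : carrier (sp (fob E j) s). ev (\<tau> j) s x = 0[sp (fob F j) s]}" if "j : Ob J" for j
   using bspec[OF se that] s unfolding short_exact_iff by simp_all
  have ue: "ev u s (ev (\<iota>d j) s x) = ev (\<iota>e j) s (ev (\<sigma> j) s x)" if "j : Ob J" "x <: sp (fob D j) s" for j x
   using bspec[OF u(2) that(1)] ev_cmp[OF DO(1)[OF that(1)] o(1,2) io(1)[OF that(1)] u(1) s that(2)]
    ev_cmp[OF DO(1)[OF that(1)] DO(2)[OF that(1)] o(2) st(1)[OF that(1)] io(2)[OF that(1)] s that(2)] by simp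
  have ve: "ev v s (ev (\<iota>e j) s x) = ev (\<iota>f j) s (ev (\<tau> j) s x)" if "j : Ob J" "x <: sp (fob E j) s" for j x
   using bspec[OF v(2) that(1)] ev_cmp[OF DO(2)[OF that(1)] o(2,3) io(2)[OF that(1)] v(1) s that(2)]
    ev_cmp[OF DO(2)[OF that(1)] DO(3)[OF that(1)] o(3) st(2)[OF that(1)] io(3)[OF that(1)] s that(2)] by simp
  have tr: "ev (\<iota>d j) s (ev (far D i j g) s x) = ev (\<iota>d i) s x" if "i : Ob J" "j : Ob J" "g : Arr J i j" "x <: sp (fob D i) s" for i j g x
   using ev_cmp[OF DO(1)[OF that(1)] DO(1)[OF that(2)] o(1) DA(1)[OF that(1-3)] io(1)[OF that(2)] s that(4)] cd that(1-3)
   by (simp add: is_colimit_def is_cocone_def)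
  have tre: "ev (\<iota>e j) s (ev (far E i j g) s x) = ev (\<iota>e i) s x" if "i : Ob J" "j : Ob J" "g : Arr J i j" "x <: sp (fob E i) s" for i j g x
   using ev_cmp[OF DO(2)[OF that(1)] DO(2)[OF that(2)] o(2) DA(2)[OF that(1-3)] io(2)[OF that(2)] s that(4)] ce that(1-3)
   by (simp add: is_colimit_def is_cocone_def)
  have ns: "ev (far E i j g) s (ev (\<sigma> i) s x) = ev (\<sigma> j) s (ev (far D i j g) s x)" if "i : Ob J" "j : Ob J" "g : Arr J i j" "x <: sp (fob D i) s" for i j g x
   using ev_cmp[OF DO(1)[OF that(1)] DO(2)[OF that(1)] DO(2)[OF that(2)] st(1)[OF that(1)] DA(2)[OF that(1-3)] s that(4)]
    ev_cmp[OF DO(1)[OF that(1)] DO(1)[OF that(2)] DO(2)[OF that(2)] DA(1)[OF that(1-3)] st(1)[OF that(2)] s that(4)] \<sigma> that(1-3)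
   unfolding nat_trans_def by simp
  have nt: "ev (far F i j g) s (ev (\<tau> i) s x) = ev (\<tau> j) s (ev (far E i j g) s x)" if "i : Ob J" "j : Ob J" "g : Arr J i j" "x <: sp (fob E i) s" for i j g x
   using ev_cmp[OF DO(2)[OF that(1)] DO(3)[OF that(1)] DO(3)[OF that(2)] st(2)[OF that(1)] DA(3)[OF that(1-3)] s that(4)]
    ev_cmp[OF DO(2)[OF that(1)] DO(2)[OF that(2)] DO(3)[OF that(2)] DA(2)[OF that(1-3)] st(2)[OF that(2)] s that(4)] \<tau> that(1-3)
   unfolding nat_trans_def by simp
  note cDs = colimit_elements[OF J D cd s] and cEs = colimit_elements[OF J E ce s] and cFs = colimit_elements[OF J F cf s]
  show "inj_on (ev u s) (carrier (sp d s))"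
   unfolding lin_inj_iff[OF sp_module[OF o(1) s] sp_module[OF o(2) s] ev_lin[OF o(1,2) u(1) s]]
  proof (intro ballI impI)
   fix x assume x: "x <: sp d s" and z: "ev u s x = 0[sp e s]"
   obtain j a where j: "j : Ob J" "a <: sp (fob D j) s" "x = ev (\<iota>d j) s a" using cDs(1)[OF x] by blast
   have "ev (\<iota>e j) s (ev (\<sigma> j) s a) = 0[sp e s]" using ue[OF j(1,2)] z j(3) by simp
   then obtain k g where k: "k : Ob J" "g : Arr J j k" "ev (far E j k g) s (ev (\<sigma> j) s a) = 0[sp (fob E k) s]"
    using cEs(2)[OF j(1) ev_closed[OF DO(1)[OF j(1)] DO(2)[OF j(1)] st(1)[OF j(1)] s j(2)]] by blast
   let ?b = "ev (far D j k g) s a"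
   have bc: "?b <: sp (fob D k) s" by (rule ev_closed[OF DO(1)[OF j(1)] DO(1)[OF k(1)] DA(1)[OF j(1) k(1,2)] s j(2)])
   have "ev (\<sigma> k) s ?b = 0[sp (fob E k) s]" using ns[OF j(1) k(1,2) j(2)] k(3) by simp
   then have "?b = 0[sp (fob D k) s]"
    using inj[OF k(1)] bc unfolding lin_inj_iff[OF sp_module[OF DO(1)[OF k(1)] s] sp_module[OF DO(2)[OF k(1)] s] ev_lin[OF DO(1)[OF k(1)] DO(2)[OF k(1)] st(1)[OF k(1)] s]] by simp
   then show "x = 0[sp d s]" using tr[OF j(1) k(1,2) j(2)] j(3) ev_zero[OF DO(1)[OF k(1)] o(1) io(1)[OF k(1)] s] by simp
  qed
  show "ev v s ` carrier (sp e s) = carrier (sp f s)"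
  proof (intro equalityI subsetI)
   fix x assume "x <: sp f s"
   then obtain j c where j: "j : Ob J" "c <: sp (fob F j) s" "x = ev (\<iota>f j) s c" using cFs(1) by blast
   have "c : ev (\<tau> j) s ` carrier (sp (fob E j) s)" unfolding surj[OF j(1)] by (rule j(2))
   then obtain b where b: "b <: sp (fob E j) s" "c = ev (\<tau> j) s b" by blast
   have "x = ev v s (ev (\<iota>e j) s b)" using ve[OF j(1) b(1)] j(3) b(2) by simp
   then show "x : ev v s ` carrier (sp e s)" using ev_closed[OF DO(2)[OF j(1)] o(2) io(2)[OF j(1)] s b(1)] by (rule image_eqI)
  next
   fix x assume "x : ev v s ` carrier (sp e s)"
   then show "x <: sp f s" using ev_closed[OF o(2,3) v(1) s] by auto
  qed
  show "ev u s ` carrier (sp d s) = {x : carrier (sp e s). ev v s x = 0[sp f s]}"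
  proof (intro equalityI subsetI)
   fix x assume "x : ev u s ` carrier (sp d s)"
   then obtain y where y: "y <: sp d s" "x = ev u s y" by blast
   obtain j a where j: "j : Ob J" "a <: sp (fob D j) s" "y = ev (\<iota>d j) s a" using cDs(1)[OF y(1)] by blast
   have "ev (\<sigma> j) s a : {x : carrier (sp (fob E j) s). ev (\<tau> j) s x = 0[sp (fob F j) s]}"
    unfolding ex[OF j(1), symmetric] by (rule imageI[OF j(2)])
   then have a: "ev (\<sigma> j) s a <: sp (fob E j) s" "ev (\<tau> j) s (ev (\<sigma> j) s a) = 0[sp (fob F j) s]" by auto
   have "ev v s x = 0[sp f s]"
    using ve[OF j(1) a(1)] a(2) ue[OF j(1,2)] y(2) j(3) ev_zero[OF DO(3)[OF j(1)] o(3) io(3)[OF j(1)] s] by simp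
   then show "x : {x : carrier (sp e s). ev v s x = 0[sp f s]}" using ev_closed[OF o(1,2) u(1) s y(1)] y(2) by simp
  next
   fix x assume "x : {x : carrier (sp e s). ev v s x = 0[sp f s]}"
   then have x: "x <: sp e s" "ev v s x = 0[sp f s]" by auto
   obtain j b where j: "j : Ob J" "b <: sp (fob E j) s" "x = ev (\<iota>e j) s b" using cEs(1)[OF x(1)] by blast
   have "ev (\<iota>f j) s (ev (\<tau> j) s b) = 0[sp f s]" using ve[OF j(1,2)] x(2) j(3) by simp
   then obtain k g where k: "k : Ob J" "g : Arr J j k" "ev (far F j k g) s (ev (\<tau> j) s b) = 0[sp (fob F k) s]"
    using cFs(2)[OF j(1) ev_closed[OF DO(2)[OF j(1)] DO(3)[OF j(1)] st(2)[OF j(1)] s j(2)]] by blast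
   let ?b = "ev (far E j k g) s b"
   have bc: "?b <: sp (fob E k) s" by (rule ev_closed[OF DO(2)[OF j(1)] DO(2)[OF k(1)] DA(2)[OF j(1) k(1,2)] s j(2)])
   have "?b : ev (\<sigma> k) s ` carrier (sp (fob D k) s)"
    unfolding ex[OF k(1)] using bc nt[OF j(1) k(1,2) j(2)] k(3) by simp
   then obtain a where a: "a <: sp (fob D k) s" "?b = ev (\<sigma> k) s a" by blast
   have "x = ev u s (ev (\<iota>d k) s a)" using ue[OF k(1) a(1)] tre[OF j(1) k(1,2) j(2)] a(2) j(3) by simp
   then show "x : ev u s ` carrier (sp d s)" using ev_closed[OF DO(1)[OF k(1)] o(1) io(1)[OF k(1)] s a(1)] by (rule image_eqI)
  qed
 qed
qed

theorem grothendieck: "grothendieck_cat U Cat"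
 unfolding grothendieck_cat_def using abelian has_coproducts AB5 generator_ex by blast

end

section \<open>The category of entwined modules\<close>

context entw
begin

lemma entmod_cat_sel:
 "Ob (entmod_cat U K C R) = {M. is_entmod K C R M & (ALL r:lobj R. small U (carrier (esp M r)))}"
 "\<eta> : Arr (entmod_cat U K C R) M N \<longleftrightarrow> ehom M N \<eta> & eres M \<eta> = \<eta>"
 "Idn (entmod_cat U K C R) M = eres M (%r m. m)"
 "Cmp (entmod_cat U K C R) M N P \<zeta> \<eta> = eres M (%r m. \<zeta> r (\<eta> r m))"
proof -
 show "\<eta> : Arr (entmod_cat U K C R) M N \<longleftrightarrow> ehom M N \<eta> & eres M \<eta> = \<eta>"
  by (simp add: entmod_cat_def entmod_hom_iff)
qed (simp_all add: entmod_cat_def entmod_id_def entmod_comp_def eres_def compose_def)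

lemma small_carrier_mono: "small U B ==> A \<subseteq> B ==> small U A"
 unfolding small_def by (rule ordLeq_ordLess_trans[OF card_of_mono1])

lemma small_carrier_image: "small U B ==> small U (f ` B)"
 unfolding small_def by (rule ordLeq_ordLess_trans[OF card_of_image])

lemma entmod_cat_kernel:
 fixes a b :: "('k, 'o, 'm, 'c, 'v) entmod"
 assumes "a : Ob (entmod_cat U K C R)" "b : Ob (entmod_cat U K C R)" "f : Arr (entmod_cat U K C R) a b"
 shows "EX k:Ob (entmod_cat U K C R). EX i:Arr (entmod_cat U K C R) k a. ALL s:lobj R. inj_on (i s) (carrier (esp k s)) &
    i s ` carrier (esp k s) = {x : carrier (esp a s). f s x = 0[esp b s]}"
proof -
 have a: "is_entmod K C R a" and b: "is_entmod K C R b" and f: "ehom a b f"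
  and sm: "ALL r:lobj R. small U (carrier (esp a r))"
  using assms by (simp_all add: entmod_cat_sel)
 show ?thesis
 proof (rule entmod_kernel[OF a b f])
  fix L :: "('k, 'o, 'm, 'c, 'v) entmod" assume L: "is_entmod K C R L" "!!r. carrier (esp L r) = {m : carrier (esp a r). f r m = 0[esp b r]}" "ehom L a (%r x. x)"
  have "small U (carrier (esp L r))" if "r <. R" for r
   by (rule small_carrier_mono[of _ "carrier (esp a r)"]) (use sm that L(2) in auto)
  then have "L : Ob (entmod_cat U K C R)" using L(1) by (simp add: entmod_cat_sel)
  moreover have "eres L (%r x. x) : Arr (entmod_cat U K C R) L a"
   using ehom_eres[OF entmodD(1)[OF L(1)] entmodD(1)[OF a] L(3)] by (simp add: entmod_cat_sel entmod_hom_iff)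
  moreover have "inj_on (eres L (%r x. x) s) (carrier (esp L s)) &
    eres L (%r x. x) s ` carrier (esp L s) = {x : carrier (esp a s). f s x = 0[esp b s]}" if s: "s <. R" for s
  proof
   show "inj_on (eres L (%r x. x) s) (carrier (esp L s))" using s by (simp add: inj_on_def)
   have "eres L (%r x. x) s ` carrier (esp L s) = (%x. x) ` carrier (esp L s)" using s by (intro image_cong) simp_all
   then show "eres L (%r x. x) s ` carrier (esp L s) = {x : carrier (esp a s). f s x = 0[esp b s]}" by (simp add: L(2))
  qed
  ultimately show ?thesis by blast
 qed
qed

lemma entmod_cat_cokernel:
 fixes a b :: "('k, 'o, 'm, 'c, 'v) entmod"
 assumes "a : Ob (entmod_cat U K C R)" "b : Ob (entmod_cat U K C R)" "f : Arr (entmod_cat U K C R) a b"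
 shows "EX q:Ob (entmod_cat U K C R). EX p:Arr (entmod_cat U K C R) b q. ALL s:lobj R. p s ` carrier (esp b s) = carrier (esp q s) &
    {x : carrier (esp b s). p s x = 0[esp q s]} = f s ` carrier (esp a s)"
proof -
 have a: "is_entmod K C R a" and b: "is_entmod K C R b" and f: "ehom a b f"
  and sm: "ALL r:lobj R. small U (carrier (esp b r))"
  using assms by (simp_all add: entmod_cat_sel)
 show ?thesis
 proof (rule entmod_cokernel[OF a b f])
  fix Q :: "('k, 'o, 'm, 'c, 'v) entmod" and e assume Q: "is_entmod K C R Q" "ehom b Q e" "!!r. carrier (esp Q r) = e r ` carrier (esp b r)"
   "!!r. r <. R ==> {m : carrier (esp b r). e r m = 0[esp Q r]} = f r ` carrier (esp a r)"
  have "small U (carrier (esp Q r))" if "r <. R" for r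
   unfolding Q(3) by (rule small_carrier_image) (use sm that in simp)
  then have "Q : Ob (entmod_cat U K C R)" using Q(1) by (simp add: entmod_cat_sel)
  moreover have "eres b e : Arr (entmod_cat U K C R) b Q"
   using ehom_eres[OF entmodD(1)[OF b] entmodD(1)[OF Q(1)] Q(2)] by (simp add: entmod_cat_sel entmod_hom_iff)
  moreover have "eres b e s ` carrier (esp b s) = carrier (esp Q s) &
    {x : carrier (esp b s). eres b e s x = 0[esp Q s]} = f s ` carrier (esp a s)" if s: "s <. R" for s
  proof
   show "eres b e s ` carrier (esp b s) = carrier (esp Q s)" unfolding Q(3) using s by (intro image_cong) simp_all
   have "{x : carrier (esp b s). eres b e s x = 0[esp Q s]} = {x : carrier (esp b s). e s x = 0[esp Q s]}" using s by auto
   then show "{x : carrier (esp b s). eres b e s x = 0[esp Q s]} = f s ` carrier (esp a s)" using Q(4)[OF s] by simp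
  qed
  ultimately show ?thesis by blast
 qed
qed

lemma entmod_conc:
 "conc K (entmod_cat U K C R :: (('k, 'o, 'm, 'c, 'v) entmod, 'o => 'v => 'v) cat) (lobj R) esp (%\<eta>. \<eta>)"
proof ((rule conc.intro[OF ground_axioms], rule conc_axioms.intro); ((rule entmod_cat_kernel entmod_cat_cokernel; assumption) | (unfold entmod_cat_sel mem_Collect_eq; (elim conjE)?)))
 fix a :: "('k, 'o, 'm, 'c, 'v) entmod" and r assume "is_entmod K C R a" "r <. R"
 then show "module K (esp a r)" by (rule entmod_module)
next
 fix a b :: "('k, 'o, 'm, 'c, 'v) entmod" and f r assume "ehom a b f" "r <. R"
 then show "lin (esp a r) (esp b r) (f r)" by (rule ehomD(2))
next
 fix a :: "('k, 'o, 'm, 'c, 'v) entmod" and f g :: "'o => 'v => 'v"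
 assume fg: "eres a f = f" "eres a g = g" and eq: "!!s x. s <. R ==> x <: esp a s ==> f s x = g s x"
 have "eres a f = eres a g" by (rule eres_cong[OF eq])
 then show "f = g" unfolding fg .
next
 fix a :: "('k, 'o, 'm, 'c, 'v) entmod" assume "is_entmod K C R a"
 then show "ehom a a (eres a (%r m. m)) & eres a (eres a (%r m. m)) = eres a (%r m. m)"
  using ehom_eres[OF entmodD(1) entmodD(1) ehom_id[OF entmodD(1)]] by (simp add: entmod_hom_iff)
next
 fix a :: "('k, 'o, 'm, 'c, 'v) entmod" and s x assume "s <. R" "x <: esp a s"
 then show "eres a (%r m. m) s x = x" by simp
next
 fix a b c :: "('k, 'o, 'm, 'c, 'v) entmod" and f g assume a: "is_entmod K C R a" and b: "is_entmod K C R b" and c: "is_entmod K C R c" and f: "ehom a b f" and g: "ehom b c g"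
 show "ehom a c (eres a (%r m. g r (f r m))) & eres a (eres a (%r m. g r (f r m))) = eres a (%r m. g r (f r m))"
  using ehom_eres[OF entmodD(1)[OF a] entmodD(1)[OF c] ehom_comp[OF entmodD(1)[OF a] entmodD(1)[OF b] entmodD(1)[OF c] f g]]
  by (simp add: entmod_hom_iff)
next
 fix a :: "('k, 'o, 'm, 'c, 'v) entmod" and f g :: "'o => 'v => 'v" and s x assume "s <. R" "x <: esp a s"
 then show "eres a (%r m. g r (f r m)) s x = g s (f s x)" by simp
next
 fix a b :: "('k, 'o, 'm, 'c, 'v) entmod" assume a: "is_entmod K C R a" and b: "is_entmod K C R b"
 have "eres a (%r m. 0[esp b r]) : Arr (entmod_cat U K C R) a b"
  using ehom_eres[OF entmodD(1)[OF a] entmodD(1)[OF b] ehom_zero[OF entmodD(1)[OF a] entmodD(1)[OF b]]] by (simp add: entmod_cat_sel entmod_hom_iff)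
 then show "EX f:Arr (entmod_cat U K C R) a b. ALL s:lobj R. ALL x:carrier (esp a s). f s x = 0[esp b s]"
  by (rule bexI[rotated]) simp
next
 fix a b :: "('k, 'o, 'm, 'c, 'v) entmod" and f g assume a: "is_entmod K C R a" and b: "is_entmod K C R b" and f: "ehom a b f" and g: "ehom a b g"
 have "eres a (%r m. f r m -[esp b r] g r m) : Arr (entmod_cat U K C R) a b"
  using ehom_eres[OF entmodD(1)[OF a] entmodD(1)[OF b] ehom_minus[OF entmodD(1)[OF a] entmodD(1)[OF b] f g]] by (simp add: entmod_cat_sel entmod_hom_iff)
 then show "EX h:Arr (entmod_cat U K C R) a b. ALL s:lobj R. ALL x:carrier (esp a s). h s x = f s x -[esp b s] g s x"
  by (rule bexI[rotated]) simp
next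
 fix a b c :: "('k, 'o, 'm, 'c, 'v) entmod" and i h assume a: "is_entmod K C R a" and b: "is_entmod K C R b" and c: "is_entmod K C R c"
  and i: "ehom b c i" and h: "ehom a c h" and inj: "!!s. s <. R ==> inj_on (i s) (carrier (esp b s))"
  and im: "!!s x. s <. R ==> x <: esp a s ==> h s x : i s ` carrier (esp b s)"
 let ?u = "%r x. the_inv_into (carrier (esp b r)) (i r) (h r x)"
 have u: "?u r x <: esp b r" "i r (?u r x) = h r x" if "r <. R" "x <: esp a r" for r x
  using the_inv_into_into[OF inj[OF that(1)] im[OF that] subset_refl] f_the_inv_into_f[OF inj[OF that(1)] im[OF that]] by auto
 have "ehom a b ?u" by (rule ehom_factor_inj[OF entmodD(1)[OF a] entmodD(1)[OF b] entmodD(1)[OF c] i inj h u])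
 then have "eres a ?u : Arr (entmod_cat U K C R) a b"
  using ehom_eres[OF entmodD(1)[OF a] entmodD(1)[OF b]] by (simp add: entmod_cat_sel entmod_hom_iff)
 then show "EX u:Arr (entmod_cat U K C R) a b. ALL s:lobj R. ALL x:carrier (esp a s). i s (u s x) = h s x"
  by (rule bexI[rotated]) (simp add: u)
next
 fix a b c :: "('k, 'o, 'm, 'c, 'v) entmod" and p h assume a: "is_entmod K C R a" and b: "is_entmod K C R b" and c: "is_entmod K C R c"
  and p: "ehom a b p" and h: "ehom a c h" and surj: "!!s. s <. R ==> p s ` carrier (esp a s) = carrier (esp b s)"
  and ker: "!!s x. s <. R ==> x <: esp a s ==> p s x = 0[esp b s] ==> h s x = 0[esp c s]"
 \<comment> \<open>The value at \<open>y\<close> is computed from an arbitrary preimage; by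
   \<open>ker\<close> the map \<open>h\<close> is constant on the fibres of
   \<open>p\<close>.\<close>
 let ?u = "%r y. h r (SOME x. x <: esp a r & p r x = y)"
 have u: "?u r (p r x) = h r x" if r: "r <. R" and x: "x <: esp a r" for r x
 proof -
  let ?y = "SOME y. y <: esp a r & p r y = p r x"
  have y: "?y <: esp a r" "p r ?y = p r x" using someI[of "%y. y <: esp a r & p r y = p r x" x] x by auto
  note m = entmod_module[OF a r] entmod_module[OF b r] entmod_module[OF c r]
  have "p r (?y -[esp a r] x) = 0[esp b r]"
   using lin_diff[OF m(1,2) ehomD(2)[OF p r] y(1) x] y(2) m(2) ehomD(3)[OF p r x] by simp
  then have "h r (?y -[esp a r] x) = 0[esp c r]" by (rule ker[OF r mod_closed(4)[OF m(1) y(1) x]])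
  then show ?thesis
   using lin_diff[OF m(1,3) ehomD(2)[OF h r] y(1) x] mod_diff_eq_0[OF m(3) ehomD(3)[OF h r y(1)] ehomD(3)[OF h r x]] by simp
 qed
 have "ehom b c ?u" by (rule ehom_factor_surj[OF entmodD(1)[OF a] entmodD(1)[OF b] entmodD(1)[OF c] p surj h u])
 then have "eres b ?u : Arr (entmod_cat U K C R) b c"
  using ehom_eres[OF entmodD(1)[OF b] entmodD(1)[OF c]] by (simp add: entmod_cat_sel entmod_hom_iff)
 then show "EX u:Arr (entmod_cat U K C R) b c. ALL s:lobj R. ALL x:carrier (esp a s). u s (p s x) = h s x"
  by (rule bexI[rotated]) (simp add: u ehomD(3)[OF p])
qed

text \<open>The inverse of a bijective morphism is again a morphism, being the factorisation of the
  identity through an injective morphism.\<close>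

lemma entmod_iso_iff:
 assumes A: "preent A" and B: "preent B"
 shows "entmod_iso K C R A B \<eta> \<longleftrightarrow> \<eta> : entmod_hom K C R A B & (ALL r:lobj R. bij_betw (\<eta> r) (carrier (esp A r)) (carrier (esp B r)))"
proof
 assume "entmod_iso K C R A B \<eta>"
 then obtain \<zeta> where \<eta>: "\<eta> : entmod_hom K C R A B" and \<zeta>: "\<zeta> : entmod_hom K C R B A"
  and c: "entmod_comp R A \<zeta> \<eta> = entmod_id R A" "entmod_comp R B \<eta> \<zeta> = entmod_id R B" unfolding entmod_iso_def by blast
 have h: "ehom A B \<eta>" "ehom B A \<zeta>" using \<eta> \<zeta> by (auto simp: entmod_hom_iff)
 have 1: "\<zeta> r (\<eta> r x) = x" if "r <. R" "x <: esp A r" for r x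
  using fun_cong[OF fun_cong[OF c(1)], of r x] that by (simp add: entmod_comp_def entmod_id_def compose_def)
 have 2: "\<eta> r (\<zeta> r x) = x" if "r <. R" "x <: esp B r" for r x
  using fun_cong[OF fun_cong[OF c(2)], of r x] that by (simp add: entmod_comp_def entmod_id_def compose_def)
 have "bij_betw (\<eta> r) (carrier (esp A r)) (carrier (esp B r))" if r: "r <. R" for r
  by (rule bij_betw_byWitness[of _ "\<zeta> r"]) (use 1 2 r ehomD(3)[OF h(1) r] ehomD(3)[OF h(2) r] in auto)
 then show "\<eta> : entmod_hom K C R A B & (ALL r:lobj R. bij_betw (\<eta> r) (carrier (esp A r)) (carrier (esp B r)))" using \<eta> by blast
next
 assume *: "\<eta> : entmod_hom K C R A B & (ALL r:lobj R. bij_betw (\<eta> r) (carrier (esp A r)) (carrier (esp B r)))"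
 then have h: "ehom A B \<eta>" and inj: "!!r. r <. R ==> inj_on (\<eta> r) (carrier (esp A r))"
  and im: "!!r. r <. R ==> \<eta> r ` carrier (esp A r) = carrier (esp B r)" by (auto simp: entmod_hom_iff bij_betw_def)
 let ?u = "%r x. the_inv_into (carrier (esp A r)) (\<eta> r) x"
 have u: "?u r x <: esp A r" "\<eta> r (?u r x) = x" if "r <. R" "x <: esp B r" for r x
  using the_inv_into_into[OF inj[OF that(1)] _ subset_refl, of x] f_the_inv_into_f[OF inj[OF that(1)], of x] im[OF that(1)] that(2) by auto
 have u': "?u r (\<eta> r x) = x" if "r <. R" "x <: esp A r" for r x by (rule the_inv_into_f_f[OF inj[OF that(1)] that(2)])
 have "ehom B A ?u" by (rule ehom_factor_inj[OF B A B h inj ehom_id[OF B] u])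
 then have "eres B ?u : entmod_hom K C R B A" by (rule ehom_eres[OF B A])
 moreover have "entmod_comp R A (eres B ?u) \<eta> = entmod_id R A"
  unfolding entmod_comp_def entmod_id_def compose_def by (intro restrict_ext) (simp add: u' ehomD(3)[OF h])
 moreover have "entmod_comp R B \<eta> (eres B ?u) = entmod_id R B"
  unfolding entmod_comp_def entmod_id_def compose_def by (intro restrict_ext) (simp add: u)
 ultimately show "entmod_iso K C R A B \<eta>" unfolding entmod_iso_def using * by blast
qed

end

section \<open>Extension of scalars\<close>

locale entmor = coalg K C for K :: "('k, 'z) ring_scheme" (structure) and C :: "('k, 'c) coalgebra" +
 fixes R :: "('k, 'o, 'm, 'c) entwining" and S :: "('k, 'o2, 'm2, 'c) entwining" and \<alpha> :: "('o, 'm, 'o2, 'm2) linfun"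
 assumes R: "is_entwining K C R" and S: "is_entwining K C S" and mor: "is_entwining_mor K C R S \<alpha>"
begin

abbreviation "es \<equiv> ext_sp K R S \<alpha>"
abbreviation "ec \<equiv> ext_cls K R S \<alpha>"
abbreviation "em \<equiv> ext_map K R S \<alpha>"

sublocale R: entw K C R by unfold_locales (rule R)
sublocale S: entw K C S by unfold_locales (rule S)

lemma \<alpha>_ob: "r <. R ==> lfob \<alpha> r <. S"
 and \<alpha>_lin: "r <. R ==> s <. R ==> lin (lhom R r s) (lhom S (lfob \<alpha> r) (lfob \<alpha> s)) (lfar \<alpha> r s)"
 using mor by (auto simp: is_entwining_mor_def is_linfun_def)

abbreviation T :: "'o2 => 'o => ('k, 'm2) module" where "T s r \<equiv> lhom S s (lfob \<alpha> r)"

lemma T_module: "s <. S ==> r <. R ==> module K (T s r)"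
 by (simp add: \<alpha>_ob)

lemma T_act:
 assumes "s <. S" "r <. R" "r' <. R" "g <: lhom R r r'" "f <: T s r"
 shows "lcomp S s (lfob \<alpha> r) (lfob \<alpha> r') (lfar \<alpha> r r' g) f <: T s r'"
 by (rule S.lcomp_closed[OF assms(1) \<alpha>_ob[OF assms(2)] \<alpha>_ob[OF assms(3)] lin_closed[OF \<alpha>_lin[OF assms(2,3)] assms(4)] assms(5)])

section \<open>The vector spaces of the extension along a morphism\<close>

context
 fixes M :: "('k, 'o, 'm, 'c, 'v) entmod" and s :: 'o2
 assumes M: "R.preent M" and s: "s <. S"
begin

lemma ext_sum_dsum:
 "is_dsum (lobj R) (ext_summand K S \<alpha> M s) (ext_sum K R S \<alpha> M s) (dsum_inj (lobj R) (ext_summand K S \<alpha> M s)) (%r u. u r)"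
 unfolding ext_sum_def
 by (rule dsum_mod_is_dsum) (simp add: ext_summand_def R.preentD(1)[OF M] T_module[OF s])

lemma ext_pre_bilin:
 assumes r: "r <. R"
 shows "bilin (esp M r) (T s r) (ext_sum K R S \<alpha> M s) (ext_pre K R S \<alpha> M s r)"
proof -
 have l: "lin (tensor K (esp M r) (T s r)) (ext_sum K R S \<alpha> M s) (dsum_inj (lobj R) (ext_summand K S \<alpha> M s) r)"
  using is_dsumD(3)[OF ext_sum_dsum r] by (simp add: ext_summand_def)
 show ?thesis using bilin_lin[OF tens_bilin[OF R.preentD(1)[OF M r] T_module[OF s r]] l] by (simp add: ext_pre_def[abs_def])
qed

lemma ext_null_subspace: "subspace (ext_sum K R S \<alpha> M s) (ext_null K R S \<alpha> M s)"
proof -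
 have E: "module K (ext_sum K R S \<alpha> M s)" by (rule is_dsumD(1)[OF ext_sum_dsum])
 show ?thesis unfolding ext_null_def
 proof (rule span_subspace[OF E], rule subsetI, elim CollectE exE conjE, hypsubst)
  fix r r' m' g f
  assume a: "r <. R" "r' <. R" "m' <: esp M r'" "g <: lhom R r r'" "f <: T s r"
  show "ext_pre K R S \<alpha> M s r' m' (lcomp S s (lfob \<alpha> r) (lfob \<alpha> r') (lfar \<alpha> r r' g) f)
     -[ext_sum K R S \<alpha> M s] ext_pre K R S \<alpha> M s r (eact M r r' m' g) f <: ext_sum K R S \<alpha> M s"
   by (rule mod_closed(4)[OF E bilinD(3)[OF ext_pre_bilin[OF a(2)] a(3) T_act[OF s a(1,2,4,5)]]
      bilinD(3)[OF ext_pre_bilin[OF a(1)] bilinD(3)[OF R.preentD(3)[OF M a(1,2)] a(3,4)] a(5)]])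
 qed
qed

lemma ext_sp_module: "module K (es M s)"
 unfolding ext_sp_def by (rule quot_module[OF is_dsumD(1)[OF ext_sum_dsum] ext_null_subspace])

lemma ext_cls_bilin: "r <. R ==> bilin (esp M r) (T s r) (es M s) (ec M s r)"
 using bilin_lin[OF ext_pre_bilin quot_lin[OF is_dsumD(1)[OF ext_sum_dsum] ext_null_subspace]]
 by (simp add: ext_cls_def[abs_def] ext_sp_def)

lemmas ext_cls_closed = bilinD(3)[OF ext_cls_bilin]

text \<open>The extension is a quotient of a direct sum of tensor products, and the claim is reduced
  through these three layers to the classes of pure tensors.\<close>

lemma ext_span:
 assumes H: "subspace (es M s) H"
  and cls: "!!r m f. r <. R ==> m <: esp M r ==> f <: T s r ==> ec M s r m f : H"
 shows "carrier (es M s) \<subseteq> H"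
proof -
 let ?P = "ext_sum K R S \<alpha> M s" and ?N = "ext_null K R S \<alpha> M s"
 note P = is_dsumD(1)[OF ext_sum_dsum]
 have H': "subspace (quot_mod ?P ?N) H" using H by (simp add: ext_sp_def)
 have sub: "subspace ?P {u : carrier ?P. ?N +>\<^bsub>?P\<^esub> u : H}"
  by (rule subspace_vimage[OF P quot_module[OF P ext_null_subspace] quot_lin[OF P ext_null_subspace] H'])
 have "carrier ?P \<subseteq> {u : carrier ?P. ?N +>\<^bsub>?P\<^esub> u : H}"
 proof (rule dsum_span[OF ext_sum_dsum sub])
  fix r t assume r: "r <. R" and t: "t <: ext_summand K S \<alpha> M s r"
  note D = is_dsumD(2,3)[OF ext_sum_dsum r]
  have "carrier (tensor K (esp M r) (T s r)) \<subseteq> {t : carrier (tensor K (esp M r) (T s r)).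
    dsum_inj (lobj R) (ext_summand K S \<alpha> M s) r t : {u : carrier ?P. ?N +>\<^bsub>?P\<^esub> u : H}}"
  proof (rule tensor_subspace_all[OF R.preentD(1)[OF M r] T_module[OF s r]])
   show "subspace (tensor K (esp M r) (T s r)) {t : carrier (tensor K (esp M r) (T s r)).
     dsum_inj (lobj R) (ext_summand K S \<alpha> M s) r t : {u : carrier ?P. ?N +>\<^bsub>?P\<^esub> u : H}}"
    using subspace_vimage[OF D(1) P D(2) sub] by (simp add: ext_summand_def)
   fix m f assume m: "m <: esp M r" and f: "f <: T s r"
   show "tens K (esp M r) (T s r) m f : {t : carrier (tensor K (esp M r) (T s r)).
     dsum_inj (lobj R) (ext_summand K S \<alpha> M s) r t : {u : carrier ?P. ?N +>\<^bsub>?P\<^esub> u : H}}"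
    using cls[OF r m f] tens_closed[OF R.preentD(1)[OF M r] T_module[OF s r] m f] bilinD(3)[OF ext_pre_bilin[OF r] m f]
    by (simp add: ext_cls_def ext_pre_def)
  qed
  then show "dsum_inj (lobj R) (ext_summand K S \<alpha> M s) r t : {u : carrier ?P. ?N +>\<^bsub>?P\<^esub> u : H}"
   using t by (auto simp: ext_summand_def)
 qed
 then show ?thesis unfolding ext_sp_def quot_carrier by auto
qed

lemma ext_cls_balanced:
 assumes a: "r <. R" "r' <. R" "m' <: esp M r'" "g <: lhom R r r'" "f <: T s r"
 shows "ec M s r' m' (lcomp S s (lfob \<alpha> r) (lfob \<alpha> r') (lfar \<alpha> r r' g) f) =
  ec M s r (eact M r r' m' g) f"
proof -
 note P = is_dsumD(1)[OF ext_sum_dsum]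
 have "ext_pre K R S \<alpha> M s r' m' (lcomp S s (lfob \<alpha> r) (lfob \<alpha> r') (lfar \<alpha> r r' g) f)
     -[ext_sum K R S \<alpha> M s] ext_pre K R S \<alpha> M s r (eact M r r' m' g) f : ext_null K R S \<alpha> M s"
  unfolding ext_null_def by (rule subsetD[OF span_superset]) (use a in blast)
 then show ?thesis unfolding ext_cls_def
  using coset_eq_iff[OF P ext_null_subspace bilinD(3)[OF ext_pre_bilin[OF a(2)] a(3) T_act[OF s a(1,2,4,5)]]
      bilinD(3)[OF ext_pre_bilin[OF a(1)] bilinD(3)[OF R.preentD(3)[OF M a(1,2)] a(3,4)] a(5)]] by simp
qed

text \<open>The universal property of the extension: a family of bilinear maps that respects the
  balancing relations induces a linear map. Its extension to the direct sum kills the relations, so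
  the representative chosen in \<open>qsum\<close> is immaterial.\<close>

lemma qsum_lift:
 assumes Z: "module K Z" and \<beta>: "!!r. r <. R ==> bilin (esp M r) (T s r) Z (\<beta> r)"
  and bal: "!!r r' m' g f. r <. R ==> r' <. R ==> m' <: esp M r' ==> g <: lhom R r r' ==>
   f <: T s r ==> \<beta> r' m' (lcomp S s (lfob \<alpha> r) (lfob \<alpha> r') (lfar \<alpha> r r' g) f) = \<beta> r (eact M r r' m' g) f"
 shows "lin (es M s) Z (%q. qsum K R S \<alpha> M s Z q \<beta>)"
  and "r <. R ==> m <: esp M r ==> f <: T s r ==>
   qsum K R S \<alpha> M s Z (ec M s r m f) \<beta> = \<beta> r m f"
proof -
 let ?P = "ext_sum K R S \<alpha> M s" and ?N = "ext_null K R S \<alpha> M s"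
 note P = is_dsumD(1)[OF ext_sum_dsum]
 let ?L = "dev (lobj R) (ext_summand K S \<alpha> M s) (%r u. u r) Z (%r t. tsum K Z t (\<beta> r))"
 have tl: "lin (ext_summand K S \<alpha> M s r) Z (%t. tsum K Z t (\<beta> r))" if r: "r <. R" for r
  unfolding ext_summand_def by (rule tsum_lin[OF R.preentD(1)[OF M r] T_module[OF s r] Z \<beta>[OF r]])
 have L: "lin ?P Z ?L" by (rule dsum_dev_lin[OF ext_sum_dsum Z tl])
 have Lp: "?L (ext_pre K R S \<alpha> M s r m f) = \<beta> r m f" if r: "r <. R" and m: "m <: esp M r" and f: "f <: T s r" for r m f
 proof -
  have t: "tens K (esp M r) (T s r) m f <: ext_summand K S \<alpha> M s r"
   unfolding ext_summand_def by (rule tens_closed[OF R.preentD(1)[OF M r] T_module[OF s r] m f])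
  show ?thesis unfolding ext_pre_def
   by (rule trans[OF dsum_dev_inj[where L = "%r t. tsum K Z t (\<beta> r)", OF ext_sum_dsum Z tl r t]
      tsum_tens[OF R.preentD(1)[OF M r] T_module[OF s r] Z \<beta>[OF r] m f]])
 qed
 have "?N \<subseteq> {u : carrier ?P. ?L u = 0[Z]}" unfolding ext_null_def
 proof (rule span_least[OF P subspace_kernel[OF P Z L]], rule subsetI, elim CollectE exE conjE, hypsubst)
  fix r r' m' g f
  assume a: "r <. R" "r' <. R" "m' <: esp M r'" "g <: lhom R r r'" "f <: T s r"
  note c = T_act[OF s a(1,2,4,5)] and d = bilinD(3)[OF R.preentD(3)[OF M a(1,2)] a(3,4)]
  note e = bilinD(3)[OF ext_pre_bilin[OF a(2)] a(3) c] bilinD(3)[OF ext_pre_bilin[OF a(1)] d a(5)]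
  show "ext_pre K R S \<alpha> M s r' m' (lcomp S s (lfob \<alpha> r) (lfob \<alpha> r') (lfar \<alpha> r r' g) f)
     -[?P] ext_pre K R S \<alpha> M s r (eact M r r' m' g) f : {u : carrier ?P. ?L u = 0[Z]}"
   using lin_diff[OF P Z L e] Lp[OF a(2,3) c] Lp[OF a(1) d a(5)] bal[OF a] mod_closed(4)[OF P e]
    mod_simps(8)[OF Z bilinD(3)[OF \<beta>[OF a(1)] d a(5)]] by simp
 qed
 then have kill: "!!n. n : ?N ==> ?L n = 0[Z]" by blast
 have qL: "qsum K R S \<alpha> M s Z (?N +>\<^bsub>?P\<^esub> u) \<beta> = ?L u" if u: "u <: ?P" for u
  using quot_some(1)[OF P ext_null_subspace Z L kill u] by (simp add: qsum_def dev_def Let_def)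
 show "lin (es M s) Z (%q. qsum K R S \<alpha> M s Z q \<beta>)" unfolding ext_sp_def
  by (rule lin_factor_surj[OF P quot_lin[OF P ext_null_subspace] quot_carrier[symmetric] L qL])
 show "qsum K R S \<alpha> M s Z (ec M s r m f) \<beta> = \<beta> r m f"
  if "r <. R" "m <: esp M r" "f <: T s r"
  unfolding ext_cls_def using qL[OF bilinD(3)[OF ext_pre_bilin[OF that(1)] that(2,3)]] Lp[OF that] by simp
qed

lemma ext_eqI:
 assumes "module K Z" "lin (es M s) Z f" "lin (es M s) Z g"
  "!!r m h. r <. R ==> m <: esp M r ==> h <: T s r ==>
   f (ec M s r m h) = g (ec M s r m h)"
  "q <: es M s"
 shows "f q = g q"
proof -
 have "carrier (es M s) \<subseteq> {q : carrier (es M s). f q = g q}"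
  by (rule ext_span[OF subspace_equalizer[OF ext_sp_module assms(1-3)]]) (use assms(4) ext_cls_closed in auto)
 then show ?thesis using assms(5) by blast
qed

text \<open>The family is balanced because \<open>\<eta>\<close> respects the action and the action
  on \<open>N\<close> is associative. This is the linear part only; that the transpose is a morphism
  of entwined modules will be part of the cartesian condition.\<close>

lemma ext_transpose_lin_cls:
 assumes N: "S.preent N" and ass: "!!t s r m f g. t <. S ==> s <. S ==> r <. S ==> m <: esp N r ==>
   f <: lhom S s r ==> g <: lhom S t s ==> eact N t r m (lcomp S t s r f g) = eact N t s (eact N s r m f) g"
  and \<eta>: "R.ehom M (res_mod \<alpha> N) \<eta>"
 shows "lin (es M s) (esp N s) (ext_transpose K R S \<alpha> M N \<eta> s)"
  and "r <. R ==> m <: esp M r ==> f <: T s r ==>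
   ext_transpose K R S \<alpha> M N \<eta> s (ec M s r m f) = eact N s (lfob \<alpha> r) (\<eta> r m) f"
proof -
 let ?\<beta> = "%r m f. eact N s (lfob \<alpha> r) (\<eta> r m) f"
 have l: "lin (esp M r) (esp N (lfob \<alpha> r)) (\<eta> r)" if "r <. R" for r
  using R.ehomD(2)[OF \<eta> that] by (simp add: res_mod_def)
 have b: "bilin (esp M r) (T s r) (esp N s) (?\<beta> r)" if r: "r <. R" for r
  by (rule bilin_precomp[OF S.preentD(3)[OF N s \<alpha>_ob[OF r]] l[OF r]])
 have bal: "?\<beta> r' m' (lcomp S s (lfob \<alpha> r) (lfob \<alpha> r') (lfar \<alpha> r r' g) f) = ?\<beta> r (eact M r r' m' g) f"
  if a: "r <. R" "r' <. R" "m' <: esp M r'" "g <: lhom R r r'" "f <: T s r" for r r' m' g f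
  using ass[OF s \<alpha>_ob[OF a(1)] \<alpha>_ob[OF a(2)] lin_closed[OF l[OF a(2)] a(3)] lin_closed[OF \<alpha>_lin[OF a(1,2)] a(4)] a(5)]
   R.ehomD(5)[OF \<eta> a(1-4)] by (simp add: res_mod_def)
 have q1: "lin (es M s) (esp N s) (%q. qsum K R S \<alpha> M s (esp N s) q ?\<beta>)"
  by (rule qsum_lift(1)[OF S.preentD(1)[OF N s] b bal])
 have q2: "qsum K R S \<alpha> M s (esp N s) (ec M s r m f) ?\<beta> = ?\<beta> r m f"
  if a: "r <. R" "m <: esp M r" "f <: T s r" for r m f
  by (rule qsum_lift(2)[where \<beta> = ?\<beta>, OF S.preentD(1)[OF N s] b bal a])
 have e: "ext_transpose K R S \<alpha> M N \<eta> s q = qsum K R S \<alpha> M s (esp N s) q ?\<beta>" if "q <: es M s" for q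
  using s that by (simp add: ext_transpose_def)
 show "lin (es M s) (esp N s) (ext_transpose K R S \<alpha> M N \<eta> s)"
  by (rule lin_cong[OF q1 ext_sp_module e[symmetric]])
 show "ext_transpose K R S \<alpha> M N \<eta> s (ec M s r m f) = eact N s (lfob \<alpha> r) (\<eta> r m) f"
  if a: "r <. R" "m <: esp M r" "f <: T s r"
  using e[OF ext_cls_closed[OF a]] q2[OF a] by simp
qed

end

section \<open>The extension on morphisms\<close>

lemma ext_map_lin_cls:
 assumes M: "R.preent M" and N: "R.preent N" and \<eta>: "R.ehom M N \<eta>" and s: "s <. S"
 shows "lin (es M s) (es N s) (em M N \<eta> s)"
  and "r <. R ==> m <: esp M r ==> f <: T s r ==>
   em M N \<eta> s (ec M s r m f) = ec N s r (\<eta> r m) f"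
proof -
 let ?\<beta> = "%r m f. ec N s r (\<eta> r m) f"
 have b: "bilin (esp M r) (T s r) (es N s) (?\<beta> r)" if r: "r <. R" for r
  by (rule bilin_precomp[OF ext_cls_bilin[OF N s r] R.ehomD(2)[OF \<eta> r]])
 have bal: "?\<beta> r' m' (lcomp S s (lfob \<alpha> r) (lfob \<alpha> r') (lfar \<alpha> r r' g) f) = ?\<beta> r (eact M r r' m' g) f"
  if a: "r <. R" "r' <. R" "m' <: esp M r'" "g <: lhom R r r'" "f <: T s r" for r r' m' g f
  using ext_cls_balanced[OF N s a(1,2) R.ehomD(3)[OF \<eta> a(2,3)] a(4,5)] R.ehomD(5)[OF \<eta> a(1-4)] by simp
 have q1: "lin (es M s) (es N s) (%q. qsum K R S \<alpha> M s (es N s) q ?\<beta>)"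
  by (rule qsum_lift(1)[OF M s ext_sp_module[OF N s] b bal])
 have e: "em M N \<eta> s q = qsum K R S \<alpha> M s (es N s) q ?\<beta>" if "q <: es M s" for q
  using s that by (simp add: ext_map_def)
 show "lin (es M s) (es N s) (em M N \<eta> s)"
  by (rule lin_cong[OF q1 ext_sp_module[OF M s] e[symmetric]])
 show "em M N \<eta> s (ec M s r m f) = ec N s r (\<eta> r m) f"
  if a: "r <. R" "m <: esp M r" "f <: T s r"
  using e[OF ext_cls_closed[OF M s a]] qsum_lift(2)[where \<beta> = ?\<beta>, OF M s ext_sp_module[OF N s] b bal a] by simp
qed

lemma ext_map_comp:
 assumes M: "R.preent M" and N: "R.preent N" and P: "R.preent P" and \<eta>: "R.ehom M N \<eta>" and \<zeta>: "R.ehom N P \<zeta>"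
  and \<xi>: "R.ehom M P \<xi>" "!!r m. r <. R ==> m <: esp M r ==> \<xi> r m = \<zeta> r (\<eta> r m)"
  and s: "s <. S" and q: "q <: es M s"
 shows "em N P \<zeta> s (em M N \<eta> s q) = em M P \<xi> s q"
 by (rule ext_eqI[OF M s ext_sp_module[OF P s] lin_comp[OF ext_map_lin_cls(1)[OF M N \<eta> s] ext_map_lin_cls(1)[OF N P \<zeta> s]]
    ext_map_lin_cls(1)[OF M P \<xi>(1) s] _ q])
  (simp add: ext_map_lin_cls(2)[OF M N \<eta> s] ext_map_lin_cls(2)[OF N P \<zeta> s] ext_map_lin_cls(2)[OF M P \<xi>(1) s]
   R.ehomD(3)[OF \<eta>] \<xi>(2))

text \<open>The classes of \<open>n \<otimes> f\<close> span the target, and each of them lifts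
  through a preimage of \<open>n\<close>.\<close>

lemma ext_map_surj:
 assumes M: "R.preent M" and N: "R.preent N" and \<eta>: "R.ehom M N \<eta>" and s: "s <. S"
  and surj: "!!r. r <. R ==> \<eta> r ` carrier (esp M r) = carrier (esp N r)"
 shows "em M N \<eta> s ` carrier (es M s) = carrier (es N s)"
proof
 note l = ext_map_lin_cls[OF M N \<eta> s]
 show "em M N \<eta> s ` carrier (es M s) \<subseteq> carrier (es N s)"
  using lin_closed[OF l(1)] by blast
 show "carrier (es N s) \<subseteq> em M N \<eta> s ` carrier (es M s)"
 proof (rule ext_span[OF N s subspace_image[OF ext_sp_module[OF M s] ext_sp_module[OF N s] l(1)]])
  fix r n f assume r: "r <. R" and n: "n <: esp N r" and f: "f <: T s r"
  have "n : \<eta> r ` carrier (esp M r)" unfolding surj[OF r] by (rule n)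
  then obtain m where m: "m <: esp M r" "n = \<eta> r m" by blast
  show "ec N s r n f : em M N \<eta> s ` carrier (es M s)"
   by (rule image_eqI[OF _ ext_cls_closed[OF M s r m(1) f]]) (simp add: l(2)[OF r m(1) f] m(2))
 qed
qed

text \<open>
 Exactness of the extension functor is only available between modules whose carriers are small,
 and both types of carriers occur in it.
\<close>

lemma flat_exact:
 fixes U :: "'u set" and L M N :: "('k, 'o, 'm, 'c, 'v) entmod"
 assumes fl: "exact_functor (entmod_cat U K C R :: (('k, 'o, 'm, 'c, 'v) entmod, 'o => 'v => 'v) cat)
   (entmod_cat U K C S) (ext_functor K C R S \<alpha>)"
  and L: "L : Ob (entmod_cat U K C R)" and M: "M : Ob (entmod_cat U K C R)" and N: "N : Ob (entmod_cat U K C R)"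
  and k: "R.ehom L M k" and f: "R.ehom M N f"
  and inj: "!!r. r <. R ==> inj_on (k r) (carrier (esp L r))"
  and ex: "!!r. r <. R ==> k r ` carrier (esp L r) = {m : carrier (esp M r). f r m = 0[esp N r]}"
  and s: "s <. S"
 shows "inj_on (em L M k s) (carrier (es L s))"
  and "em L M k s ` carrier (es L s) =
   {q : carrier (es M s). em M N f s q = 0[es N s]}"
proof -
 let ?A = "entmod_cat U K C R :: (('k, 'o, 'm, 'c, 'v) entmod, 'o => 'v => 'v) cat"
 let ?B = "entmod_cat U K C S :: (('k, 'o2, 'm2, 'c, ('k, 'o, 'v, 'm2) extel) entmod, 'o2 => ('k, 'o, 'v, 'm2) extel => ('k, 'o, 'v, 'm2) extel) cat"
 interpret A: conc K ?A "lobj R" esp "%\<eta>. \<eta>" by (rule R.entmod_conc)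
 interpret B: conc K ?B "lobj S" esp "%\<eta>. \<eta>" by (rule S.entmod_conc)
 have pre: "R.preent X" if "X : Ob ?A" for X using that R.entmodD(1) by (auto simp: R.entmod_cat_sel)
 have res: "R.eres X \<eta> : Arr ?A X Y" if "X : Ob ?A" "Y : Ob ?A" "R.ehom X Y \<eta>" for X Y \<eta>
  using R.ehom_eres[OF pre[OF that(1)] pre[OF that(2)] that(3)] by (simp add: R.entmod_cat_sel R.entmod_hom_iff)
 have arr: "R.ehom X Y \<eta>" if "\<eta> : Arr ?A X Y" for X Y \<eta> using that by (simp add: R.entmod_cat_sel)
 have exact: "inj_on (em X Y \<eta> s) (carrier (es X s)) &
   em X Y \<eta> s ` carrier (es X s) = {q : carrier (es Y s). em Y Z \<zeta> s q = 0[es Z s]}"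
  if "short_exact ?A X Y Z \<eta> \<zeta>" for X Y Z \<eta> \<zeta>
 proof -
  have "short_exact ?B (fob (ext_functor K C R S \<alpha>) X) (fob (ext_functor K C R S \<alpha>) Y) (fob (ext_functor K C R S \<alpha>) Z)
    (far (ext_functor K C R S \<alpha>) X Y \<eta>) (far (ext_functor K C R S \<alpha>) Y Z \<zeta>)"
   using fl that unfolding exact_functor_def by blast
  then show ?thesis unfolding B.short_exact_iff using s by (simp add: ext_functor_def ext_mod_def)
 qed
 \<comment> \<open>Arrows of the category are extensional, while \<open>k\<close> and
   \<open>f\<close> are arbitrary. Truncation does not change the extended map, which is determined
   on the classes.\<close>
 have cg: "em X Y (R.eres X \<eta>) s q = em X Y \<eta> s q"
  if X: "X : Ob ?A" and Y: "Y : Ob ?A" and \<eta>: "R.ehom X Y \<eta>" and q: "q <: es X s" for X Y \<eta> q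
 proof -
  have e: "R.ehom X Y (R.eres X \<eta>)" by (rule arr[OF res[OF X Y \<eta>]])
  note l = ext_map_lin_cls[OF pre[OF X] pre[OF Y] e s] and l' = ext_map_lin_cls[OF pre[OF X] pre[OF Y] \<eta> s]
  show ?thesis by (rule ext_eqI[OF pre[OF X] s ext_sp_module[OF pre[OF Y] s] l(1) l'(1) _ q]) (simp add: l(2) l'(2))
 qed
 note mono = exact
 \<comment> \<open>An injection is completed to a short exact sequence by its cokernel, and
   exactness of the functor applies to that sequence.\<close>
 have inj_ex: "inj_on (em X Y \<eta> s) (carrier (es X s))"
  if X: "X : Ob ?A" and Y: "Y : Ob ?A" and \<eta>: "R.ehom X Y \<eta>" and i: "!!r. r <. R ==> inj_on (\<eta> r) (carrier (esp X r))" for X Y \<eta>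
 proof -
  obtain Q p where Q: "Q : Ob ?A" "p : Arr ?A Y Q" "!!r. r <. R ==> p r ` carrier (esp Y r) = carrier (esp Q r)"
   "!!r. r <. R ==> {x : carrier (esp Y r). p r x = 0[esp Q r]} = R.eres X \<eta> r ` carrier (esp X r)"
   by (rule A.cokernel_obtain[OF X Y res[OF X Y \<eta>]]; (assumption | (rule that; assumption)))
  have "inj_on (R.eres X \<eta> r) (carrier (esp X r))" if "r <. R" for r
   using i[OF that] that by (simp add: inj_on_def)
  then have "short_exact ?A X Y Q (R.eres X \<eta>) p"
   unfolding A.short_exact_iff using X Y Q res[OF X Y \<eta>] by simp
  then have "inj_on (em X Y (R.eres X \<eta>) s) (carrier (es X s))" using exact by blast
  then show ?thesis by (rule inj_on_cong[THEN iffD1, rotated]) (rule cg[OF X Y \<eta>])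
 qed
 show "inj_on (em L M k s) (carrier (es L s))" by (rule inj_ex[OF L M k inj])
 obtain Q p where Q: "Q : Ob ?A" "p : Arr ?A M Q" "!!r. r <. R ==> p r ` carrier (esp M r) = carrier (esp Q r)"
  "!!r. r <. R ==> {x : carrier (esp M r). p r x = 0[esp Q r]} = R.eres L k r ` carrier (esp L r)"
  by (rule A.cokernel_obtain[OF L M res[OF L M k]]; (assumption | (rule that; assumption)))
 have ki: "R.eres L k r ` carrier (esp L r) = {m : carrier (esp M r). f r m = 0[esp N r]}" if r: "r <. R" for r
 proof -
  have "R.eres L k r ` carrier (esp L r) = k r ` carrier (esp L r)" using r by (intro image_cong) simp_all
  then show ?thesis using ex[OF r] by simp
 qed
 have "inj_on (R.eres L k r) (carrier (esp L r))" if "r <. R" for r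
  using inj[OF that] that by (simp add: inj_on_def)
 then have se: "short_exact ?A L M Q (R.eres L k) p"
  unfolding A.short_exact_iff using L M Q res[OF L M k] by simp
 note fr = res[OF M N f]
 have sur: "ALL r:lobj R. p r ` carrier (esp M r) = carrier (esp Q r)" using Q(3) by blast
 have kq: "{x : carrier (esp M r). p r x = 0[esp Q r]} = {m : carrier (esp M r). f r m = 0[esp N r]}" if "r <. R" for r
  using Q(4)[OF that] ki[OF that] by simp
 then have "ALL r:lobj R. ALL x:carrier (esp M r). p r x = 0[esp Q r] --> R.eres M f r x = 0[esp N r]"
  by auto
 \<comment> \<open>The functor is exact on short exact sequences, whereas \<open>f\<close> may fail
   to be surjective. So \<open>f\<close> is written as the cokernel \<open>p\<close> of
   \<open>k\<close> followed by \<open>j\<close>.\<close>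
 then obtain j where j: "j : Arr ?A Q N" "ALL r:lobj R. ALL x:carrier (esp M r). j r (p r x) = R.eres M f r x"
  by (rule A.factor_surj'[OF M Q(1) N Q(2) fr sur])
 have jp: "f r x = j r (p r x)" if "r <. R" "x <: esp M r" for r x using j(2) that by simp
 \<comment> \<open>\<open>p\<close> and \<open>f\<close> have the same kernel, so \<open>j\<close>
   is injective; it stays injective after extension, so the extensions of \<open>p\<close> and
   \<open>f\<close> have the same kernel as well.\<close>
 have jinj: "inj_on (j r) (carrier (esp Q r))" if r: "r <. R" for r
  unfolding lin_inj_iff[OF A.sp_module[OF Q(1) r] A.sp_module[OF N r] A.ev_lin[OF Q(1) N j(1) r]]
 proof (intro ballI impI)
  fix y assume "y <: esp Q r" and z: "j r y = 0[esp N r]"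
  then obtain x where x: "x <: esp M r" "y = p r x" using Q(3)[OF r] by blast
  then have "x : {x : carrier (esp M r). p r x = 0[esp Q r]}" unfolding kq[OF r] using z jp[OF r x(1)] by simp
  then show "y = 0[esp Q r]" using x by simp
 qed
 have "em L M k s ` carrier (es L s) = em L M (R.eres L k) s ` carrier (es L s)"
  by (rule image_cong[OF refl]) (rule cg[OF L M k, symmetric])
 also have "\<dots> = {q : carrier (es M s). em M Q p s q = 0[es Q s]}"
  using exact[OF se] by blast
 also have "\<dots> = {q : carrier (es M s). em M N f s q = 0[es N s]}"
 proof (rule Collect_cong, rule conj_cong[OF refl])
  fix q assume q: "q <: es M s"
  note lp = ext_map_lin_cls(1)[OF pre[OF M] pre[OF Q(1)] arr[OF Q(2)] s]
  note lj = ext_map_lin_cls(1)[OF pre[OF Q(1)] pre[OF N] arr[OF j(1)] s]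
  note mQ = ext_sp_module[OF pre[OF Q(1)] s] and mN = ext_sp_module[OF pre[OF N] s]
  have c: "em Q N j s (em M Q p s q) = em M N f s q"
   by (rule ext_map_comp[OF pre[OF M] pre[OF Q(1)] pre[OF N] arr[OF Q(2)] arr[OF j(1)] f jp s q])
  have ij: "inj_on (em Q N j s) (carrier (es Q s))"
   by (rule inj_ex[OF Q(1) N arr[OF j(1)] jinj])
  show "em M Q p s q = 0[es Q s] \<longleftrightarrow> em M N f s q = 0[es N s]"
   using c ij[unfolded lin_inj_iff[OF mQ mN lj]] lin_closed[OF lp q] lin_zero[OF mQ mN lj] by auto
 qed
 finally show "em L M k s ` carrier (es L s) =
   {q : carrier (es M s). em M N f s q = 0[es N s]}" .
qed

end

context entw
begin

lemma ehom_factor_surj_ex: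
 fixes a :: "('k, 'o, 'm, 'c, 'v) entmod"
 assumes a: "preent a" and b: "preent b" and c: "preent c"
  and p: "ehom a b p" and h: "ehom a c h" and surj: "!!s. s <. R ==> p s ` carrier (esp a s) = carrier (esp b s)"
  and ker: "!!s x. s <. R ==> x <: esp a s ==> p s x = 0[esp b s] ==> h s x = 0[esp c s]"
 obtains u where "ehom b c u" "!!s x. s <. R ==> x <: esp a s ==> u s (p s x) = h s x"
proof -
 let ?u = "%r y. h r (SOME x. x <: esp a r & p r x = y)"
 have u: "?u r (p r x) = h r x" if r: "r <. R" and x: "x <: esp a r" for r x
 proof -
  let ?y = "SOME y. y <: esp a r & p r y = p r x"
  have y: "?y <: esp a r" "p r ?y = p r x" using someI[of "%y. y <: esp a r & p r y = p r x" x] x by auto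
  note m = preentD(1)[OF a r] preentD(1)[OF b r] preentD(1)[OF c r]
  have "p r (?y -[esp a r] x) = 0[esp b r]"
   using lin_diff[OF m(1,2) ehomD(2)[OF p r] y(1) x] y(2) m(2) ehomD(3)[OF p r x] by simp
  then have "h r (?y -[esp a r] x) = 0[esp c r]" by (rule ker[OF r mod_closed(4)[OF m(1) y(1) x]])
  then show ?thesis
   using lin_diff[OF m(1,3) ehomD(2)[OF h r] y(1) x] mod_diff_eq_0[OF m(3) ehomD(3)[OF h r y(1)] ehomD(3)[OF h r x]] by simp
 qed
 have "ehom b c ?u" by (rule ehom_factor_surj[OF a b c p surj h u])
 then show ?thesis using u by (rule that)
qed

end

context entmor
begin

lemma res_preent:
 assumes N: "S.preent N"
 shows "R.preent (res_mod \<alpha> N)"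
 unfolding R.preent_def res_mod_def
 using S.preentD(1,2)[OF N \<alpha>_ob] bilin_postcomp[OF S.preentD(3)[OF N \<alpha>_ob \<alpha>_ob] \<alpha>_lin] by simp

lemma res_ehom:
 assumes \<eta>: "S.ehom M N \<eta>"
 shows "R.ehom (res_mod \<alpha> M) (res_mod \<alpha> N) (%r. \<eta> (lfob \<alpha> r))"
 unfolding R.ehom_def res_mod_def
 using S.ehomD(1)[OF \<eta> \<alpha>_ob] S.ehomD(5)[OF \<eta> \<alpha>_ob \<alpha>_ob] lin_closed[OF \<alpha>_lin] by simp

text \<open>Classes are linear in the module element, so generators of the spaces of
  \<open>M\<close> suffice.\<close>

lemma ext_gen:
 assumes M: "R.preent M" and s: "s <. S" and H: "subspace (es M s) H"
  and span: "!!r G. r <. R ==> subspace (esp M r) G ==> B r \<subseteq> G ==> carrier (esp M r) \<subseteq> G"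
  and B: "!!r. r <. R ==> B r \<subseteq> carrier (esp M r)"
  and cls: "!!r m f. r <. R ==> m : B r ==> f <: T s r ==> ec M s r m f : H"
 shows "carrier (es M s) \<subseteq> H"
proof (rule ext_span[OF M s H])
 fix r m f assume r: "r <. R" and m: "m <: esp M r" and f: "f <: T s r"
 have "carrier (esp M r) \<subseteq> {m : carrier (esp M r). ec M s r m f : H}"
  by (rule span[OF r subspace_vimage[OF R.preentD(1)[OF M r] ext_sp_module[OF M s] bilinD(2)[OF ext_cls_bilin[OF M s r] f] H]])
   (use B[OF r] cls[OF r _ f] in auto)
 then show "ec M s r m f : H" using m by blast
qed

end

section \<open>Cartesian modules\<close>

text \<open>\<open>U\<close> is a set of elements of the carrier type \<open>'v\<close> itself.
  Small sets therefore embed into the carrier type, which is what the transport of direct sums asks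
  for.\<close>

locale cartl = coalg K C + universe U
 for K :: "('k, 'z) ring_scheme" (structure) and C :: "('k, 'c) coalgebra" and U :: "'v set" +
 fixes \<X> :: "('x, 'a) cat" and \<R> :: "('x, 'a, 'k, 'o, 'm, 'c) rep"
 assumes cat: "is_cat \<X>" and rep: "entwined_rep K C \<X> \<R>" and flat: "flat_rep U K C \<X> \<R>"
begin

abbreviation "X \<equiv> Ob \<X>"
abbreviation R :: "'x => ('k, 'o, 'm, 'c) entwining" where "R \<equiv> fob \<R>"
abbreviation al :: "'x => 'x => 'a => ('o, 'm, 'o, 'm) linfun" where "al \<equiv> far \<R>"
abbreviation ob :: "'x => 'x => 'a => 'o => 'o" where "ob x y a \<equiv> lfob (al x y a)"
abbreviation eh where "eh x \<equiv> entw.ehom K C (R x)"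
abbreviation EO :: "'x => ('k, 'o, 'm, 'c, 'v) entmod set" where "EO x \<equiv> Ob (entmod_cat U K C (R x))"
abbreviation xs :: "'x => 'x => 'a => ('k, 'o, 'm, 'c, 'v) entmod => 'o => ('k, ('k, 'o, 'v, 'm) extel) module" where
 "xs x y a M \<equiv> ext_sp K (R x) (R y) (al x y a) M"
abbreviation xm where "xm x y a \<equiv> ext_map K (R x) (R y) (al x y a)"
abbreviation ph where "ph x y a M \<equiv> ext_transpose K (R x) (R y) (al x y a) (rat M x) (rat M y) (rtr M x y a)"
abbreviation XM where "XM x y a \<equiv> ext_mod K C (R x) (R y) (al x y a)"

lemma ew: "x : X ==> entw K C (R x)"
 using rep by unfold_locales (auto simp: entwined_rep_def is_functor_def ent_cat_def)

lemma em: "x : X ==> y : X ==> a : Arr \<X> x y ==> entmor K C (R x) (R y) (al x y a)"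
 using rep by unfold_locales (auto simp: entwined_rep_def is_functor_def ent_cat_def)

lemma ob_closed: "x : X ==> y : X ==> a : Arr \<X> x y ==> r <. R x ==> ob x y a r <. R y"
 by (rule entmor.\<alpha>_ob[OF em])

lemma ob_idn_comp:
 shows "x : X ==> r <. R x ==> ob x x (Idn \<X> x) r = r"
  and "x : X ==> y : X ==> z : X ==> a : Arr \<X> x y ==> \<beta> : Arr \<X> y z ==> r <. R x ==>
   ob x z (Cmp \<X> x y z \<beta> a) r = ob y z \<beta> (ob x y a r)"
 using rep by (simp_all add: entwined_rep_def is_functor_def ent_cat_def linfun_restrict_def)

lemma EO_iff: "x : X ==> M : EO x \<longleftrightarrow> is_entmod K C (R x) M & (ALL r:lobj (R x). small U (carrier (esp M r)))"
 by (simp add: entmod_cat_def)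

lemma EO_entmod: "x : X ==> M : EO x ==> is_entmod K C (R x) M"
 by (simp add: entmod_cat_def)

lemma EO_preent: "x : X ==> M : EO x ==> entw.preent K C (R x) M"
 by (rule entw.entmodD(1)[OF ew EO_entmod])

lemma EO_module: "x : X ==> M : EO x ==> r <. R x ==> module K (esp M r)"
 by (rule entw.preentD(1)[OF ew EO_preent])

lemma EO_act_assoc:
 assumes "x : X" "M : EO x" "t <. R x" "s <. R x" "r <. R x" "m <: esp M r"
  "f <: lhom (R x) s r" "g <: lhom (R x) t s"
 shows "eact M t r m (lcomp (R x) t s r f g) = eact M t s (eact M s r m f) g"
 by (rule entw.entmodD(4)[OF ew[OF assms(1)] EO_entmod[OF assms(1,2)] assms(3-8)])

section \<open>Modules over the representation and their morphisms\<close>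

abbreviation rmod :: "('x, 'a, 'k, 'o, 'm, 'c, 'v) repmod => bool" where "rmod \<equiv> is_repmod U K C \<X> \<R>"

text \<open>The elementwise form of \<open>repmod_hom\<close>, free of extensionality;
  \<open>rres\<close> makes such a family an arrow.\<close>

definition rhom :: "('x, 'a, 'k, 'o, 'm, 'c, 'v) repmod => ('x, 'a, 'k, 'o, 'm, 'c, 'v) repmod => ('x => 'o => 'v => 'v) => bool" where
 "rhom M N \<eta> \<longleftrightarrow> (ALL x:X. eh x (rat M x) (rat N x) (\<eta> x)) &
   (ALL x:X. ALL y:X. ALL a:Arr \<X> x y. ALL r:lobj (R x). ALL m:carrier (rsp M x r).
    rtr N x y a r (\<eta> x r m) = \<eta> y (ob x y a r) (rtr M x y a r m))"

definition rres :: "('x, 'a, 'k, 'o, 'm, 'c, 'v) repmod => ('x => 'o => 'v => 'v) => ('x => 'o => 'v => 'v)" where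
 "rres M \<eta> = (\<lambda>x\<in>X. \<lambda>r\<in>lobj (R x). \<lambda>m\<in>carrier (rsp M x r). \<eta> x r m)"

lemma rmod_alt:
 "rmod M \<longleftrightarrow> (ALL x:X. rat M x : EO x) &
  (ALL x:X. ALL y:X. ALL a:Arr \<X> x y. rtr M x y a : entmod_hom K C (R x) (rat M x) (res_mod (al x y a) (rat M y))) &
  (ALL x:X. rtr M x x (Idn \<X> x) = entmod_id (R x) (rat M x)) &
  (ALL x:X. ALL y:X. ALL z:X. ALL a:Arr \<X> x y. ALL \<beta>:Arr \<X> y z. rtr M x z (Cmp \<X> x y z \<beta> a) =
    (\<lambda>r\<in>lobj (R x). \<lambda>m\<in>carrier (rsp M x r). rtr M y z \<beta> (ob x y a r) (rtr M x y a r m)))"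
proof -
 have e: "entmod_comp (R x) (rat M x) (res_map (R x) (al x y a) (rtr M y z \<beta>)) (rtr M x y a) =
   (\<lambda>r\<in>lobj (R x). \<lambda>m\<in>carrier (rsp M x r). rtr M y z \<beta> (ob x y a r) (rtr M x y a r m))" for x y z a \<beta>
  unfolding entmod_comp_def res_map_def compose_def by (intro restrict_ext) simp
 show ?thesis unfolding is_repmod_def e by blast
qed

lemma rmodD:
 assumes M: "rmod M"
 shows "x : X ==> rat M x : EO x"
  and "x : X ==> y : X ==> a : Arr \<X> x y ==> eh x (rat M x) (res_mod (al x y a) (rat M y)) (rtr M x y a)"
  and "x : X ==> y : X ==> a : Arr \<X> x y ==> r <. R x ==>
   lin (rsp M x r) (esp (rat M y) (ob x y a r)) (rtr M x y a r)"
  and "x : X ==> r <. R x ==> m <: rsp M x r ==> rtr M x x (Idn \<X> x) r m = m"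
  and "x : X ==> y : X ==> z : X ==> a : Arr \<X> x y ==> \<beta> : Arr \<X> y z ==> r <. R x ==>
   m <: rsp M x r ==>
   rtr M x z (Cmp \<X> x y z \<beta> a) r m = rtr M y z \<beta> (ob x y a r) (rtr M x y a r m)"
proof -
 note A = M[unfolded rmod_alt]
 show "rat M x : EO x" if "x : X" using A that by blast
 show t: "eh x (rat M x) (res_mod (al x y a) (rat M y)) (rtr M x y a)" if "x : X" "y : X" "a : Arr \<X> x y" for x y a
  using A that entw.entmod_hom_iff[OF ew[OF that(1)]] by blast
 show "lin (rsp M x r) (esp (rat M y) (ob x y a r)) (rtr M x y a r)"
  if a: "x : X" "y : X" "a : Arr \<X> x y" "r <. R x"
  using entw.ehomD(2)[OF ew[OF a(1)] t[OF a(1-3)] a(4)] by (simp add: res_mod_def)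
 show "rtr M x x (Idn \<X> x) r m = m" if a: "x : X" "r <. R x" "m <: rsp M x r"
 proof -
  have "rtr M x x (Idn \<X> x) = entmod_id (R x) (rat M x)" using A a(1) by blast
  then show ?thesis using a by (simp add: entmod_id_def)
 qed
 show "rtr M x z (Cmp \<X> x y z \<beta> a) r m = rtr M y z \<beta> (ob x y a r) (rtr M x y a r m)"
  if a: "x : X" "y : X" "z : X" "a : Arr \<X> x y" "\<beta> : Arr \<X> y z" "r <. R x" "m <: rsp M x r"
 proof -
  have "rtr M x z (Cmp \<X> x y z \<beta> a) =
    (\<lambda>r\<in>lobj (R x). \<lambda>m\<in>carrier (rsp M x r). rtr M y z \<beta> (ob x y a r) (rtr M x y a r m))" using A a(1-5) by blast
  then show ?thesis using a(6,7) by simp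
 qed
qed

lemma rm_ent: "x : X ==> rmod M ==> is_entmod K C (R x) (rat M x)"
 by (rule EO_entmod[OF _ rmodD(1)])

lemma rm_pre: "x : X ==> rmod M ==> entw.preent K C (R x) (rat M x)"
 by (rule EO_preent[OF _ rmodD(1)])

lemma rm_mod: "x : X ==> rmod M ==> r <. R x ==> module K (rsp M x r)"
 by (rule EO_module[OF _ rmodD(1)])

lemma rm_tr_closed:
 "rmod M ==> x : X ==> y : X ==> a : Arr \<X> x y ==> r <. R x ==> m <: rsp M x r ==>
  rtr M x y a r m <: esp (rat M y) (ob x y a r)"
 by (rule lin_closed[OF rmodD(3)])

text \<open>Arrows are extensional, so structure maps are made \<open>undefined\<close> outside the carriers.\<close>

definition mk :: "('x => ('k, 'o, 'm, 'c, 'v) entmod) => ('x => 'x => 'a => 'o => 'v => 'v) => ('x, 'a, 'k, 'o, 'm, 'c, 'v) repmod" where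
 "mk Q tr = \<lparr>rat = Q, rtr = (%x y a. \<lambda>r\<in>lobj (R x). \<lambda>m\<in>carrier (esp (Q x) r). tr x y a r m)\<rparr>"

lemma mk_sel: "rat (mk Q tr) = Q"
 "r <. R x ==> m <: esp (Q x) r ==> rtr (mk Q tr) x y a r m = tr x y a r m"
 by (simp_all add: mk_def)

lemma mk_rmod:
 assumes Q: "!!x. x : X ==> Q x : EO x"
  and tr: "!!x y a. x : X ==> y : X ==> a : Arr \<X> x y ==> eh x (Q x) (res_mod (al x y a) (Q y)) (tr x y a)"
  and idn: "!!x r m. x : X ==> r <. R x ==> m <: esp (Q x) r ==> tr x x (Idn \<X> x) r m = m"
  and cmp: "!!x y z a \<beta> r m. x : X ==> y : X ==> z : X ==> a : Arr \<X> x y ==> \<beta> : Arr \<X> y z ==> r <. R x ==>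
   m <: esp (Q x) r ==> tr x z (Cmp \<X> x y z \<beta> a) r m = tr y z \<beta> (ob x y a r) (tr x y a r m)"
 shows "rmod (mk Q tr)"
 unfolding rmod_alt mk_sel(1)
proof (intro conjI ballI)
 fix x assume x: "x : X"
 show "Q x : EO x" by (rule Q[OF x])
 show "rtr (mk Q tr) x x (Idn \<X> x) = entmod_id (R x) (Q x)"
  unfolding mk_def entmod_id_def by (simp, intro restrict_ext) (simp add: idn x)
next
 fix x y a assume a: "x : X" "y : X" "a : Arr \<X> x y"
 show "rtr (mk Q tr) x y a : entmod_hom K C (R x) (Q x) (res_mod (al x y a) (Q y))"
  using entw.ehom_eres[OF ew[OF a(1)] EO_preent[OF a(1) Q[OF a(1)]] entmor.res_preent[OF em[OF a] EO_preent[OF a(2) Q[OF a(2)]]] tr[OF a]]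
  by (simp add: mk_def entw.eres_def[OF ew[OF a(1)]])
next
 fix x y z a \<beta> assume a: "x : X" "y : X" "z : X" "a : Arr \<X> x y" "\<beta> : Arr \<X> y z"
 have c: "tr x y a r m <: esp (Q y) (ob x y a r)" if "r <. R x" "m <: esp (Q x) r" for r m
  using entw.ehomD(3)[OF ew[OF a(1)] tr[OF a(1,2,4)] that] by (simp add: res_mod_def)
 show "rtr (mk Q tr) x z (Cmp \<X> x y z \<beta> a) = (\<lambda>r\<in>lobj (R x). \<lambda>m\<in>carrier (esp (Q x) r).
    rtr (mk Q tr) y z \<beta> (ob x y a r) (rtr (mk Q tr) x y a r m))"
  unfolding mk_def by (simp, intro restrict_ext) (simp add: cmp[OF a] c ob_closed[OF a(1,2,4)])
qed

lemma rhomD: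
 assumes "rhom M N \<eta>"
 shows "x : X ==> eh x (rat M x) (rat N x) (\<eta> x)"
  "x : X ==> r <. R x ==> lin (rsp M x r) (rsp N x r) (\<eta> x r)"
  "x : X ==> r <. R x ==> m <: rsp M x r ==> \<eta> x r m <: rsp N x r"
  "x : X ==> y : X ==> a : Arr \<X> x y ==> r <. R x ==> m <: rsp M x r ==>
    rtr N x y a r (\<eta> x r m) = \<eta> y (ob x y a r) (rtr M x y a r m)"
proof -
 show 1: "eh x (rat M x) (rat N x) (\<eta> x)" if "x : X" for x using assms that by (simp add: rhom_def)
 show "lin (rsp M x r) (rsp N x r) (\<eta> x r)" if "x : X" "r <. R x" by (rule entw.ehomD(2)[OF ew[OF that(1)] 1[OF that(1)] that(2)])
 show "\<eta> x r m <: rsp N x r" if "x : X" "r <. R x" "m <: rsp M x r"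
  by (rule entw.ehomD(3)[OF ew[OF that(1)] 1[OF that(1)] that(2,3)])
qed (use assms in \<open>simp add: rhom_def\<close>)

lemma rhomI:
 assumes "!!x. x : X ==> eh x (rat M x) (rat N x) (\<eta> x)"
  "!!x y a r m. x : X ==> y : X ==> a : Arr \<X> x y ==> r <. R x ==> m <: rsp M x r ==>
    rtr N x y a r (\<eta> x r m) = \<eta> y (ob x y a r) (rtr M x y a r m)"
 shows "rhom M N \<eta>"
 using assms by (simp add: rhom_def)

lemma rres_apply [simp]:
 "x : X ==> r <. R x ==> m <: rsp M x r ==> rres M \<eta> x r m = \<eta> x r m"
 by (simp add: rres_def)

lemma rres_cong: "(!!x r m. x : X ==> r <. R x ==> m <: rsp M x r ==> \<eta> x r m = \<zeta> x r m) ==> rres M \<eta> = rres M \<zeta>"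
 unfolding rres_def by (intro restrict_ext) simp

lemma repmod_hom_iff:
 assumes M: "rmod M" and N: "rmod N"
 shows "\<eta> : repmod_hom K C \<X> \<R> M N \<longleftrightarrow> rhom M N \<eta> & rres M \<eta> = \<eta>"
proof -
 have hom: "(\<eta> : extensional (X) & (ALL x:X. \<eta> x : entmod_hom K C (R x) (rat M x) (rat N x))) \<longleftrightarrow>
   (ALL x:X. eh x (rat M x) (rat N x) (\<eta> x)) & rres M \<eta> = \<eta>"
 proof
  assume a: "\<eta> : extensional (X) & (ALL x:X. \<eta> x : entmod_hom K C (R x) (rat M x) (rat N x))"
  then have e: "eh x (rat M x) (rat N x) (\<eta> x)" "(\<lambda>r\<in>lobj (R x). \<lambda>m\<in>carrier (rsp M x r). \<eta> x r m) = \<eta> x" if "x : X" for x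
   using entw.entmod_hom_iff[OF ew[OF that]] that by (auto simp: entw.eres_def[OF ew[OF that]])
  have "rres M \<eta> = \<eta>"
  proof
   fix x show "rres M \<eta> x = \<eta> x"
    using a e(2)[of x] by (cases "x : X") (simp_all add: rres_def extensional_def)
  qed
  then show "(ALL x:X. eh x (rat M x) (rat N x) (\<eta> x)) & rres M \<eta> = \<eta>" using e(1) by blast
 next
  assume a: "(ALL x:X. eh x (rat M x) (rat N x) (\<eta> x)) & rres M \<eta> = \<eta>"
  then have r: "rres M \<eta> = \<eta>" by simp
  have "\<eta> : extensional (X)" by (subst r[symmetric]) (simp add: rres_def)
  moreover have "\<eta> x : entmod_hom K C (R x) (rat M x) (rat N x)" if x: "x : X" for x
  proof -
   have "entw.eres (R x) (rat M x) (\<eta> x) = \<eta> x"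
    using fun_cong[OF r, of x] x by (simp add: rres_def entw.eres_def[OF ew[OF x]])
   then show ?thesis using a x entw.entmod_hom_iff[OF ew[OF x]] by blast
  qed
  ultimately show "\<eta> : extensional (X) & (ALL x:X. \<eta> x : entmod_hom K C (R x) (rat M x) (rat N x))" by blast
 qed
 have comm: "entmod_comp (R x) (rat M x) (rtr N x y a) (\<eta> x) = entmod_comp (R x) (rat M x) (res_map (R x) (al x y a) (\<eta> y)) (rtr M x y a)
   \<longleftrightarrow> (ALL r:lobj (R x). ALL m:carrier (rsp M x r). rtr N x y a r (\<eta> x r m) = \<eta> y (ob x y a r) (rtr M x y a r m))"
  for x y a
 proof
  assume e: "entmod_comp (R x) (rat M x) (rtr N x y a) (\<eta> x) = entmod_comp (R x) (rat M x) (res_map (R x) (al x y a) (\<eta> y)) (rtr M x y a)"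
  show "ALL r:lobj (R x). ALL m:carrier (rsp M x r). rtr N x y a r (\<eta> x r m) = \<eta> y (ob x y a r) (rtr M x y a r m)"
  proof (intro ballI)
   fix r m assume "r <. R x" "m <: rsp M x r"
   then show "rtr N x y a r (\<eta> x r m) = \<eta> y (ob x y a r) (rtr M x y a r m)"
    using fun_cong[OF fun_cong[OF e, of r], of m] by (simp add: entmod_comp_def res_map_def compose_def)
  qed
 qed (unfold entmod_comp_def res_map_def compose_def, intro restrict_ext, simp)
 show ?thesis unfolding repmod_hom_def rhom_def mem_Collect_eq comm using hom by blast
qed

lemma rhom_cong:
 assumes M: "rmod M" and N: "rmod N" and \<eta>: "rhom M N \<eta>"
  and eq: "!!x r m. x : X ==> r <. R x ==> m <: rsp M x r ==> \<zeta> x r m = \<eta> x r m"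
 shows "rhom M N \<zeta>"
proof (rule rhomI)
 fix x assume x: "x : X"
 show "eh x (rat M x) (rat N x) (\<zeta> x)"
  by (rule entw.ehom_cong[OF ew[OF x] rm_pre[OF x M] rm_pre[OF x N] rhomD(1)[OF \<eta> x] eq[OF x]])
next
 fix x y a r m assume a: "x : X" "y : X" "a : Arr \<X> x y" "r <. R x" "m <: rsp M x r"
 show "rtr N x y a r (\<zeta> x r m) = \<zeta> y (ob x y a r) (rtr M x y a r m)"
  using rhomD(4)[OF \<eta> a] eq[OF a(1,4,5)] eq[OF a(2) ob_closed[OF a(1-4)] rm_tr_closed[OF M a]] by simp
qed

lemma rhom_rres: "rmod M ==> rmod N ==> rhom M N \<eta> ==> rres M \<eta> : repmod_hom K C \<X> \<R> M N"
 unfolding repmod_hom_iff by (intro conjI rhom_cong[of M N \<eta> "rres M \<eta>"] rres_cong) simp_all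

lemma rhom_comp:
 assumes M: "rmod M" and N: "rmod N" and P: "rmod P" and \<eta>: "rhom M N \<eta>" and \<zeta>: "rhom N P \<zeta>"
 shows "rhom M P (%x r m. \<zeta> x r (\<eta> x r m))"
proof (rule rhomI)
 fix x assume x: "x : X"
 show "eh x (rat M x) (rat P x) (%r m. \<zeta> x r (\<eta> x r m))"
  by (rule entw.ehom_comp[OF ew[OF x] rm_pre[OF x M] rm_pre[OF x N] rm_pre[OF x P] rhomD(1)[OF \<eta> x] rhomD(1)[OF \<zeta> x]])
next
 fix x y a r m assume a: "x : X" "y : X" "a : Arr \<X> x y" "r <. R x" "m <: rsp M x r"
 show "rtr P x y a r (\<zeta> x r (\<eta> x r m)) = \<zeta> y (ob x y a r) (\<eta> y (ob x y a r) (rtr M x y a r m))"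
  using rhomD(4)[OF \<zeta> a(1-4) rhomD(3)[OF \<eta> a(1,4,5)]] rhomD(4)[OF \<eta> a] by simp
qed

lemma rhom_id: "rmod M ==> rhom M M (%x r m. m)"
 by (rule rhomI) (simp_all add: entw.ehom_id[OF ew rm_pre])

lemma rhom_zero: "rmod M ==> rmod N ==> rhom M N (%x r m. 0[rsp N x r])"
 by (rule rhomI) (simp_all add: entw.ehom_zero[OF ew rm_pre rm_pre] lin_zero[OF rm_mod rm_mod rmodD(3)] ob_closed)

lemma rhom_minus:
 assumes M: "rmod M" and N: "rmod N" and \<eta>: "rhom M N \<eta>" and \<zeta>: "rhom M N \<zeta>"
 shows "rhom M N (%x r m. \<eta> x r m -[rsp N x r] \<zeta> x r m)"
proof (rule rhomI)
 fix x assume x: "x : X"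
 show "eh x (rat M x) (rat N x) (%r m. \<eta> x r m -[rsp N x r] \<zeta> x r m)"
  by (rule entw.ehom_minus[OF ew[OF x] rm_pre[OF x M] rm_pre[OF x N] rhomD(1)[OF \<eta> x] rhomD(1)[OF \<zeta> x]])
next
 fix x y a r m assume a: "x : X" "y : X" "a : Arr \<X> x y" "r <. R x" "m <: rsp M x r"
 show "rtr N x y a r (\<eta> x r m -[rsp N x r] \<zeta> x r m) =
   \<eta> y (ob x y a r) (rtr M x y a r m) -[esp (rat N y) (ob x y a r)] \<zeta> y (ob x y a r) (rtr M x y a r m)"
  using lin_diff[OF rm_mod[OF a(1) N a(4)] rm_mod[OF a(2) N ob_closed[OF a(1-4)]] rmodD(3)[OF N a(1-4)] rhomD(3)[OF \<eta> a(1,4,5)] rhomD(3)[OF \<zeta> a(1,4,5)]]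
   rhomD(4)[OF \<eta> a] rhomD(4)[OF \<zeta> a] by simp
qed

lemma rhom_factor_inj:
 assumes L: "rmod L" and M: "rmod M" and N: "rmod N" and i: "rhom M N i"
  and inj: "!!x r. x : X ==> r <. R x ==> inj_on (i x r) (carrier (rsp M x r))" and h: "rhom L N h"
  and u: "!!x r m. x : X ==> r <. R x ==> m <: rsp L x r ==> u x r m <: rsp M x r"
   "!!x r m. x : X ==> r <. R x ==> m <: rsp L x r ==> i x r (u x r m) = h x r m"
 shows "rhom L M u"
proof (rule rhomI)
 fix x assume x: "x : X"
 show "eh x (rat L x) (rat M x) (u x)"
  by (rule entw.ehom_factor_inj[OF ew[OF x] rm_pre[OF x L] rm_pre[OF x M] rm_pre[OF x N] rhomD(1)[OF i x] inj[OF x] rhomD(1)[OF h x] u[OF x]])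
next
 fix x y a r m assume a: "x : X" "y : X" "a : Arr \<X> x y" "r <. R x" "m <: rsp L x r"
 note o = ob_closed[OF a(1-4)] and t = rm_tr_closed[OF L a]
 show "rtr M x y a r (u x r m) = u y (ob x y a r) (rtr L x y a r m)"
  by (rule inj_onD[OF inj[OF a(2) o]])
   (use rhomD(4)[OF i a(1-4) u(1)[OF a(1,4,5)]] u(2)[OF a(1,4,5)] rhomD(4)[OF h a] u(2)[OF a(2) o t] u(1)[OF a(2) o t]
    rm_tr_closed[OF M a(1-4) u(1)[OF a(1,4,5)]] in simp_all)
qed

section \<open>Extension along the arrows of the representation\<close>

lemma XM_EO:
 assumes x: "x : X" "y : X" "a : Arr \<X> x y" and M: "M : EO x"
 shows "entw.preent K C (R y) (XM x y a M)"
proof -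
 have "XM x y a M : Ob (entmod_cat U K C (R y))"
  using flat x M unfolding flat_rep_def exact_functor_def is_functor_def by (simp add: ext_functor_def)
 then have "is_entmod K C (R y) (XM x y a M)" by (simp add: entmod_cat_def)
 then show ?thesis by (rule entw.entmodD(1)[OF ew[OF x(2)]])
qed

lemma XM_esp: "esp (XM x y a M) = xs x y a M"
 by (simp add: ext_mod_def)

text \<open>Flatness contains the functoriality of extension for extensional arrows; the general
  case follows as truncation leaves the extended map unchanged.\<close>

lemma xm_ehom:
 assumes x: "x : X" "y : X" "a : Arr \<X> x y" and M: "M : EO x" and N: "N : EO x" and \<eta>: "eh x M N \<eta>"
 shows "eh y (XM x y a M) (XM x y a N) (xm x y a M N \<eta>)"
proof -
 interpret E: entmor K C "R x" "R y" "al x y a" by (rule em[OF x])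
 note pM = EO_preent[OF x(1) M] and pN = EO_preent[OF x(1) N]
 let ?e = "E.R.eres M \<eta>"
 have e: "?e : Arr (entmod_cat U K C (R x)) M N" "eh x M N ?e"
  using E.R.ehom_eres[OF pM pN \<eta>] by (simp_all add: E.R.entmod_cat_sel E.R.entmod_hom_iff)
 have "xm x y a M N ?e : Arr (entmod_cat U K C (R y)) (XM x y a M) (XM x y a N)"
  using flat x M N e(1) unfolding flat_rep_def exact_functor_def is_functor_def by (simp add: ext_functor_def)
 then have h: "eh y (XM x y a M) (XM x y a N) (xm x y a M N ?e)" by (simp add: E.S.entmod_cat_sel)
 show ?thesis
 proof (rule E.S.ehom_cong[OF XM_EO[OF x M] XM_EO[OF x N] h])
  fix s q assume s: "s <. R y" and "q <: esp (XM x y a M) s"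
  then have q: "q <: xs x y a M s" by (simp add: XM_esp)
  note l = E.ext_map_lin_cls[OF pM pN \<eta> s] and l' = E.ext_map_lin_cls[OF pM pN e(2) s]
  show "xm x y a M N \<eta> s q = xm x y a M N ?e s q"
   by (rule E.ext_eqI[OF pM s E.ext_sp_module[OF pN s] l(1) l'(1) _ q]) (simp add: l(2) l'(2))
 qed
qed

lemma ph_lin_cls:
 assumes M: "rmod M" and x: "x : X" "y : X" "a : Arr \<X> x y" and s: "s <. R y"
 shows "lin (xs x y a (rat M x) s) (rsp M y s) (ph x y a M s)"
  and "r <. R x ==> m <: rsp M x r ==> f <: lhom (R y) s (ob x y a r) ==>
   ph x y a M s (ext_cls K (R x) (R y) (al x y a) (rat M x) s r m f) = eact (rat M y) s (ob x y a r) (rtr M x y a r m) f"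
 using entmor.ext_transpose_lin_cls[OF em[OF x] rm_pre[OF x(1) M] s rm_pre[OF x(2) M] EO_act_assoc[OF x(2) rmodD(1)[OF M x(2)]] rmodD(2)[OF M x]]
 by simp_all

text \<open>Both sides are linear, so the classes of \<open>m \<otimes> f\<close> suffice. There the
  claim combines the compatibility of \<open>\<eta>\<close> with the structure maps and with the
  action over \<open>y\<close>.\<close>

lemma ph_natural:
 assumes M: "rmod M" and N: "rmod N" and \<eta>: "rhom M N \<eta>" and x: "x : X" "y : X" "a : Arr \<X> x y"
  and s: "s <. R y" and q: "q <: xs x y a (rat M x) s"
 shows "ph x y a N s (xm x y a (rat M x) (rat N x) (\<eta> x) s q) = \<eta> y s (ph x y a M s q)"
proof -
 interpret E: entmor K C "R x" "R y" "al x y a" by (rule em[OF x])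
 note pM = rm_pre[OF x(1) M] and pN = rm_pre[OF x(1) N]
 note l = E.ext_map_lin_cls[OF pM pN rhomD(1)[OF \<eta> x(1)] s] and pm = ph_lin_cls[OF M x s] and pn = ph_lin_cls[OF N x s]
 show ?thesis
 proof (rule E.ext_eqI[OF pM s rm_mod[OF x(2) N s] lin_comp[OF l(1) pn(1)] lin_comp[OF pm(1) rhomD(2)[OF \<eta> x(2) s]] _ q])
  fix r m f assume r: "r <. R x" and m: "m <: rsp M x r" and f: "f <: lhom (R y) s (ob x y a r)"
  note o = ob_closed[OF x r] and t = rm_tr_closed[OF M x r m]
  show "ph x y a N s (xm x y a (rat M x) (rat N x) (\<eta> x) s (ext_cls K (R x) (R y) (al x y a) (rat M x) s r m f)) =
    \<eta> y s (ph x y a M s (ext_cls K (R x) (R y) (al x y a) (rat M x) s r m f))"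
   using l(2)[OF r m f] pn(2)[OF r rhomD(3)[OF \<eta> x(1) r m] f] pm(2)[OF r m f] rhomD(4)[OF \<eta> x r m]
    E.S.ehomD(5)[OF rhomD(1)[OF \<eta> x(2)] s o t f] by simp
 qed
qed

lemma cartesian_iff:
 assumes M: "rmod M"
 shows "cartesian K C \<X> \<R> M \<longleftrightarrow> (ALL x:X. ALL y:X. ALL a:Arr \<X> x y. eh y (XM x y a (rat M x)) (rat M y) (ph x y a M) &
   (ALL s:lobj (R y). bij_betw (ph x y a M s) (carrier (xs x y a (rat M x) s)) (carrier (rsp M y s))))"
 unfolding cartesian_def
proof (intro ball_cong refl)
 fix x y a assume x: "x : X" "y : X" "a : Arr \<X> x y"
 interpret Y: entw K C "R y" by (rule ew[OF x(2)])
 have "Y.eres (XM x y a (rat M x)) (ph x y a M) = ph x y a M"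
  unfolding Y.eres_def ext_transpose_def XM_esp by (intro restrict_ext) simp
 then show "entmod_iso K C (R y) (XM x y a (rat M x)) (rat M y) (ph x y a M) \<longleftrightarrow> eh y (XM x y a (rat M x)) (rat M y) (ph x y a M) &
   (ALL s:lobj (R y). bij_betw (ph x y a M s) (carrier (xs x y a (rat M x) s)) (carrier (rsp M y s)))"
  unfolding Y.entmod_iso_iff[OF XM_EO[OF x rmodD(1)[OF M x(1)]] rm_pre[OF x(2) M]] Y.entmod_hom_iff XM_esp by blast
qed

abbreviation cart :: "('x, 'a, 'k, 'o, 'm, 'c, 'v) repmod => bool" where
 "cart M \<equiv> rmod M & cartesian K C \<X> \<R> M"

lemma cartD:
 assumes "cart M"
 shows "rmod M" "x : X ==> y : X ==> a : Arr \<X> x y ==> eh y (XM x y a (rat M x)) (rat M y) (ph x y a M)"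
  "x : X ==> y : X ==> a : Arr \<X> x y ==> s <. R y ==> inj_on (ph x y a M s) (carrier (xs x y a (rat M x) s))"
  "x : X ==> y : X ==> a : Arr \<X> x y ==> s <. R y ==>
   ph x y a M s ` carrier (xs x y a (rat M x) s) = carrier (rsp M y s)"
proof -
 show M: "rmod M" using assms by blast
 note c = conjunct2[OF assms, unfolded cartesian_iff[OF M]]
 show "eh y (XM x y a (rat M x)) (rat M y) (ph x y a M)" if "x : X" "y : X" "a : Arr \<X> x y" using c that by blast
 have b: "bij_betw (ph x y a M s) (carrier (xs x y a (rat M x) s)) (carrier (rsp M y s))"
  if "x : X" "y : X" "a : Arr \<X> x y" "s <. R y" for x y a s using c that by blast
 show "inj_on (ph x y a M s) (carrier (xs x y a (rat M x) s))"
  "ph x y a M s ` carrier (xs x y a (rat M x) s) = carrier (rsp M y s)"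
  if "x : X" "y : X" "a : Arr \<X> x y" "s <. R y" using b[OF that] by (simp_all add: bij_betw_def)
qed

end

section \<open>Testing the cartesian condition\<close>

lemma bchoice2:
 assumes "!!x. x : A ==> EX a b. P x a b"
 obtains f g where "!!x. x : A ==> P x (f x) (g x)"
 using assms by metis

context ground
begin

text \<open>The maps \<open>f i\<close> add up to a surjection from the direct sum of the
  \<open>V i\<close>, and the \<open>g i\<close> recover the components. So an element on which all
  \<open>g i\<close> vanish is the image of zero. Applied to extended modules, this replaces an
  isomorphism between the extension of a direct sum and the direct sum of the extensions.\<close>

lemma jointly_separating:
 assumes V: "!!i. i : I ==> module K (V i)" and W: "module K W"
  and f: "!!i. i : I ==> lin (V i) W (f i)" and g: "!!i. i : I ==> lin W (V i) (g i)"
  and eq: "!!i v. i : I ==> v <: V i ==> g i (f i v) = v"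
   "!!i j v. i : I ==> j : I ==> i ~= j ==> v <: V i ==> g j (f i v) = 0[V j]"
  and span: "!!H. subspace W H ==> (!!i v. i : I ==> v <: V i ==> f i v : H) ==> carrier W \<subseteq> H"
  and w: "w <: W" "!!i. i : I ==> g i w = 0[V i]"
 shows "w = 0[W]"
proof -
 let ?D = "dsum_mod I V" and ?j = "dsum_inj I V"
 have d: "is_dsum I V ?D ?j (%i u. u i)" by (rule dsum_mod_is_dsum[OF V])
 have D: "module K ?D" by (rule is_dsumD(1)[OF d])
 let ?L = "dev I V (%i u. u i) W f"
 note L = dsum_dev_lin[OF d W f]
 have Lj: "?L (?j i v) = f i v" if "i : I" "v <: V i" for i v by (rule dsum_dev_inj[OF d W f that])
 have "carrier W \<subseteq> ?L ` carrier ?D"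
 proof (rule span)
  show "subspace W (?L ` carrier ?D)" by (rule subspace_image[OF D W L])
  fix i v assume i: "i : I" and v: "v <: V i"
  show "f i v : ?L ` carrier ?D"
   by (rule image_eqI[where f = ?L, OF Lj[OF i v, symmetric] lin_closed[OF is_dsumD(3)[OF d i] v]])
 qed
 then obtain u where u: "u <: ?D" "w = ?L u" using w(1) by blast
 have gL: "g i (?L u) = u i" if i: "i : I" for i
 proof -
  have "carrier ?D \<subseteq> {u : carrier ?D. g i (?L u) = u i}"
  proof (rule dsum_span[OF d subspace_equalizer[OF D V[OF i] lin_comp[OF L g[OF i]] is_dsumD(4)[OF d i]]])
   fix j v assume j: "j : I" and v: "v <: V j"
   have "g i (?L (?j j v)) = ?j j v i"
    using Lj[OF j v] eq(1)[OF i, of v] eq(2)[OF j i _ v] is_dsumD(5)[OF d j v] is_dsumD(6)[OF d j i v] v by (cases "i = j") simp_all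
   then show "?j j v : {u : carrier ?D. g i (?L u) = u i}"
    using lin_closed[OF is_dsumD(3)[OF d j] v] by simp
  qed
  then show ?thesis using u(1) by blast
 qed
 have "u = 0[?D]" by (rule is_dsumD(8)[OF d u(1)]) (use gL w(2) u(2) in simp)
 then show ?thesis using u(2) lin_zero[OF D W L] by simp
qed

end

context entmor
begin

lemma ext_map_zero:
 assumes M: "R.preent M" and N: "R.preent N" and s: "s <. S" and q: "q <: es M s"
 shows "em M N (%r m. 0[esp N r]) s q = 0[es N s]"
proof -
 note l = ext_map_lin_cls[OF M N R.ehom_zero[OF M N] s] and Z = ext_sp_module[OF N s]
 show ?thesis
  by (rule ext_eqI[OF M s Z l(1) lin_const_zero[OF Z] _ q])
   (simp add: l(2) bilin_zero[OF R.preentD(1)[OF N] S.H_module Z ext_cls_bilin[OF N s]] s \<alpha>_ob)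
qed

end

context cartl
begin

lemma rhom_mk:
 assumes "rmod L" "!!x. x : X ==> eh x (rat L x) (Q x) (\<eta> x)"
  "!!x y \<alpha> r m. x : X ==> y : X ==> \<alpha> : Arr \<X> x y ==> r <. R x ==> m <: rsp L x r ==>
    tr x y \<alpha> r (\<eta> x r m) = \<eta> y (ob x y \<alpha> r) (rtr L x y \<alpha> r m)"
 shows "rhom L (mk Q tr) \<eta>"
proof (rule rhomI)
 fix x assume x: "x : X"
 show "eh x (rat L x) (rat (mk Q tr) x) (\<eta> x)" using assms(2)[OF x] by (simp add: mk_sel(1))
next
 fix x y \<alpha> r m assume a: "x : X" "y : X" "\<alpha> : Arr \<X> x y" "r <. R x" "m <: rsp L x r"
 show "rtr (mk Q tr) x y \<alpha> r (\<eta> x r m) = \<eta> y (ob x y \<alpha> r) (rtr L x y \<alpha> r m)"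
  using mk_sel(2)[where Q = Q and m = "\<eta> x r m", OF a(4) entw.ehomD(3)[OF ew[OF a(1)] assms(2)[OF a(1)] a(4,5)]] assms(3)[OF a] by simp
qed

lemma ph_zero:
 assumes "rmod M" "x : X" "y : X" "a : Arr \<X> x y" "s <. R y"
 shows "ph x y a M s 0[xs x y a (rat M x) s] = 0[rsp M y s]"
 by (rule lin_zero[OF entmor.ext_sp_module[OF em[OF assms(2-4)] rm_pre[OF assms(2,1)] assms(5)] rm_mod[OF assms(3,1,5)] ph_lin_cls(1)[OF assms]])

lemma cartI:
 assumes N: "rmod N"
  and hom: "!!x y a. x : X ==> y : X ==> a : Arr \<X> x y ==> eh y (XM x y a (rat N x)) (rat N y) (ph x y a N)"
  and inj: "!!x y a s q. x : X ==> y : X ==> a : Arr \<X> x y ==> s <. R y ==> q <: xs x y a (rat N x) s ==>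
   ph x y a N s q = 0[rsp N y s] ==> q = 0[xs x y a (rat N x) s]"
  and surj: "!!x y a s. x : X ==> y : X ==> a : Arr \<X> x y ==> s <. R y ==>
   carrier (rsp N y s) \<subseteq> ph x y a N s ` carrier (xs x y a (rat N x) s)"
 shows "cart N"
 unfolding cartesian_iff[OF N, symmetric]
proof (intro conjI N, unfold cartesian_iff[OF N], intro ballI conjI)
 fix x y a assume x: "x : X" "y : X" "a : Arr \<X> x y"
 show "eh y (XM x y a (rat N x)) (rat N y) (ph x y a N)" by (rule hom[OF x])
 fix s assume s: "s <. R y"
 note l = ph_lin_cls(1)[OF N x s] and m = entmor.ext_sp_module[OF em[OF x] rm_pre[OF x(1) N] s]
 have "inj_on (ph x y a N s) (carrier (xs x y a (rat N x) s))"
  unfolding lin_inj_iff[OF m rm_mod[OF x(2) N s] l] using inj[OF x s] by blast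
 moreover have "ph x y a N s ` carrier (xs x y a (rat N x) s) = carrier (rsp N y s)"
  by (rule subset_antisym[OF image_subsetI[OF lin_closed[OF l]] surj[OF x s]])
 ultimately show "bij_betw (ph x y a N s) (carrier (xs x y a (rat N x) s)) (carrier (rsp N y s))"
  by (rule bij_betw_imageI)
qed

text \<open>The cokernel of the injection supplies the third term of an exact sequence, to which
  \<open>flat_exact\<close> applies.\<close>

lemma xm_inj:
 assumes x: "x : X" "y : X" "a : Arr \<X> x y" and L: "L : EO x" and M: "M : EO x" and k: "eh x L M k"
  and inj: "!!r. r <. R x ==> inj_on (k r) (carrier (esp L r))" and s: "s <. R y"
 shows "inj_on (xm x y a L M k s) (carrier (xs x y a L s))"
proof -
 interpret E: entmor K C "R x" "R y" "al x y a" by (rule em[OF x])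
 have fl: "exact_functor (entmod_cat U K C (R x) :: (('k, 'o, 'm, 'c, 'v) entmod, 'o => 'v => 'v) cat)
   (entmod_cat U K C (R y)) (ext_functor K C (R x) (R y) (al x y a))"
  using flat x by (simp add: flat_rep_def)
 have pL: "E.R.preent L" and pM: "E.R.preent M" by (rule EO_preent[OF x(1) L], rule EO_preent[OF x(1) M])
 have "E.R.eres L k : Arr (entmod_cat U K C (R x)) L M"
  using E.R.ehom_eres[OF pL pM k] by (simp add: E.R.entmod_cat_sel E.R.entmod_hom_iff)
 from E.R.entmod_cat_cokernel[OF L M this] obtain Q p where Q: "Q : EO x" and p: "p : Arr (entmod_cat U K C (R x)) M Q"
  and ex: "ALL s:lobj (R x). p s ` carrier (esp M s) = carrier (esp Q s) &
    {x : carrier (esp M s). p s x = 0[esp Q s]} = E.R.eres L k s ` carrier (esp L s)" by blast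
 show ?thesis
 proof (rule E.flat_exact(1)[OF fl L M Q k _ inj _ s])
  show "E.R.ehom M Q p" using p by (simp add: E.R.entmod_cat_sel)
  fix r assume r: "r <. R x"
  have "k r ` carrier (esp L r) = E.R.eres L k r ` carrier (esp L r)"
   by (rule image_cong) (simp_all add: E.R.eres_def r)
  then show "k r ` carrier (esp L r) = {m : carrier (esp M r). p r m = 0[esp Q r]}" using ex r by simp
 qed
qed

end

text \<open>The situation common to cokernels and coproducts: \<open>Q\<close> is generated by the
  images of modules \<open>M i\<close>, and its structure maps are linear and prescribed on these
  images. Everything except the injectivity of the transposed maps is then inherited from the
  \<open>M i\<close>.\<close>

locale cartl_gen = cartl K C U \<X> \<R>
 for K :: "('k, 'z) ring_scheme" (structure) and C :: "('k, 'c) coalgebra" and U :: "'v set"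
  and \<X> :: "('x, 'a) cat" and \<R> :: "('x, 'a, 'k, 'o, 'm, 'c) rep" +
 fixes I :: "'i set" and M :: "'i => ('x, 'a, 'k, 'o, 'm, 'c, 'v) repmod" and Q :: "'x => ('k, 'o, 'm, 'c, 'v) entmod"
  and \<iota> :: "'i => 'x => 'o => 'v => 'v" and tr :: "'x => 'x => 'a => 'o => 'v => 'v"
 assumes M: "!!i. i : I ==> rmod (M i)" and Q: "!!x. x : X ==> Q x : EO x"
  and \<iota>: "!!i x. i : I ==> x : X ==> eh x (rat (M i) x) (Q x) (\<iota> i x)"
  and span: "!!x r H. x : X ==> r <. R x ==> subspace (esp (Q x) r) H ==>
   (!!i v. i : I ==> v <: esp (rat (M i) x) r ==> \<iota> i x r v : H) ==> carrier (esp (Q x) r) \<subseteq> H"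
  and tr: "!!x y a r. x : X ==> y : X ==> a : Arr \<X> x y ==> r <. R x ==>
   lin (esp (Q x) r) (esp (Q y) (ob x y a r)) (tr x y a r)"
  and tr_\<iota>: "!!i x y a r m. i : I ==> x : X ==> y : X ==> a : Arr \<X> x y ==> r <. R x ==>
   m <: esp (rat (M i) x) r ==> tr x y a r (\<iota> i x r m) = \<iota> i y (ob x y a r) (rtr (M i) x y a r m)"
begin

lemma gen_\<iota>_closed: "i : I ==> x : X ==> r <. R x ==> m <: esp (rat (M i) x) r ==> \<iota> i x r m <: esp (Q x) r"
 by (rule entw.ehomD(3)[OF ew \<iota>])

lemma gen_ehom:
 fixes P :: "('k, 'o, 'm, 'c, 'w) entmod"
 assumes x: "x : X" and P: "entw.preent K C (R x) P" and u: "!!r. r <. R x ==> lin (esp (Q x) r) (esp P r) (u r)"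
  and h: "!!i. i : I ==> eh x (rat (M i) x) P (%r v. u r (\<iota> i x r v))"
 shows "eh x (Q x) P u"
proof (rule entw.ehom_gen[OF ew[OF x] EO_preent[OF x Q[OF x]] P u, where S = "%r. \<Union>i\<in>I. \<iota> i x r ` carrier (esp (rat (M i) x) r)"])
 fix r H assume r: "r <. R x" "subspace (esp (Q x) r) H" "(\<Union>i\<in>I. \<iota> i x r ` carrier (esp (rat (M i) x) r)) \<subseteq> H"
 show "carrier (esp (Q x) r) \<subseteq> H" by (rule span[OF x r(1,2)]) (use r(3) in blast)
next
 fix r n assume r: "r <. R x" and "n : (\<Union>i\<in>I. \<iota> i x r ` carrier (esp (rat (M i) x) r))"
 then obtain i m where i: "i : I" "m <: esp (rat (M i) x) r" "n = \<iota> i x r m" by blast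
 show "EX (M :: ('k, 'o, 'm, 'c, 'v) entmod) f m. entw.preent K C (R x) M & eh x M (Q x) f & eh x M P (%r x. u r (f r x)) & m <: esp M r & n = f r m"
  by (intro exI conjI, rule rm_pre[OF x M[OF i(1)]], rule \<iota>[OF i(1) x], rule h[OF i(1)], rule i(2), rule i(3))
qed (assumption, rule UN_least, rule image_subsetI, rule gen_\<iota>_closed[OF _ x])

lemma gen_rmod: "rmod (mk Q tr)"
proof (rule mk_rmod[OF Q])
 fix x y a assume a: "x : X" "y : X" "a : Arr \<X> x y"
 interpret E: entmor K C "R x" "R y" "al x y a" by (rule em[OF a])
 show "eh x (Q x) (res_mod (al x y a) (Q y)) (tr x y a)"
 proof (rule gen_ehom[OF a(1) E.res_preent[OF EO_preent[OF a(2) Q[OF a(2)]]]])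
  fix r assume "r <. R x"
  then show "lin (esp (Q x) r) (esp (res_mod (al x y a) (Q y)) r) (tr x y a r)" using tr[OF a] by (simp add: res_mod_def)
 next
  fix i assume i: "i : I"
  note pM = rm_pre[OF a(1) M[OF i]] and pQ = E.res_preent[OF EO_preent[OF a(2) Q[OF a(2)]]]
  show "eh x (rat (M i) x) (res_mod (al x y a) (Q y)) (%r v. tr x y a r (\<iota> i x r v))"
   by (rule E.R.ehom_cong[OF pM pQ E.R.ehom_comp[OF pM E.res_preent[OF rm_pre[OF a(2) M[OF i]]] pQ rmodD(2)[OF M[OF i] a] E.res_ehom[OF \<iota>[OF i a(2)]]]
     tr_\<iota>[OF i a]])
 qed
next
 fix x r m assume x: "x : X" and r: "r <. R x" and m: "m <: esp (Q x) r"
 note o = ob_idn_comp(1)[OF x r]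
 have i: "Idn \<X> x : Arr \<X> x x" using cat x by (simp add: is_cat_def)
 note mQ = EO_module[OF x Q[OF x] r]
 have "carrier (esp (Q x) r) \<subseteq> {m : carrier (esp (Q x) r). tr x x (Idn \<X> x) r m = m}"
  by (rule span[OF x r subspace_equalizer[OF mQ mQ tr[OF x x i r, unfolded o] lin_id]])
   (simp add: gen_\<iota>_closed[OF _ x r] tr_\<iota>[OF _ x x i r] rmodD(4)[OF M x r] o)
 then show "tr x x (Idn \<X> x) r m = m" using m by blast
next
 fix x y z a \<beta> r m assume a: "x : X" "y : X" "z : X" "a : Arr \<X> x y" "\<beta> : Arr \<X> y z" "r <. R x"
  and m: "m <: esp (Q x) r"
 have c: "Cmp \<X> x y z \<beta> a : Arr \<X> x z" using cat a unfolding is_cat_def by blast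
 note o = ob_idn_comp(2)[OF a] and oy = ob_closed[OF a(1,2,4,6)] note oz = ob_closed[OF a(2,3,5) oy]
 have "carrier (esp (Q x) r) \<subseteq> {m : carrier (esp (Q x) r). tr x z (Cmp \<X> x y z \<beta> a) r m = tr y z \<beta> (ob x y a r) (tr x y a r m)}"
 proof (rule span[OF a(1,6) subspace_equalizer[OF EO_module[OF a(1) Q[OF a(1)] a(6)] EO_module[OF a(3) Q[OF a(3)] oz]
     tr[OF a(1,3) c a(6), unfolded o] lin_comp[OF tr[OF a(1,2,4,6)] tr[OF a(2,3,5) oy]]]])
  fix i v assume i: "i : I" and v: "v <: esp (rat (M i) x) r"
  show "\<iota> i x r v : {m : carrier (esp (Q x) r). tr x z (Cmp \<X> x y z \<beta> a) r m = tr y z \<beta> (ob x y a r) (tr x y a r m)}"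
   by (simp add: gen_\<iota>_closed[OF i a(1,6) v] tr_\<iota>[OF i a(1,3) c a(6) v] tr_\<iota>[OF i a(1,2,4,6) v]
     tr_\<iota>[OF i a(2,3,5) oy rm_tr_closed[OF M[OF i] a(1,2,4,6) v]] rmodD(5)[OF M[OF i] a v] o)
 qed
 then show "tr x z (Cmp \<X> x y z \<beta> a) r m = tr y z \<beta> (ob x y a r) (tr x y a r m)" using m by blast
qed

lemma gen_rhom: "i : I ==> rhom (M i) (mk Q tr) (\<iota> i)"
 by (rule rhom_mk[OF M \<iota> tr_\<iota>])

lemma gen_copair:
 assumes N: "rmod N" and h: "!!i. i : I ==> rhom (M i) N (h i)"
  and u: "!!x r. x : X ==> r <. R x ==> lin (esp (Q x) r) (rsp N x r) (u x r)"
  and eq: "!!i x r v. i : I ==> x : X ==> r <. R x ==> v <: esp (rat (M i) x) r ==> u x r (\<iota> i x r v) = h i x r v"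
 shows "rhom (mk Q tr) N u"
proof (rule rhomI, unfold mk_sel(1))
 fix x assume x: "x : X"
 show "eh x (Q x) (rat N x) (u x)"
  by (rule gen_ehom[OF x rm_pre[OF x N] u[OF x]], assumption, rule entw.ehom_cong[OF ew[OF x] rm_pre[OF x M] rm_pre[OF x N] rhomD(1)[OF h x]])
   (simp_all add: eq x)
next
 fix x y \<alpha> r m assume a: "x : X" "y : X" "\<alpha> : Arr \<X> x y" "r <. R x" and m: "m <: esp (Q x) r"
 note o = ob_closed[OF a]
 have "carrier (esp (Q x) r) \<subseteq> {m : carrier (esp (Q x) r). rtr N x y \<alpha> r (u x r m) = u y (ob x y \<alpha> r) (tr x y \<alpha> r m)}"
 proof (rule span[OF a(1,4) subspace_equalizer[OF EO_module[OF a(1) Q[OF a(1)] a(4)] rm_mod[OF a(2) N o]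
     lin_comp[OF u[OF a(1,4)] rmodD(3)[OF N a]] lin_comp[OF tr[OF a] u[OF a(2) o]]]])
  fix i v assume i: "i : I" and v: "v <: esp (rat (M i) x) r"
  show "\<iota> i x r v : {m : carrier (esp (Q x) r). rtr N x y \<alpha> r (u x r m) = u y (ob x y \<alpha> r) (tr x y \<alpha> r m)}"
   by (simp add: gen_\<iota>_closed[OF i a(1,4) v] tr_\<iota>[OF i a v] eq[OF i a(1,4) v] eq[OF i a(2) o rm_tr_closed[OF M[OF i] a v]] rhomD(4)[OF h[OF i] a v])
 qed
 then show "rtr N x y \<alpha> r (u x r m) = u y (ob x y \<alpha> r) (rtr (mk Q tr) x y \<alpha> r m)" using m mk_sel(2)[where r=r and x = x and Q=Q, OF a(4) m] by auto
qed

text \<open>Extension preserves joint generation: for \<open>m\<close> in the image of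
  \<open>M i\<close>, the class of \<open>m \<otimes> f\<close> is the image of a class in the
  extension of \<open>M i\<close>.\<close>

lemma gen_xs_span:
 assumes x: "x : X" "y : X" "a : Arr \<X> x y" and s: "s <. R y" and H: "subspace (xs x y a (Q x) s) H"
  and h: "!!i q. i : I ==> q <: xs x y a (rat (M i) x) s ==> xm x y a (rat (M i) x) (Q x) (\<iota> i x) s q : H"
 shows "carrier (xs x y a (Q x) s) \<subseteq> H"
proof (rule entmor.ext_gen[OF em[OF x] EO_preent[OF x(1) Q[OF x(1)]] s H, where B = "%r. \<Union>i\<in>I. \<iota> i x r ` carrier (esp (rat (M i) x) r)"])
 fix r G assume r: "r <. R x" "subspace (esp (Q x) r) G" "(\<Union>i\<in>I. \<iota> i x r ` carrier (esp (rat (M i) x) r)) \<subseteq> G"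
 show "carrier (esp (Q x) r) \<subseteq> G" by (rule span[OF x(1) r(1,2)]) (use r(3) in blast)
next
 fix r m f assume r: "r <. R x" and m: "m : (\<Union>i\<in>I. \<iota> i x r ` carrier (esp (rat (M i) x) r))"
  and f: "f <: lhom (R y) s (ob x y a r)"
 obtain i v where i: "i : I" "v <: esp (rat (M i) x) r" "m = \<iota> i x r v" using m by blast
 note E = em[OF x] and pM = rm_pre[OF x(1) M[OF i(1)]]
 show "ext_cls K (R x) (R y) (al x y a) (Q x) s r m f : H"
  using h[OF i(1) entmor.ext_cls_closed[OF E pM s r i(2) f]]
   entmor.ext_map_lin_cls(2)[OF E pM EO_preent[OF x(1) Q[OF x(1)]] \<iota>[OF i(1) x(1)] s r i(2) f] i(3) by simp
qed (rule UN_least, rule image_subsetI, rule gen_\<iota>_closed[OF _ x(1)])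

lemma gen_ph:
 assumes "i : I" "x : X" "y : X" "a : Arr \<X> x y" "s <. R y" "q <: xs x y a (rat (M i) x) s"
 shows "ph x y a (mk Q tr) s (xm x y a (rat (M i) x) (Q x) (\<iota> i x) s q) = \<iota> i y s (ph x y a (M i) s q)"
 using ph_natural[OF M[OF assms(1)] gen_rmod gen_rhom[OF assms(1)] assms(2-6)] by (simp add: mk_sel(1))

text \<open>The transposed map of \<open>Q\<close> after the extension of \<open>\<iota> i\<close>
  is \<open>\<iota> i\<close> after the transposed map of \<open>M i\<close>. Hence it is a morphism
  on generators of its source and reaches generators of its target; only injectivity has to be
  supplied.\<close>

lemma gen_cart:
 assumes ca: "!!i. i : I ==> cart (M i)"
  and inj: "!!x y a s q. x : X ==> y : X ==> a : Arr \<X> x y ==> s <. R y ==> q <: xs x y a (Q x) s ==>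
   ph x y a (mk Q tr) s q = 0[esp (Q y) s] ==> q = 0[xs x y a (Q x) s]"
 shows "cart (mk Q tr)"
proof (rule cartI[OF gen_rmod], unfold mk_sel(1))
 fix x y a assume x: "x : X" "y : X" "a : Arr \<X> x y"
 let ?p = "ext_transpose K (R x) (R y) (al x y a) (Q x) (Q y) (rtr (mk Q tr) x y a)"
 note E = em[OF x] and pQ = EO_preent[OF x(1) Q[OF x(1)]] and pM = rm_pre[OF x(1) M]
 have l: "lin (xs x y a (rat (M i) x) s) (xs x y a (Q x) s) (xm x y a (rat (M i) x) (Q x) (\<iota> i x) s)"
  if i: "i : I" and s: "s <. R y" for i s
  by (rule entmor.ext_map_lin_cls(1)[OF E pM[OF i] pQ \<iota>[OF i x(1)] s])
 note pl = ph_lin_cls(1)[OF gen_rmod x, unfolded mk_sel(1)]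
 show "eh y (XM x y a (Q x)) (Q y) (?p)"
 proof (rule entw.ehom_gen[OF ew[OF x(2)] XM_EO[OF x Q[OF x(1)]] EO_preent[OF x(2) Q[OF x(2)]],
    where S = "%s. \<Union>i\<in>I. xm x y a (rat (M i) x) (Q x) (\<iota> i x) s ` carrier (xs x y a (rat (M i) x) s)", unfolded XM_esp])
  fix s assume "s <. R y"
  then show "lin (xs x y a (Q x) s) (esp (Q y) s) (?p s)" by (rule pl)
 next
  fix s H assume s: "s <. R y" "subspace (xs x y a (Q x) s) H"
   "(\<Union>i\<in>I. xm x y a (rat (M i) x) (Q x) (\<iota> i x) s ` carrier (xs x y a (rat (M i) x) s)) \<subseteq> H"
  show "carrier (xs x y a (Q x) s) \<subseteq> H" by (rule gen_xs_span[OF x s(1,2)]) (use s(3) in blast)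
 next
  fix s assume s: "s <. R y"
  show "(\<Union>i\<in>I. xm x y a (rat (M i) x) (Q x) (\<iota> i x) s ` carrier (xs x y a (rat (M i) x) s)) \<subseteq> carrier (xs x y a (Q x) s)"
   by (rule UN_least, rule image_subsetI, rule lin_closed[OF l[OF _ s]])
 next
  fix s n assume s: "s <. R y" and n: "n : (\<Union>i\<in>I. xm x y a (rat (M i) x) (Q x) (\<iota> i x) s ` carrier (xs x y a (rat (M i) x) s))"
  obtain i q where i: "i : I" "q <: xs x y a (rat (M i) x) s" "n = xm x y a (rat (M i) x) (Q x) (\<iota> i x) s q" using n by blast
  note MO = rmodD(1)[OF M[OF i(1)]]
  have hh: "eh y (XM x y a (rat (M i) x)) (Q y) (%s q. ?p s (xm x y a (rat (M i) x) (Q x) (\<iota> i x) s q))"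
   by (rule entw.ehom_cong[OF ew[OF x(2)] XM_EO[OF x MO[OF x(1)]] EO_preent[OF x(2) Q[OF x(2)]]
      entw.ehom_comp[OF ew[OF x(2)] XM_EO[OF x MO[OF x(1)]] EO_preent[OF x(2) MO[OF x(2)]] EO_preent[OF x(2) Q[OF x(2)]]
       cartD(2)[OF ca[OF i(1)] x] \<iota>[OF i(1) x(2)]]])
    (simp add: XM_esp gen_ph[OF i(1) x, unfolded mk_sel(1)])
  show "EX (M :: ('k, 'o, 'm, 'c, ('k, 'o, 'v, 'm) extel) entmod) f m. entw.preent K C (R y) M & eh y M (XM x y a (Q x)) f &
    eh y M (Q y) (%s q. ?p s (f s q)) & m <: esp M s & n = f s m"
   by (intro exI[of _ "XM x y a (rat (M i) x)"] exI[of _ "xm x y a (rat (M i) x) (Q x) (\<iota> i x)"] exI[of _ q] conjI)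
    (rule XM_EO[OF x MO[OF x(1)]], rule xm_ehom[OF x MO[OF x(1)] Q[OF x(1)] \<iota>[OF i(1) x(1)]], rule hh,
     simp add: XM_esp i(2), rule i(3))
 qed
 fix s assume s: "s <. R y"
 show "q = 0[xs x y a (Q x) s]" if "q <: xs x y a (Q x) s" "?p s q = 0[esp (Q y) s]" for q
  by (rule inj[unfolded mk_sel(1), OF x s that])
 note mx = entmor.ext_sp_module[OF E pQ s] and my = EO_module[OF x(2) Q[OF x(2)] s]
 show "carrier (esp (Q y) s) \<subseteq> ?p s ` carrier (xs x y a (Q x) s)"
 proof (rule span[OF x(2) s subspace_image[OF mx my pl[OF s]]])
  fix i v assume i: "i : I" and v: "v <: esp (rat (M i) y) s"
  obtain q where q: "q <: xs x y a (rat (M i) x) s" "v = ph x y a (M i) s q"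
   using v cartD(4)[OF ca[OF i] x s] by blast
  show "\<iota> i y s v : ?p s ` carrier (xs x y a (Q x) s)"
   unfolding q(2) by (rule image_eqI[where f = "?p s", OF gen_ph[OF i x s q(1), unfolded mk_sel(1), symmetric] lin_closed[OF l[OF i s] q(1)]])
 qed
qed

end

section \<open>Kernels and cokernels of cartesian modules\<close>

context cartl
begin

text \<open>The structure maps of \<open>M\<close> are pulled back along the injections
  \<open>k\<close>, which also reflect functoriality and the morphism laws.\<close>

lemma sub_repmod:
 assumes M: "rmod M" and L: "!!x. x : X ==> L x : EO x" and k: "!!x. x : X ==> eh x (L x) (rat M x) (k x)"
  and inj: "!!x r. x : X ==> r <. R x ==> inj_on (k x r) (carrier (esp (L x) r))"
  and stable: "!!x y \<alpha> r v. x : X ==> y : X ==> \<alpha> : Arr \<X> x y ==> r <. R x ==> v <: esp (L x) r ==>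
   rtr M x y \<alpha> r (k x r v) : k y (ob x y \<alpha> r) ` carrier (esp (L y) (ob x y \<alpha> r))"
 obtains N where "rmod N" "rat N = L" "rhom N M k"
proof -
 let ?t = "%x y \<alpha> r v. the_inv_into (carrier (esp (L y) (ob x y \<alpha> r))) (k y (ob x y \<alpha> r)) (rtr M x y \<alpha> r (k x r v))"
 have t: "?t x y \<alpha> r v <: esp (L y) (ob x y \<alpha> r)" "k y (ob x y \<alpha> r) (?t x y \<alpha> r v) = rtr M x y \<alpha> r (k x r v)"
  if a: "x : X" "y : X" "\<alpha> : Arr \<X> x y" "r <. R x" "v <: esp (L x) r" for x y \<alpha> r v
  using the_inv_into_into[OF inj[OF a(2) ob_closed[OF a(1-4)]] stable[OF a] subset_refl]
   f_the_inv_into_f[OF inj[OF a(2) ob_closed[OF a(1-4)]] stable[OF a]] by blast+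
 have kc: "k x r v <: rsp M x r" if "x : X" "r <. R x" "v <: esp (L x) r" for x r v
  by (rule entw.ehomD(3)[OF ew[OF that(1)] k[OF that(1)] that(2,3)])
 have N: "rmod (mk L ?t)"
 proof (rule mk_rmod[OF L])
  fix x y \<alpha> assume a: "x : X" "y : X" "\<alpha> : Arr \<X> x y"
  interpret E: entmor K C "R x" "R y" "al x y \<alpha>" by (rule em[OF a])
  note pL = EO_preent[OF _ L] and pM = rm_pre[OF _ M]
  show "eh x (L x) (res_mod (al x y \<alpha>) (L y)) (?t x y \<alpha>)"
  proof (rule E.R.ehom_factor_inj[OF pL[OF a(1)] E.res_preent[OF pL[OF a(2)]] E.res_preent[OF pM[OF a(2)]] E.res_ehom[OF k[OF a(2)]] _
     E.R.ehom_comp[OF pL[OF a(1)] pM[OF a(1)] E.res_preent[OF pM[OF a(2)]] k[OF a(1)] rmodD(2)[OF M a]]])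
  qed (simp_all add: res_mod_def inj a ob_closed[OF a] t[OF a])
 next
  fix x r m assume a: "x : X" "r <. R x" and m: "m <: esp (L x) r"
  have i: "Idn \<X> x : Arr \<X> x x" using cat a(1) by (simp add: is_cat_def)
  show "?t x x (Idn \<X> x) r m = m"
   using the_inv_into_f_f[OF inj[OF a] m] by (simp add: ob_idn_comp(1)[OF a] rmodD(4)[OF M a kc[OF a m]])
 next
  fix x y z \<alpha> \<beta> r m assume a: "x : X" "y : X" "z : X" "\<alpha> : Arr \<X> x y" "\<beta> : Arr \<X> y z" "r <. R x"
   and m: "m <: esp (L x) r"
  show "?t x z (Cmp \<X> x y z \<beta> \<alpha>) r m = ?t y z \<beta> (ob x y \<alpha> r) (?t x y \<alpha> r m)"
   using t(2)[OF a(1,2,4,6) m] by (simp add: ob_idn_comp(2)[OF a] rmodD(5)[OF M a kc[OF a(1,6) m]])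
 qed
 have "rhom (mk L ?t) M k"
 proof (rule rhomI, unfold mk_sel(1), rule k)
  fix x y \<alpha> r m assume a: "x : X" "y : X" "\<alpha> : Arr \<X> x y" "r <. R x" and m: "m <: esp (L x) r"
  show "rtr M x y \<alpha> r (k x r m) = k y (ob x y \<alpha> r) (rtr (mk L ?t) x y \<alpha> r m)"
   using mk_sel(2)[where Q = L and tr = ?t, OF a(4) m] t(2)[OF a m] by simp
 qed
 then show ?thesis by (rule that[OF N mk_sel(1)])
qed

text \<open>The transposed map of \<open>N\<close> is injective because that of \<open>M\<close> is
  and because, by flatness, so is the extension of \<open>k\<close>. The hypothesis
  \<open>surj\<close> asks that the preimage of an element of \<open>N\<close> in the extension of
  \<open>M\<close> can be taken from the extension of \<open>N\<close>.\<close>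

lemma sub_cart:
 assumes M: "cart M" and N: "rmod N" and k: "rhom N M k"
  and inj: "!!x r. x : X ==> r <. R x ==> inj_on (k x r) (carrier (rsp N x r))"
  and surj: "!!x y a s v. x : X ==> y : X ==> a : Arr \<X> x y ==> s <. R y ==> v <: rsp N y s ==>
   EX q:carrier (xs x y a (rat N x) s). ph x y a M s (xm x y a (rat N x) (rat M x) (k x) s q) = k y s v"
 shows "cart N"
proof (rule cartI[OF N])
 note M' = cartD(1)[OF M]
 fix x y a assume x: "x : X" "y : X" "a : Arr \<X> x y"
 note nat = ph_natural[OF N M' k x] and pl = ph_lin_cls(1)[OF N x]
 note Nx = rmodD(1)[OF N x(1)] and Mx = rmodD(1)[OF M' x(1)]
 note hk = xm_ehom[OF x Nx Mx rhomD(1)[OF k x(1)]]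
 note pX = XM_EO[OF x Nx] XM_EO[OF x Mx]
 show "eh y (XM x y a (rat N x)) (rat N y) (ph x y a N)"
  by (rule entw.ehom_factor_inj[OF ew[OF x(2)] pX(1) rm_pre[OF x(2) N] rm_pre[OF x(2) M'] rhomD(1)[OF k x(2)] inj[OF x(2)]
     entw.ehom_comp[OF ew[OF x(2)] pX rm_pre[OF x(2) M'] hk cartD(2)[OF M x]]], assumption)
   (simp_all add: XM_esp nat lin_closed[OF pl])
 fix s assume s: "s <. R y"
 note lk = entw.ehomD(2)[OF ew[OF x(2)] hk s, unfolded XM_esp]
 show "q = 0[xs x y a (rat N x) s]" if q: "q <: xs x y a (rat N x) s" and z: "ph x y a N s q = 0[rsp N y s]" for q
 proof -
  note mx = entmor.ext_sp_module[OF em[OF x] rm_pre[OF x(1) N] s] entmor.ext_sp_module[OF em[OF x] rm_pre[OF x(1) M'] s]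
  note zc = mod_closed(2)[OF mx(1)] and z0 = lin_zero[OF mx lk]
  have "ph x y a M s (xm x y a (rat N x) (rat M x) (k x) s q) = ph x y a M s (xm x y a (rat N x) (rat M x) (k x) s 0[xs x y a (rat N x) s])"
   using nat[OF s q] z z0 ph_zero[OF M' x s] lin_zero[OF rm_mod[OF x(2) N s] rm_mod[OF x(2) M' s] rhomD(2)[OF k x(2) s]] by simp
  then have "xm x y a (rat N x) (rat M x) (k x) s q = xm x y a (rat N x) (rat M x) (k x) s 0[xs x y a (rat N x) s]"
   by (rule inj_onD[OF cartD(3)[OF M x s] _ lin_closed[OF lk q] lin_closed[OF lk zc]])
  moreover have "inj_on (xm x y a (rat N x) (rat M x) (k x) s) (carrier (xs x y a (rat N x) s))"
   by (rule xm_inj[OF x Nx Mx rhomD(1)[OF k x(1)] inj[OF x(1)] s])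
  ultimately show ?thesis using q zc by (simp only: inj_on_eq_iff)
 qed
 show "carrier (rsp N y s) \<subseteq> ph x y a N s ` carrier (xs x y a (rat N x) s)"
 proof
  fix v assume v: "v <: rsp N y s"
  obtain q where q: "q <: xs x y a (rat N x) s" "ph x y a M s (xm x y a (rat N x) (rat M x) (k x) s q) = k y s v"
   using surj[OF x s v] by blast
  have "k y s (ph x y a N s q) = k y s v" using nat[OF s q(1)] q(2) by simp
  then have "ph x y a N s q = v" by (rule inj_onD[OF inj[OF x(2) s] _ lin_closed[OF pl[OF s] q(1)] v])
  then show "v : ph x y a N s ` carrier (xs x y a (rat N x) s)" using q(1) by blast
 qed
qed

text \<open>An element of the kernel over \<open>y\<close> is the image of some \<open>q\<close>
  under the transposed map of \<open>M\<close>. The transposed map of \<open>P\<close> is injective,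
  so the extension of \<open>f\<close> kills \<open>q\<close>; by flatness \<open>q\<close> comes
  from the extension of the kernel.\<close>

lemma cart_kernel:
 assumes M: "cart M" and P: "cart P" and f: "rhom M P f"
 obtains N k where "cart N" "rhom N M k" "!!x r. x : X ==> r <. R x ==> inj_on (k x r) (carrier (rsp N x r))"
  "!!x r. x : X ==> r <. R x ==> k x r ` carrier (rsp N x r) = {m : carrier (rsp M x r). f x r m = 0[rsp P x r]}"
proof -
 note M' = cartD(1)[OF M] and P' = cartD(1)[OF P]
 have Lk_ex: "EX L k. L : EO x & eh x L (rat M x) k & (ALL r:lobj (R x). inj_on (k r) (carrier (esp L r)) &
   k r ` carrier (esp L r) = {m : carrier (rsp M x r). f x r m = 0[rsp P x r]})" if x: "x : X" for x
 proof -
  interpret E: entw K C "R x" by (rule ew[OF x])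
  have "E.eres (rat M x) (f x) : Arr (entmod_cat U K C (R x)) (rat M x) (rat P x)"
   using E.ehom_eres[OF rm_pre[OF x M'] rm_pre[OF x P'] rhomD(1)[OF f x]] by (simp add: E.entmod_cat_sel E.entmod_hom_iff)
  from E.entmod_cat_kernel[OF rmodD(1)[OF M' x] rmodD(1)[OF P' x] this] obtain L k where
   L: "L : EO x" and k: "k : Arr (entmod_cat U K C (R x)) L (rat M x)"
   and e: "ALL s:lobj (R x). inj_on (k s) (carrier (esp L s)) &
    k s ` carrier (esp L s) = {m : carrier (rsp M x s). E.eres (rat M x) (f x) s m = 0[rsp P x s]}" by blast
  have "{m : carrier (rsp M x s). E.eres (rat M x) (f x) s m = 0[rsp P x s]} =
    {m : carrier (rsp M x s). f x s m = 0[rsp P x s]}" if "s <. R x" for s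
   by (rule Collect_cong) (auto simp: E.eres_def that)
  then show ?thesis using L k e by (intro exI[of _ L] exI[of _ k]) (simp add: E.entmod_cat_sel(2))
 qed
 obtain L k where Lk: "!!x. x : X ==> L x : EO x & eh x (L x) (rat M x) (k x) & (ALL r:lobj (R x). inj_on (k x r) (carrier (esp (L x) r)) &
   k x r ` carrier (esp (L x) r) = {m : carrier (rsp M x r). f x r m = 0[rsp P x r]})"
  by (rule bchoice2[OF Lk_ex]; (assumption | (rule that; assumption)))
 have L: "L x : EO x" and k: "eh x (L x) (rat M x) (k x)" if "x : X" for x using Lk that by blast+
 have inj: "inj_on (k x r) (carrier (esp (L x) r))"
  and im: "k x r ` carrier (esp (L x) r) = {m : carrier (rsp M x r). f x r m = 0[rsp P x r]}"
  if "x : X" "r <. R x" for x r using Lk that by blast+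
 have st: "rtr M x y a r (k x r v) : k y (ob x y a r) ` carrier (esp (L y) (ob x y a r))"
  if a: "x : X" "y : X" "a : Arr \<X> x y" "r <. R x" and v: "v <: esp (L x) r" for x y a r v
 proof -
  have m: "k x r v <: rsp M x r" "f x r (k x r v) = 0[rsp P x r]" using im[OF a(1,4)] v by blast+
  show ?thesis unfolding im[OF a(2) ob_closed[OF a]]
   using rm_tr_closed[OF M' a m(1)] rhomD(4)[OF f a m(1)] m(2)
    lin_zero[OF rm_mod[OF a(1) P' a(4)] rm_mod[OF a(2) P' ob_closed[OF a]] rmodD(3)[OF P' a]] by simp
 qed
 obtain N where N: "rmod N" "rat N = L" "rhom N M k" by (rule sub_repmod[OF M' L k inj st]; (assumption | (rule that; assumption)))
 have "cart N"
 proof (rule sub_cart[OF M N(1,3)], unfold N(2), rule inj)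
  fix x y a s v assume x: "x : X" "y : X" "a : Arr \<X> x y" and s: "s <. R y" and v: "v <: esp (L y) s"
  have m: "k y s v <: rsp M y s" "f y s (k y s v) = 0[rsp P y s]" using im[OF x(2) s] v by blast+
  obtain q where q: "q <: xs x y a (rat M x) s" "k y s v = ph x y a M s q" using cartD(4)[OF M x s] m(1) by blast
  note O = rmodD(1)[OF M' x(1)] rmodD(1)[OF P' x(1)]
  note pO = EO_preent[OF x(1) O(1)] EO_preent[OF x(1) O(2)]
  note lf = entmor.ext_map_lin_cls(1)[OF em[OF x] pO rhomD(1)[OF f x(1)] s]
  have "ph x y a P s (xm x y a (rat M x) (rat P x) (f x) s q) = ph x y a P s 0[xs x y a (rat P x) s]"
   using ph_natural[OF M' P' f x s q(1)] q(2) m(2) ph_zero[OF P' x s] by simp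
  then have "xm x y a (rat M x) (rat P x) (f x) s q = 0[xs x y a (rat P x) s]"
   by (rule inj_onD[OF cartD(3)[OF P x s] _ lin_closed[OF lf q(1)] mod_closed(2)[OF entmor.ext_sp_module[OF em[OF x] pO(2) s]]])
  moreover have "xm x y a (L x) (rat M x) (k x) s ` carrier (xs x y a (L x) s) =
   {q : carrier (xs x y a (rat M x) s). xm x y a (rat M x) (rat P x) (f x) s q = 0[xs x y a (rat P x) s]}"
   by (rule entmor.flat_exact(2)[OF em[OF x] _ L[OF x(1)] O k[OF x(1)] rhomD(1)[OF f x(1)] inj[OF x(1)] im[OF x(1)] s])
    (use flat x in \<open>simp_all add: flat_rep_def\<close>)
  ultimately have "q : xm x y a (L x) (rat M x) (k x) s ` carrier (xs x y a (L x) s)" using q(1) by simp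
  then show "EX q:carrier (xs x y a (L x) s). ph x y a M s (xm x y a (L x) (rat M x) (k x) s q) = k y s v" using q(2) by auto
 qed
 then show ?thesis using that[OF _ N(3)] inj im unfolding N(2) by blast
qed

text \<open>The quotient is generated by \<open>M\<close>, so injectivity of its transposed map is
  left. An element killed by that map lifts to some \<open>m\<close> in the extension of
  \<open>M\<close>, whose image under the transposed map of \<open>M\<close> is a value of
  \<open>f\<close>. As the transposed map of \<open>A\<close> is onto and that of \<open>M\<close>
  is injective, \<open>m\<close> comes from the extension of \<open>A\<close> and is zero in the
  quotient.\<close>

lemma cart_cokernel:
 assumes A: "cart A" and M: "cart M" and f: "rhom A M f"
 obtains N p where "cart N" "rhom M N p" "!!x r. x : X ==> r <. R x ==> p x r ` carrier (rsp M x r) = carrier (rsp N x r)"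
  "!!x r. x : X ==> r <. R x ==> {m : carrier (rsp M x r). p x r m = 0[rsp N x r]} = f x r ` carrier (rsp A x r)"
proof -
 note A' = cartD(1)[OF A] and M' = cartD(1)[OF M]
 have Qp_ex: "EX Q p. Q : EO x & eh x (rat M x) Q p & (ALL r:lobj (R x). p r ` carrier (rsp M x r) = carrier (esp Q r) &
   {m : carrier (rsp M x r). p r m = 0[esp Q r]} = f x r ` carrier (rsp A x r))" if x: "x : X" for x
 proof -
  interpret E: entw K C "R x" by (rule ew[OF x])
  have "E.eres (rat A x) (f x) : Arr (entmod_cat U K C (R x)) (rat A x) (rat M x)"
   using E.ehom_eres[OF rm_pre[OF x A'] rm_pre[OF x M'] rhomD(1)[OF f x]] by (simp add: E.entmod_cat_sel E.entmod_hom_iff)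
  from E.entmod_cat_cokernel[OF rmodD(1)[OF A' x] rmodD(1)[OF M' x] this] obtain Q p where
   Q: "Q : EO x" and p: "p : Arr (entmod_cat U K C (R x)) (rat M x) Q"
   and e: "ALL s:lobj (R x). p s ` carrier (rsp M x s) = carrier (esp Q s) &
    {m : carrier (rsp M x s). p s m = 0[esp Q s]} = E.eres (rat A x) (f x) s ` carrier (rsp A x s)" by blast
  have "E.eres (rat A x) (f x) s ` carrier (rsp A x s) = f x s ` carrier (rsp A x s)" if "s <. R x" for s
   by (rule image_cong) (simp_all add: E.eres_def that)
  then show ?thesis using Q p e by (intro exI[of _ Q] exI[of _ p]) (simp add: E.entmod_cat_sel(2))
 qed
 obtain Q p where Qp: "!!x. x : X ==> Q x : EO x & eh x (rat M x) (Q x) (p x) & (ALL r:lobj (R x). p x r ` carrier (rsp M x r) = carrier (esp (Q x) r) &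
   {m : carrier (rsp M x r). p x r m = 0[esp (Q x) r]} = f x r ` carrier (rsp A x r))"
  by (rule bchoice2[OF Qp_ex]; (assumption | (rule that; assumption)))
 have Q: "Q x : EO x" and p: "eh x (rat M x) (Q x) (p x)" if "x : X" for x using Qp that by blast+
 have surj: "p x r ` carrier (rsp M x r) = carrier (esp (Q x) r)"
  and ker: "{m : carrier (rsp M x r). p x r m = 0[esp (Q x) r]} = f x r ` carrier (rsp A x r)"
  if "x : X" "r <. R x" for x r using Qp that by blast+
 note pl = entw.ehomD(2)[OF ew p]
 have ml: "!!x r. x : X ==> r <. R x ==> lin (rsp M x r) (esp (Q x) r) (p x r)"
  by (rule entw.ehomD(2)[OF ew p])
 \<comment> \<open>The structure map is computed from an arbitrary preimage. Two preimages differ by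
   a value of \<open>f\<close>, which the structure map of \<open>M\<close> sends to a value of
   \<open>f\<close> again.\<close>
 define tr where "tr x y \<alpha> r v = p y (ob x y \<alpha> r) (rtr M x y \<alpha> r (SOME m. m <: rsp M x r & p x r m = v))" for x y \<alpha> r v
 have trp: "tr x y \<alpha> r (p x r m) = p y (ob x y \<alpha> r) (rtr M x y \<alpha> r m)"
  if a: "x : X" "y : X" "\<alpha> : Arr \<X> x y" "r <. R x" and m: "m <: rsp M x r" for x y \<alpha> r m
 proof -
  note o = ob_closed[OF a]
  let ?n = "SOME n. n <: rsp M x r & p x r n = p x r m"
  have n: "?n <: rsp M x r" "p x r ?n = p x r m"
   using someI[of "%n. n <: rsp M x r & p x r n = p x r m" m] m by auto
  note mo = rm_mod[OF a(1) M' a(4)] EO_module[OF a(1) Q[OF a(1)] a(4)] EO_module[OF a(2) Q[OF a(2)] o]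
  have "?n -[rsp M x r] m : {m : carrier (rsp M x r). p x r m = 0[esp (Q x) r]}"
   using lin_diff[OF mo(1,2) ml[OF a(1,4)] n(1) m] mod_closed(4)[OF mo(1) n(1) m] n(2)
    mod_diff_eq_0[OF mo(2) lin_closed[OF ml[OF a(1,4)] n(1)] lin_closed[OF ml[OF a(1,4)] m]] by simp
  then obtain v where v: "v <: rsp A x r" "?n -[rsp M x r] m = f x r v" using ker[OF a(1,4)] by blast
  have "f y (ob x y \<alpha> r) (rtr A x y \<alpha> r v) : {m : carrier (esp (rat M y) (ob x y \<alpha> r)). p y (ob x y \<alpha> r) m = 0[esp (Q y) (ob x y \<alpha> r)]}"
   unfolding ker[OF a(2) o] by (rule imageI[OF rm_tr_closed[OF A' a v(1)]])
  then have z: "p y (ob x y \<alpha> r) (rtr M x y \<alpha> r (?n -[rsp M x r] m)) = 0[esp (Q y) (ob x y \<alpha> r)]"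
   using rhomD(4)[OF f a v(1)] v(2) by simp
  note l = lin_comp[OF rmodD(3)[OF M' a] ml[OF a(2) o]]
  show ?thesis unfolding tr_def
   using lin_diff[OF mo(1,3) l n(1) m] z mod_diff_eq_0[OF mo(3) lin_closed[OF l n(1)] lin_closed[OF l m]] by simp
 qed
 have tl: "lin (esp (Q x) r) (esp (Q y) (ob x y \<alpha> r)) (tr x y \<alpha> r)"
  if a: "x : X" "y : X" "\<alpha> : Arr \<X> x y" "r <. R x" for x y \<alpha> r
  by (rule lin_factor_surj[OF rm_mod[OF a(1) M' a(4)] ml[OF a(1,4)] surj[OF a(1,4)] lin_comp[OF rmodD(3)[OF M' a] ml[OF a(2) ob_closed[OF a]]] trp[OF a]])
 have sp: "carrier (esp (Q x) r) \<subseteq> H" if x: "x : X" "r <. R x" and "subspace (esp (Q x) r) H"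
   and H: "!!i v. i : {()} ==> v <: rsp M x r ==> p x r v : H" for x r H
  unfolding surj[OF x, symmetric] by (rule image_subsetI) (rule H[OF singletonI])
 have tc: "tr x y \<alpha> r (p x r m) = p y (ob x y \<alpha> r) (rtr M x y \<alpha> r m)"
  if i: "i : {()}" and a: "x : X" "y : X" "\<alpha> : Arr \<X> x y" "r <. R x" and m: "m <: rsp M x r" for i x y \<alpha> r m
  by (rule trp[OF a m])
 interpret G: cartl_gen K C U \<X> \<R> "{()}" "%_. M" Q "%_. p" tr
  by (rule cartl_gen.intro[OF cartl_axioms cartl_gen_axioms.intro]) (rule M' Q p sp tl tc; assumption)+
 note gp = G.gen_ph[OF singletonI, unfolded mk_sel(1)]
 have rp: "rhom M (mk Q tr) p" by (rule rhom_mk[OF M' p trp])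
 have "cart (mk Q tr)"
 proof (rule G.gen_cart[OF M], unfold mk_sel(1))
  fix x y \<alpha> s q assume x: "x : X" "y : X" "\<alpha> : Arr \<X> x y" and s: "s <. R y" and q: "q <: xs x y \<alpha> (Q x) s"
   and z: "ext_transpose K (R x) (R y) (al x y \<alpha>) (Q x) (Q y) (rtr (mk Q tr) x y \<alpha>) s q = 0[esp (Q y) s]"
  interpret E: entmor K C "R x" "R y" "al x y \<alpha>" by (rule em[OF x])
  note pA = rm_pre[OF x(1) A'] and pM = rm_pre[OF x(1) M'] and pQ = EO_preent[OF x(1) Q[OF x(1)]]
  note lf = E.ext_map_lin_cls(1)[OF pA pM rhomD(1)[OF f x(1)] s]
  have "xm x y \<alpha> (rat M x) (Q x) (p x) s ` carrier (xs x y \<alpha> (rat M x) s) = carrier (xs x y \<alpha> (Q x) s)"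
   by (rule E.ext_map_surj[OF pM pQ p[OF x(1)] s surj[OF x(1)]])
  then obtain m where m: "m <: xs x y \<alpha> (rat M x) s" "q = xm x y \<alpha> (rat M x) (Q x) (p x) s m"
   using q by blast
  have "p y s (ph x y \<alpha> M s m) = 0[esp (Q y) s]" using gp[OF x s m(1)] z m(2) by simp
  then have "ph x y \<alpha> M s m : f y s ` carrier (rsp A y s)"
   using ker[OF x(2) s] lin_closed[OF ph_lin_cls(1)[OF M' x s] m(1)] by blast
  then obtain a where a: "a <: xs x y \<alpha> (rat A x) s" "ph x y \<alpha> M s m = f y s (ph x y \<alpha> A s a)"
   unfolding cartD(4)[OF A x s, symmetric] by blast
  have "ph x y \<alpha> M s m = ph x y \<alpha> M s (xm x y \<alpha> (rat A x) (rat M x) (f x) s a)"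
   using a(2) ph_natural[OF A' M' f x s a(1)] by simp
  then have "m = xm x y \<alpha> (rat A x) (rat M x) (f x) s a" by (rule inj_onD[OF cartD(3)[OF M x s] _ m(1) lin_closed[OF lf a(1)]])
  moreover have "p x r (f x r v) = 0[esp (Q x) r]" if "r <. R x" "v <: rsp A x r" for r v
   using ker[OF x(1) that(1)] that(2) by blast
  then have "xm x y \<alpha> (rat M x) (Q x) (p x) s (xm x y \<alpha> (rat A x) (rat M x) (f x) s a) = 0[xs x y \<alpha> (Q x) s]"
   by (simp add: E.ext_map_comp[OF pA pM pQ rhomD(1)[OF f x(1)] p[OF x(1)] E.R.ehom_zero[OF pA pQ] _ s a(1)] E.ext_map_zero[OF pA pQ s a(1)])
  ultimately show "q = 0[xs x y \<alpha> (Q x) s]" using m(2) by simp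
 qed
 then show ?thesis using that[OF _ rp] surj ker by (simp add: mk_sel(1))
qed

section \<open>Cartesian modules as families of vector spaces\<close>

abbreviation CC :: "(('x, 'a, 'k, 'o, 'm, 'c, 'v) repmod, 'x => 'o => 'v => 'v) cat" where "CC \<equiv> cart_cat U K C \<X> \<R>"
abbreviation sorts :: "('x \<times> 'o) set" where "sorts \<equiv> SIGMA x:X. lobj (R x)"
abbreviation csp' :: "('x, 'a, 'k, 'o, 'm, 'c, 'v) repmod => 'x \<times> 'o => ('k, 'v) module" where
 "csp' M p \<equiv> esp (rat M (fst p)) (snd p)"
abbreviation cev :: "('x => 'o => 'v => 'v) => 'x \<times> 'o => 'v => 'v" where "cev \<eta> p \<equiv> \<eta> (fst p) (snd p)"

lemma cart_cat_sel:
 "M : Ob CC \<longleftrightarrow> cart M"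
 "cart M ==> cart N ==> \<eta> : Arr CC M N \<longleftrightarrow> rhom M N \<eta> & rres M \<eta> = \<eta>"
 "Idn CC M = rres M (%x r m. m)"
 "Cmp CC M N P \<zeta> \<eta> = rres M (%x r m. \<zeta> x r (\<eta> x r m))"
 by (simp_all add: cart_cat_def repmod_cat_def repmod_hom_iff entmod_id_def rres_def entmod_comp_def compose_def)

lemma arr_of_rhom:
 assumes "cart M" "cart N" "rhom M N \<eta>"
 shows "rres M \<eta> : Arr CC M N"
 using rhom_rres[OF cartD(1)[OF assms(1)] cartD(1)[OF assms(2)] assms(3)]
 unfolding cart_cat_sel(2)[OF assms(1,2)] repmod_hom_iff[OF cartD(1)[OF assms(1)] cartD(1)[OF assms(2)]] .

lemma rhom_of_arr: "cart M ==> cart N ==> \<eta> : Arr CC M N ==> rhom M N \<eta>"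
 by (simp only: cart_cat_sel(2))

lemma rres_cev: "p : sorts ==> m <: csp' M p ==> cev (rres M \<eta>) p m = cev \<eta> p m"
 by (rule rres_apply) auto

lemma rhom_factor_surj:
 assumes L: "rmod L" and M: "rmod M" and N: "rmod N" and p: "rhom L M p"
  and surj: "!!x r. x : X ==> r <. R x ==> p x r ` carrier (rsp L x r) = carrier (rsp M x r)"
  and h: "rhom L N h"
  and ker: "!!x r m. x : X ==> r <. R x ==> m <: rsp L x r ==> p x r m = 0[rsp M x r] ==> h x r m = 0[rsp N x r]"
 obtains u where "rhom M N u" "!!x r m. x : X ==> r <. R x ==> m <: rsp L x r ==> u x r (p x r m) = h x r m"
proof -
 have "EX u. eh x (rat M x) (rat N x) u & (ALL r:lobj (R x). ALL m:carrier (rsp L x r). u r (p x r m) = h x r m)" if x: "x : X" for x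
 proof -
  obtain u where u: "eh x (rat M x) (rat N x) u" "!!r m. r <. R x ==> m <: rsp L x r ==> u r (p x r m) = h x r m"
   by (rule entw.ehom_factor_surj_ex[OF ew[OF x] rm_pre[OF x L] rm_pre[OF x M] rm_pre[OF x N] rhomD(1)[OF p x] rhomD(1)[OF h x] surj[OF x] ker[OF x]];
     (assumption | (rule that; assumption)))
  show ?thesis by (intro exI[of _ u] conjI ballI, rule u(1), rule u(2))
 qed
 then have "ALL x:X. EX u. eh x (rat M x) (rat N x) u & (ALL r:lobj (R x). ALL m:carrier (rsp L x r). u r (p x r m) = h x r m)" by (rule ballI)
 from bchoice[OF this] obtain u where
  u': "ALL x:X. eh x (rat M x) (rat N x) (u x) & (ALL r:lobj (R x). ALL m:carrier (rsp L x r). u x r (p x r m) = h x r m)" ..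
 have u: "u x r (p x r m) = h x r m" if "x : X" "r <. R x" "m <: rsp L x r" for x r m
  using u' that by blast
 have "rhom M N u"
 proof (rule rhomI)
  show "eh x (rat M x) (rat N x) (u x)" if "x : X" for x using u' that by blast
  fix x y \<alpha> r m assume a: "x : X" "y : X" "\<alpha> : Arr \<X> x y" "r <. R x" and m: "m <: rsp M x r"
  obtain l where l: "l <: rsp L x r" "m = p x r l" using m unfolding surj[OF a(1,4), symmetric] by blast
  show "rtr N x y \<alpha> r (u x r m) = u y (ob x y \<alpha> r) (rtr M x y \<alpha> r m)"
   using rhomD(4)[OF p a l(1)] rhomD(4)[OF h a l(1)] u[OF a(1,4) l(1)] u[OF a(2) ob_closed[OF a] rm_tr_closed[OF L a l(1)]] l(2) by simp
 qed
 then show ?thesis using u by (rule that)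
qed

lemma cart_conc: "conc K CC sorts csp' cev"
proof ((rule conc.intro[OF ground_axioms], rule conc_axioms.intro); (unfold cart_cat_sel(1))?)
 fix a s assume a: "cart a" and s: "s : sorts"
 show "module K (csp' a s)" by (rule rm_mod[OF _ cartD(1)[OF a]]) (use s in auto)
next
 fix a b f s assume a: "cart a" "cart b" "f : Arr CC a b" and s: "s : sorts"
 show "lin (csp' a s) (csp' b s) (cev f s)" by (rule rhomD(2)[OF rhom_of_arr[OF a]]) (use s in auto)
next
 fix a b f g assume a: "cart a" "cart b" and f: "f : Arr CC a b" and g: "g : Arr CC a b"
  and e: "!!s x. s : sorts ==> x <: csp' a s ==> cev f s x = cev g s x"
 have "rres a f = rres a g" by (rule rres_cong) (use e in force)
 then show "f = g" using f g unfolding cart_cat_sel(2)[OF a] by simp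
next
 fix a assume a: "cart a"
 show "Idn CC a : Arr CC a a" unfolding cart_cat_sel(3) by (rule arr_of_rhom[OF a a rhom_id[OF cartD(1)[OF a]]])
next
 fix a s x assume a: "cart a" and s: "s : sorts" and x: "x <: csp' a s"
 show "cev (Idn CC a) s x = x" unfolding cart_cat_sel(3) rres_cev[OF s x] by (rule refl)
next
 fix a b c f g assume a: "cart a" "cart b" "cart c" and f: "f : Arr CC a b" and g: "g : Arr CC b c"
 show "Cmp CC a b c g f : Arr CC a c" unfolding cart_cat_sel(4)
  by (rule arr_of_rhom[OF a(1,3) rhom_comp[OF a(1,2,3)[THEN cartD(1)] rhom_of_arr[OF a(1,2) f] rhom_of_arr[OF a(2,3) g]]])
next
 fix a b c f g s x assume s: "s : sorts" and x: "x <: csp' a s"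
 show "cev (Cmp CC a b c g f) s x = cev g s (cev f s x)" unfolding cart_cat_sel(4) rres_cev[OF s x] by (rule refl)
next
 fix a b assume a: "cart a" "cart b"
 show "EX f:Arr CC a b. ALL s:sorts. ALL x:carrier (csp' a s). cev f s x = 0[csp' b s]"
  by (rule bexI[OF _ arr_of_rhom[OF a rhom_zero[OF a[THEN cartD(1)]]]], intro ballI, subst rres_cev) simp_all
next
 fix a b f g assume a: "cart a" "cart b" and f: "f : Arr CC a b" and g: "g : Arr CC a b"
 show "EX h:Arr CC a b. ALL s:sorts. ALL x:carrier (csp' a s). cev h s x = cev f s x -[csp' b s] cev g s x"
  by (rule bexI[OF _ arr_of_rhom[OF a rhom_minus[OF a[THEN cartD(1)] rhom_of_arr[OF a f] rhom_of_arr[OF a g]]]], intro ballI, subst rres_cev) simp_all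
next
 fix a b c i h assume a: "cart a" "cart b" "cart c" and i: "i : Arr CC b c" and inj: "!!s. s : sorts ==> inj_on (cev i s) (carrier (csp' b s))"
  and h: "h : Arr CC a c" and im: "!!s x. s : sorts ==> x <: csp' a s ==> cev h s x : cev i s ` carrier (csp' b s)"
 let ?u = "%x r m. the_inv_into (carrier (rsp b x r)) (i x r) (h x r m)"
 have inj': "inj_on (i x r) (carrier (rsp b x r))" if "x : X" "r <. R x" for x r
  using inj[of "(x, r)"] that by simp
 have im': "h x r m : i x r ` carrier (rsp b x r)" if "x : X" "r <. R x" "m <: rsp a x r" for x r m
  using im[of "(x, r)" m] that by simp
 have u: "?u x r m <: rsp b x r" "i x r (?u x r m) = h x r m" if "x : X" "r <. R x" "m <: rsp a x r" for x r m
  by (rule the_inv_into_into[OF inj'[OF that(1,2)] im'[OF that] subset_refl], rule f_the_inv_into_f[OF inj'[OF that(1,2)] im'[OF that]])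
 have "rhom a b ?u" by (rule rhom_factor_inj[OF a[THEN cartD(1)] rhom_of_arr[OF a(2,3) i] inj' rhom_of_arr[OF a(1,3) h] u])
 then show "EX u:Arr CC a b. ALL s:sorts. ALL x:carrier (csp' a s). cev i s (cev u s x) = cev h s x"
  by (intro bexI[OF _ arr_of_rhom[OF a(1,2)]] ballI, subst rres_cev) (auto intro: u(2))
next
 fix a b c p h assume a: "cart a" "cart b" "cart c" and p: "p : Arr CC a b" and surj: "!!s. s : sorts ==> cev p s ` carrier (csp' a s) = carrier (csp' b s)"
  and h: "h : Arr CC a c" and ker: "!!s x. s : sorts ==> x <: csp' a s ==> cev p s x = 0[csp' b s] ==> cev h s x = 0[csp' c s]"
 have surj': "p x r ` carrier (rsp a x r) = carrier (rsp b x r)" if "x : X" "r <. R x" for x r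
  using surj[of "(x, r)"] that by simp
 have ker': "h x r m = 0[rsp c x r]" if "x : X" "r <. R x" "m <: rsp a x r" "p x r m = 0[rsp b x r]" for x r m
  using ker[of "(x, r)" m] that by simp
 obtain u where u: "rhom b c u" "!!x r m. x : X ==> r <. R x ==> m <: rsp a x r ==> u x r (p x r m) = h x r m"
  by (rule rhom_factor_surj[OF a[THEN cartD(1)] rhom_of_arr[OF a(1,2) p] surj' rhom_of_arr[OF a(1,3) h] ker']; (assumption | (rule that; assumption)))
 have pc: "cev p s m <: csp' b s" if "s : sorts" "m <: csp' a s" for s m using surj[OF that(1)] that(2) by blast
 show "EX u:Arr CC b c. ALL s:sorts. ALL x:carrier (csp' a s). cev u s (cev p s x) = cev h s x"
  by (intro bexI[OF _ arr_of_rhom[OF a(2,3) u(1)]] ballI, subst rres_cev) (auto intro: u(2) pc)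
next
 fix a b f assume a: "cart a" "cart b" and f: "f : Arr CC a b"
 obtain N k where N: "cart N" "rhom N a k" "!!x r. x : X ==> r <. R x ==> inj_on (k x r) (carrier (rsp N x r))"
  "!!x r. x : X ==> r <. R x ==> k x r ` carrier (rsp N x r) = {m : carrier (rsp a x r). f x r m = 0[rsp b x r]}"
  by (rule cart_kernel[OF a rhom_of_arr[OF a f]]; (assumption | (rule that; assumption)))
 have "inj_on (cev (rres N k) s) (carrier (csp' N s)) & cev (rres N k) s ` carrier (csp' N s) = {x : carrier (csp' a s). cev f s x = 0[csp' b s]}"
  if s: "s : sorts" for s
 proof -
  have s': "fst s : X" "snd s : lobj (R (fst s))" using s by auto
  have "inj_on (cev (rres N k) s) (carrier (csp' N s)) \<longleftrightarrow> inj_on (cev k s) (carrier (csp' N s))"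
   by (rule inj_on_cong) (rule rres_cev[OF s])
  moreover have "cev (rres N k) s ` carrier (csp' N s) = cev k s ` carrier (csp' N s)" by (rule image_cong[OF refl]) (rule rres_cev[OF s])
  ultimately show ?thesis using N(3,4)[OF s'] by simp
 qed
 then show "EX k:Ob CC. EX i:Arr CC k a. ALL s:sorts. inj_on (cev i s) (carrier (csp' k s)) &
    cev i s ` carrier (csp' k s) = {x : carrier (csp' a s). cev f s x = 0[csp' b s]}"
  by (intro bexI[of _ N] bexI[OF _ arr_of_rhom[OF N(1) a(1) N(2)]] ballI) (simp_all only: cart_cat_sel(1) N(1))
next
 fix a b f assume a: "cart a" "cart b" and f: "f : Arr CC a b"
 obtain N p where N: "cart N" "rhom b N p" "!!x r. x : X ==> r <. R x ==> p x r ` carrier (rsp b x r) = carrier (rsp N x r)"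
  "!!x r. x : X ==> r <. R x ==> {m : carrier (rsp b x r). p x r m = 0[rsp N x r]} = f x r ` carrier (rsp a x r)"
  by (rule cart_cokernel[OF a rhom_of_arr[OF a f]]; (assumption | (rule that; assumption)))
 have "cev (rres b p) s ` carrier (csp' b s) = carrier (csp' N s) & {x : carrier (csp' b s). cev (rres b p) s x = 0[csp' N s]} = cev f s ` carrier (csp' a s)"
  if s: "s : sorts" for s
 proof -
  have s': "fst s : X" "snd s : lobj (R (fst s))" using s by auto
  have "cev (rres b p) s ` carrier (csp' b s) = cev p s ` carrier (csp' b s)" by (rule image_cong[OF refl]) (rule rres_cev[OF s])
  moreover have "{x : carrier (csp' b s). cev (rres b p) s x = 0[csp' N s]} = {x : carrier (csp' b s). cev p s x = 0[csp' N s]}"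
   by (rule Collect_cong, rule conj_cong[OF refl]) (simp only: rres_cev[OF s])
  ultimately show ?thesis using N(3,4)[OF s'] by simp
 qed
 then show "EX q:Ob CC. EX p:Arr CC b q. ALL s:sorts. cev p s ` carrier (csp' b s) = carrier (csp' q s) &
    {x : carrier (csp' b s). cev p s x = 0[csp' q s]} = cev f s ` carrier (csp' a s)"
  by (intro bexI[of _ N] bexI[OF _ arr_of_rhom[OF a(2) N(1,2)]] ballI) (simp_all only: cart_cat_sel(1) N(1))
qed

end

section \<open>Coproducts of cartesian modules\<close>

lemma (in entmor) ext_map_id:
 assumes M: "R.preent M" and s: "s <. S" and q: "q <: es M s"
 shows "em M M (%r m. m) s q = q"
 by (rule ext_eqI[OF M s ext_sp_module[OF M s] ext_map_lin_cls(1)[OF M M R.ehom_id[OF M] s] lin_id _ q])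
  (simp add: ext_map_lin_cls(2)[OF M M R.ehom_id[OF M] s])

context cartl
begin

text \<open>The direct sums at the single sorts come first; action, coaction and structure maps are
  extended to them from the summands. For the injectivity of the transposed maps the projections are
  used, which are morphisms, too.\<close>

lemma cart_coproduct:
 fixes I :: "'v set" and F :: "'v => ('x, 'a, 'k, 'o, 'm, 'c, 'v) repmod"
 assumes I: "small U I" and F: "!!i. i : I ==> cart (F i)"
 obtains c \<iota> \<pi> where "cart c" "!!i. i : I ==> rhom (F i) c (\<iota> i)"
  "!!x r. x : X ==> r <. R x ==> is_dsum I (%i. esp (rat (F i) x) r) (rsp c x r) (%i. \<iota> i x r) (\<pi> x r)"
  "!!N h. cart N ==> (!!i. i : I ==> rhom (F i) N (h i)) ==>
   EX u. rhom c N u & (ALL i:I. ALL x:X. ALL r:lobj (R x). ALL v:carrier (esp (rat (F i) x) r). u x r (\<iota> i x r v) = h i x r v)"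
proof -
 note F' = F[THEN cartD(1)]
 let ?V = "%x r i. esp (rat (F i) x) r"
 have P_ex: "EX P :: ('k, 'v) module. EX \<iota> \<pi>. is_dsum I (?V x r) P \<iota> \<pi> & small U (carrier P)" if x: "x : X" and r: "r <. R x" for x r
 proof -
  have d: "is_dsum I (?V x r) (dsum_mod I (?V x r)) (dsum_inj I (?V x r)) (%i u. u i)"
   by (rule dsum_mod_is_dsum[OF rm_mod[OF x F' r]])
  have sm: "small U (carrier (dsum_mod I (?V x r)))"
  proof (rule small_dsum[OF universe_axioms d I])
   fix i assume "i : I"
   from rmodD(1)[OF F'[OF this] x] show "small U (carrier (?V x r i))" using r by (simp add: EO_iff[OF x])
  qed
  \<comment> \<open>The direct sum consists of functions; being small, it embeds into the type of
    \<open>U\<close>, which is the carrier type.\<close>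
  obtain \<theta> :: "('v => 'v) => 'v" where th: "inj_on \<theta> (carrier (dsum_mod I (?V x r)))" using small_index[OF sm] by blast
  obtain P :: "('k, 'v) module" and \<iota> \<pi> where P: "is_dsum I (?V x r) P \<iota> \<pi>" "carrier P = \<theta> ` carrier (dsum_mod I (?V x r))"
   by (rule dsum_transport[OF d th]; (assumption | (rule that; assumption)))
  have "small U (carrier P)" unfolding P(2) by (rule small_image[OF sm])
  with P(1) show ?thesis by blast
 qed
 have "EX P \<iota> \<pi>. ALL x:X. ALL r:lobj (R x). is_dsum I (?V x r) (P x r :: ('k, 'v) module) (\<iota> x r) (\<pi> x r) & small U (carrier (P x r))"
 proof -
  let ?T = "%x r t. is_dsum I (?V x r) (fst t :: ('k, 'v) module) (fst (snd t)) (snd (snd t)) & small U (carrier (fst t))"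
  have "?T x r (SOME t. ?T x r t)" if xr: "x : X" "r <. R x" for x r
  proof -
   obtain P :: "('k, 'v) module" and \<iota> \<pi> where "is_dsum I (?V x r) P \<iota> \<pi> & small U (carrier P)" using P_ex[OF xr] by blast
   then have "?T x r (P, \<iota>, \<pi>)" by simp
   then show ?thesis by (rule someI[where P = "?T x r"])
  qed
  then show ?thesis
   by (intro exI[of _ "%x r. fst (SOME t. ?T x r t)"] exI[of _ "%x r. fst (snd (SOME t. ?T x r t))"]
     exI[of _ "%x r. snd (snd (SOME t. ?T x r t))"] ballI)
 qed
 then obtain P :: "'x => 'o => ('k, 'v) module" and \<iota> \<pi> where
  P: "ALL x:X. ALL r:lobj (R x). is_dsum I (?V x r) (P x r) (\<iota> x r) (\<pi> x r) & small U (carrier (P x r))" by blast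
 have d: "is_dsum I (?V x r) (P x r) (\<iota> x r) (\<pi> x r)" and sm: "small U (carrier (P x r))" if "x : X" "r <. R x" for x r
  using P that by blast+
 have "EX Q. Q : EO x & esp Q = P x & (ALL i:I. eh x (rat (F i) x) Q (%r. \<iota> x r i))" if x: "x : X" for x
 proof -
  obtain Q :: "('k, 'o, 'm, 'c, 'v) entmod" where Q: "is_entmod K C (R x) Q" "esp Q = P x" "!!i. i : I ==> eh x (rat (F i) x) Q (%r. \<iota> x r i)"
   by (rule entw.entmod_dsum[OF ew[OF x] rm_ent[OF x F'] d[OF x]]; (assumption | (rule that; assumption)))
  show ?thesis unfolding EO_iff[OF x] by (intro exI[of _ Q] conjI ballI, rule Q(1), simp add: Q(2) sm[OF x], rule Q(2), rule Q(3))
 qed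
 then have "ALL x:X. EX Q. Q : EO x & esp Q = P x & (ALL i:I. eh x (rat (F i) x) Q (%r. \<iota> x r i))" by (rule ballI)
 from bchoice[OF this] obtain Q where Q': "ALL x:X. Q x : EO x & esp (Q x) = P x & (ALL i:I. eh x (rat (F i) x) (Q x) (%r. \<iota> x r i))" ..
 have Q: "Q x : EO x" "esp (Q x) = P x" if "x : X" for x using Q' that by blast+
 have \<iota>: "eh x (rat (F i) x) (Q x) (%r. \<iota> x r i)" if "i : I" "x : X" for i x using Q' that by blast
 have dQ: "is_dsum I (?V x r) (esp (Q x) r) (\<iota> x r) (\<pi> x r)" if "x : X" "r <. R x" for x r
  using d[OF that] Q(2)[OF that(1)] by simp
 define tr where "tr x y a r = dev I (?V x r) (\<pi> x r) (esp (Q y) (ob x y a r)) (%i v. \<iota> y (ob x y a r) i (rtr (F i) x y a r v))" for x y a r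
 have cl: "lin (?V x r i) (esp (Q y) (ob x y a r)) (%v. \<iota> y (ob x y a r) i (rtr (F i) x y a r v))"
  if "x : X" "y : X" "a : Arr \<X> x y" "r <. R x" "i : I" for x y a r i
  by (rule lin_comp[OF rmodD(3)[OF F'[OF that(5)] that(1-4)] is_dsumD(3)[OF dQ[OF that(2) ob_closed[OF that(1-4)]] that(5)]])
 note mQ = EO_module[OF _ Q(1)]
 have tl: "lin (esp (Q x) r) (esp (Q y) (ob x y a r)) (tr x y a r)"
  if a: "x : X" "y : X" "a : Arr \<X> x y" "r <. R x" for x y a r
  unfolding tr_def by (rule dsum_dev_lin[OF dQ[OF a(1,4)] mQ[OF a(2,2) ob_closed[OF a]] cl[OF a]])
 have ti: "tr x y a r (\<iota> x r i m) = \<iota> y (ob x y a r) i (rtr (F i) x y a r m)"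
  if i: "i : I" and a: "x : X" "y : X" "a : Arr \<X> x y" "r <. R x" and m: "m <: ?V x r i" for i x y a r m
  unfolding tr_def by (rule dsum_dev_inj[OF dQ[OF a(1,4)] mQ[OF a(2,2) ob_closed[OF a]] cl[OF a] i m])
 have sp: "carrier (esp (Q x) r) \<subseteq> H" if "x : X" "r <. R x" "subspace (esp (Q x) r) H"
  "!!i v. i : I ==> v <: ?V x r i ==> \<iota> x r i v : H" for x r H
  by (rule dsum_span[OF dQ[OF that(1,2)] that(3,4)])
 interpret G: cartl_gen K C U \<X> \<R> I F Q "%i x r. \<iota> x r i" tr
  by (rule cartl_gen.intro[OF cartl_axioms cartl_gen_axioms.intro]) (rule F' Q(1) \<iota> sp tl ti; assumption)+
 have copair: "EX u. rhom (mk Q tr) N u & (ALL i:I. ALL x:X. ALL r:lobj (R x). ALL v:carrier (?V x r i). u x r (\<iota> x r i v) = h i x r v)"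
  if N: "rmod N" and h: "!!i. i : I ==> rhom (F i) N (h i)" for N h
 proof -
  let ?u = "%x r. dev I (?V x r) (\<pi> x r) (rsp N x r) (%i. h i x r)"
  have ul: "lin (esp (Q x) r) (rsp N x r) (?u x r)" if "x : X" "r <. R x" for x r
   by (rule dsum_dev_lin[OF dQ[OF that] rm_mod[OF that(1) N that(2)] rhomD(2)[OF h that]])
  have ue: "?u x r (\<iota> x r i v) = h i x r v" if "i : I" "x : X" "r <. R x" "v <: ?V x r i" for i x r v
   by (rule dsum_dev_inj[OF dQ[OF that(2,3)] rm_mod[OF that(2) N that(3)] rhomD(2)[OF h that(2,3)] that(1,4)])
  show ?thesis by (intro exI[of _ ?u] conjI ballI, rule G.gen_copair[OF N h ul ue]) (assumption | rule ue)+
 qed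
 \<comment> \<open>The projection to the summand \<open>j\<close> is the copairing of the identity
   there with zero on the other summands.\<close>
 have pr: "rhom (mk Q tr) (F j) (%x r. \<pi> x r j)" if j: "j : I" for j
 proof (rule G.gen_copair[OF F'[OF j], where h = "%i. if i = j then (%x r m. m) else (%x r m. 0[esp (rat (F j) x) r])"])
  fix i assume i: "i : I"
  show "rhom (F i) (F j) (if i = j then (%x r m. m) else (%x r m. 0[esp (rat (F j) x) r]))"
   by (cases "i = j") (simp_all only: if_True if_False refl rhom_id[OF F'[OF j]] rhom_zero[OF F'[OF i] F'[OF j]])
 next
  fix x r assume "x : X" "r <. R x"
  then show "lin (esp (Q x) r) (esp (rat (F j) x) r) (\<pi> x r j)" by (rule is_dsumD(4)[OF dQ j])
 next
  fix i x r v assume i: "i : I" and x: "x : X" "r <. R x" and v: "v <: ?V x r i"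
  show "\<pi> x r j (\<iota> x r i v) = (if i = j then (%x r m. m) else (%x r m. 0[esp (rat (F j) x) r])) x r v"
   using is_dsumD(5)[OF dQ[OF x] i v] is_dsumD(6)[OF dQ[OF x] i j v] by (cases "i = j") simp_all
 qed
 have "cart (mk Q tr)"
 proof (rule G.gen_cart[OF F])
  fix x y a s q assume x: "x : X" "y : X" "a : Arr \<X> x y" and s: "s <. R y" and q: "q <: xs x y a (Q x) s"
   and z: "ph x y a (mk Q tr) s q = 0[esp (Q y) s]"
  interpret E: entmor K C "R x" "R y" "al x y a" by (rule em[OF x])
  note pF = rm_pre[OF x(1) F'] and pQ = EO_preent[OF x(1) Q(1)[OF x(1)]] and i' = \<iota>[OF _ x(1)]
  note p' = rhomD(1)[OF pr x(1), unfolded mk_sel(1)]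
  note li = E.ext_map_lin_cls(1)[OF pF pQ i' s] and lp = E.ext_map_lin_cls(1)[OF pQ pF p' s]
  show "q = 0[xs x y a (Q x) s]"
  \<comment> \<open>By functoriality the extended injections and projections satisfy the relations
    of a direct sum, so it suffices that the extended projections kill \<open>q\<close>.\<close>
  proof (rule jointly_separating[where I = I and V = "%i. xs x y a (rat (F i) x) s" and f = "%i. xm x y a (rat (F i) x) (Q x) (%r. \<iota> x r i) s"
     and g = "%i. xm x y a (Q x) (rat (F i) x) (%r. \<pi> x r i) s", OF _ E.ext_sp_module[OF pQ s] _ _ _ _ _ q])
   fix i assume i: "i : I"
   show "module K (xs x y a (rat (F i) x) s)" by (rule E.ext_sp_module[OF pF[OF i] s])
   show "lin (xs x y a (rat (F i) x) s) (xs x y a (Q x) s) (xm x y a (rat (F i) x) (Q x) (%r. \<iota> x r i) s)" by (rule li[OF i i])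
   show "lin (xs x y a (Q x) s) (xs x y a (rat (F i) x) s) (xm x y a (Q x) (rat (F i) x) (%r. \<pi> x r i) s)" by (rule lp[OF i i])
   \<comment> \<open>By naturality the left side is a component of the image of \<open>q\<close>,
     which is zero; \<open>F i\<close> is cartesian, so its transposed map is injective.\<close>
   have "ph x y a (F i) s (xm x y a (Q x) (rat (F i) x) (%r. \<pi> x r i) s q) = ph x y a (F i) s 0[xs x y a (rat (F i) x) s]"
    using ph_natural[OF G.gen_rmod F'[OF i] pr[OF i] x s, unfolded mk_sel(1), OF q] z
     lin_zero[OF EO_module[OF x(2) Q(1)[OF x(2)] s] rm_mod[OF x(2) F'[OF i] s] is_dsumD(4)[OF dQ[OF x(2) s] i]] ph_zero[OF F'[OF i] x s]
    by (simp add: mk_sel(1))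
   then show "xm x y a (Q x) (rat (F i) x) (%r. \<pi> x r i) s q = 0[xs x y a (rat (F i) x) s]"
    by (rule inj_onD[OF cartD(3)[OF F[OF i] x s] _ lin_closed[OF lp[OF i i] q] mod_closed(2)[OF E.ext_sp_module[OF pF[OF i] s]]])
  next
   fix i v assume i: "i : I" and v: "v <: xs x y a (rat (F i) x) s"
   show "xm x y a (Q x) (rat (F i) x) (%r. \<pi> x r i) s (xm x y a (rat (F i) x) (Q x) (%r. \<iota> x r i) s v) = v"
    by (subst E.ext_map_comp[OF pF[OF i] pQ pF[OF i] i'[OF i] p'[OF i] E.R.ehom_id[OF pF[OF i]] _ s v])
     (simp_all add: is_dsumD(5)[OF dQ[OF x(1)] i] E.ext_map_id[OF pF[OF i] s v])
  next
   fix i j v assume i: "i : I" and j: "j : I" and ij: "i ~= j" and v: "v <: xs x y a (rat (F i) x) s"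
   show "xm x y a (Q x) (rat (F j) x) (%r. \<pi> x r j) s (xm x y a (rat (F i) x) (Q x) (%r. \<iota> x r i) s v) = 0[xs x y a (rat (F j) x) s]"
    by (subst E.ext_map_comp[OF pF[OF i] pQ pF[OF j] i'[OF i] p'[OF j] E.R.ehom_zero[OF pF[OF i] pF[OF j]] _ s v])
     (simp_all add: is_dsumD(6)[OF dQ[OF x(1)] i j _ ij] E.ext_map_zero[OF pF[OF i] pF[OF j] s v])
  next
   fix H assume H: "subspace (xs x y a (Q x) s) H"
    "!!i v. i : I ==> v <: xs x y a (rat (F i) x) s ==> xm x y a (rat (F i) x) (Q x) (%r. \<iota> x r i) s v : H"
   show "carrier (xs x y a (Q x) s) \<subseteq> H" by (rule G.gen_xs_span[OF x s H])
  qed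
 qed
 then show ?thesis
  by (rule that[of "mk Q tr" "%i x r. \<iota> x r i" \<pi>]) (rule G.gen_rhom, assumption, simp only: mk_sel(1), rule dQ, assumption+, rule copair, rule cartD(1), assumption+)
qed

end

section \<open>Cardinal bounds for closures, and finite supports\<close>

lemma card_image_le: "|A| \<le>o |B| ==> |f ` A| \<le>o |B|"
 by (rule ordLeq_transitive[OF card_of_image])

lemma card_finite_le: "infinite D ==> finite A ==> |A| \<le>o |D|"
 by (rule ordLess_imp_ordLeq[OF finite_ordLess_infinite[OF card_of_Well_order card_of_Well_order]]) (simp_all add: Field_card_of)

lemma card_Un_le: "infinite D ==> |A| \<le>o |D| ==> |B| \<le>o |D| ==> |A \<union> B| \<le>o |D|"
 by (rule card_of_Un_ordLeq_infinite_Field[OF _ _ _ card_of_Card_order]) (simp_all only: Field_card_of not_False_eq_True)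

lemma card_UN_le: "infinite D ==> |I| \<le>o |D| ==> (!!i. i : I ==> |A i| \<le>o |D| ) ==> |\<Union>i\<in>I. A i| \<le>o |D|"
 by (rule card_of_UNION_ordLeq_infinite) auto

lemma card_Sigma_le: "infinite D ==> |I| \<le>o |D| ==> (!!i. i : I ==> |A i| \<le>o |D| ) ==> |Sigma I A| \<le>o |D|"
 by (rule card_of_Sigma_ordLeq_infinite) auto

text \<open>The operations are applied countably often. As \<open>D\<close> is infinite, it absorbs
  each stage and the union of all stages; the stages increase, so two elements of the union lie in a
  common one.\<close>

lemma bounded_closure:
 assumes D: "infinite D" and S: "|S| \<le>o |D|" and A: "!!e. e : E ==> |A e| \<le>o |D|" and B: "!!e e'. e : E ==> e' : E ==> |B e e'| \<le>o |D|"
  and E: "S \<subseteq> E" "!!e. e : E ==> A e \<subseteq> E" "!!e e'. e : E ==> e' : E ==> B e e' \<subseteq> E"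
 obtains T where "S \<subseteq> T" "T \<subseteq> E" "|T| \<le>o |D|" "!!e. e : T ==> A e \<subseteq> T" "!!e e'. e : T ==> e' : T ==> B e e' \<subseteq> T"
proof -
 define F where "F T = T \<union> (\<Union>e\<in>T. A e) \<union> (\<Union>e\<in>T. \<Union>e'\<in>T. B e e')" for T
 define T where "T n = (F ^^ n) S" for n :: nat
 have T0: "T 0 = S" and TS: "T (Suc n) = F (T n)" for n by (simp_all add: T_def)
 have TE: "T n \<subseteq> E" for n
 proof (induction n)
  case (Suc n) show ?case unfolding TS F_def using Suc E(2,3) by blast
 qed (simp add: T0 E(1))
 have card: "|T n| \<le>o |D|" for n
 proof (induction n)
  case (Suc n)
  have "|\<Union>e\<in>T n. A e| \<le>o |D|" by (rule card_UN_le[OF D Suc]) (use A TE in blast)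
  moreover have "|\<Union>e\<in>T n. \<Union>e'\<in>T n. B e e'| \<le>o |D|"
   by (rule card_UN_le[OF D Suc], rule card_UN_le[OF D Suc]) (use B TE in blast)
  ultimately show ?case unfolding TS F_def by (intro card_Un_le D Suc)
 qed (simp add: T0 S)
 have mono: "T m \<subseteq> T n" if "m \<le> n" for m n
  by (rule lift_Suc_mono_le[OF _ that]) (auto simp: TS F_def)
 show ?thesis
 proof (rule that[of "\<Union>n. T n"])
  show "S \<subseteq> (\<Union>n. T n)" using T0 by blast
  show "(\<Union>n. T n) \<subseteq> E" using TE by blast
  have "|UNIV :: nat set| \<le>o |D|" using D by (simp add: infinite_iff_card_of_nat)
  then show "|\<Union>n. T n| \<le>o |D|" by (rule card_UN_le[OF D]) (rule card)
  fix e assume e: "e : (\<Union>n. T n)"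
  then obtain n where n: "e : T n" by blast
  then have "A e \<subseteq> T (Suc n)" unfolding TS F_def by blast
  then show "A e \<subseteq> (\<Union>n. T n)" by blast
  fix e' assume "e' : (\<Union>n. T n)"
  then obtain n' where n': "e' : T n'" by blast
  have "e : T (max n n')" "e' : T (max n n')" using n n' mono[of n "max n n'"] mono[of n' "max n n'"] by auto
  then have "B e e' \<subseteq> T (Suc (max n n'))" unfolding TS F_def by blast
  then show "B e e' \<subseteq> (\<Union>n. T n)" by blast
 qed
qed

context ground
begin

lemma tmap_rep:
 assumes "module K V" "module K W" "module K V'" "lin V V' f" "t <: tensor K V W"
 defines "\<phi> \<equiv> SOME \<phi>. \<phi> : t"
 shows "tmap V' W f t = finsum (tensor K V' W) (%p. \<phi> p *[tensor K V' W] tens K V' W (f (fst p)) (snd p)) {p. \<phi> p ~= \<zero>}"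
 unfolding tmap_def tsum_def Let_def \<phi>_def by (rule refl)

text \<open>The representative of \<open>t\<close> picked by \<open>SOME\<close> writes
  \<open>t\<close> as a finite sum of pure tensors. If all left factors lie in \<open>N\<close>,
  each summand comes from the smaller tensor product.\<close>

lemma tensor_of_sub:
 assumes V: "module K V" and W: "module K W" and N: "subspace V N" and t: "t <: tensor K V W"
  and sup: "!!p. (SOME \<phi>. \<phi> : t) p ~= \<zero> ==> fst p : N"
 shows "t : tmap V W (%x. x) ` carrier (tensor K (V\<lparr>carrier := N\<rparr>) W)"
proof -
 let ?N = "V\<lparr>carrier := N\<rparr>" and ?T = "tensor K V W" and ?\<phi> = "SOME \<phi>. \<phi> : t"
 note NM = submodule_module[OF V N] and i = sub_lin[OF N]
 note \<phi> = free_carrierD[OF tensor_rep(1)[OF V W t]]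
 have T: "module K ?T" by (rule tensor_module[OF V W])
 have H: "subspace ?T (tmap V W (%x. x) ` carrier (tensor K ?N W))"
  by (rule subspace_image[OF tensor_module[OF NM W] T tmap_lin[OF NM V W i]])
 have "t = tmap V W (%x. x) t" by (rule tmap_id[OF V W _ t, symmetric]) (rule refl)
 also have "\<dots> = finsum ?T (%p. ?\<phi> p *[?T] tens K V W (fst p) (snd p)) {p. ?\<phi> p ~= \<zero>}"
  by (rule tmap_rep[OF V W V lin_id t])
 also have "\<dots> : tmap V W (%x. x) ` carrier (tensor K ?N W)"
 proof (rule finsum_subspace[OF T H \<phi>(3)])
  fix p assume "p : {p. ?\<phi> p ~= \<zero>}"
  then have p: "?\<phi> p ~= \<zero>" by simp
  have n: "fst p <: ?N" and w: "snd p <: W" using sup[OF p] \<phi>(2)[OF p] by auto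
  have "tens K V W (fst p) (snd p) : tmap V W (%x. x) ` carrier (tensor K ?N W)"
   by (rule image_eqI[where f = "tmap V W (%x. x)", OF tmap_tens[OF NM V W i n w, symmetric] tens_closed[OF NM W n w]])
  then show "?\<phi> p *[?T] tens K V W (fst p) (snd p) : tmap V W (%x. x) ` carrier (tensor K ?N W)"
   by (rule subspaceD(4)[OF H \<phi>(1)])
 qed
 finally show ?thesis .
qed

end

context entmor
begin

text \<open>An element of the extension is built from a finite set \<open>W\<close> of module
  elements. This is expressed without a formula for the element: it comes from the extension of
  every submodule that contains \<open>W\<close>.\<close>

definition supported :: "('k, 'o, 'm, 'c, 'v) entmod => 'o2 => ('o \<times> 'v) set => ('k, 'o, 'v, 'm2) extel => bool" where
 "supported M s W q \<longleftrightarrow> (ALL L :: ('k, 'o, 'm, 'c, 'v) entmod. R.preent L --> R.ehom L M (%r m. m) --> (ALL (r, m):W. m <: esp L r) -->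
   q : em L M (%r m. m) s ` carrier (es L s))"

text \<open>For the class of \<open>m \<otimes> f\<close> the singleton of \<open>m\<close> serves,
  and unions of supports show that the elements with a finite support form a subspace.\<close>

lemma ex_supported:
 fixes M :: "('k, 'o, 'm, 'c, 'v) entmod"
 assumes M: "R.preent M" and s: "s <. S" and q: "q <: es M s"
 shows "EX W. finite W & W \<subseteq> (SIGMA r:lobj R. carrier (esp M r)) & supported M s W q"
proof -
 let ?X = "es M s"
 let ?G = "SIGMA r:lobj R. carrier (esp M r)"
 let ?H = "{q : carrier ?X. EX W. finite W & W \<subseteq> ?G & supported M s W q}"
 note X = ext_sp_module[OF M s]
 have im: "subspace ?X (em L M (%r m. m) s ` carrier (es L s))"
  if "R.preent L" "R.ehom L M (%r m. m)" for L :: "('k, 'o, 'm, 'c, 'v) entmod"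
  by (rule subspace_image[OF ext_sp_module[OF that(1) s] X ext_map_lin_cls(1)[OF that(1) M that(2) s]])
 have "carrier ?X \<subseteq> ?H"
 proof (rule ext_span[OF M s])
  show "subspace ?X ?H"
  proof (rule subspaceI)
   show "0[?X] : ?H"
    using mod_closed(2)[OF X] subspaceD(2)[OF im] by (auto simp: supported_def intro!: exI[of _ "{}"])
  next
   fix a b assume "a : ?H" "b : ?H"
   then obtain W W' where a: "a <: ?X" "finite W" "W \<subseteq> ?G" "supported M s W a"
    and b: "b <: ?X" "finite W'" "W' \<subseteq> ?G" "supported M s W' b" by blast
   have "supported M s (W \<union> W') (a +[?X] b)" unfolding supported_def
   proof (intro allI impI)
    fix L :: "('k, 'o, 'm, 'c, 'v) entmod"
    assume L: "R.preent L" "R.ehom L M (%r m. m)" and w: "ALL (r, m):W \<union> W'. m <: esp L r"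
    show "a +[?X] b : em L M (%r m. m) s ` carrier (es L s)"
     by (rule subspaceD(3)[OF im[OF L]]) (use a(4) b(4) L w in \<open>simp_all add: supported_def\<close>)
   qed
   then show "a +[?X] b : ?H" using a b mod_closed(1)[OF X a(1) b(1)] by (intro CollectI conjI exI[of _ "W \<union> W'"]) auto
  next
   fix c a assume c: "c <: K" and "a : ?H"
   then obtain W where a: "a <: ?X" "finite W" "W \<subseteq> ?G" "supported M s W a" by blast
   have "supported M s W (c *[?X] a)" unfolding supported_def
   proof (intro allI impI)
    fix L :: "('k, 'o, 'm, 'c, 'v) entmod"
    assume L: "R.preent L" "R.ehom L M (%r m. m)" and w: "ALL (r, m):W. m <: esp L r"
    show "c *[?X] a : em L M (%r m. m) s ` carrier (es L s)"
     by (rule subspaceD(4)[OF im[OF L] c]) (use a(4) L w in \<open>simp add: supported_def\<close>)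
   qed
   then show "c *[?X] a : ?H" using a mod_closed(5)[OF X c a(1)] by blast
  qed blast
 next
  fix r m f assume r: "r <. R" and m: "m <: esp M r" and f: "f <: T s r"
  have "supported M s {(r, m)} (ec M s r m f)" unfolding supported_def
  proof (intro allI impI)
   fix L :: "('k, 'o, 'm, 'c, 'v) entmod"
   assume L: "R.preent L" "R.ehom L M (%r m. m)" and "ALL (r, m):{(r, m)}. m <: esp L r"
   then have m': "m <: esp L r" by simp
   show "ec M s r m f : em L M (%r m. m) s ` carrier (es L s)"
    by (rule image_eqI[where f = "em L M (%r m. m) s", OF ext_map_lin_cls(2)[OF L(1) M L(2) s r m' f, symmetric] ext_cls_closed[OF L(1) s r m' f]])
  qed
  then show "ec M s r m f : ?H"
   using ext_cls_closed[OF M s r m f] r m by (intro CollectI conjI exI[of _ "{(r, m)}"]) auto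
 qed
 then show ?thesis using q by blast
qed

end

section \<open>Cartesian submodules of bounded size\<close>

context cartl
begin

definition bound :: "'v set => bool" where
 "bound D \<longleftrightarrow> infinite D & |carrier K| \<le>o |D| & |carrier (csp C)| \<le>o |D| &
   |X| \<le>o |D| & (ALL x:X. ALL y:X. |Arr \<X> x y| \<le>o |D| ) &
   (ALL x:X. |lobj (R x)| \<le>o |D| & (ALL r:lobj (R x). ALL s:lobj (R x). |carrier (lhom (R x) r s)| \<le>o |D| ))"

lemma boundD:
 assumes "bound D"
 shows "infinite D" "|carrier K| \<le>o |D|" "|carrier (csp C)| \<le>o |D|" "|X| \<le>o |D|"
  "x : X ==> y : X ==> |Arr \<X> x y| \<le>o |D|" "x : X ==> |lobj (R x)| \<le>o |D|"
  "x : X ==> r <. R x ==> s <. R x ==> |carrier (lhom (R x) r s)| \<le>o |D|"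
 using assms by (simp_all add: bound_def)

text \<open>All sorts are closed up simultaneously, as one set of triples of an object
  \<open>x\<close>, a sort \<open>r\<close> over it and an element. The demands of one element, over
  all scalars, arrows and objects together, have size at most that of \<open>D\<close>, so
  \<open>bounded_closure\<close> applies.\<close>

lemma bounded_sub:
 assumes D: "bound D" and M: "cart M" and x0: "x0 : X" and r0: "r0 : lobj (R x0)" and m0: "m0 <: rsp M x0 r0"
 obtains N where "cart N" "rhom N M (%x r m. m)" "m0 <: rsp N x0 r0"
  "!!x r. x : X ==> r <. R x ==> |carrier (rsp N x r)| \<le>o |D|"
proof -
 note M' = cartD(1)[OF M] and bD = boundD[OF D] note inf = bD(1)
 \<comment> \<open>\<open>W\<close> is a finite support of some preimage \<open>q\<close> of
   \<open>m\<close> under the transposed map along \<open>\<alpha>\<close>. A submodule that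
   contains \<open>W\<close> over \<open>w\<close> can thus still represent
   \<open>m\<close>.\<close>
 define wit where "wit w x \<alpha> r m W \<longleftrightarrow> finite W & W \<subseteq> (SIGMA r:lobj (R w). carrier (rsp M w r)) &
   (EX q:carrier (xs w x \<alpha> (rat M w) r). ph w x \<alpha> M r q = m &
    entmor.supported K C (R w) (R x) (al w x \<alpha>) (rat M w) r W q)" for w x \<alpha> r m W
 define Wt where "Wt w x \<alpha> r m = (SOME W. wit w x \<alpha> r m W)" for w x \<alpha> r m
 have Wt: "wit w x \<alpha> r m (Wt w x \<alpha> r m)"
  if a: "w : X" "x : X" "\<alpha> : Arr \<X> w x" and r: "r <. R x" and m: "m <: rsp M x r" for w x \<alpha> r m
 proof -
  obtain q where q: "q <: xs w x \<alpha> (rat M w) r" "ph w x \<alpha> M r q = m" using m unfolding cartD(4)[OF M a r, symmetric] by blast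
  obtain W where "finite W" "W \<subseteq> (SIGMA r:lobj (R w). carrier (rsp M w r))"
   "entmor.supported K C (R w) (R x) (al w x \<alpha>) (rat M w) r W q"
   using entmor.ex_supported[OF em[OF a] rm_pre[OF a(1) M'] r q(1)] by blast
  then have "wit w x \<alpha> r m W" unfolding wit_def using q by blast
  then show ?thesis unfolding Wt_def by (rule someI)
 qed
 define E where "E = {(x, r, m). x : X & r <. R x & m <: rsp M x r}"
 \<comment> \<open>The zero vectors of all sorts are included from the start, so that the closure is
   a subspace also at sorts that nothing else reaches.\<close>
 define S where "S = insert (x0, r0, m0) ((%(x, r). (x, r, 0[rsp M x r])) ` sorts)"
 define cs where "cs x r m = {p. (SOME \<phi>. \<phi> : ecoact (rat M x) r m) p ~= \<zero>}" for x r m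
 define A1 where "A1 x r m = (%a. (x, r, a *[rsp M x r] m)) ` carrier K" for x r m
 define A2 where "A2 x r m = (\<Union>s\<in>lobj (R x). (%f. (x, s, eact (rat M x) s r m f)) ` carrier (lhom (R x) s r))" for x r m
 define A3 where "A3 x r m = (\<Union>y\<in>X. (%\<alpha>. (y, ob x y \<alpha> r, rtr M x y \<alpha> r m)) ` Arr \<X> x y)" for x r m
 define A4 where "A4 x r m = (%p. (x, r, fst p)) ` cs x r m" for x r m
 define A5 where "A5 x r m = (\<Union>w\<in>X. \<Union>\<alpha>\<in>Arr \<X> w x. Pair w ` Wt w x \<alpha> r m)" for x r m
 define A where "A = (%(x, r, m). A1 x r m \<union> A2 x r m \<union> A3 x r m \<union> A4 x r m \<union> A5 x r m)"
 \<comment> \<open>Addition is the only binary operation, and it makes sense only for two elements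
   of the same sort.\<close>
 define B where "B = (%(x, r, m) (x', r', m'). if (x', r') = (x, r) then {(x, r, m +[rsp M x r] m')} else {})"
 have cs: "finite (cs x r m)" "p : cs x r m ==> fst p <: rsp M x r"
  if "x : X" "r <. R x" "m <: rsp M x r" for x r m p
 proof -
  note t = lin_closed[OF entw.preentD(2)[OF ew[OF that(1)] rm_pre[OF that(1) M'] that(2)] that(3)]
  note f = free_carrierD[OF tensor_rep(1)[OF rm_mod[OF that(1) M' that(2)] V_module t]]
  show "finite (cs x r m)" unfolding cs_def by (rule f(3))
  show "fst p <: rsp M x r" if "p : cs x r m" using f(2)[of p] that unfolding cs_def by auto
 qed
 have sorts_le: "|sorts| \<le>o |D|" by (rule card_Sigma_le[OF inf bD(4) bD(6)])
 have S_le: "|S| \<le>o |D|" unfolding S_def insert_is_Un[of _ "_ ` _"]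
  by (intro card_Un_le inf card_finite_le card_image_le sorts_le) simp
 have E_cases: thesis if "e : E" "!!x r m. e = (x, r, m) ==> x : X ==> r <. R x ==> m <: rsp M x r ==> thesis" for e thesis
  using that(1) unfolding E_def by (auto intro: that(2))
 have A_le: "|A e| \<le>o |D|" if "e : E" for e
 proof (rule E_cases[OF that])
  fix x r m assume e: "e = (x, r, m)" and a: "x : X" "r <. R x" "m <: rsp M x r"
  have "|A1 x r m| \<le>o |D|" unfolding A1_def by (rule card_image_le[OF bD(2)])
  moreover have "|A2 x r m| \<le>o |D|" unfolding A2_def by (rule card_UN_le[OF inf bD(6)[OF a(1)] card_image_le[OF bD(7)[OF a(1) _ a(2)]]])
  moreover have "|A3 x r m| \<le>o |D|" unfolding A3_def by (rule card_UN_le[OF inf bD(4) card_image_le[OF bD(5)[OF a(1)]]])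
  moreover have "|A4 x r m| \<le>o |D|" unfolding A4_def by (rule card_image_le[OF card_finite_le[OF inf cs(1)[OF a]]])
  moreover have "|A5 x r m| \<le>o |D|" unfolding A5_def
   by (rule card_UN_le[OF inf bD(4)], rule card_UN_le[OF inf bD(5)[OF _ a(1)]], assumption, rule card_image_le[OF card_finite_le[OF inf]])
    (use Wt[OF _ a(1) _ a(2,3)] in \<open>simp add: wit_def\<close>)
  ultimately show ?thesis unfolding e A_def prod.case by (intro card_Un_le inf)
 qed
 have B_le: "|B e e'| \<le>o |D|" for e e' by (rule card_finite_le[OF inf]) (simp add: B_def split: prod.splits)
 have SE: "S \<subseteq> E" unfolding S_def E_def using x0 r0 m0 by (auto intro: mod_closed(2)[OF rm_mod[OF _ M']])
 have AE: "A e \<subseteq> E" if "e : E" for e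
 proof (rule E_cases[OF that])
  fix x r m assume e: "e = (x, r, m)" and a: "x : X" "r <. R x" "m <: rsp M x r"
  have "A1 x r m \<subseteq> E" unfolding A1_def
   by (rule image_subsetI) (use mod_closed(5)[OF rm_mod[OF a(1) M' a(2)] _ a(3)] a in \<open>simp add: E_def\<close>)
  moreover have "A2 x r m \<subseteq> E" unfolding A2_def
   by (rule UN_least, rule image_subsetI)
    (use bilinD(3)[OF entw.preentD(3)[OF ew[OF a(1)] rm_pre[OF a(1) M'] _ a(2)] a(3)] a in \<open>simp add: E_def\<close>)
  moreover have "A3 x r m \<subseteq> E" unfolding A3_def
   by (rule UN_least, rule image_subsetI) (use ob_closed[OF a(1) _ _ a(2)] rm_tr_closed[OF M' a(1) _ _ a(2,3)] in \<open>simp add: E_def\<close>)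
  moreover have "A4 x r m \<subseteq> E" unfolding A4_def by (rule image_subsetI) (use cs(2)[OF a] a in \<open>simp add: E_def\<close>)
  moreover have "A5 x r m \<subseteq> E" unfolding A5_def
  proof (rule UN_least, rule UN_least, rule image_subsetI)
   fix w \<alpha> p assume w: "w : X" "\<alpha> : Arr \<X> w x" and p: "p : Wt w x \<alpha> r m"
   have "Wt w x \<alpha> r m \<subseteq> (SIGMA r:lobj (R w). carrier (rsp M w r))" using Wt[OF w(1) a(1) w(2) a(2,3)] unfolding wit_def by (elim conjE)
   then show "(w, p) : E" using p w unfolding E_def by auto
  qed
  ultimately show ?thesis unfolding e A_def prod.case by (intro Un_least)
 qed
 have BE: "B e e' \<subseteq> E" if e: "e : E" and e': "e' : E" for e e'
 proof (rule E_cases[OF e], rule E_cases[OF e'])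
  fix x r m x' r' m' assume "e = (x, r, m)" "e' = (x', r', m')" and a: "x : X" "r <. R x" "m <: rsp M x r"
   "m' <: esp (rat M x') r'"
  then show ?thesis using mod_closed(1)[OF rm_mod[OF a(1) M' a(2)] a(3)] by (auto simp: B_def E_def)
 qed
 obtain T where T: "S \<subseteq> T" "T \<subseteq> E" "|T| \<le>o |D|" "!!e. e : T ==> A e \<subseteq> T" "!!e e'. e : T ==> e' : T ==> B e e' \<subseteq> T"
  by (rule bounded_closure[OF inf S_le A_le B_le SE AE BE]; (assumption | (rule that; assumption)))
 define N where "N x r = {m. (x, r, m) : T}" for x r
 have NE: "x : X" "r <. R x" "m <: rsp M x r" if "m : N x r" for x r m
  using that T(2) unfolding N_def E_def by auto
 have AT: "A1 x r m \<subseteq> T" "A2 x r m \<subseteq> T" "A3 x r m \<subseteq> T" "A4 x r m \<subseteq> T" "A5 x r m \<subseteq> T" if "m : N x r" for x r m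
  using T(4)[of "(x, r, m)"] that unfolding N_def A_def by simp_all
 have N_le: "|N x r| \<le>o |D|" for x r
  by (rule ordLeq_transitive[OF _ card_image_le[OF T(3), of "%(x, r, m). m"]], rule card_of_mono1) (force simp: N_def)
 have Nsub: "subspace (rsp M x r) (N x r)" if x: "x : X" and r: "r <. R x" for x r
 proof (rule subspaceI)
  show "N x r \<subseteq> carrier (rsp M x r)" using NE(3) by blast
  show "0[rsp M x r] : N x r" using T(1) x r unfolding S_def N_def by blast
  show "m +[rsp M x r] m' : N x r" if "m : N x r" "m' : N x r" for m m'
   using T(5)[of "(x, r, m)" "(x, r, m')"] that by (simp add: N_def B_def)
  show "a *[rsp M x r] m : N x r" if "a <: K" "m : N x r" for a m
   using AT(1)[OF that(2)] that(1) unfolding N_def A1_def by blast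
 qed
 have "EX L. is_entmod K C (R x) L & (ALL r. carrier (esp L r) = N x r) & eh x L (rat M x) (%r m. m)" if x: "x : X" for x
 proof -
  have act: "eact (rat M x) s r m f : N x s" if "s <. R x" "r <. R x" "m : N x r" "f <: lhom (R x) s r" for s r m f
   using AT(2)[OF that(3)] that(1,4) unfolding N_def A2_def by blast
  have co: "ecoact (rat M x) r m : tmap (rsp M x r) V (%x. x) ` carrier (tensor K ((rsp M x r)\<lparr>carrier := N x r\<rparr>) V)"
   if r: "r <. R x" and m: "m : N x r" for r m
  \<comment> \<open>The left factors of the chosen representative of the coaction were put into the
    closure by \<open>A4\<close>.\<close>
  proof (rule tensor_of_sub[OF rm_mod[OF x M' r] V_module Nsub[OF x r] lin_closed[OF entw.preentD(2)[OF ew[OF x] rm_pre[OF x M'] r] NE(3)[OF m]]])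
   fix p assume "(SOME \<phi>. \<phi> : ecoact (rat M x) r m) p ~= \<zero>"
   then have "p : cs x r m" by (simp add: cs_def)
   then show "fst p : N x r" using AT(4)[OF m] unfolding N_def A4_def by blast
  qed
  obtain L :: "('k, 'o, 'm, 'c, 'v) entmod" where "is_entmod K C (R x) L" "!!r. carrier (esp L r) = N x r" "eh x L (rat M x) (%r m. m)"
   by (rule entw.entmod_sub[OF ew[OF x] rm_ent[OF x M'] Nsub[OF x] act co]; (assumption | (rule that; assumption)))
  then show ?thesis by blast
 qed
 then have "ALL x:X. EX L. is_entmod K C (R x) L & (ALL r. carrier (esp L r) = N x r) & eh x L (rat M x) (%r m. m)" by (rule ballI)
 from bchoice[OF this] obtain L where L': "ALL x:X. is_entmod K C (R x) (L x) & (ALL r. carrier (esp (L x) r) = N x r) & eh x (L x) (rat M x) (%r m. m)" ..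
 have Lc: "carrier (esp (L x) r) = N x r" and Lh: "eh x (L x) (rat M x) (%r m. m)" if "x : X" for x r using L' that by blast+
 have LO: "L x : EO x" if x: "x : X" for x unfolding EO_iff[OF x]
 proof (intro conjI ballI)
  show "is_entmod K C (R x) (L x)" using L' x by blast
  fix r assume r: "r <. R x"
  have "small U (carrier (rsp M x r))" using rmodD(1)[OF M' x] r by (simp add: EO_iff[OF x])
  then show "small U (carrier (esp (L x) r))" unfolding Lc[OF x] by (rule small_subset) (use NE(3) in blast)
 qed
 have st: "rtr M x y \<alpha> r v : (%m. m) ` carrier (esp (L y) (ob x y \<alpha> r))"
  if a: "x : X" "y : X" "\<alpha> : Arr \<X> x y" "r <. R x" and v: "v <: esp (L x) r" for x y \<alpha> r v
 proof -
  have v': "v : N x r" using v Lc[OF a(1)] by simp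
  have "(y, ob x y \<alpha> r, rtr M x y \<alpha> r v) : T" using AT(3)[OF v'] a(2,3) unfolding A3_def by blast
  then show ?thesis by (simp add: N_def Lc[OF a(2)])
 qed
 obtain P where P: "rmod P" "rat P = L" "rhom P M (%x r m. m)"
  by (rule sub_repmod[OF M' LO Lh inj_on_id2 st]; (assumption | (rule that; assumption)))
 have "cart P"
 proof (rule sub_cart[OF M P(1,3) inj_on_id2], unfold P(2))
  fix x y \<alpha> s v assume a: "x : X" "y : X" "\<alpha> : Arr \<X> x y" and s: "s <. R y" and "v <: esp (L y) s"
  then have v: "v : N y s" using Lc[OF a(2)] by simp
  obtain q where q: "q <: xs x y \<alpha> (rat M x) s" "ph x y \<alpha> M s q = v"
   and sq: "entmor.supported K C (R x) (R y) (al x y \<alpha>) (rat M x) s (Wt x y \<alpha> s v) q"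
   using Wt[OF a s NE(3)[OF v]] unfolding wit_def by blast
  \<comment> \<open>The support chosen for \<open>v\<close> along \<open>\<alpha>\<close> was put
    into the closure by \<open>A5\<close>, so the preimage \<open>q\<close> comes from the extension
    of \<open>L x\<close>.\<close>
  have "ALL (r, m):Wt x y \<alpha> s v. m <: esp (L x) r"
  proof (intro ballI, clarify)
   fix r m assume "(r, m) : Wt x y \<alpha> s v"
   then have "(x, r, m) : T" using AT(5)[OF v] a(1,3) unfolding A5_def by blast
   then show "m <: esp (L x) r" unfolding Lc[OF a(1)] N_def by simp
  qed
  then have "q : xm x y \<alpha> (L x) (rat M x) (%r m. m) s ` carrier (xs x y \<alpha> (L x) s)"
   using sq EO_preent[OF a(1) LO[OF a(1)]] Lh[OF a(1)] unfolding entmor.supported_def[OF em[OF a]] by blast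
  then show "EX q:carrier (xs x y \<alpha> (L x) s). ph x y \<alpha> M s (xm x y \<alpha> (L x) (rat M x) (%r m. m) s q) = v" using q(2) by auto
 qed
 moreover have "m0 <: rsp P x0 r0" using T(1) unfolding P(2) Lc[OF x0] N_def S_def by blast
 moreover have "|carrier (rsp P x r)| \<le>o |D|" if "x : X" "r <. R x" for x r unfolding P(2) Lc[OF that(1)] by (rule N_le)
 ultimately show ?thesis using that[OF _ P(3)] by blast
qed

end

text \<open>If the representatives of \<open>t\<close> and \<open>t'\<close> picked by
  \<open>SOME\<close> correspond under \<open>u\<close>, the two finite sums agree term by term.
  Comparing representatives instead of tensors is what allows a coaction to be recorded in
  labels.\<close>

lemma (in ground) tmap_reindex:
 assumes V: "module K V" and V': "module K V'" and W: "module K W" and u: "lin V V' u" and inj: "inj_on u (carrier V)"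
  and t: "t <: tensor K V W" and t': "t' <: tensor K V' W"
 defines "\<phi> \<equiv> SOME \<phi>. \<phi> : t" and "\<phi>' \<equiv> SOME \<phi>'. \<phi>' : t'"
 assumes supp: "{p. \<phi>' p ~= \<zero>} = (%p. (u (fst p), snd p)) ` {p. \<phi> p ~= \<zero>}"
  and val: "!!p. \<phi> p ~= \<zero> ==> \<phi>' (u (fst p), snd p) = \<phi> p"
 shows "tmap V' W u t = t'"
proof -
 let ?T = "tensor K V' W" and ?h = "%p. (u (fst p), snd p)"
 interpret T: module K ?T by (rule tensor_module[OF V' W])
 note \<phi> = free_carrierD[OF tensor_rep(1)[OF V W t], folded \<phi>_def] and \<phi>' = free_carrierD[OF tensor_rep(1)[OF V' W t'], folded \<phi>'_def]
 have c: "\<phi> p *[?T] tens K V' W (u (fst p)) (snd p) <: ?T" if "\<phi> p ~= \<zero>" for p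
  using \<phi>(2)[OF that] by (intro T.smult_closed \<phi>(1) tens_closed[OF V' W] lin_closed[OF u]) auto
 have i: "inj_on ?h {p. \<phi> p ~= \<zero>}"
  by (rule inj_onI) (use inj \<phi>(2) in \<open>auto simp: inj_on_def mem_Times_iff prod_eq_iff\<close>)
 have "t' = tmap V' W (%x. x) t'" by (rule tmap_id[OF V' W _ t', symmetric]) (rule refl)
 also have "\<dots> = finsum ?T (%p. \<phi>' p *[?T] tens K V' W (fst p) (snd p)) {p. \<phi>' p ~= \<zero>}"
  unfolding \<phi>'_def by (rule tmap_rep[OF V' W V' lin_id t'])
 also have "\<dots> = finsum ?T (%p. \<phi>' (?h p) *[?T] tens K V' W (fst (?h p)) (snd (?h p))) {p. \<phi> p ~= \<zero>}"
  unfolding supp by (rule T.finsum_reindex[OF _ i]) (use c val in auto)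
 also have "\<dots> = finsum ?T (%p. \<phi> p *[?T] tens K V' W (u (fst p)) (snd p)) {p. \<phi> p ~= \<zero>}"
  by (rule T.finsum_cong') (use c val in auto)
 also have "\<dots> = tmap V' W u t" unfolding \<phi>_def by (rule tmap_rep[OF V W V' u t, symmetric])
 finally show ?thesis by (rule sym)
qed

lemma (in ground) is_dsum_cong:
 assumes d: "is_dsum I V P \<iota> \<pi>" and eq: "!!i v. i : I ==> v <: V i ==> \<iota>' i v = \<iota> i v"
 shows "is_dsum I V P \<iota>' \<pi>"
proof -
 have "lin (V i) P (\<iota>' i)" if i: "i : I" for i
  by (rule lin_cong[OF is_dsumD(3)[OF d i] is_dsumD(2)[OF d i] eq[OF i, symmetric]])
 then show ?thesis using d eq unfolding is_dsum_def by (elim conjE) (intro conjI; simp)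
qed

section \<open>A small separating family\<close>

context cartl
begin

context
 fixes D :: "'v set"
 assumes D: "bound D" and PD: "small U (Pow D)"
begin

text \<open>One fixed formal sum for the coaction of \<open>m\<close>; its factors and coefficients
  can be listed, unlike the tensor, which is a coset in a type that involves the module.\<close>

definition crep :: "('x, 'a, 'k, 'o, 'm, 'c, 'v) repmod => 'x => 'o => 'v => ('v \<times> 'c => 'k)" where
 "crep N x r m = (SOME \<phi>. \<phi> : ecoact (rat N x) r m)"

text \<open>Labels in \<open>D\<close> take the place of module elements, so that modules with
  different carriers can be compared.\<close>

definition labelled :: "('x, 'a, 'k, 'o, 'm, 'c, 'v) repmod => ('x => 'o => 'v => 'v) => bool" where
 "labelled N \<theta> \<longleftrightarrow> cart N & (ALL x:X. ALL r:lobj (R x). inj_on (\<theta> x r) (carrier (rsp N x r)) & \<theta> x r ` carrier (rsp N x r) \<subseteq> D)"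

text \<open>The structure of \<open>N\<close>, read off in the labels; it determines \<open>N\<close> up to isomorphism.\<close>

definition code1 where "code1 N \<theta> = {(x, r, \<theta> x r m) | x r m. x : X & r <. R x & m <: rsp N x r}"
definition code2 where "code2 N \<theta> = {(x, r, \<theta> x r m, \<theta> x r n, \<theta> x r (m +[rsp N x r] n)) | x r m n.
 x : X & r <. R x & m <: rsp N x r & n <: rsp N x r}"
definition code3 where "code3 N \<theta> = {(x, r, a, \<theta> x r m, \<theta> x r (a *[rsp N x r] m)) | x r a m.
 x : X & r <. R x & a <: K & m <: rsp N x r}"
definition code4 where "code4 N \<theta> = {(x, s, r, f, \<theta> x r m, \<theta> x s (eact (rat N x) s r m f)) | x s r f m.
 x : X & s <. R x & r <. R x & f <: lhom (R x) s r & m <: rsp N x r}"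
definition code5 where "code5 N \<theta> = {(x, y, a, r, \<theta> x r m, \<theta> y (ob x y a r) (rtr N x y a r m)) | x y a r m.
 x : X & y : X & a : Arr \<X> x y & r <. R x & m <: rsp N x r}"
definition code6 where "code6 N \<theta> = {(x, r, \<theta> x r m, \<theta> x r (fst p), snd p, crep N x r m p) | x r m p.
 x : X & r <. R x & m <: rsp N x r & crep N x r m p ~= \<zero>}"
definition code where "code N \<theta> = (code1 N \<theta>, code2 N \<theta>, code3 N \<theta>, code4 N \<theta>, code5 N \<theta>, code6 N \<theta>)"

lemma small_Pow: "|E| \<le>o |D| ==> small U (Pow E)"
proof -
 assume "|E| \<le>o |D|"
 then obtain f where f: "inj_on f E" "f ` E \<subseteq> D" unfolding card_of_ordLeq[symmetric] by blast
 show ?thesis by (rule small_inj[OF PD inj_on_image_Pow[OF f(1)]]) (use f(2) in blast)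
qed

lemma crep:
 assumes N: "rmod N" and x: "x : X" and r: "r <. R x" and m: "m <: rsp N x r"
 shows "crep N x r m p <: K" "crep N x r m p ~= \<zero> ==> fst p <: rsp N x r"
  "crep N x r m p ~= \<zero> ==> snd p <: csp C" "ecoact (rat N x) r m <: tensor K (rsp N x r) V"
proof -
 show t: "ecoact (rat N x) r m <: tensor K (rsp N x r) V"
  by (rule lin_closed[OF entw.preentD(2)[OF ew[OF x] rm_pre[OF x N] r] m])
 note f = free_carrierD[OF tensor_rep(1)[OF rm_mod[OF x N r] V_module t], folded crep_def]
 show "crep N x r m p <: K" by (rule f(1))
 show "fst p <: rsp N x r" "snd p <: csp C" if "crep N x r m p ~= \<zero>" using f(2)[OF that] by auto
qed

text \<open>Each component of a code is a subset of a product built from the data and from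
  \<open>D\<close>, hence of a set no larger than \<open>D\<close>. Module elements themselves do
  not occur in codes.\<close>

lemma small_codes: "small U {code N \<theta> | N \<theta>. labelled N \<theta>}"
proof (rule small_subset)
 let ?P1 = "SIGMA x:X. SIGMA r:lobj (R x). D"
 let ?P2 = "SIGMA x:X. SIGMA r:lobj (R x). D \<times> D \<times> D"
 let ?P3 = "SIGMA x:X. SIGMA r:lobj (R x). carrier K \<times> D \<times> D"
 let ?P4 = "SIGMA x:X. SIGMA s:lobj (R x). SIGMA r:lobj (R x). carrier (lhom (R x) s r) \<times> D \<times> D"
 let ?P5 = "SIGMA x:X. SIGMA y:X. SIGMA a:Arr \<X> x y. lobj (R x) \<times> D \<times> D"
 let ?P6 = "SIGMA x:X. SIGMA r:lobj (R x). D \<times> D \<times> carrier (csp C) \<times> carrier K"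
 note bD = boundD[OF D]
 have DD: "|D| \<le>o |D|" by (rule card_of_mono1[OF subset_refl])
 note S = card_Sigma_le[OF bD(1)]
 have le: "|?P1| \<le>o |D|" "|?P2| \<le>o |D|" "|?P3| \<le>o |D|" "|?P4| \<le>o |D|" "|?P5| \<le>o |D|" "|?P6| \<le>o |D|"
  by (intro S bD(2-7) DD; assumption)+
 show "small U (Pow ?P1 \<times> Pow ?P2 \<times> Pow ?P3 \<times> Pow ?P4 \<times> Pow ?P5 \<times> Pow ?P6)"
  by (intro small_Sigma small_Pow le)
 show "{code N \<theta> | N \<theta>. labelled N \<theta>} \<subseteq> Pow ?P1 \<times> Pow ?P2 \<times> Pow ?P3 \<times> Pow ?P4 \<times> Pow ?P5 \<times> Pow ?P6"
 proof
  fix c assume "c : {code N \<theta> | N \<theta>. labelled N \<theta>}"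
  then obtain N \<theta> where c: "c = code N \<theta>" and l: "labelled N \<theta>" by blast
  have N: "rmod N" using l unfolding labelled_def by (elim conjE)
  have \<theta>: "\<theta> x r m : D" if "x : X" "r <. R x" "m <: rsp N x r" for x r m
   using l that unfolding labelled_def by blast
  note m = rm_mod[OF _ N]
  have "code1 N \<theta> \<subseteq> ?P1" unfolding code1_def
   by (rule subsetI, elim CollectE exE conjE, hypsubst, intro SigmaI \<theta>; assumption)
  moreover have "code2 N \<theta> \<subseteq> ?P2" unfolding code2_def
   by (rule subsetI, elim CollectE exE conjE, hypsubst, intro SigmaI \<theta> mod_closed(1)[OF m]; assumption)
  moreover have "code3 N \<theta> \<subseteq> ?P3" unfolding code3_def
   by (rule subsetI, elim CollectE exE conjE, hypsubst, intro SigmaI \<theta> mod_closed(5)[OF m]; assumption)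
  moreover have "code4 N \<theta> \<subseteq> ?P4" unfolding code4_def
   by (rule subsetI, elim CollectE exE conjE, hypsubst, intro SigmaI \<theta> bilinD(3)[OF entw.preentD(3)[OF ew rm_pre[OF _ N]]]; assumption)
  moreover have "code5 N \<theta> \<subseteq> ?P5" unfolding code5_def
   by (rule subsetI, elim CollectE exE conjE, hypsubst, intro SigmaI \<theta> ob_closed rm_tr_closed[OF N]; assumption)
  moreover have "code6 N \<theta> \<subseteq> ?P6" unfolding code6_def
   by (rule subsetI, elim CollectE exE conjE, hypsubst, intro SigmaI \<theta> crep[OF N]; assumption)
  ultimately show "c : Pow ?P1 \<times> Pow ?P2 \<times> Pow ?P3 \<times> Pow ?P4 \<times> Pow ?P5 \<times> Pow ?P6" unfolding c code_def by simp
 qed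
qed

text \<open>\<open>u\<close> sends an element to the one with the same label. The code contains the
  graph of every operation in terms of labels, so equality of the codes says that \<open>u\<close>
  respects all of them.\<close>

lemma code_iso:
 assumes l: "labelled N \<theta>" and l': "labelled N' \<theta>'" and c: "code N \<theta> = code N' \<theta>'"
 obtains u where "rhom N N' u" "!!x r. x : X ==> r <. R x ==> u x r ` carrier (rsp N x r) = carrier (esp (rat N' x) r)"
proof -
 have N: "rmod N" using l unfolding labelled_def by (elim conjE)
 have N': "rmod N'" using l' unfolding labelled_def by (elim conjE)
 have inj: "inj_on (\<theta> x r) (carrier (rsp N x r))" and inj': "inj_on (\<theta>' x r) (carrier (esp (rat N' x) r))"
  if "x : X" "r <. R x" for x r using l l' that unfolding labelled_def by blast+
 have c: "code1 N \<theta> = code1 N' \<theta>'" "code2 N \<theta> = code2 N' \<theta>'" "code3 N \<theta> = code3 N' \<theta>'"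
  "code4 N \<theta> = code4 N' \<theta>'" "code5 N \<theta> = code5 N' \<theta>'" "code6 N \<theta> = code6 N' \<theta>'" using c unfolding code_def by simp_all
 define u where "u x r m = the_inv_into (carrier (esp (rat N' x) r)) (\<theta>' x r) (\<theta> x r m)" for x r m
 \<comment> \<open>Labels are injective, so any element of \<open>N'\<close> that carries the label
   of \<open>m\<close> is \<open>u x r m\<close>. Each component of the code is exploited through
   this.\<close>
 have uI: "u x r m = m'" if "x : X" "r <. R x" "m' <: esp (rat N' x) r" "\<theta> x r m = \<theta>' x r m'" for x r m m'
  unfolding u_def that(4) by (rule the_inv_into_f_f[OF inj'[OF that(1,2)] that(3)])
 have u: "u x r m <: esp (rat N' x) r" "\<theta>' x r (u x r m) = \<theta> x r m"
  if x: "x : X" "r <. R x" and m: "m <: rsp N x r" for x r m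
 proof -
  have "(x, r, \<theta> x r m) : code1 N \<theta>" unfolding code1_def using x m by blast
  then have "(x, r, \<theta> x r m) : code1 N' \<theta>'" unfolding c(1) .
  then obtain m' where m': "m' <: esp (rat N' x) r" "\<theta> x r m = \<theta>' x r m'" unfolding code1_def by blast
  show "u x r m <: esp (rat N' x) r" "\<theta>' x r (u x r m) = \<theta> x r m" using uI[OF x m'] m' by simp_all
 qed
 have surj: "u x r ` carrier (rsp N x r) = carrier (esp (rat N' x) r)" if x: "x : X" "r <. R x" for x r
 proof (rule subset_antisym[OF image_subsetI[OF u(1)[OF x]]], assumption, rule subsetI)
  fix m' assume m': "m' <: esp (rat N' x) r"
  have "(x, r, \<theta>' x r m') : code1 N' \<theta>'" unfolding code1_def using x m' by blast
  then have "(x, r, \<theta>' x r m') : code1 N \<theta>" unfolding c(1) .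
  then obtain m where m: "m <: rsp N x r" "\<theta>' x r m' = \<theta> x r m" unfolding code1_def by blast
  show "m' : u x r ` carrier (rsp N x r)" using uI[OF x m' m(2)[symmetric]] m(1) by blast
 qed
 have u_inj: "inj_on (u x r) (carrier (rsp N x r))" if x: "x : X" "r <. R x" for x r
 proof (rule inj_onI)
  fix m n assume m: "m <: rsp N x r" and n: "n <: rsp N x r" and "u x r m = u x r n"
  then have "\<theta> x r m = \<theta> x r n" using u(2)[OF x m] u(2)[OF x n] by simp
  then show "m = n" by (rule inj_onD[OF inj[OF x] _ m n])
 qed
 have lin: "lin (rsp N x r) (esp (rat N' x) r) (u x r)" if x: "x : X" "r <. R x" for x r
 proof (rule linI)
  show "u x r m <: esp (rat N' x) r" if "m <: rsp N x r" for m by (rule u(1)[OF x that])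
  fix m assume m: "m <: rsp N x r"
  show "u x r (m +[rsp N x r] n) = u x r m +[esp (rat N' x) r] u x r n" if n: "n <: rsp N x r" for n
  proof -
   have "(x, r, \<theta> x r m, \<theta> x r n, \<theta> x r (m +[rsp N x r] n)) : code2 N \<theta>" unfolding code2_def using x m n by blast
   then have "(x, r, \<theta> x r m, \<theta> x r n, \<theta> x r (m +[rsp N x r] n)) : code2 N' \<theta>'" unfolding c(2) .
   then obtain m' n' where m': "m' <: esp (rat N' x) r" "n' <: esp (rat N' x) r"
    and e: "\<theta> x r m = \<theta>' x r m'" "\<theta> x r n = \<theta>' x r n'" "\<theta> x r (m +[rsp N x r] n) = \<theta>' x r (m' +[esp (rat N' x) r] n')"
    unfolding code2_def by blast
   show ?thesis
    using uI[OF x m'(1) e(1)] uI[OF x m'(2) e(2)] uI[OF x mod_closed(1)[OF rm_mod[OF x(1) N' x(2)] m'] e(3)] by simp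
  qed
  show "u x r (a *[rsp N x r] m) = a *[esp (rat N' x) r] u x r m" if a: "a <: K" for a
  proof -
   have "(x, r, a, \<theta> x r m, \<theta> x r (a *[rsp N x r] m)) : code3 N \<theta>" unfolding code3_def using x m a by blast
   then have "(x, r, a, \<theta> x r m, \<theta> x r (a *[rsp N x r] m)) : code3 N' \<theta>'" unfolding c(3) .
   then obtain m' where m': "m' <: esp (rat N' x) r"
    and e: "\<theta> x r m = \<theta>' x r m'" "\<theta> x r (a *[rsp N x r] m) = \<theta>' x r (a *[esp (rat N' x) r] m')"
    unfolding code3_def by blast
   show ?thesis
    using uI[OF x m' e(1)] uI[OF x mod_closed(5)[OF rm_mod[OF x(1) N' x(2)] a m'] e(2)] by simp
  qed
 qed
 have coact: "ecoact (rat N' x) r (u x r m) = tmap (esp (rat N' x) r) V (u x r) (ecoact (rat N x) r m)"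
  if x: "x : X" "r <. R x" and m: "m <: rsp N x r" for x r m
 proof -
  note um = u(1)[OF x m]
  have val: "crep N' x r (u x r m) (u x r (fst p), snd p) = crep N x r m p" if p: "crep N x r m p ~= \<zero>" for p
  proof -
   have "(x, r, \<theta> x r m, \<theta> x r (fst p), snd p, crep N x r m p) : code6 N \<theta>" unfolding code6_def using x m p by blast
   then have "(x, r, \<theta> x r m, \<theta> x r (fst p), snd p, crep N x r m p) : code6 N' \<theta>'" unfolding c(6) .
   then obtain m' p' where m': "m' <: esp (rat N' x) r" and p': "crep N' x r m' p' ~= \<zero>"
    and e: "\<theta> x r m = \<theta>' x r m'" "\<theta> x r (fst p) = \<theta>' x r (fst p')" "snd p = snd p'" "crep N x r m p = crep N' x r m' p'"
    unfolding code6_def by blast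
   have "(u x r (fst p), snd p) = p'" using uI[OF x crep(2)[OF N' x m' p'] e(2)] e(3) by (simp add: prod_eq_iff)
   then show ?thesis using uI[OF x m' e(1)] e(4) by simp
  qed
  \<comment> \<open>By \<open>val\<close>, \<open>u\<close> carries terms for \<open>m\<close> to
    terms for \<open>u x r m\<close>. Conversely a term for \<open>u x r m\<close> is found in the
    code of \<open>N\<close>, where injectivity of the labels identifies its element with
    \<open>m\<close>.\<close>
  have "{p. crep N' x r (u x r m) p ~= \<zero>} = (%p. (u x r (fst p), snd p)) ` {p. crep N x r m p ~= \<zero>}"
  proof (rule subset_antisym; rule subsetI)
   fix p' assume "p' : {p. crep N' x r (u x r m) p ~= \<zero>}"
   then have p': "crep N' x r (u x r m) p' ~= \<zero>" by simp
   have "(x, r, \<theta>' x r (u x r m), \<theta>' x r (fst p'), snd p', crep N' x r (u x r m) p') : code6 N' \<theta>'" unfolding code6_def using x um p' by blast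
   then have "(x, r, \<theta>' x r (u x r m), \<theta>' x r (fst p'), snd p', crep N' x r (u x r m) p') : code6 N \<theta>" unfolding c(6) .
   then obtain n p where n: "n <: rsp N x r" and p: "crep N x r n p ~= \<zero>"
    and e: "\<theta>' x r (u x r m) = \<theta> x r n" "\<theta>' x r (fst p') = \<theta> x r (fst p)" "snd p' = snd p"
    unfolding code6_def by blast
   have "n = m" using inj_onD[OF inj[OF x] _ n m] e(1) u(2)[OF x m] by simp
   moreover have "p' = (u x r (fst p), snd p)" using uI[OF x crep(2)[OF N' x um p'] e(2)[symmetric]] e(3) by (simp add: prod_eq_iff)
   ultimately show "p' : (%p. (u x r (fst p), snd p)) ` {p. crep N x r m p ~= \<zero>}" using p by blast
  next
   fix p' assume "p' : (%p. (u x r (fst p), snd p)) ` {p. crep N x r m p ~= \<zero>}"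
   then obtain p where "crep N x r m p ~= \<zero>" "p' = (u x r (fst p), snd p)" by blast
   then show "p' : {p. crep N' x r (u x r m) p ~= \<zero>}" using val[of p] by simp
  qed
  then show ?thesis
   by (intro tmap_reindex[OF rm_mod[OF x(1) N x(2)] rm_mod[OF x(1) N' x(2)] V_module lin[OF x] u_inj[OF x] crep(4)[OF N x m] crep(4)[OF N' x um], symmetric])
    (simp_all add: crep_def[symmetric] val)
 qed
 have "rhom N N' u"
 proof (rule rhomI)
  fix x assume x: "x : X"
  show "eh x (rat N x) (rat N' x) (u x)" unfolding entw.ehom_def[OF ew[OF x]]
  proof (intro conjI ballI)
   show "colinear_map K C (rsp N x r) (ecoact (rat N x) r) (esp (rat N' x) r) (ecoact (rat N' x) r) (u x r)" if r: "r <. R x" for r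
    unfolding colinear_map_def using lin[OF x r] coact[OF x r] unfolding tmap_def by simp
   fix s r m f assume s: "s <. R x" and r: "r <. R x" and m: "m <: rsp N x r" and f: "f <: lhom (R x) s r"
   have "(x, s, r, f, \<theta> x r m, \<theta> x s (eact (rat N x) s r m f)) : code4 N \<theta>" unfolding code4_def using x s r m f by blast
   then have "(x, s, r, f, \<theta> x r m, \<theta> x s (eact (rat N x) s r m f)) : code4 N' \<theta>'" unfolding c(4) .
   then obtain m' where m': "m' <: esp (rat N' x) r"
    and e: "\<theta> x r m = \<theta>' x r m'" "\<theta> x s (eact (rat N x) s r m f) = \<theta>' x s (eact (rat N' x) s r m' f)" unfolding code4_def by blast
   show "u x s (eact (rat N x) s r m f) = eact (rat N' x) s r (u x r m) f"
    using uI[OF x r m' e(1)] uI[OF x s bilinD(3)[OF entw.preentD(3)[OF ew[OF x] rm_pre[OF x N'] s r] m' f] e(2)] by simp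
  qed
 next
  fix x y \<alpha> r m assume a: "x : X" "y : X" "\<alpha> : Arr \<X> x y" "r <. R x" and m: "m <: rsp N x r"
  have "(x, y, \<alpha>, r, \<theta> x r m, \<theta> y (ob x y \<alpha> r) (rtr N x y \<alpha> r m)) : code5 N \<theta>" unfolding code5_def using a m by blast
  then have "(x, y, \<alpha>, r, \<theta> x r m, \<theta> y (ob x y \<alpha> r) (rtr N x y \<alpha> r m)) : code5 N' \<theta>'" unfolding c(5) .
  then obtain m' where m': "m' <: esp (rat N' x) r"
   and e: "\<theta> x r m = \<theta>' x r m'" "\<theta> y (ob x y \<alpha> r) (rtr N x y \<alpha> r m) = \<theta>' y (ob x y \<alpha> r) (rtr N' x y \<alpha> r m')" unfolding code5_def by blast
  show "rtr N' x y \<alpha> r (u x r m) = u y (ob x y \<alpha> r) (rtr N x y \<alpha> r m)"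
   using uI[OF a(1,4) m' e(1)] uI[OF a(2) ob_closed[OF a] rm_tr_closed[OF N' a m'] e(2)] by simp
 qed
 then show ?thesis using surj by (rule that)
qed

text \<open>One labelled module is chosen for each code. An element of a cartesian module lies in a
  submodule of bounded size; this can be labelled, and the module chosen for its code maps onto
  it.\<close>

lemma separating_family:
 "EX (I :: 'v set) T. small U I & (ALL i:I. cart (T i)) &
   (ALL M. cart M --> (ALL x:X. ALL r:lobj (R x). ALL m:carrier (rsp M x r).
    EX i:I. EX h. rhom (T i) M h & m : h x r ` carrier (esp (rat (T i) x) r)))"
proof -
 let ?J = "{code N \<theta> | N \<theta>. labelled N \<theta>}"
 obtain e where e: "inj_on (e :: _ => 'v) ?J" using small_index[OF small_codes] by blast
 define G where "G i t \<longleftrightarrow> labelled (fst t) (snd t) & e (code (fst t) (snd t)) = i" for i and t :: "_ \<times> _"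
 define T where "T i = (SOME t. G i t)" for i
 have T: "G i (T i)" if i: "i : e ` ?J" for i
 proof -
  obtain N \<theta> where "labelled N \<theta>" "i = e (code N \<theta>)" using i by blast
  then have "G i (N, \<theta>)" by (simp add: G_def)
  then show ?thesis unfolding T_def by (rule someI)
 qed
 show ?thesis
 proof (intro exI[of _ "e ` ?J"] exI[of _ "%i. fst (T i)"] conjI ballI allI impI)
  show "small U (e ` ?J)" by (rule small_image[OF small_codes])
  have Tc: "cart (fst (T i))" if "i : e ` ?J" for i
   using T[OF that] unfolding G_def labelled_def by (elim conjE, intro conjI)
  show "rmod (fst (T i))" if "i : e ` ?J" for i by (rule conjunct1[OF Tc[OF that]])
  show "cartesian K C \<X> \<R> (fst (T i))" if "i : e ` ?J" for i by (rule conjunct2[OF Tc[OF that]])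
  fix M x0 r0 m0 assume M: "cart M" and x0: "x0 : X" and r0: "r0 : lobj (R x0)" and m0: "m0 <: rsp M x0 r0"
  obtain N where N: "cart N" "rhom N M (%x r m. m)" "m0 <: rsp N x0 r0"
   and le: "!!x r. x : X ==> r <. R x ==> |carrier (rsp N x r)| \<le>o |D|"
   by (rule bounded_sub[OF D M x0 r0 m0]; (assumption | (rule that; assumption)))
  \<comment> \<open>The bound on the size of \<open>N\<close> provides the injections into
    \<open>D\<close> that serve as labels.\<close>
  define \<theta> where "\<theta> x r = (SOME f. inj_on f (carrier (rsp N x r)) & f ` carrier (rsp N x r) \<subseteq> D)" for x r
  have "inj_on (\<theta> x r) (carrier (rsp N x r)) & \<theta> x r ` carrier (rsp N x r) \<subseteq> D" if xr: "x : X" "r <. R x" for x r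
  proof -
   from le[OF xr] have "EX f. inj_on f (carrier (rsp N x r)) & f ` carrier (rsp N x r) \<subseteq> D" by (rule iffD2[OF card_of_ordLeq])
   from someI_ex[OF this] show ?thesis unfolding \<theta>_def .
  qed
  then have l: "labelled N \<theta>" unfolding labelled_def using N(1) by blast
  let ?i = "e (code N \<theta>)"
  have i: "?i : e ` ?J" by (rule imageI) (use l in blast)
  have l': "labelled (fst (T ?i)) (snd (T ?i))" and "e (code (fst (T ?i)) (snd (T ?i))) = ?i" using T[OF i] unfolding G_def by blast+
  then have eq: "code (fst (T ?i)) (snd (T ?i)) = code N \<theta>" using l by (intro inj_onD[OF e]) blast+
  obtain u where u: "rhom (fst (T ?i)) N u"
   "!!x r. x : X ==> r <. R x ==> u x r ` carrier (esp (rat (fst (T ?i)) x) r) = carrier (rsp N x r)"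
   by (rule code_iso[OF l' l eq]; (assumption | (rule that; assumption)))
  have "rmod (fst (T ?i))" using l' unfolding labelled_def by (elim conjE)
  from rhom_comp[OF this cartD(1)[OF N(1)] cartD(1)[OF M] u(1) N(2)]
  show "EX i:e ` ?J. EX h. rhom (fst (T i)) M h & m0 : h x0 r0 ` carrier (esp (rat (fst (T i)) x0) r0)"
   using i N(3) unfolding u(2)[OF x0 r0, symmetric] by blast
 qed
qed

text \<open>Coproducts and separators were obtained for morphisms given by formulas; truncation by
  \<open>rres\<close> restates them for the arrows of the category.\<close>

lemma cart_groth: "groth K CC sorts csp' cev U"
proof (rule groth.intro[OF cart_conc universe_axioms groth_axioms.intro])
 fix I :: "'v set" and F assume I: "small U I" and "!!i. i : I ==> F i : Ob CC"
 then have F: "!!i. i : I ==> cart (F i)" by (simp only: cart_cat_sel(1))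
 show "EX c:Ob CC. EX \<iota> \<pi>. (ALL i:I. \<iota> i : Arr CC (F i) c) &
    (ALL s:sorts. is_dsum I (%i. csp' (F i) s) (csp' c s) (%i. cev (\<iota> i) s) (\<pi> s)) &
    (ALL x:Ob CC. ALL h. (ALL i:I. h i : Arr CC (F i) x) -->
     (EX u:Arr CC c x. ALL i:I. ALL s:sorts. ALL v:carrier (csp' (F i) s). cev u s (cev (\<iota> i) s v) = cev (h i) s v))"
 proof (rule cart_coproduct[OF I F])
  fix c \<iota> \<pi> assume c: "cart c" and \<iota>: "!!i. i : I ==> rhom (F i) c (\<iota> i)"
   and d: "!!x r. x : X ==> r <. R x ==> is_dsum I (%i. esp (rat (F i) x) r) (rsp c x r) (%i. \<iota> i x r) (\<pi> x r)"
   and u: "!!N h. cart N ==> (!!i. i : I ==> rhom (F i) N (h i)) ==>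
    EX u. rhom c N u & (ALL i:I. ALL x:X. ALL r:lobj (R x). ALL v:carrier (esp (rat (F i) x) r). u x r (\<iota> i x r v) = h i x r v)"
  let ?i = "%i. rres (F i) (\<iota> i)"
  show ?thesis
  proof (intro bexI[of _ c] exI[of _ ?i] exI[of _ "%s. \<pi> (fst s) (snd s)"] conjI ballI allI impI)
   show "c : Ob CC" unfolding cart_cat_sel(1) by (rule c)
   show "?i i : Arr CC (F i) c" if "i : I" for i by (rule arr_of_rhom[OF F[OF that] c \<iota>[OF that]])
   show "is_dsum I (%i. csp' (F i) s) (csp' c s) (%i. cev (?i i) s) (\<pi> (fst s) (snd s))" if s: "s : sorts" for s
    by (rule is_dsum_cong[OF d]) (use s rres_cev[OF s] in auto)
   fix N h assume "N : Ob CC" and h: "ALL i:I. h i : Arr CC (F i) N"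
   then have N: "cart N" by (simp only: cart_cat_sel(1))
   have "rhom (F i) N (h i)" if "i : I" for i by (rule rhom_of_arr[OF F[OF that] N bspec[OF h that]])
   from u[OF N this] obtain u where uh: "rhom c N u"
    and ue: "ALL i:I. ALL x:X. ALL r:lobj (R x). ALL v:carrier (esp (rat (F i) x) r). u x r (\<iota> i x r v) = h i x r v" by blast
   show "EX u:Arr CC c N. ALL i:I. ALL s:sorts. ALL v:carrier (csp' (F i) s). cev u s (cev (?i i) s v) = cev (h i) s v"
   proof (intro bexI[of _ "rres c u"] ballI)
    show "rres c u : Arr CC c N" by (rule arr_of_rhom[OF c N uh])
    fix i s v assume i: "i : I" and s: "s : sorts" and v: "v <: csp' (F i) s"
    have s': "fst s : X" "snd s : lobj (R (fst s))" using s by auto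
    show "cev (rres c u) s (cev (?i i) s v) = cev (h i) s v"
     unfolding rres_cev[OF s v] rres_cev[OF s rhomD(3)[OF \<iota>[OF i] s' v]] using ue i s' v by blast
   qed
  qed
 qed
next
 obtain I :: "'v set" and T where I: "small U I" and T: "ALL i:I. cart (T i)"
  and sep: "ALL M. cart M --> (ALL x:X. ALL r:lobj (R x). ALL m:carrier (rsp M x r).
    EX i:I. EX h. rhom (T i) M h & m : h x r ` carrier (esp (rat (T i) x) r))"
  using separating_family by (elim exE conjE)
 show "EX (I :: 'v set) T. small U I & (ALL i:I. T i : Ob CC) &
   (ALL a:Ob CC. ALL s:sorts. ALL x:carrier (csp' a s). EX i:I. EX h:Arr CC (T i) a. x : cev h s ` carrier (csp' (T i) s))"
 proof (intro exI[of _ I] exI[of _ T] conjI I ballI)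
  show "T i : Ob CC" if "i : I" for i unfolding cart_cat_sel(1) by (rule bspec[OF T that])
  fix a s m assume "a : Ob CC" and s: "s : sorts" and m: "m <: csp' a s"
  then have a: "cart a" by (simp only: cart_cat_sel(1))
  have s': "fst s : X" "snd s : lobj (R (fst s))" using s by auto
  obtain i h where i: "i : I" and h: "rhom (T i) a h" and mh: "m : cev h s ` carrier (csp' (T i) s)"
   using sep a s' m by blast
  have "m : cev (rres (T i) h) s ` carrier (csp' (T i) s)"
   using mh by (simp only: image_cong[OF refl rres_cev[OF s]])
  then show "EX i:I. EX h:Arr CC (T i) a. m : cev h s ` carrier (csp' (T i) s)"
   using i arr_of_rhom[OF bspec[OF T i] a h] by blast
 qed
qed

end

end

theorem theorem5:
  fixes K :: "('k, 'z) ring_scheme"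
    and C :: "('k, 'c) coalgebra"
    and X :: "'x set" and leq :: "'x rel"
    and \<R> :: "('x, unit, 'k, 'o, 'm, 'c) rep"
    and U :: "'v set"
  assumes "field K"
    and "is_coalgebra K C"
    and "partial_order_on X leq"
    and "entwined_rep K C (poset_cat X leq) \<R>"
    and "universe_for U K C (poset_cat X leq) \<R>"
    and "right_semiperfect U K C"
    and "flat_rep U K C (poset_cat X leq) \<R>"
  shows "grothendieck_cat U (cart_cat U K C (poset_cat X leq) \<R>)"
proof -
 let ?X = "poset_cat X leq"
 obtain D :: "'v set" where reg: "regularCard |U|" and PD: "small U (Pow D)" and D: "infinite D"
  and b: "|carrier K| \<le>o |D|" "|carrier (csp C)| \<le>o |D|" "|Ob ?X| \<le>o |D|" "ALL x:Ob ?X. ALL y:Ob ?X. |Arr ?X x y| \<le>o |D|"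
   "ALL x:Ob ?X. |lobj (fob \<R> x)| \<le>o |D| & (ALL r:lobj (fob \<R> x). ALL s:lobj (fob \<R> x). |carrier (lhom (fob \<R> x) r s)| \<le>o |D| )"
  using assms(5) unfolding universe_for_def by blast
 \<comment> \<open>\<open>D\<close> is infinite and its power set is small, so the set of natural
   numbers is small, as the closure properties of small sets require.\<close>
 have "|UNIV :: nat set| \<le>o |D|" using D by (simp add: infinite_iff_card_of_nat)
 also have "|D| \<le>o |Pow D|" by (rule ordLess_imp_ordLeq[OF card_of_Pow])
 finally have nat: "small U (UNIV :: nat set)" using PD unfolding small_def by (rule ordLeq_ordLess_trans)
 have cat: "is_cat ?X"
  using assms(3) unfolding is_cat_def poset_cat_def partial_order_on_def preorder_on_def refl_on_def trans_def
  by (auto split: if_splits)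
 interpret cartl K C U ?X \<R>
  by (intro cartl.intro cartl_axioms.intro coalg.intro ground.intro coalg_axioms.intro universe.intro assms reg nat cat)
 show ?thesis by (rule groth.grothendieck[OF cart_groth[OF _ PD]]) (unfold bound_def, intro conjI D b)
qed

end
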